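(* Consider the Filippov system (with $0<\epsilon\ll 1$, upper signs for $v>0$, lower signs for $v<0$) $$\dot y=w,\quad \dot w=b(\theta,\phi)+p_\pm(\theta)F_N,\quad \dot\theta=\phi,\quad \dot\phi=c_\pm(\theta)F_N,\quad \dot v=a(\theta,\phi)+q_\pm(\theta)F_N,$$ with $F_N=\epsilon^{-1}[-\epsilon^{-1}y-\delta w]$, where the coefficients and the bracket $[\cdot]$ are as defined in the context. Consider an initial condition $$(y,w,\theta,\phi,v)=(0,\mathcal O(\epsilon),\theta_0,\phi_0,v_0),\qquad v_0>0,$$ with $$p_+(\theta_0)<0,\quad b(\theta_0,\phi_0)<0,\quad q_+(\theta_0)<0,\quad q_-(\theta_0)>0,\quad a(\theta_0,\phi_0)\neq 0 .$$ Then the forward flow of this initial condition returns to $\{(y,w,\theta,\phi,v)\mid y=0\}$ after a time $\mathcal O(\epsilon\ln\epsilon^{-1})$ with $$w=e(\delta,\theta_0)v_0+o(1),\qquad \theta=\theta_0+o(1),$$ $$\phi=\phi_0+\left\{-\frac{c_+(\theta_0)}{q_+(\theta_0)}+\frac{S_\phi(\theta_0)}{S_w(\theta_0)}\left(e(\delta,\theta_0)+\frac{p_+(\theta_0)}{q_+(\theta_0)}\right)\right\}v_0+o(1),\qquad v=o(1),$$ as $\epsilon\to0$. During this time $y=\mathcal O(\epsilon)$ and $w=\mathcal O(1)$, so that $F_N=\mathcal O(\epsilon^{-1})$. The function $e(\delta,\theta_0)$ (defined in the context) is smooth and monotonic in $\delta$ and has the asymptotic expansions $$e(\delta,\theta_0)=\frac{p_-(\theta_0)-p_+(\theta_0)}{q_-(\theta_0)p_+(\theta_0)-q_+(\theta_0)p_-(\theta_0)}\,\delta^{-2}\left(1+\mathcal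 O(\delta^{-2}\ln\delta^{-1})\right)\quad\text{for }\delta\gg1,$$ $$e(\delta,\theta_0)=\sqrt{\frac{p_+(\theta_0)(p_-(\theta_0)-p_+(\theta_0))}{q_+(\theta_0)(q_-(\theta_0)-q_+(\theta_0))}}\left(1-\frac{\sqrt{S_w(\theta_0)}}{2}\left(\pi-\arctan\sqrt{-\frac{S_w(\theta_0)}{p_+(\theta_0)}}\right)\delta+\mathcal O(\delta^2)\right)\quad\text{for }\delta\ll1.$$
   Context: Fixed parameters: $\alpha>0$, $\mu>0$, $\delta>0$. Coefficients: $a(\theta,\phi)=-\phi^2\cos\theta$, $b(\theta,\phi)=-1+\phi^2\sin\theta$, $q_\pm(\theta)=\alpha\sin\theta\cos\theta\mp\mu(1+\alpha\sin^2\theta)$, $p_\pm(\theta)=1+\alpha\cos^2\theta\mp\mu\alpha\sin\theta\cos\theta$, $c_\pm(\theta)=-\alpha(\cos\theta\mp\mu\sin\theta)$. Also $$S_w(\theta)=\frac{q_-p_+-q_+p_-}{q_--q_+}=\frac{1+\alpha}{1+\alpha\sin^2\theta},\qquad S_\phi(\theta)=\frac{q_-c_+-q_+c_-}{q_--q_+}=-\frac{\alpha\cos\theta}{1+\alpha\sin^2\theta}.$$ Bracket: for a function $f(y,w)$, $[f(y,w)]=0$ if $y>0$ and $[f(y,w)]=\max\{f(y,w),0\}$ if $y\le0$. The system is discontinuous across the switching manifold $\{v=0\}$; solutions are understood in the sense of Filippov (on $v=0$ the standard Filippov convex combination is used where the two vector fields both point towards $v=0$). Definition of $e$: at $\theta=\theta_0$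 (argument suppressed) let $$\lambda_+=-\frac{\delta p_+}{2}+\frac12\sqrt{\delta^2p_+^2-4p_+},\qquad \xi_\pm=-\frac{\delta S_w}{2}\pm\frac12\sqrt{\delta^2S_w^2-4S_w}\ (\text{possibly complex}),$$ let $\tau_s$ be the least positive solution of $e^{(\xi_+-\xi_-)\tau_s}=\dfrac{\xi_-^2(\lambda_+-\xi_+)}{\xi_+^2(\lambda_+-\xi_-)}$, and $$e(\delta,\theta_0)=\frac{\xi_+}{\xi_-}(\lambda_+-\xi_-)\frac{p_+}{q_+\lambda_+}e^{\xi_+\tau_s},$$ for $\delta\ne 2/\sqrt{S_w(\theta_0)}$, extended by continuity to $\delta=2/\sqrt{S_w(\theta_0)}$. *)

theory Defs
  imports "HOL-Analysis.Analysis" "HOL-Library.Landau_Symbols"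
begin

text \<open>
  The parameter \<open>s\<close> is the slip sign: \<open>s = 1\<close> gives the upper (plus) coefficients, which act for
  \<open>v > 0\<close>, and \<open>s = - 1\<close> gives the lower (minus) coefficients, which act for \<open>v < 0\<close>.
\<close>

definition a_coeff :: "real \<Rightarrow> real \<Rightarrow> real" where
  "a_coeff \<theta> \<phi> = - (\<phi>\<^sup>2 * cos \<theta>)"

definition b_coeff :: "real \<Rightarrow> real \<Rightarrow> real" where
  "b_coeff \<theta> \<phi> = - 1 + \<phi>\<^sup>2 * sin \<theta>"

definition q_coeff :: "real \<Rightarrow> real \<Rightarrow> real \<Rightarrow> real \<Rightarrow> real" where
  "q_coeff \<alpha> \<mu> s \<theta> = \<alpha> * sin \<theta> * cos \<theta> - s * \<mu> * (1 + \<alpha> * (sin \<theta>)\<^sup>2)"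

definition p_coeff :: "real \<Rightarrow> real \<Rightarrow> real \<Rightarrow> real \<Rightarrow> real" where
  "p_coeff \<alpha> \<mu> s \<theta> = 1 + \<alpha> * (cos \<theta>)\<^sup>2 - s * \<mu> * \<alpha> * sin \<theta> * cos \<theta>"

definition c_coeff :: "real \<Rightarrow> real \<Rightarrow> real \<Rightarrow> real \<Rightarrow> real" where
  "c_coeff \<alpha> \<mu> s \<theta> = - (\<alpha> * (cos \<theta> - s * \<mu> * sin \<theta>))"

abbreviation "q_plus \<alpha> \<mu> \<equiv> q_coeff \<alpha> \<mu> 1"
abbreviation "q_minus \<alpha> \<mu> \<equiv> q_coeff \<alpha> \<mu> (- 1)"
abbreviation "p_plus \<alpha> \<mu> \<equiv> p_coeff \<alpha> \<mu> 1"
abbreviation "p_minus \<alpha> \<mu> \<equiv> p_coeff \<alpha> \<mu> (- 1)"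
abbreviation "c_plus \<alpha> \<mu> \<equiv> c_coeff \<alpha> \<mu> 1"
abbreviation "c_minus \<alpha> \<mu> \<equiv> c_coeff \<alpha> \<mu> (- 1)"

definition S_w :: "real \<Rightarrow> real \<Rightarrow> real \<Rightarrow> real" where
  "S_w \<alpha> \<mu> \<theta> =
     (q_minus \<alpha> \<mu> \<theta> * p_plus \<alpha> \<mu> \<theta> - q_plus \<alpha> \<mu> \<theta> * p_minus \<alpha> \<mu> \<theta>)
       / (q_minus \<alpha> \<mu> \<theta> - q_plus \<alpha> \<mu> \<theta>)"

definition S_phi :: "real \<Rightarrow> real \<Rightarrow> real \<Rightarrow> real" where
  "S_phi \<alpha> \<mu> \<theta> =
     (q_minus \<alpha> \<mu> \<theta> * c_plus \<alpha> \<mu> \<theta> - q_plus \<alpha> \<mu> \<theta> * c_minus \<alpha> \<mu> \<theta>)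
       / (q_minus \<alpha> \<mu> \<theta> - q_plus \<alpha> \<mu> \<theta>)"

lemma
  assumes "\<alpha> > 0" "\<mu> > 0"
  shows S_w_eq: "S_w \<alpha> \<mu> \<theta> = (1 + \<alpha>) / (1 + \<alpha> * (sin \<theta>)\<^sup>2)"
    and S_phi_eq: "S_phi \<alpha> \<mu> \<theta> = - (\<alpha> * cos \<theta>) / (1 + \<alpha> * (sin \<theta>)\<^sup>2)"
proof -
  define x y where "x = sin \<theta>" and "y = cos \<theta>"
  have pos: "1 + \<alpha> * x\<^sup>2 > 0"
    using assms by (simp add: add_pos_nonneg)
  have y2: "y\<^sup>2 = 1 - x\<^sup>2"
    by (simp add: x_def y_def cos_squared_eq)
  have den: "q_minus \<alpha> \<mu> \<theta> - q_plus \<alpha> \<mu> \<theta> = 2 * \<mu> * (1 + \<alpha> * x\<^sup>2)"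
    by (simp add: q_coeff_def x_def)
  have "q_minus \<alpha> \<mu> \<theta> * p_plus \<alpha> \<mu> \<theta> - q_plus \<alpha> \<mu> \<theta> * p_minus \<alpha> \<mu> \<theta>
      = 2 * \<mu> * ((1 + \<alpha> * x\<^sup>2) * (1 + \<alpha> * y\<^sup>2) - \<alpha>\<^sup>2 * x\<^sup>2 * y\<^sup>2)"
    by (simp add: q_coeff_def p_coeff_def flip: x_def y_def)
       (simp add: algebra_simps power2_eq_square)
  also have "\<dots> = 2 * \<mu> * (1 + \<alpha>)"
    unfolding y2 by algebra
  finally show "S_w \<alpha> \<mu> \<theta> = (1 + \<alpha>) / (1 + \<alpha> * (sin \<theta>)\<^sup>2)"
    using assms pos by (simp add: S_w_def den x_def)
  have "q_minus \<alpha> \<mu> \<theta> * c_plus \<alpha> \<mu> \<theta> - q_plus \<alpha> \<mu> \<theta> * c_minus \<alpha> \<mu> \<theta>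
      = 2 * \<mu> * (- (\<alpha> * y))"
    by (simp add: q_coeff_def c_coeff_def flip: x_def y_def)
       (simp add: algebra_simps power2_eq_square)
  then show "S_phi \<alpha> \<mu> \<theta> = - (\<alpha> * cos \<theta>) / (1 + \<alpha> * (sin \<theta>)\<^sup>2)"
    using assms pos by (simp add: S_phi_def den x_def y_def)
qed

definition bracket :: "real \<Rightarrow> real \<Rightarrow> real" where
  "bracket y f = (if y > 0 then 0 else max f 0)"

definition normal_force :: "real \<Rightarrow> real \<Rightarrow> real \<Rightarrow> real \<Rightarrow> real" where
  "normal_force \<delta> \<epsilon> y w = 1 / \<epsilon> * bracket y (- (1 / \<epsilon> * y) - \<delta> * w)"

text \<open>States are ordered as \<open>(y, w, \<theta>, \<phi>, v)\<close>.\<close>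

type_synonym state = "real \<times> real \<times> real \<times> real \<times> real"

fun vfield :: "real \<Rightarrow> real \<Rightarrow> real \<Rightarrow> real \<Rightarrow> real \<Rightarrow> state \<Rightarrow> state" where
  "vfield \<alpha> \<mu> \<delta> \<epsilon> s (y, w, \<theta>, \<phi>, v) =
     (w,
      b_coeff \<theta> \<phi> + p_coeff \<alpha> \<mu> s \<theta> * normal_force \<delta> \<epsilon> y w,
      \<phi>,
      c_coeff \<alpha> \<mu> s \<theta> * normal_force \<delta> \<epsilon> y w,
      a_coeff \<theta> \<phi> + q_coeff \<alpha> \<mu> s \<theta> * normal_force \<delta> \<epsilon> y w)"

text \<open>
  The Filippov set-valued field for the switching manifold \<open>v = 0\<close>. Where both fields point
  towards \<open>v = 0\<close>, a solution that stays in \<open>v = 0\<close> is forced to use the unique element of the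
  convex hull with zero \<open>v\<close>-component, that is, the standard sliding field. Each one-sided field
  jumps across \<open>y = 0\<close> when \<open>w < 0\<close>, but there \<open>y' = w \<noteq> 0\<close>, so solutions cross \<open>y = 0\<close> at isolated
  times and the value of the field on \<open>y = 0\<close> does not matter.
\<close>

fun filippov_field :: "real \<Rightarrow> real \<Rightarrow> real \<Rightarrow> real \<Rightarrow> state \<Rightarrow> state set" where
  "filippov_field \<alpha> \<mu> \<delta> \<epsilon> (y, w, \<theta>, \<phi>, v) =
     (if v > 0 then {vfield \<alpha> \<mu> \<delta> \<epsilon> 1 (y, w, \<theta>, \<phi>, v)}
      else if v < 0 then {vfield \<alpha> \<mu> \<delta> \<epsilon> (- 1) (y, w, \<theta>, \<phi>, v)}
      else convex hull {vfield \<alpha> \<mu> \<delta> \<epsilon> 1 (y, w, \<theta>, \<phi>, v),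
                        vfield \<alpha> \<mu> \<delta> \<epsilon> (- 1) (y, w, \<theta>, \<phi>, v)})"

definition abs_continuous_on_Icc :: "real \<Rightarrow> real \<Rightarrow> (real \<Rightarrow> 'a::metric_space) \<Rightarrow> bool" where
  "abs_continuous_on_Icc a b X \<longleftrightarrow>
     (\<forall>e>0. \<exists>d>0. \<forall>P. finite P \<and> (\<forall>(r, t)\<in>P. a \<le> r \<and> r \<le> t \<and> t \<le> b) \<and>
        disjoint_family_on (\<lambda>(r, t). {r<..<t}) P \<and> (\<Sum>(r, t)\<in>P. t - r) < d \<longrightarrow>
        (\<Sum>(r, t)\<in>P. dist (X r) (X t)) < e)"

definition filippov_solution ::
    "('a::real_normed_vector \<Rightarrow> 'a set) \<Rightarrow> 'a \<Rightarrow> real \<Rightarrow> (real \<Rightarrow> 'a) \<Rightarrow> bool" where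
  "filippov_solution F x0 T X \<longleftrightarrow>
     X 0 = x0 \<and> abs_continuous_on_Icc 0 T X \<and>
     (\<exists>N. negligible N \<and>
        (\<forall>t\<in>{0..T} - N. \<exists>D\<in>F (X t). (X has_vector_derivative D) (at t within {0..T})))"

text \<open>
  Speaking of the forward flow of an initial condition presupposes that the forward solution
  is unique, which is not automatic for a differential inclusion.
\<close>

definition filippov_forward_flow ::
    "('a::real_normed_vector \<Rightarrow> 'a set) \<Rightarrow> 'a \<Rightarrow> real \<Rightarrow> (real \<Rightarrow> 'a) \<Rightarrow> bool" where
  "filippov_forward_flow F x0 T X \<longleftrightarrow>
     filippov_solution F x0 T X \<and>
     (\<forall>T' Z. 0 \<le> T' \<and> filippov_solution F x0 T' Z \<longrightarrow> (\<forall>t\<in>{0..min T T'}. Z t = X t))"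

definition lambda_plus :: "real \<Rightarrow> real \<Rightarrow> real \<Rightarrow> real \<Rightarrow> real" where
  "lambda_plus \<alpha> \<mu> \<delta> \<theta> =
     - (\<delta> * p_plus \<alpha> \<mu> \<theta> / 2)
     + 1 / 2 * sqrt (\<delta>\<^sup>2 * (p_plus \<alpha> \<mu> \<theta>)\<^sup>2 - 4 * p_plus \<alpha> \<mu> \<theta>)"

definition xi_plus :: "real \<Rightarrow> real \<Rightarrow> real \<Rightarrow> real \<Rightarrow> complex" where
  "xi_plus \<alpha> \<mu> \<delta> \<theta> =
     - of_real (\<delta> * S_w \<alpha> \<mu> \<theta> / 2)
     + 1 / 2 * csqrt (of_real (\<delta>\<^sup>2 * (S_w \<alpha> \<mu> \<theta>)\<^sup>2 - 4 * S_w \<alpha> \<mu> \<theta>))"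

definition xi_minus :: "real \<Rightarrow> real \<Rightarrow> real \<Rightarrow> real \<Rightarrow> complex" where
  "xi_minus \<alpha> \<mu> \<delta> \<theta> =
     - of_real (\<delta> * S_w \<alpha> \<mu> \<theta> / 2)
     - 1 / 2 * csqrt (of_real (\<delta>\<^sup>2 * (S_w \<alpha> \<mu> \<theta>)\<^sup>2 - 4 * S_w \<alpha> \<mu> \<theta>))"

definition tau_s :: "real \<Rightarrow> real \<Rightarrow> real \<Rightarrow> real \<Rightarrow> real" where
  "tau_s \<alpha> \<mu> \<delta> \<theta> =
     (LEAST \<tau>. \<tau> > 0 \<and>
        exp ((xi_plus \<alpha> \<mu> \<delta> \<theta> - xi_minus \<alpha> \<mu> \<delta> \<theta>) * of_real \<tau>) =
        (xi_minus \<alpha> \<mu> \<delta> \<theta>)\<^sup>2 * (of_real (lambda_plus \<alpha> \<mu> \<delta> \<theta>) - xi_plus \<alpha> \<mu> \<delta> \<theta>)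
          / ((xi_plus \<alpha> \<mu> \<delta> \<theta>)\<^sup>2 * (of_real (lambda_plus \<alpha> \<mu> \<delta> \<theta>) - xi_minus \<alpha> \<mu> \<delta> \<theta>)))"

definition e_formula :: "real \<Rightarrow> real \<Rightarrow> real \<Rightarrow> real \<Rightarrow> complex" where
  "e_formula \<alpha> \<mu> \<delta> \<theta> =
     xi_plus \<alpha> \<mu> \<delta> \<theta> / xi_minus \<alpha> \<mu> \<delta> \<theta>
     * (of_real (lambda_plus \<alpha> \<mu> \<delta> \<theta>) - xi_minus \<alpha> \<mu> \<delta> \<theta>)
     * of_real (p_plus \<alpha> \<mu> \<theta> / (q_plus \<alpha> \<mu> \<theta> * lambda_plus \<alpha> \<mu> \<delta> \<theta>))
     * exp (xi_plus \<alpha> \<mu> \<delta> \<theta> * of_real (tau_s \<alpha> \<mu> \<delta> \<theta>))"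

text \<open>
  The value of \<open>e_formula\<close> is real, so \<open>Re\<close> loses nothing: either \<open>\<xi>\<^sub>+\<close> and \<open>\<xi>\<^sub>-\<close> are real, or they
  are complex conjugates and the equation that defines \<open>\<tau>\<^sub>s\<close> says exactly that the value equals
  its conjugate. The first branch is the extension by continuity to the double root
  \<open>\<xi>\<^sub>+ = \<xi>\<^sub>-\<close>.
\<close>

definition e_coeff :: "real \<Rightarrow> real \<Rightarrow> real \<Rightarrow> real \<Rightarrow> real" where
  "e_coeff \<alpha> \<mu> \<delta> \<theta> =
     (if \<delta> = 2 / sqrt (S_w \<alpha> \<mu> \<theta>)
      then Lim (at \<delta>) (\<lambda>d. Re (e_formula \<alpha> \<mu> d \<theta>))
      else Re (e_formula \<alpha> \<mu> \<delta> \<theta>))"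

definition smooth_on_open :: "real set \<Rightarrow> (real \<Rightarrow> real) \<Rightarrow> bool" where
  "smooth_on_open U f \<longleftrightarrow> (\<forall>n. \<forall>x\<in>U. (deriv ^^ n) f differentiable at x)"

end

theory Submission
 imports Defs "HOL-Complex_Analysis.Complex_Analysis" "HOL-Real_Asymp.Real_Asymp"
begin

text \<open>
 In the scaled time \<open>t / \<epsilon>\<close> and with \<open>y / \<epsilon>\<close> in place of \<open>y\<close> the motion splits into four stages: a free
 flight of bounded duration; compression with slip, which takes a time of order \<open>ln (1 / \<epsilon>)\<close> because the
 trajectory leaves a neighbourhood of the saddle \<open>y = w = 0\<close> along its unstable direction \<open>\<lambda>\<^sub>+\<close>, and
 ends at \<open>v = 0\<close>; sliding along \<open>v = 0\<close>, where \<open>(y, w)\<close> is in the limit a damped linear oscillator; and a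
 release with vanishing contact force. The last two stages converge by continuous dependence to the
 linear problem, whose Riccati equation for \<open>w / y\<close> gives the sliding time as an integral of \<open>1 / (z\<^sup>2 + S \<delta> z + S)\<close>
 and \<open>e\<close> in closed form. Forward uniqueness holds because the slip sign enters, in suitable coordinates,
 only through a dissipative term.
\<close>

subsection \<open>Ordinary differential equations with a Lipschitz right-hand side\<close>

text \<open>The field jumps at \<open>y = 0\<close> and at \<open>v = 0\<close>, so Picard iteration
  does not apply to it directly. Each stage is solved for a globally Lipschitz field in which \<phi>
  and the contact force are clipped at a level \<open>M\<close>; afterwards the clip is shown to be
  inactive. \<open>M\<close> is computed from limit data, before \<open>eps\<close>. Compression is
  too long for continuous dependence: the horizon grows while the perturbation shrinks. It is
  controlled through the impulse, the integral of the force. The impulse stays bounded because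
  otherwise \<open>v\<close> would become negative, and the changes of \<open>w\<close>, \<phi> and
  \<open>v\<close> are proportional to it up to a vanishing error; the divisions by
  \<open>q_plus\<close> in the statement come from the impulse that uses up \<open>v0\<close>. The
  hypothesis on \<open>a\<close> selects the side of \<open>v = 0\<close> whose field governs the
  release, when the contact force has dropped to order \<open>eps\<close>. Real and complex roots of
  the sliding oscillator are treated together, and the closed form obtained for \<open>e\<close> is
  regular at the double root.\<close>

lemma integral_has_vector_derivative_atLeast:
 fixes g :: "real \<Rightarrow> 'a::banach"
 assumes "continuous_on {0..} g" "t \<ge> 0"
 shows "((\<lambda>u. integral {0..u} g) has_vector_derivative g t) (at t within {0..})"
proof -
 have "((\<lambda>u. integral {0..u} g) has_vector_derivative g t) (at t within {0..t+1})"
  by (rule integral_has_vector_derivative) (use assms continuous_on_subset[of "{0..}" g "{0..t+1}"] in auto)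
 moreover have "at t within {0..t+1} = at t within {0..}"
  by (rule at_within_nhd[where S = "{t-1<..<t+1}"]) (use assms in auto)
 ultimately show ?thesis by simp
qed

text \<open>With \<open>X t = x0 + exp (2 * K * t) *\<^sub>R W t\<close> and \<open>W\<close>
  bounded and continuous, the integral operator contracts the sup norm of \<open>W\<close> by the
  factor 1/2. Because of the weight, one application of Banach's theorem gives a solution on the
  whole half-line, without continuation from interval to interval.\<close>

lemma picard_lindeloef:
 fixes f :: "'a::euclidean_space \<Rightarrow> 'a"
 assumes lip: "L-lipschitz_on UNIV f"
 obtains X where "X 0 = x0"
  "\<And>t. t \<ge> 0 \<Longrightarrow> (X has_vector_derivative f (X t)) (at t within {0..})"
proof -
 \<comment> \<open>\<open>K \<ge> 1\<close> gives \<open>u \<le> 2 * K * u\<close> below, so that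
   the weight absorbs the linear growth of the integral of the constant \<open>f x0\<close>.\<close>
 define K where "K = max L 1"
 have K1: "K \<ge> 1" by (simp add: K_def)
 have Kf: "norm (f x - f y) \<le> K * norm (x - y)" for x y
  using lipschitz_onD[OF lip, of x y] K1
  by (simp add: dist_norm K_def) (meson mult_right_mono norm_ge_zero max.cobounded1 order_trans)
 have cf: "continuous_on UNIV f"
  using lip lipschitz_on_continuous_on by blast
 define g where "g W s = f (x0 + exp (2 * K * s) *\<^sub>R apply_bcontfun W s)" for W :: "real \<Rightarrow>\<^sub>C 'a" and s
 have cg: "continuous_on A (g W)" for A W
  unfolding g_def
  by (rule continuous_on_compose2[OF cf]) (auto intro!: continuous_intros)
 have gint: "g W integrable_on {0..t}" for W t
  by (rule integrable_continuous_interval[OF cg])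
 \<comment> \<open>Bounded continuous functions live on the whole line, hence
   \<open>max t 0\<close>: the image vanishes for negative times.\<close>
 define H where "H W t = exp (-2*K*max t 0) *\<^sub>R integral {0..max t 0} (g W)" for W t
 have expint: "((\<lambda>s. c * K * exp (2 * K * s)) has_integral c * (exp (2 * K * t) - 1) / 2) {0..t}"
  if "t \<ge> 0" for t c
 proof -
  have "((\<lambda>s. c * K * exp (2 * K * s)) has_integral (c * exp (2 * K * t) / 2 - c * exp (2 * K * 0) / 2)) {0..t}"
   by (rule fundamental_theorem_of_calculus[OF that])
    (auto intro!: derivative_eq_intros simp flip: has_real_derivative_iff_has_vector_derivative)
  then show ?thesis by (simp add: field_simps)
 qed
 have Hb: "norm (H W t) \<le> norm (f x0) + norm W" for W t
 proof -
  define u where "u = max t 0"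
  have u0: "u \<ge> 0" by (simp add: u_def)
  have "norm (g W s) \<le> norm (f x0) + norm W * K * exp (2 * K * s)" for s
  proof -
   have "norm (g W s) \<le> norm (f x0) + norm (g W s - f x0)" by norm
   also have "norm (g W s - f x0) \<le> K * (exp (2 * K * s) * norm (apply_bcontfun W s))"
    unfolding g_def using Kf[of "x0 + exp (2 * K * s) *\<^sub>R apply_bcontfun W s" x0] by simp
   also have "\<dots> \<le> K * (exp (2 * K * s) * norm W)"
    using K1 norm_bounded[of W s] by (intro mult_left_mono) auto
   finally show ?thesis by (simp add: mult_ac)
  qed
  moreover have hi: "((\<lambda>s. norm (f x0) + norm W * K * exp (2 * K * s)) has_integral
    (norm (f x0) * u + norm W * (exp (2 * K * u) - 1) / 2)) {0..u}"
   using has_integral_add[OF has_integral_const_real[of "norm (f x0)" 0 u] expint[OF u0, of "norm W"]] u0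
   by (simp add: mult.commute)
  ultimately have "norm (integral {0..u} (g W)) \<le> norm (f x0) * u + norm W * (exp (2 * K * u) - 1) / 2"
   using integral_norm_bound_integral[OF gint[of W u] has_integral_integrable[OF hi]] integral_unique[OF hi]
   by auto
  also have "\<dots> \<le> norm (f x0) * exp (2 * K * u) + norm W * exp (2 * K * u)"
  proof -
   have "u \<le> 2 * K * u" using K1 u0 by (simp add: mult_le_cancel_right1)
   also have "\<dots> \<le> exp (2 * K * u)" using exp_ge_add_one_self[of "2 * K * u"] by linarith
   finally have "norm (f x0) * u \<le> norm (f x0) * exp (2 * K * u)" by (rule mult_left_mono) simp
   moreover have "norm W * (exp (2 * K * u) - 1) / 2 \<le> norm W * exp (2 * K * u)"
    using mult_nonneg_nonneg[of "norm W" "exp (2 * K * u)"] by (simp add: field_simps)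
   ultimately show ?thesis by simp
  qed
  finally have "exp (-2 * K * u) * norm (integral {0..u} (g W)) \<le> exp (-2 * K * u) * ((norm (f x0) + norm W) * exp (2 * K * u))"
   by (intro mult_left_mono) (auto simp: algebra_simps)
  also have "\<dots> = norm (f x0) + norm W" by (simp add: exp_minus)
  finally show ?thesis by (simp add: H_def u_def)
 qed
 have Hc: "continuous_on UNIV (H W)" for W
 proof -
  have "continuous_on {0..} (\<lambda>u. integral {0..u} (g W))"
   unfolding continuous_on_eq_continuous_within
   using has_vector_derivative_continuous[OF integral_has_vector_derivative_atLeast[OF cg]] by simp
  then have "continuous_on UNIV (\<lambda>t. integral {0..max t 0} (g W))"
   by (rule continuous_on_compose2[where g = "\<lambda>u. integral {0..u} (g W)"]) (auto intro!: continuous_intros)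
  then show ?thesis unfolding H_def by (intro continuous_intros)
 qed
 define T where "T W = Bcontfun (H W)" for W
 have HT: "apply_bcontfun (T W) = H W" for W
  unfolding T_def by (rule Bcontfun_inverse, rule bcontfun_normI[OF Hc Hb])
 have contr: "dist (T V) (T W) \<le> 1/2 * dist V W" for V W
 proof -
  have "norm (apply_bcontfun (T V - T W) t) \<le> norm (V - W) / 2" for t
  proof -
   define u where "u = max t 0"
   have u0: "u \<ge> 0" by (simp add: u_def)
   have "norm (g V s - g W s) \<le> norm (V - W) * K * exp (2 * K * s)" for s
   proof -
    have "norm (g V s - g W s) \<le> K * (exp (2 * K * s) * norm (apply_bcontfun (V - W) s))"
     unfolding g_def using Kf[of "x0 + exp (2 * K * s) *\<^sub>R apply_bcontfun V s" "x0 + exp (2 * K * s) *\<^sub>R apply_bcontfun W s"]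
     by (simp flip: scaleR_diff_right)
    also have "\<dots> \<le> K * (exp (2 * K * s) * norm (V - W))"
     using K1 norm_bounded[of "V - W" s] by (intro mult_left_mono) auto
    finally show ?thesis by (simp add: mult_ac)
   qed
   then have "norm (integral {0..u} (\<lambda>s. g V s - g W s)) \<le> norm (V - W) * (exp (2 * K * u) - 1) / 2"
    using integral_norm_bound_integral[OF integrable_diff[OF gint[of V u] gint[of W u]]
      has_integral_integrable[OF expint[OF u0, of "norm (V - W)"]]]
    unfolding integral_unique[OF expint[OF u0, of "norm (V - W)"]] by blast
   also have "\<dots> \<le> norm (V - W) / 2 * exp (2 * K * u)"
    by (simp add: field_simps)
   finally have "exp (-2 * K * u) * norm (integral {0..u} (\<lambda>s. g V s - g W s)) \<le> exp (-2 * K * u) * (norm (V - W) / 2 * exp (2 * K * u))"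
    by (intro mult_left_mono) auto
   also have "\<dots> = norm (V - W) / 2" by (simp add: exp_minus)
   finally show ?thesis
    by (simp add: HT H_def u_def integral_diff[OF gint gint] flip: scaleR_diff_right)
  qed
  then have "norm (T V - T W) \<le> norm (V - W) / 2" by (intro norm_bound) auto
  then show ?thesis by (simp add: dist_norm)
 qed
 have "\<exists>!W. T W = W" by (rule banach_fix_type[where c = "1/2"]) (use contr in auto)
 then obtain W where W: "T W = W" by blast
 define X where "X t = x0 + integral {0..t} (g W)" for t
 have XW: "X t = x0 + exp (2 * K * t) *\<^sub>R apply_bcontfun W t" if "t \<ge> 0" for t
 proof -
  have "apply_bcontfun W t = exp (-2 * K * t) *\<^sub>R integral {0..t} (g W)"
   using fun_cong[OF HT[of W], of t] that by (simp add: W H_def)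
  then show ?thesis by (simp add: X_def exp_minus)
 qed
 have "(X has_vector_derivative f (X t)) (at t within {0..})" if "t \<ge> 0" for t
 proof -
  have "(X has_vector_derivative g W t) (at t within {0..})"
   unfolding X_def using integral_has_vector_derivative_atLeast[OF cg[of _ W] that]
   by (auto intro!: derivative_eq_intros)
  then show ?thesis using XW[OF that] by (simp add: g_def)
 qed
 moreover have "X 0 = x0" by (simp add: X_def)
 ultimately show ?thesis using that by blast
qed

lemma decreasing_from_derivative:
 fixes g :: "real \<Rightarrow> real"
 assumes "a \<le> b"
  and "\<And>t. t \<in> {a..b} \<Longrightarrow> (g has_real_derivative g' t) (at t within {a..b})"
  and "\<And>t. t \<in> {a..b} \<Longrightarrow> g' t \<le> 0"
 shows "g b \<le> g a"
proof (rule DERIV_nonpos_imp_decreasing_open[OF assms(1)])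
 show "continuous_on {a..b} g"
  using assms(2) by (meson DERIV_continuous continuous_on_eq_continuous_within)
 show "\<exists>y. DERIV g x :> y \<and> y \<le> 0" if "a < x" "x < b" for x
  using assms(2)[of x] assms(3)[of x] that by (auto simp: at_within_Icc_at)
qed

lemma increasing_from_derivative:
 fixes g :: "real \<Rightarrow> real"
 assumes "a \<le> b"
  and "\<And>t. t \<in> {a..b} \<Longrightarrow> (g has_real_derivative g' t) (at t within {a..b})"
  and "\<And>t. t \<in> {a..b} \<Longrightarrow> g' t \<ge> 0"
 shows "g a \<le> g b"
 using decreasing_from_derivative[OF assms(1), of "\<lambda>t. - g t" "\<lambda>t. - g' t"] assms(2,3)
 by (auto intro!: derivative_eq_intros)

lemma gronwall:
 fixes g :: "real \<Rightarrow> real"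
 assumes "t \<in> {0..T}"
  and "\<And>t. t \<in> {0..T} \<Longrightarrow> (g has_real_derivative g' t) (at t within {0..T})"
  and "\<And>t. t \<in> {0..T} \<Longrightarrow> g' t \<le> K * g t"
 shows "g t \<le> g 0 * exp (K * t)"
proof -
 have "exp (- K * t) * g t \<le> exp (- K * 0) * g 0"
 proof (rule decreasing_from_derivative[where g = "\<lambda>t. exp (- K * t) * g t"
    and g' = "\<lambda>t. exp (- K * t) * (g' t - K * g t)"])
  fix s assume s: "s \<in> {0..t}"
  then have "(g has_real_derivative g' s) (at s within {0..t})"
   using assms(1) by (intro DERIV_subset[OF assms(2)]) auto
  then show "((\<lambda>t. exp (- K * t) * g t) has_real_derivative exp (- K * s) * (g' s - K * g s)) (at s within {0..t})"
   by (auto intro!: derivative_eq_intros simp: algebra_simps)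
  show "exp (- K * s) * (g' s - K * g s) \<le> 0"
   using assms(1) assms(3)[of s] s by (simp add: mult_le_0_iff)
 qed (use assms(1) in auto)
 then show ?thesis by (simp add: exp_minus field_simps)
qed

text \<open>The squared distance is differentiable also where the distance vanishes. Adding
  \<open>\<gamma>\<^sup>2\<close> to it absorbs the defect through
  \<open>2 * n * \<gamma> \<le> n\<^sup>2 + \<gamma>\<^sup>2\<close>, so the differential inequality
  becomes homogeneous and Gronwall applies to it.\<close>

lemma ode_comparison:
 fixes X Z :: "real \<Rightarrow> 'a::euclidean_space"
 assumes lip: "L-lipschitz_on UNIV f"
  and X: "\<And>t. t \<in> {0..T} \<Longrightarrow> (X has_vector_derivative f (X t)) (at t within {0..T})"
  and Z: "\<And>t. t \<in> {0..T} \<Longrightarrow> (Z has_vector_derivative z t) (at t within {0..T})"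
  and zf: "\<And>t. t \<in> {0..T} \<Longrightarrow> norm (f (Z t) - z t) \<le> \<gamma>"
  and t: "t \<in> {0..T}"
 shows "(norm (X t - Z t))\<^sup>2 \<le> ((norm (X 0 - Z 0))\<^sup>2 + \<gamma>\<^sup>2) * exp ((2*L+1) * T)"
proof -
 have L0: "L \<ge> 0" using lip lipschitz_on_nonneg by blast
 define g where "g t = (norm (X t - Z t))\<^sup>2 + \<gamma>\<^sup>2" for t
 have "g t \<le> g 0 * exp ((2*L+1) * t)"
 proof (rule gronwall[OF t])
  fix s assume s: "s \<in> {0..T}"
  let ?g = "2 * ((X s - Z s) \<bullet> (f (X s) - z s))"
  have "((\<lambda>t. (X t - Z t) \<bullet> (X t - Z t)) has_vector_derivative
    (X s - Z s) \<bullet> (f (X s) - z s) + (f (X s) - z s) \<bullet> (X s - Z s)) (at s within {0..T})"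
   by (intro bounded_bilinear.has_vector_derivative[OF bounded_bilinear_inner]
     has_vector_derivative_diff X[OF s] Z[OF s])
  then show "(g has_real_derivative ?g) (at s within {0..T})"
   unfolding g_def has_real_derivative_iff_has_vector_derivative
   by (auto intro!: derivative_eq_intros simp: power2_norm_eq_inner inner_commute)
  define n where "n = norm (X s - Z s)"
  have "(X s - Z s) \<bullet> (f (X s) - z s) \<le> n * norm (f (X s) - z s)"
   unfolding n_def by (rule norm_cauchy_schwarz)
  also have "norm (f (X s) - z s) \<le> norm (f (X s) - f (Z s)) + norm (f (Z s) - z s)"
   by norm
  also have "\<dots> \<le> L * n + \<gamma>"
   using lipschitz_onD[OF lip, of "X s" "Z s"] zf[OF s] by (simp add: dist_norm n_def)
  finally have "?g \<le> 2 * (n * (L * n + \<gamma>))"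
   by (simp add: n_def mult_left_mono)
  also have "\<dots> \<le> (2*L+1) * (n\<^sup>2 + \<gamma>\<^sup>2)"
  proof -
   have "0 \<le> (n - \<gamma>)\<^sup>2 + 2 * L * \<gamma>\<^sup>2" using L0 by simp
   then show ?thesis by (simp add: power2_eq_square algebra_simps)
  qed
  finally show "?g \<le> (2*L+1) * g s" by (simp add: g_def n_def)
 qed
 also have "\<dots> \<le> g 0 * exp ((2*L+1) * T)"
  using t L0 by (intro mult_left_mono) (auto simp: g_def mult_left_mono)
 finally show ?thesis unfolding g_def using zero_le_power2[of \<gamma>] by linarith
qed

subsection \<open>Absolutely continuous functions\<close>

lemma AC_lipschitz:
 assumes "L-lipschitz_on {a..b} X"
 shows "abs_continuous_on_Icc a b X"
 unfolding abs_continuous_on_Icc_def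
proof (intro allI impI)
 fix e :: real assume e: "e > 0"
 have L: "L \<ge> 0" using assms lipschitz_on_nonneg by blast
 show "\<exists>d>0. \<forall>P. finite P \<and> (\<forall>(r, t)\<in>P. a \<le> r \<and> r \<le> t \<and> t \<le> b) \<and>
   disjoint_family_on (\<lambda>(r, t). {r<..<t}) P \<and> (\<Sum>(r, t)\<in>P. t - r) < d \<longrightarrow>
   (\<Sum>(r, t)\<in>P. dist (X r) (X t)) < e"
 proof (intro exI[of _ "e / (L + 1)"] conjI allI impI)
  fix P assume P: "finite P \<and> (\<forall>(r, t)\<in>P. a \<le> r \<and> r \<le> t \<and> t \<le> b) \<and>
   disjoint_family_on (\<lambda>(r, t). {r<..<t}) P \<and> (\<Sum>(r, t)\<in>P. t - r) < e / (L + 1)"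
  have "(\<Sum>(r, t)\<in>P. dist (X r) (X t)) \<le> (\<Sum>(r, t)\<in>P. (L + 1) * (t - r))"
  proof (rule sum_mono, clarify)
   fix r t assume "(r, t) \<in> P"
   then have rt: "a \<le> r" "r \<le> t" "t \<le> b" using P by auto
   have "dist (X r) (X t) \<le> L * dist r t"
    using rt by (intro lipschitz_onD[OF assms]) auto
   also have "\<dots> \<le> (L + 1) * (t - r)" using rt by (simp add: dist_real_def mult_right_mono)
   finally show "dist (X r) (X t) \<le> (L + 1) * (t - r)" .
  qed
  also have "\<dots> = (L + 1) * (\<Sum>(r, t)\<in>P. t - r)"
   by (simp add: sum_distrib_left case_prod_unfold)
  also have "\<dots> < e" using P L by (simp add: field_simps)
  finally show "(\<Sum>(r, t)\<in>P. dist (X r) (X t)) < e" .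
 qed (use e L in auto)
qed

text \<open>One estimate behind all closure properties used later: the increments of sums,
  differences, products and Lipschitz images are dominated by those of at most two given
  functions.\<close>

lemma AC_dominated:
 assumes u: "abs_continuous_on_Icc a b u" and v: "abs_continuous_on_Icc a b v"
  and K: "\<And>r t. r \<in> {a..b} \<Longrightarrow> t \<in> {a..b} \<Longrightarrow> dist (h r) (h t) \<le> K * (dist (u r) (u t) + dist (v r) (v t))"
 shows "abs_continuous_on_Icc a b h"
 unfolding abs_continuous_on_Icc_def
proof (intro allI impI)
 fix e :: real assume e: "e > 0"
 define K' where "K' = \<bar>K\<bar> + 1"
 have K': "K' > 0" by (simp add: K'_def add_nonneg_pos)
 then have e': "e / (2 * K') > 0" using e by simp
 let ?A = "\<lambda>P d. finite P \<and> (\<forall>(r, t)\<in>P. a \<le> r \<and> r \<le> t \<and> t \<le> b) \<and>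
   disjoint_family_on (\<lambda>(r, t). {r<..<t}) P \<and> (\<Sum>(r, t)\<in>P. t - r) < d"
 obtain d1 where d1: "d1 > 0" "\<And>P. ?A P d1 \<Longrightarrow> (\<Sum>(r, t)\<in>P. dist (u r) (u t)) < e / (2 * K')"
  using u e' unfolding abs_continuous_on_Icc_def by blast
 obtain d2 where d2: "d2 > 0" "\<And>P. ?A P d2 \<Longrightarrow> (\<Sum>(r, t)\<in>P. dist (v r) (v t)) < e / (2 * K')"
  using v e' unfolding abs_continuous_on_Icc_def by blast
 show "\<exists>d>0. \<forall>P. ?A P d \<longrightarrow> (\<Sum>(r, t)\<in>P. dist (h r) (h t)) < e"
 proof (intro exI[of _ "min d1 d2"] conjI allI impI)
  fix P assume P: "?A P (min d1 d2)"
  have "(\<Sum>(r, t)\<in>P. dist (h r) (h t)) \<le> (\<Sum>(r, t)\<in>P. K' * (dist (u r) (u t) + dist (v r) (v t)))"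
  proof (rule sum_mono, clarify)
   fix r t assume "(r, t) \<in> P"
   then have rt: "a \<le> r" "r \<le> t" "t \<le> b" using P by auto
   have "dist (h r) (h t) \<le> K * (dist (u r) (u t) + dist (v r) (v t))"
    using rt by (intro K) auto
   also have "\<dots> \<le> K' * (dist (u r) (u t) + dist (v r) (v t))"
    by (intro mult_right_mono) (auto simp: K'_def)
   finally show "dist (h r) (h t) \<le> K' * (dist (u r) (u t) + dist (v r) (v t))" .
  qed
  also have "\<dots> = K' * ((\<Sum>(r, t)\<in>P. dist (u r) (u t)) + (\<Sum>(r, t)\<in>P. dist (v r) (v t)))"
   by (simp add: sum_distrib_left case_prod_unfold sum.distrib distrib_left)
  also have "\<dots> < K' * (e / (2 * K') + e / (2 * K'))"
   using P K' by (intro mult_strict_left_mono add_strict_mono d1 d2) auto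
  also have "\<dots> = e" using K' by simp
  finally show "(\<Sum>(r, t)\<in>P. dist (h r) (h t)) < e" .
 qed (use d1 d2 in auto)
qed

lemma AC_lipschitz_comp:
 assumes "abs_continuous_on_Icc a b u"
  and "\<And>r t. r \<in> {a..b} \<Longrightarrow> t \<in> {a..b} \<Longrightarrow> dist (h r) (h t) \<le> K * dist (u r) (u t)"
 shows "abs_continuous_on_Icc a b h"
proof (rule AC_dominated[OF assms(1) assms(1)])
 show "dist (h r) (h t) \<le> (K / 2) * (dist (u r) (u t) + dist (u r) (u t))"
  if "r \<in> {a..b}" "t \<in> {a..b}" for r t
  using assms(2)[OF that] by simp
qed

lemma AC_subinterval:
 assumes "abs_continuous_on_Icc a b u" "a \<le> a'" "b' \<le> b"
 shows "abs_continuous_on_Icc a' b' u"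
 unfolding abs_continuous_on_Icc_def
proof (intro allI impI)
 fix e :: real assume "e > 0"
 then obtain d where "d > 0" and d: "\<And>P. finite P \<and> (\<forall>(r, t)\<in>P. a \<le> r \<and> r \<le> t \<and> t \<le> b) \<and>
    disjoint_family_on (\<lambda>(r, t). {r<..<t}) P \<and> (\<Sum>(r, t)\<in>P. t - r) < d \<Longrightarrow>
    (\<Sum>(r, t)\<in>P. dist (u r) (u t)) < e"
  using assms(1) unfolding abs_continuous_on_Icc_def by blast
 then show "\<exists>d>0. \<forall>P. finite P \<and> (\<forall>(r, t)\<in>P. a' \<le> r \<and> r \<le> t \<and> t \<le> b') \<and>
    disjoint_family_on (\<lambda>(r, t). {r<..<t}) P \<and> (\<Sum>(r, t)\<in>P. t - r) < d \<longrightarrow>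
    (\<Sum>(r, t)\<in>P. dist (u r) (u t)) < e"
  using assms(2,3) by (intro exI[of _ d]) fastforce
qed

lemma AC_imp_continuous_on:
 assumes "abs_continuous_on_Icc a b u"
 shows "continuous_on {a..b} u"
 unfolding continuous_on_iff
proof (intro ballI allI impI)
 fix x e :: real assume x: "x \<in> {a..b}" and "e > 0"
 then obtain d where "d > 0" and d: "\<And>P. finite P \<and> (\<forall>(r, t)\<in>P. a \<le> r \<and> r \<le> t \<and> t \<le> b) \<and>
    disjoint_family_on (\<lambda>(r, t). {r<..<t}) P \<and> (\<Sum>(r, t)\<in>P. t - r) < d \<Longrightarrow>
    (\<Sum>(r, t)\<in>P. dist (u r) (u t)) < e"
  using assms unfolding abs_continuous_on_Icc_def by blast
 have "dist (u x') (u x) < e" if "x' \<in> {a..b}" "dist x' x < d" for x'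
 proof -
  have "dist (u (min x x')) (u (max x x')) < e"
   using d[of "{(min x x', max x x')}"] x that
   by (auto simp: disjoint_family_on_def dist_real_def min_def max_def split: if_splits)
  then show ?thesis by (cases "x \<le> x'") (auto simp: min_def max_def dist_commute)
 qed
 then show "\<exists>d>0. \<forall>x'\<in>{a..b}. dist x' x < d \<longrightarrow> dist (u x') (u x) < e"
  using \<open>d > 0\<close> by blast
qed

lemma AC_mult:
 fixes u v :: "real \<Rightarrow> real"
 assumes u: "abs_continuous_on_Icc a b u" and v: "abs_continuous_on_Icc a b v"
 shows "abs_continuous_on_Icc a b (\<lambda>t. u t * v t)"
proof -
 have "bounded (u ` {a..b})" "bounded (v ` {a..b})"
  by (auto intro!: compact_imp_bounded compact_continuous_image AC_imp_continuous_on u v)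
 then obtain A B where A: "\<And>t. t \<in> {a..b} \<Longrightarrow> \<bar>u t\<bar> \<le> A" and B: "\<And>t. t \<in> {a..b} \<Longrightarrow> \<bar>v t\<bar> \<le> B"
  unfolding bounded_iff by (fastforce simp: real_norm_def)
 show ?thesis
 proof (rule AC_dominated[OF u v])
  fix r t assume rt: "r \<in> {a..b}" "t \<in> {a..b}"
  have "u r * v r - u t * v t = u r * (v r - v t) + (u r - u t) * v t" by algebra
  then have "\<bar>u r * v r - u t * v t\<bar> \<le> \<bar>u r\<bar> * \<bar>v r - v t\<bar> + \<bar>u r - u t\<bar> * \<bar>v t\<bar>"
   by (metis abs_mult abs_triangle_ineq)
  also have "\<dots> \<le> max A B * \<bar>v r - v t\<bar> + \<bar>u r - u t\<bar> * max A B"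
   using A[OF rt(1)] B[OF rt(2)] by (intro add_mono mult_left_mono mult_right_mono) auto
  finally show "dist (u r * v r) (u t * v t) \<le> max A B * (dist (u r) (u t) + dist (v r) (v t))"
   by (simp add: dist_real_def algebra_simps)
 qed
qed

lemma AC_add:
 fixes u v :: "real \<Rightarrow> real"
 assumes "abs_continuous_on_Icc a b u" "abs_continuous_on_Icc a b v"
 shows "abs_continuous_on_Icc a b (\<lambda>t. u t + v t)"
 by (rule AC_dominated[OF assms, where K = 1]) (auto simp: dist_real_def)

lemma AC_diff:
 fixes u v :: "real \<Rightarrow> real"
 assumes "abs_continuous_on_Icc a b u" "abs_continuous_on_Icc a b v"
 shows "abs_continuous_on_Icc a b (\<lambda>t. u t - v t)"
 by (rule AC_dominated[OF assms, where K = 1]) (auto simp: dist_real_def)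

text \<open>
 Gauge argument: on a tagged division that is fine for the straddle gauge outside \<open>N\<close> and for a
 small open cover of \<open>N\<close>, the tags outside \<open>N\<close> contribute almost nonpositive increments, and
 absolute continuity makes the contribution of the tags in \<open>N\<close> small.
\<close>

lemma AC_nonincreasing:
 fixes g :: "real \<Rightarrow> real"
 assumes ab: "a \<le> b" and ac: "abs_continuous_on_Icc a b g" and N: "negligible N"
  and D: "\<And>t. t \<in> {a..b} - N \<Longrightarrow> \<exists>D\<le>0. (g has_real_derivative D) (at t within {a..b})"
 shows "g b \<le> g a"
proof -
 have main: "g b - g a \<le> e * (b - a + 1)" if e: "e > 0" for e
 proof -
  obtain d where d0: "d > 0" and d: "\<And>P. finite P \<and> (\<forall>(r, t)\<in>P. a \<le> r \<and> r \<le> t \<and> t \<le> b) \<and>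
    disjoint_family_on (\<lambda>(r, t). {r<..<t}) P \<and> (\<Sum>(r, t)\<in>P. t - r) < d \<Longrightarrow>
    (\<Sum>(r, t)\<in>P. dist (g r) (g t)) < e"
   using ac e unfolding abs_continuous_on_Icc_def by blast
  have "N \<in> lmeasurable" "measure lebesgue N = 0"
   using N by (auto simp: negligible_iff_measure)
  then obtain U where U0: "open U" "N \<subseteq> U" "U - N \<in> lmeasurable" "emeasure lebesgue (U - N) < ennreal d"
   using sets_lebesgue_outer_open[of N d] d0 by blast
  have UN: "U = N \<union> (U - N)" using U0(2) by blast
  then have "U \<in> lmeasurable" using U0(3) \<open>N \<in> lmeasurable\<close> by (metis fmeasurable.Un)
  moreover have "measure lebesgue (U - N) < d"
   using U0(3,4) d0 by (simp add: emeasure_eq_measure2 ennreal_less_iff)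
  moreover have "measure lebesgue U \<le> measure lebesgue N + measure lebesgue (U - N)"
   using UN measure_Un_le[of N lebesgue "U - N"] U0(3) \<open>N \<in> lmeasurable\<close> by auto
  ultimately have U: "open U" "N \<subseteq> U" "U \<in> lmeasurable" "measure lebesgue U < d"
   using U0 \<open>measure lebesgue N = 0\<close> by auto
  have "\<exists>r>0. \<forall>y\<in>{a..b}. \<bar>y - t\<bar> < r \<longrightarrow>
    (t \<le> y \<longrightarrow> g y - g t \<le> e * (y - t)) \<and> (y \<le> t \<longrightarrow> g t - g y \<le> e * (t - y))"
   if t: "t \<in> {a..b} - N" for t
  proof -
   obtain D where "D \<le> 0" and D: "(g has_derivative (*) D) (at t within {a..b})"
    using D[OF t] by (auto simp: has_field_derivative_def)
   obtain r where "r > 0" and r: "\<And>y. y \<in> {a..b} \<Longrightarrow> \<bar>y - t\<bar> < r \<Longrightarrow> \<bar>g y - g t - D * (y - t)\<bar> \<le> e * \<bar>y - t\<bar>"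
    using D e unfolding has_derivative_within_alt by (auto simp: real_norm_def)
   have "(t \<le> y \<longrightarrow> g y - g t \<le> e * (y - t)) \<and> (y \<le> t \<longrightarrow> g t - g y \<le> e * (t - y))"
    if y: "y \<in> {a..b}" "\<bar>y - t\<bar> < r" for y
   proof (intro conjI impI)
    assume "t \<le> y"
    then have "D * (y - t) \<le> 0" using \<open>D \<le> 0\<close> by (simp add: mult_le_0_iff)
    then show "g y - g t \<le> e * (y - t)" using r[OF y] \<open>t \<le> y\<close> by (simp add: abs_le_iff)
   next
    assume "y \<le> t"
    then have "D * (y - t) \<ge> 0" using \<open>D \<le> 0\<close> by (simp add: zero_le_mult_iff)
    then show "g t - g y \<le> e * (t - y)" using r[OF y] \<open>y \<le> t\<close> by (simp add: abs_le_iff)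
   qed
   then show ?thesis using \<open>r > 0\<close> by blast
  qed
  then obtain r where r0: "\<And>t. t \<in> {a..b} - N \<Longrightarrow> r t > 0" and r: "\<And>t y. t \<in> {a..b} - N \<Longrightarrow> y \<in> {a..b} \<Longrightarrow> \<bar>y - t\<bar> < r t \<Longrightarrow>
    (t \<le> y \<longrightarrow> g y - g t \<le> e * (y - t)) \<and> (y \<le> t \<longrightarrow> g t - g y \<le> e * (t - y))"
   by metis
  define \<gamma> where "\<gamma> t = (if t \<in> N then U else if t \<in> {a..b} then ball t (r t) else ball t 1)" for t
  have "gauge \<gamma>"
   unfolding gauge_def \<gamma>_def using U r0 by auto
  then obtain p where p: "p tagged_division_of {a..b}" and fine: "\<gamma> fine p"
   using fine_division_exists_real by blast
  note pD = tagged_division_ofD[OF p]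
  have pI: "\<exists>u v. K = {u..v} \<and> a \<le> u \<and> u \<le> x \<and> x \<le> v \<and> v \<le> b" if xK: "(x, K) \<in> p" for x K
  proof -
   obtain u v where K: "K = {u..v}" using pD(4)[OF xK] by (auto simp: cbox_interval)
   then show ?thesis using pD(2,3)[OF xK] by force
  qed
  define F where "F = (\<lambda>(x::real, K). g (Sup K) - g (Inf K))"
  define len where "len = (\<lambda>(x::real, K::real set). Sup K - Inf K)"
  have sumF: "sum F p = g b - g a"
   unfolding F_def by (rule additive_tagged_division_1[OF ab p])
  have sumlen: "sum len p = b - a"
   unfolding len_def using additive_tagged_division_1[OF ab p, of "\<lambda>x. x"] by simp
  \<comment> \<open>Degenerate intervals contribute nothing to \<open>F\<close>. Leaving them out
    makes \<open>h\<close> injective on \<open>q\<close>, so that the intervals can be passed to the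
    definition of absolute continuity as a set of pairs.\<close>
  define q where "q = {(x, K) \<in> p. x \<in> N \<and> Inf K < Sup K}"
  have qp: "q \<subseteq> p" by (auto simp: q_def)
  then have fq: "finite q" using pD(1) finite_subset by blast
  have "sum F (p - q) \<le> sum (\<lambda>z. e * len z) (p - q)"
  proof (rule sum_mono, clarify)
   fix x K assume xK: "(x, K) \<in> p" "(x, K) \<notin> q"
   obtain u v where K: "K = {u..v}" "a \<le> u" "u \<le> x" "x \<le> v" "v \<le> b" using pI[OF xK(1)] by blast
   show "F (x, K) \<le> e * len (x, K)"
   proof (cases "x \<in> N")
    case True
    then have "u = v" using xK K by (auto simp: q_def)
    then show ?thesis by (simp add: F_def len_def K)
   next
    case False
    have "K \<subseteq> \<gamma> x" using fine xK(1) by (auto simp: fine_def)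
    then have "u \<in> ball x (r x)" "v \<in> ball x (r x)" using False K by (auto simp: \<gamma>_def subset_iff)
    then have "g v - g x \<le> e * (v - x)" "g x - g u \<le> e * (x - u)"
     using r[of x v] r[of x u] False K by (auto simp: dist_real_def abs_minus_commute)
    then show ?thesis using K by (simp add: F_def len_def algebra_simps)
   qed
  qed
  also have "\<dots> \<le> sum (\<lambda>z. e * len z) p"
  proof (rule sum_mono2)
   show "0 \<le> e * len z" if "z \<in> p - (p - q)" for z
    using that pI e by (cases z) (fastforce simp: len_def q_def)
  qed (use pD(1) in auto)
  also have "\<dots> = e * (b - a)" by (simp add: sumlen flip: sum_distrib_left)
  finally have part1: "sum F (p - q) \<le> e * (b - a)" .
  define h where "h = (\<lambda>(x::real, K::real set). (Inf K, Sup K))"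
  have sep: "{Inf K<..<Sup K} \<inter> {Inf K'<..<Sup K'} = {}" if qq: "(x, K) \<in> q" "(x', K') \<in> q" "(x, K) \<noteq> (x', K')" for x K x' K'
  proof -
   obtain u v where K: "K = {u..v}" "u \<le> v" using pI[of x K] qq(1) qp by (meson order_trans subsetD)
   obtain u' v' where K': "K' = {u'..v'}" "u' \<le> v'" using pI[of x' K'] qq(2) qp by (meson order_trans subsetD)
   have "interior K \<inter> interior K' = {}"
    using pD(5)[of x K x' K'] qq qp by auto
   then show ?thesis using K K' by (simp add: interior_atLeastAtMost_real)
  qed
  have "inj_on h q"
  proof (rule inj_onI, clarify)
   fix x K x' K' assume xK: "(x, K) \<in> q" "(x', K') \<in> q" "h (x, K) = h (x', K')"
   show "x = x' \<and> K = K'"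
   proof (rule ccontr)
    assume "\<not> (x = x' \<and> K = K')"
    then have "{Inf K<..<Sup K} = {}" using sep[OF xK(1,2)] xK(3) by (auto simp: h_def)
    then show False using xK(1) by (auto simp: q_def)
   qed
  qed
  have lenq: "sum len q \<le> measure lebesgue U"
  proof -
   let ?J = "\<lambda>(x::real, K::real set). {Inf K<..<Sup K}"
   have "sum len q = (\<Sum>z\<in>q. measure lebesgue (?J z))"
    by (intro sum.cong) (auto simp: len_def q_def)
   also have "\<dots> = measure lebesgue (\<Union>(?J ` q))"
   proof (intro measure_negligible_finite_Union_image[symmetric])
    show "pairwise (\<lambda>x y. negligible (?J x \<inter> ?J y)) q"
     unfolding pairwise_def
    proof (intro ballI impI)
     fix x y assume "x \<in> q" "y \<in> q" "x \<noteq> y"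
     then have "?J x \<inter> ?J y = {}"
      using sep[of "fst x" "snd x" "fst y" "snd y"] unfolding case_prod_unfold prod.collapse by blast
     then show "negligible (?J x \<inter> ?J y)" by (simp only: negligible_empty)
    qed
   qed (use fq in auto)
   also have "\<dots> \<le> measure lebesgue U"
   proof (rule measure_mono_fmeasurable)
    have "{Inf K<..<Sup K} \<subseteq> U" if xK: "(x, K) \<in> q" for x K
    proof -
     obtain u v where "K = {u..v}" "u \<le> v" using pI[of x K] xK qp by (meson order_trans subsetD)
     then have "{Inf K<..<Sup K} \<subseteq> K" by auto
     moreover have "K \<subseteq> U" using fineD[OF fine, of x K] xK by (auto simp: q_def \<gamma>_def)
     ultimately show ?thesis by blast
    qed
    then show "\<Union>(?J ` q) \<subseteq> U" by auto
    show "\<Union>(?J ` q) \<in> sets lebesgue" by (intro fmeasurableD fmeasurable.finite_UN) (use fq in auto)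
   qed (use U in auto)
   finally show ?thesis .
  qed
  have "(\<Sum>(r, t)\<in>h ` q. dist (g r) (g t)) < e"
  proof (rule d, intro conjI)
   show "\<forall>(r, t)\<in>h ` q. a \<le> r \<and> r \<le> t \<and> t \<le> b"
    using pI qp by (fastforce simp: h_def)
   show "disjoint_family_on (\<lambda>(r, t). {r<..<t}) (h ` q)"
    unfolding disjoint_family_on_def using sep by (fastforce simp: h_def)
   have "(\<Sum>(r, t)\<in>h ` q. t - r) = sum len q"
    by (subst sum.reindex[OF \<open>inj_on h q\<close>]) (auto simp: h_def len_def intro!: sum.cong)
   then show "(\<Sum>(r, t)\<in>h ` q. t - r) < d" using lenq U by simp
  qed (use fq in auto)
  moreover have "sum F q \<le> (\<Sum>(r, t)\<in>h ` q. dist (g r) (g t))"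
   by (subst sum.reindex[OF \<open>inj_on h q\<close>]) (auto simp: h_def F_def dist_real_def intro!: sum_mono)
  moreover have "sum F p = sum F (p - q) + sum F q"
   using sum.subset_diff[OF qp pD(1), of F] by simp
  ultimately show ?thesis using part1 sumF by (simp add: algebra_simps)
 qed
 have "g b - g a \<le> 0"
 proof (rule ccontr)
  assume neg: "\<not> g b - g a \<le> 0"
  \<comment> \<open>For this \<open>e\<close> the right-hand side of \<open>main\<close> is half of
    the assumed positive excess.\<close>
  define e where "e = (g b - g a) / (2 * (b - a + 1))"
  have "e > 0" using neg ab by (simp add: e_def)
  moreover have "e * (b - a + 1) = (g b - g a) / 2"
  proof -
   define c where "c = b - a + 1"
   have "c > 0" using ab by (simp add: c_def)
   then show ?thesis unfolding e_def c_def[symmetric] by simp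
  qed
  ultimately have "g b - g a \<le> (g b - g a) / 2" using main by metis
  then show False using neg by simp
 qed
 then show ?thesis by simp
qed

lemma AC_gronwall:
 fixes g :: "real \<Rightarrow> real"
 assumes ab: "a \<le> b" and ac: "abs_continuous_on_Icc a b g" and N: "negligible N"
  and D: "\<And>t. t \<in> {a..b} - N \<Longrightarrow> \<exists>D\<le>K * g t. (g has_real_derivative D) (at t within {a..b})"
 shows "g b \<le> g a * exp (K * (b - a))"
proof -
 let ?h = "\<lambda>t. exp (- K * (t - a)) * g t"
 have "abs_continuous_on_Icc a b (\<lambda>t. exp (- K * (t - a)))"
 proof -
  have "\<exists>L. L-lipschitz_on {a..b} (\<lambda>t. exp (- K * (t - a)))"
  proof -
   have "continuous_on {a..b} (\<lambda>t. - K * exp (- K * (t - a)))" by (intro continuous_intros)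
   then have "bounded ((\<lambda>t. - K * exp (- K * (t - a))) ` {a..b})"
    by (intro compact_imp_bounded compact_continuous_image) auto
   then obtain B where "B > 0" and B: "\<And>t. t \<in> {a..b} \<Longrightarrow> \<bar>- K * exp (- K * (t - a))\<bar> \<le> B"
    unfolding bounded_pos by (auto simp: image_iff)
   have "B-lipschitz_on {a..b} (\<lambda>t. exp (- K * (t - a)))"
   proof (rule bounded_derivative_imp_lipschitz[where f' = "\<lambda>t h. (- K * exp (- K * (t - a))) * h"])
    show "((\<lambda>t. exp (- K * (t - a))) has_derivative (\<lambda>h. (- K * exp (- K * (x - a))) * h)) (at x within {a..b})" for x
     by (auto intro!: derivative_eq_intros)
    show "onorm (\<lambda>h. (- K * exp (- K * (x - a))) * h) \<le> B" if "x \<in> {a..b}" for x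
     using B[OF that] \<open>B > 0\<close> by (intro onorm_le) (auto simp: abs_mult mult_right_mono)
   qed (use \<open>B > 0\<close> in auto)
   then show ?thesis by blast
  qed
  then show ?thesis using AC_lipschitz by blast
 qed
 then have "abs_continuous_on_Icc a b ?h" using ac by (rule AC_mult)
 then have "?h b \<le> ?h a"
 proof (rule AC_nonincreasing[OF ab _ N])
  fix t assume t: "t \<in> {a..b} - N"
  then obtain D where D: "D \<le> K * g t" "(g has_real_derivative D) (at t within {a..b})" using D by blast
  have "exp (- K * (t - a)) * (D - K * g t) \<le> 0" using D by (simp add: mult_le_0_iff)
  moreover have "(?h has_real_derivative exp (- K * (t - a)) * (D - K * g t)) (at t within {a..b})"
   using D(2) by (auto intro!: derivative_eq_intros simp: algebra_simps)
  ultimately show "\<exists>D\<le>0. (?h has_real_derivative D) (at t within {a..b})" by blast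
 qed
 then have "g b * exp (- K * (b - a)) \<le> g a" by (simp add: mult.commute)
 then have "g b * exp (- K * (b - a)) * exp (K * (b - a)) \<le> g a * exp (K * (b - a))"
  by (rule mult_right_mono) simp
 then show ?thesis by (simp add: mult.assoc flip: exp_add)
qed

subsection \<open>Bounded Lipschitz functions\<close>

text \<open>A single constant serves as bound and as Lipschitz constant, which makes the class
  closed under products. The set is a bounded box in the uniqueness argument and \<open>UNIV\<close>
  for the clipped fields.\<close>

definition blip_on :: "'a::metric_space set \<Rightarrow> ('a \<Rightarrow> real) \<Rightarrow> bool" where
 "blip_on S f \<longleftrightarrow> (\<exists>B\<ge>0. \<forall>x\<in>S. \<bar>f x\<bar> \<le> B \<and> (\<forall>y\<in>S. \<bar>f x - f y\<bar> \<le> B * dist x y))"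

lemma blip_const: "blip_on S (\<lambda>x. c)"
 unfolding blip_on_def by (intro exI[of _ "\<bar>c\<bar>"]) auto

lemma blip_add:
 assumes "blip_on S f" "blip_on S g"
 shows "blip_on S (\<lambda>x. f x + g x)"
proof -
 obtain A B where A: "A \<ge> 0" "\<And>x. x \<in> S \<Longrightarrow> \<bar>f x\<bar> \<le> A" "\<And>x y. x \<in> S \<Longrightarrow> y \<in> S \<Longrightarrow> \<bar>f x - f y\<bar> \<le> A * dist x y"
  and B: "B \<ge> 0" "\<And>x. x \<in> S \<Longrightarrow> \<bar>g x\<bar> \<le> B" "\<And>x y. x \<in> S \<Longrightarrow> y \<in> S \<Longrightarrow> \<bar>g x - g y\<bar> \<le> B * dist x y"
  using assms unfolding blip_on_def by blast
 show ?thesis unfolding blip_on_def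
 proof (intro exI[of _ "A + B"] conjI ballI)
  fix x y assume xy: "x \<in> S" "y \<in> S"
  show "\<bar>f x + g x - (f y + g y)\<bar> \<le> (A + B) * dist x y"
   unfolding distrib_right using A(3)[OF xy] B(3)[OF xy] by linarith
 next
  fix x assume "x \<in> S"
  then show "\<bar>f x + g x\<bar> \<le> A + B" using A(2)[of x] B(2)[of x] by linarith
 qed (use A B in auto)
qed

lemma blip_mult:
 assumes "blip_on S f" "blip_on S g"
 shows "blip_on S (\<lambda>x. f x * g x)"
proof -
 obtain A B where A: "A \<ge> 0" "\<And>x. x \<in> S \<Longrightarrow> \<bar>f x\<bar> \<le> A" "\<And>x y. x \<in> S \<Longrightarrow> y \<in> S \<Longrightarrow> \<bar>f x - f y\<bar> \<le> A * dist x y"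
  and B: "B \<ge> 0" "\<And>x. x \<in> S \<Longrightarrow> \<bar>g x\<bar> \<le> B" "\<And>x y. x \<in> S \<Longrightarrow> y \<in> S \<Longrightarrow> \<bar>g x - g y\<bar> \<le> B * dist x y"
  using assms unfolding blip_on_def by blast
 show ?thesis unfolding blip_on_def
 proof (intro exI[of _ "2 * A * B"] conjI ballI)
  fix x y assume xy: "x \<in> S" "y \<in> S"
  have "f x * g x - f y * g y = f x * (g x - g y) + (f x - f y) * g y" by algebra
  then have "\<bar>f x * g x - f y * g y\<bar> \<le> \<bar>f x\<bar> * \<bar>g x - g y\<bar> + \<bar>f x - f y\<bar> * \<bar>g y\<bar>"
   by (metis abs_mult abs_triangle_ineq)
  also have "\<dots> \<le> A * (B * dist x y) + (A * dist x y) * B"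
   using xy A B by (intro add_mono mult_mono) auto
  finally show "\<bar>f x * g x - f y * g y\<bar> \<le> 2 * A * B * dist x y" by (simp add: algebra_simps)
 next
  fix x assume x: "x \<in> S"
  have "\<bar>f x * g x\<bar> \<le> A * B" unfolding abs_mult using x A B by (intro mult_mono) auto
  then show "\<bar>f x * g x\<bar> \<le> 2 * A * B" using mult_nonneg_nonneg[OF A(1) B(1)] by linarith
 qed (use A B in auto)
qed

lemma blip_lipschitz_comp:
 assumes "blip_on S f" "\<And>x y. \<bar>h x - h y\<bar> \<le> \<bar>x - y\<bar>"
 shows "blip_on S (\<lambda>x. h (f x))"
proof -
 obtain A where A: "A \<ge> 0" "\<And>x. x \<in> S \<Longrightarrow> \<bar>f x\<bar> \<le> A" "\<And>x y. x \<in> S \<Longrightarrow> y \<in> S \<Longrightarrow> \<bar>f x - f y\<bar> \<le> A * dist x y"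
  using assms unfolding blip_on_def by blast
 show ?thesis unfolding blip_on_def
 proof (intro exI[of _ "A + \<bar>h 0\<bar>"] conjI ballI)
  fix x y assume xy: "x \<in> S" "y \<in> S"
  have "\<bar>h (f x) - h (f y)\<bar> \<le> A * dist x y" using assms(2) A(3)[OF xy] order_trans by blast
  then show "\<bar>h (f x) - h (f y)\<bar> \<le> (A + \<bar>h 0\<bar>) * dist x y" by (simp add: distrib_right add_increasing2)
 next
  fix x assume "x \<in> S"
  then show "\<bar>h (f x)\<bar> \<le> A + \<bar>h 0\<bar>" using A(2)[of x] assms(2)[of "f x" 0] by linarith
 qed (use A in auto)
qed

lemma blip_minus: "blip_on S f \<Longrightarrow> blip_on S (\<lambda>x. - f x)"
 by (rule blip_lipschitz_comp) auto

lemma blip_diff: "blip_on S f \<Longrightarrow> blip_on S g \<Longrightarrow> blip_on S (\<lambda>x. f x - g x)"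
 using blip_add[OF _ blip_minus, of S f g] by simp

lemma blip_power2: "blip_on S f \<Longrightarrow> blip_on S (\<lambda>x. (f x)\<^sup>2)"
 unfolding power2_eq_square by (rule blip_mult)

lemma abs_sin_diff_le: "\<bar>sin x - sin y\<bar> \<le> \<bar>x - y\<bar>" for x y :: real
proof -
 have "\<bar>sin x - sin y\<bar> = 2 * \<bar>sin ((x - y) / 2)\<bar> * \<bar>cos ((x + y) / 2)\<bar>"
  by (simp add: sin_diff_sin abs_mult)
 also have "\<dots> \<le> 2 * \<bar>(x - y) / 2\<bar> * 1"
  by (intro mult_mono abs_sin_x_le_abs_x mult_nonneg_nonneg) auto
 finally show ?thesis by simp
qed

lemma abs_cos_diff_le: "\<bar>cos x - cos y\<bar> \<le> \<bar>x - y\<bar>" for x y :: real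
 using abs_sin_diff_le[of "x + pi / 2" "y + pi / 2"] by (simp add: sin_add)

lemma blip_sin: "(\<And>x y. \<bar>f x - f y\<bar> \<le> dist x y) \<Longrightarrow> blip_on S (\<lambda>x. sin (f x))"
 unfolding blip_on_def using abs_sin_diff_le order_trans by (intro exI[of _ 1]) fastforce

lemma blip_cos: "(\<And>x y. \<bar>f x - f y\<bar> \<le> dist x y) \<Longrightarrow> blip_on S (\<lambda>x. cos (f x))"
 unfolding blip_on_def using abs_cos_diff_le order_trans by (intro exI[of _ 1]) fastforce

lemma blip_divide:
 assumes "blip_on S f" "blip_on S g" "\<And>x. g x \<ge> 1"
 shows "blip_on S (\<lambda>x. f x / g x)"
proof -
 obtain B where B: "B \<ge> 0" "\<And>x y. x \<in> S \<Longrightarrow> y \<in> S \<Longrightarrow> \<bar>g x - g y\<bar> \<le> B * dist x y"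
  using assms unfolding blip_on_def by blast
 have "blip_on S (\<lambda>x. 1 / g x)"
  unfolding blip_on_def
 proof (intro exI[of _ "B + 1"] conjI ballI)
  fix x y assume xy: "x \<in> S" "y \<in> S"
  have g: "g x \<ge> 1" "g y \<ge> 1" using assms by auto
  have "\<bar>1 / g x - 1 / g y\<bar> = \<bar>g x - g y\<bar> / (g x * g y)"
   using g by (simp add: diff_frac_eq abs_minus_commute abs_mult)
  also have "\<dots> \<le> \<bar>g x - g y\<bar> / 1"
   using g mult_mono[of 1 "g x" 1 "g y"] by (intro divide_left_mono) auto
  finally show "\<bar>1 / g x - 1 / g y\<bar> \<le> (B + 1) * dist x y"
   using B(2)[OF xy] by (simp add: distrib_right add_increasing2)
 next
  fix x show "\<bar>1 / g x\<bar> \<le> B + 1"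
   using assms(3)[of x] B(1) by (simp add: divide_le_eq mult_ge1_I)
 qed (use B in auto)
 from blip_mult[OF assms(1) this] show ?thesis by simp
qed

lemma blip_proj:
 assumes "\<And>x. x \<in> S \<Longrightarrow> \<bar>f x\<bar> \<le> R" "\<And>x y. \<bar>f x - f y\<bar> \<le> dist x y" "R \<ge> 0"
 shows "blip_on S f"
 unfolding blip_on_def
proof (intro exI[of _ "R + 1"] conjI ballI)
 fix x y show "\<bar>f x - f y\<bar> \<le> (R + 1) * dist x y"
  using assms(2)[of x y] assms(3) by (simp add: distrib_right add_increasing)
next
 fix x assume "x \<in> S" then show "\<bar>f x\<bar> \<le> R + 1" using assms(1)[of x] by simp
qed (use assms in auto)

lemma dist_Pair_le: "dist (a, b) (c, d) \<le> dist a c + dist b d"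
 by (simp add: dist_Pair_Pair sqrt_sum_squares_le_sum)

subsection \<open>The Filippov field as a one-parameter family\<close>

abbreviation "st_y x \<equiv> fst x"
abbreviation "st_w x \<equiv> fst (snd x)"
abbreviation "st_th x \<equiv> fst (snd (snd x))"
abbreviation "st_ph x \<equiv> fst (snd (snd (snd x)))"
abbreviation "st_v x \<equiv> snd (snd (snd (snd x)))"

text \<open>All coefficients are affine in the slip sign, so the weights \<open>u\<close>,
  \<open>u'\<close> produce the field with sign \<open>u - u'\<close>. The Filippov hull on
  \<open>v = 0\<close> thus becomes a family indexed by a number in \<open>{- 1..1}\<close>.\<close>

lemma vfield_convex_combination:
 assumes "u + u' = 1"
 shows "u *\<^sub>R vfield \<alpha> \<mu> \<delta> eps 1 x + u' *\<^sub>R vfield \<alpha> \<mu> \<delta> eps (- 1) x = vfield \<alpha> \<mu> \<delta> eps (u - u') x"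
proof -
 obtain y w \<theta> \<phi> v where x: "x = (y, w, \<theta>, \<phi>, v)" by (metis prod.exhaust)
 have u: "u = 1 - u'" using assms by simp
 show ?thesis
  unfolding x u by (simp add: p_coeff_def q_coeff_def c_coeff_def) (simp add: algebra_simps)
qed

lemma filippov_field_iff:
 "D \<in> filippov_field \<alpha> \<mu> \<delta> eps x \<longleftrightarrow>
  (\<exists>s. \<bar>s\<bar> \<le> 1 \<and> (st_v x > 0 \<longrightarrow> s = 1) \<and> (st_v x < 0 \<longrightarrow> s = - 1) \<and> D = vfield \<alpha> \<mu> \<delta> eps s x)"
proof -
 obtain y w \<theta> \<phi> v where x: "x = (y, w, \<theta>, \<phi>, v)" by (metis prod.exhaust)
 consider "v > 0" | "v < 0" | "v = 0" by linarith
 then show ?thesis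
 proof cases
  assume v: "v = 0"
  have "D \<in> convex hull {vfield \<alpha> \<mu> \<delta> eps 1 x, vfield \<alpha> \<mu> \<delta> eps (- 1) x} \<longleftrightarrow>
    (\<exists>s. \<bar>s\<bar> \<le> 1 \<and> D = vfield \<alpha> \<mu> \<delta> eps s x)" (is "?l \<longleftrightarrow> ?r")
  proof
   assume ?l
   then obtain u u' where "u \<ge> 0" "u' \<ge> 0" "u + u' = 1"
    "D = u *\<^sub>R vfield \<alpha> \<mu> \<delta> eps 1 x + u' *\<^sub>R vfield \<alpha> \<mu> \<delta> eps (- 1) x"
    by (auto simp: convex_hull_2)
   then show ?r using vfield_convex_combination[of u u'] by (intro exI[of _ "u - u'"]) auto
  next
   assume ?r
   then obtain s where s: "\<bar>s\<bar> \<le> 1" "D = vfield \<alpha> \<mu> \<delta> eps s x" by blast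
   have "D = ((1 + s) / 2) *\<^sub>R vfield \<alpha> \<mu> \<delta> eps 1 x + ((1 - s) / 2) *\<^sub>R vfield \<alpha> \<mu> \<delta> eps (- 1) x"
    using vfield_convex_combination[of "(1 + s) / 2" "(1 - s) / 2" \<alpha> \<mu> \<delta> eps x] s(2)
    by (simp add: diff_divide_distrib add_divide_distrib)
   then show ?l unfolding convex_hull_2 using s(1)
    by (intro CollectI exI[of _ "(1 + s) / 2"] exI[of _ "(1 - s) / 2"]) (auto simp: field_simps)
  qed
  then show ?thesis by (simp add: x v)
 qed (auto simp: x)
qed

lemma has_vector_derivative_components:
 assumes "(X has_vector_derivative (d1, d2, d3, d4, d5)) F"
 shows "((\<lambda>t. st_y (X t)) has_real_derivative d1) F"
  and "((\<lambda>t. st_w (X t)) has_real_derivative d2) F"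
  and "((\<lambda>t. st_th (X t)) has_real_derivative d3) F"
  and "((\<lambda>t. st_ph (X t)) has_real_derivative d4) F"
  and "((\<lambda>t. st_v (X t)) has_real_derivative d5) F"
proof -
 note f = bounded_linear.has_vector_derivative[OF bounded_linear_fst]
  and s = bounded_linear.has_vector_derivative[OF bounded_linear_snd]
 note 1 = s[OF assms] note 2 = s[OF 1] note 3 = s[OF 2]
 show "((\<lambda>t. st_y (X t)) has_real_derivative d1) F"
  "((\<lambda>t. st_w (X t)) has_real_derivative d2) F"
  "((\<lambda>t. st_th (X t)) has_real_derivative d3) F"
  "((\<lambda>t. st_ph (X t)) has_real_derivative d4) F"
  "((\<lambda>t. st_v (X t)) has_real_derivative d5) F"
  unfolding has_real_derivative_iff_has_vector_derivative
  using f[OF assms] f[OF 1] f[OF 2] f[OF 3] s[OF 3] by simp_all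
qed

lemma AC_components:
 assumes "abs_continuous_on_Icc a b X"
 shows "abs_continuous_on_Icc a b (\<lambda>t. st_y (X t))"
  and "abs_continuous_on_Icc a b (\<lambda>t. st_w (X t))"
  and "abs_continuous_on_Icc a b (\<lambda>t. st_th (X t))"
  and "abs_continuous_on_Icc a b (\<lambda>t. st_ph (X t))"
  and "abs_continuous_on_Icc a b (\<lambda>t. st_v (X t))"
 by (rule AC_lipschitz_comp[OF assms, where K = 1],
   simp, meson dist_fst_le dist_snd_le order_trans)+

subsection \<open>Uniqueness of Filippov solutions\<close>

text \<open>
 In the coordinates \<open>w - k_w \<theta> * v\<close> and \<open>\<phi> - k_ph \<theta> * v\<close> the sign \<open>s\<close> enters only the equation
 for \<open>v\<close>, through the dissipative term \<open>- s * \<mu> * (1 + \<alpha> * sin\<^sup>2 \<theta>) * F\<^sub>N\<close>.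
\<close>

definition k_den :: "real \<Rightarrow> real \<Rightarrow> real" where "k_den \<alpha> \<theta> = 1 + \<alpha> * (sin \<theta>)\<^sup>2"
definition k_w :: "real \<Rightarrow> real \<Rightarrow> real" where "k_w \<alpha> \<theta> = \<alpha> * sin \<theta> * cos \<theta> / k_den \<alpha> \<theta>"
definition k_ph :: "real \<Rightarrow> real \<Rightarrow> real" where "k_ph \<alpha> \<theta> = - (\<alpha> * sin \<theta>) / k_den \<alpha> \<theta>"
definition k_w' :: "real \<Rightarrow> real \<Rightarrow> real" where
 "k_w' \<alpha> \<theta> = \<alpha> * ((cos \<theta>)\<^sup>2 - (sin \<theta>)\<^sup>2) / k_den \<alpha> \<theta> - 2 * \<alpha>\<^sup>2 * (sin \<theta>)\<^sup>2 * (cos \<theta>)\<^sup>2 / (k_den \<alpha> \<theta> * k_den \<alpha> \<theta>)"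
definition k_ph' :: "real \<Rightarrow> real \<Rightarrow> real" where
 "k_ph' \<alpha> \<theta> = - (\<alpha> * cos \<theta>) / k_den \<alpha> \<theta> + 2 * \<alpha>\<^sup>2 * (sin \<theta>)\<^sup>2 * cos \<theta> / (k_den \<alpha> \<theta> * k_den \<alpha> \<theta>)"

lemma k_den_ge: "\<alpha> > 0 \<Longrightarrow> k_den \<alpha> \<theta> \<ge> 1"
 by (simp add: k_den_def)

lemma k_den_deriv:
 assumes "(g has_real_derivative d) (at t within A)"
 shows "((\<lambda>t. k_den \<alpha> (g t)) has_real_derivative 2 * \<alpha> * sin (g t) * cos (g t) * d) (at t within A)"
 using assms unfolding k_den_def by (auto intro!: derivative_eq_intros)

lemma k_w_deriv:
 assumes "\<alpha> > 0" and g: "(g has_real_derivative d) (at t within A)"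
 shows "((\<lambda>t. k_w \<alpha> (g t)) has_real_derivative k_w' \<alpha> (g t) * d) (at t within A)"
proof -
 define D where "D = k_den \<alpha> (g t)"
 have D: "D \<noteq> 0" using k_den_ge[OF assms(1), of "g t"] by (simp add: D_def)
 have num: "((\<lambda>t. \<alpha> * sin (g t) * cos (g t)) has_real_derivative \<alpha> * ((cos (g t))\<^sup>2 - (sin (g t))\<^sup>2) * d) (at t within A)"
  using g by (auto intro!: derivative_eq_intros simp: power2_eq_square algebra_simps)
 have "k_w' \<alpha> (g t) * d = (\<alpha> * ((cos (g t))\<^sup>2 - (sin (g t))\<^sup>2) * d * D
   - \<alpha> * sin (g t) * cos (g t) * (2 * \<alpha> * sin (g t) * cos (g t) * d)) / (D * D)"
  unfolding k_w'_def D_def[symmetric] using D by (simp add: field_simps power2_eq_square)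
 then show ?thesis
  using DERIV_divide[OF num k_den_deriv[OF g] D[unfolded D_def]] unfolding k_w_def D_def by simp
qed

lemma k_ph_deriv:
 assumes "\<alpha> > 0" and g: "(g has_real_derivative d) (at t within A)"
 shows "((\<lambda>t. k_ph \<alpha> (g t)) has_real_derivative k_ph' \<alpha> (g t) * d) (at t within A)"
proof -
 define D where "D = k_den \<alpha> (g t)"
 have D: "D \<noteq> 0" using k_den_ge[OF assms(1), of "g t"] by (simp add: D_def)
 have num: "((\<lambda>t. - (\<alpha> * sin (g t))) has_real_derivative - (\<alpha> * cos (g t)) * d) (at t within A)"
  using g by (auto intro!: derivative_eq_intros)
 have "k_ph' \<alpha> (g t) * d = (- (\<alpha> * cos (g t)) * d * D
   - - (\<alpha> * sin (g t)) * (2 * \<alpha> * sin (g t) * cos (g t) * d)) / (D * D)"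
  unfolding k_ph'_def D_def[symmetric] using D by (simp add: field_simps power2_eq_square)
 then show ?thesis
  using DERIV_divide[OF num k_den_deriv[OF g] D[unfolded D_def]] unfolding k_ph_def D_def by simp
qed

lemma blip_k:
 assumes par: "\<alpha> > 0" and g: "\<And>x y. \<bar>g x - g y\<bar> \<le> dist x y"
 shows "blip_on S (\<lambda>z. k_w \<alpha> (g z))" "blip_on S (\<lambda>z. k_ph \<alpha> (g z))"
  "blip_on S (\<lambda>z. k_w' \<alpha> (g z))" "blip_on S (\<lambda>z. k_ph' \<alpha> (g z))"
  "blip_on S (\<lambda>z. (1 + \<alpha>) / k_den \<alpha> (g z))" "blip_on S (\<lambda>z. - (\<alpha> * cos (g z)) / k_den \<alpha> (g z))"
  "blip_on S (\<lambda>z. k_den \<alpha> (g z))"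
proof -
 note * = blip_sin[of g, OF g] blip_cos[of g, OF g]
 show d: "blip_on S (\<lambda>z. k_den \<alpha> (g z))" unfolding k_den_def by (intro blip_add blip_mult blip_power2 blip_const *)
 have dd: "k_den \<alpha> \<theta> * k_den \<alpha> \<theta> \<ge> 1" for \<theta>
  using mult_mono[OF k_den_ge[OF par, of \<theta>] k_den_ge[OF par, of \<theta>]] k_den_ge[OF par, of \<theta>] by simp
 note dv = blip_divide[OF _ d k_den_ge[OF par]] blip_divide[OF _ blip_mult[OF d d] dd]
 show "blip_on S (\<lambda>z. k_w \<alpha> (g z))" "blip_on S (\<lambda>z. k_ph \<alpha> (g z))"
  "blip_on S (\<lambda>z. k_w' \<alpha> (g z))" "blip_on S (\<lambda>z. k_ph' \<alpha> (g z))"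
  "blip_on S (\<lambda>z. (1 + \<alpha>) / k_den \<alpha> (g z))" "blip_on S (\<lambda>z. - (\<alpha> * cos (g z)) / k_den \<alpha> (g z))"
  unfolding k_w_def k_ph_def k_w'_def k_ph'_def
  by (intro dv blip_add blip_diff blip_minus blip_mult blip_power2 blip_const *)+
qed

text \<open>The slip sign enters \<open>p_coeff\<close> only through \<open>q_coeff\<close>, and
  \<open>S_w\<close> is the value that remains when \<open>q_coeff\<close> vanishes. Hence
  \<open>w - k_w * v\<close> has an equation free of the sign; the same identity later eliminates
  the sign from the sliding field.\<close>

lemma p_coeff_eq:
 assumes "\<alpha> > 0"
 shows "p_coeff \<alpha> \<mu> s \<theta> = (1 + \<alpha>) / k_den \<alpha> \<theta> + k_w \<alpha> \<theta> * q_coeff \<alpha> \<mu> s \<theta>"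
proof -
 define x y where "x = sin \<theta>" and "y = cos \<theta>"
 have y2: "y\<^sup>2 = 1 - x\<^sup>2" by (simp add: x_def y_def cos_squared_eq)
 define d where "d = 1 + \<alpha> * x\<^sup>2"
 have d: "d \<noteq> 0" using k_den_ge[OF assms, of \<theta>] by (simp add: d_def k_den_def x_def)
 have "(1 + \<alpha> * y\<^sup>2 - s * \<mu> * \<alpha> * x * y) * d = (1 + \<alpha>) + \<alpha> * x * y * (\<alpha> * x * y - s * \<mu> * d)"
  unfolding d_def power2_eq_square using y2[unfolded power2_eq_square] by algebra
 then show ?thesis
  using d by (simp add: p_coeff_def q_coeff_def k_w_def k_den_def field_simps flip: x_def y_def d_def)
qed

lemma c_coeff_eq:
 assumes "\<alpha> > 0"
 shows "c_coeff \<alpha> \<mu> s \<theta> = - (\<alpha> * cos \<theta>) / k_den \<alpha> \<theta> + k_ph \<alpha> \<theta> * q_coeff \<alpha> \<mu> s \<theta>"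
proof -
 define x y where "x = sin \<theta>" and "y = cos \<theta>"
 define d where "d = 1 + \<alpha> * x\<^sup>2"
 have d: "d \<noteq> 0" using k_den_ge[OF assms, of \<theta>] by (simp add: d_def k_den_def x_def)
 have "- (\<alpha> * (y - s * \<mu> * x)) * d = - (\<alpha> * y) - \<alpha> * x * (\<alpha> * x * y - s * \<mu> * d)"
  unfolding d_def power2_eq_square by algebra
 then show ?thesis
  using d by (simp add: c_coeff_def q_coeff_def k_ph_def k_den_def field_simps flip: x_def y_def d_def)
qed

lemma normal_force_nonneg: "eps > 0 \<Longrightarrow> normal_force \<delta> eps y w \<ge> 0"
 by (auto simp: normal_force_def bracket_def)

lemma normal_force_bound:
 assumes "eps > 0" "\<delta> > 0"
 shows "\<bar>normal_force \<delta> eps y w\<bar> \<le> (\<bar>y\<bar> / eps + \<delta> * \<bar>w\<bar>) / eps"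
proof -
 have "\<bar>bracket y (- (1 / eps * y) - \<delta> * w)\<bar> \<le> \<bar>- (1 / eps * y) - \<delta> * w\<bar>"
  by (auto simp: bracket_def)
 also have "\<dots> \<le> \<bar>- (1 / eps * y)\<bar> + \<bar>\<delta> * w\<bar>" by (rule abs_triangle_ineq4)
 also have "\<dots> = \<bar>y\<bar> / eps + \<delta> * \<bar>w\<bar>" using assms by (simp add: abs_mult)
 finally show ?thesis using assms by (simp add: normal_force_def abs_mult divide_right_mono)
qed

text \<open>The bracket jumps across \<open>y = 0\<close> when \<open>w < 0\<close>. On either side
  it is Lipschitz, being zero for positive \<open>y\<close> and the positive part of a linear
  function otherwise; therefore both states have to lie on the same side.\<close>

lemma normal_force_lipschitz:
 assumes "eps > 0" "\<delta> > 0" "y \<le> 0 \<and> y' \<le> 0 \<or> y > 0 \<and> y' > 0"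
 shows "\<bar>normal_force \<delta> eps y w - normal_force \<delta> eps y' w'\<bar> \<le> (\<bar>y - y'\<bar> / eps + \<delta> * \<bar>w - w'\<bar>) / eps"
proof -
 let ?g = "\<lambda>y w. - (1 / eps * y) - \<delta> * w"
 have "\<bar>bracket y (?g y w) - bracket y' (?g y' w')\<bar> \<le> \<bar>?g y w - ?g y' w'\<bar>"
  using assms(3) unfolding bracket_def by auto
 also have "?g y w - ?g y' w' = - ((y - y') / eps) - \<delta> * (w - w')"
  by (simp add: diff_divide_distrib algebra_simps)
 also have "\<bar>\<dots>\<bar> \<le> \<bar>(y - y') / eps\<bar> + \<bar>\<delta> * (w - w')\<bar>" by linarith
 also have "\<dots> = \<bar>y - y'\<bar> / eps + \<delta> * \<bar>w - w'\<bar>" using assms by (simp add: abs_mult)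
 finally have "1 / eps * \<bar>bracket y (?g y w) - bracket y' (?g y' w')\<bar> \<le> 1 / eps * (\<bar>y - y'\<bar> / eps + \<delta> * \<bar>w - w'\<bar>)"
  using assms by (intro mult_left_mono) auto
 moreover have "\<bar>1 / eps * A - 1 / eps * A'\<bar> = 1 / eps * \<bar>A - A'\<bar>" for A A'
  using assms by (simp add: abs_mult flip: right_diff_distrib diff_divide_distrib)
 ultimately show ?thesis unfolding normal_force_def by simp
qed

text \<open>Free of an initial value and of the starting time 0, so that a solution can be cut at
  any time and uniqueness restarted there.\<close>

definition filippov_on :: "(state \<Rightarrow> state set) \<Rightarrow> real \<Rightarrow> real \<Rightarrow> (real \<Rightarrow> state) \<Rightarrow> bool" where
 "filippov_on F c d X \<longleftrightarrow> abs_continuous_on_Icc c d X \<and>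
   (\<exists>N. negligible N \<and> (\<forall>t\<in>{c..d} - N. \<exists>D\<in>F (X t). (X has_vector_derivative D) (at t within {c..d})))"

lemma filippov_on_subinterval:
 assumes "filippov_on F c d X" "c \<le> c'" "d' \<le> d"
 shows "filippov_on F c' d' X"
proof -
 obtain N where N: "negligible N" "\<And>t. t \<in> {c..d} - N \<Longrightarrow> \<exists>D\<in>F (X t). (X has_vector_derivative D) (at t within {c..d})"
  using assms unfolding filippov_on_def by blast
 have "\<exists>D\<in>F (X t). (X has_vector_derivative D) (at t within {c'..d'})" if "t \<in> {c'..d'} - N" for t
  using N(2)[of t] that assms(2,3) has_vector_derivative_within_subset[of X _ t "{c..d}" "{c'..d'}"] by fastforce
 then show ?thesis using assms AC_subinterval N(1) unfolding filippov_on_def by blast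
qed

lemma sum5_squares: "(a + b + c + d + e)\<^sup>2 \<le> 5 * (a\<^sup>2 + b\<^sup>2 + c\<^sup>2 + d\<^sup>2 + e\<^sup>2)" for a b c d e :: real
proof -
 have "0 \<le> (a-b)\<^sup>2 + (a-c)\<^sup>2 + (a-d)\<^sup>2 + (a-e)\<^sup>2 + (b-c)\<^sup>2 + (b-d)\<^sup>2 + (b-e)\<^sup>2 + (c-d)\<^sup>2 + (c-e)\<^sup>2 + (d-e)\<^sup>2"
  by simp
 then show ?thesis by (simp add: power2_eq_square algebra_simps)
qed

text \<open>Gronwall for the sum \<open>\<Phi>\<close> of the squared differences in the coordinates
  \<open>y\<close>, \<open>W\<close>, \<theta>, \<open>P\<close>, \<open>v\<close>. All right-hand
  sides are Lipschitz in these coordinates and in the force, the force is Lipschitz while both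
  trajectories are on one side of \<open>y = 0\<close>, and the remaining term, in which the slip
  signs differ, can only decrease \<open>\<Phi>\<close>.\<close>

lemma filippov_unique_one_sided:
 fixes X Z :: "real \<Rightarrow> state"
 assumes par: "\<alpha> > 0" "\<mu> > 0" "\<delta> > 0" "eps > 0" and cd: "c \<le> d"
  and X: "filippov_on (filippov_field \<alpha> \<mu> \<delta> eps) c d X"
  and Z: "filippov_on (filippov_field \<alpha> \<mu> \<delta> eps) c d Z"
  and start: "X c = Z c"
  and same: "\<And>t. t \<in> {c<..<d} \<Longrightarrow> st_y (X t) \<le> 0 \<and> st_y (Z t) \<le> 0 \<or> st_y (X t) > 0 \<and> st_y (Z t) > 0"
 shows "X d = Z d"
proof -
 define nf where "nf x = normal_force \<delta> eps (st_y x) (st_w x)" for x :: state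
 define W where "W x = st_w x - k_w \<alpha> (st_th x) * st_v x" for x :: state
 define P where "P x = st_ph x - k_ph \<alpha> (st_th x) * st_v x" for x :: state
 obtain N1 where N1: "negligible N1" "\<And>t. t \<in> {c..d} - N1 \<Longrightarrow> \<exists>D\<in>filippov_field \<alpha> \<mu> \<delta> eps (X t). (X has_vector_derivative D) (at t within {c..d})"
  using X unfolding filippov_on_def by blast
 obtain N2 where N2: "negligible N2" "\<And>t. t \<in> {c..d} - N2 \<Longrightarrow> \<exists>D\<in>filippov_field \<alpha> \<mu> \<delta> eps (Z t). (Z has_vector_derivative D) (at t within {c..d})"
  using Z unfolding filippov_on_def by blast
 have acX: "abs_continuous_on_Icc c d X" and acZ: "abs_continuous_on_Icc c d Z"
  using X Z by (auto simp: filippov_on_def)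
 note blipk = blip_k[OF par(1)]
 have "blip_on UNIV (\<lambda>x. k_w \<alpha> x)" "blip_on UNIV (\<lambda>x. k_ph \<alpha> x)"
  by (intro blipk, simp add: dist_real_def)+
 then obtain Bw Bp where Bw: "\<And>x y. \<bar>k_w \<alpha> x - k_w \<alpha> y\<bar> \<le> Bw * \<bar>x - y\<bar>" and Bp: "\<And>x y. \<bar>k_ph \<alpha> x - k_ph \<alpha> y\<bar> \<le> Bp * \<bar>x - y\<bar>"
  unfolding blip_on_def dist_real_def by blast
 have acW: "abs_continuous_on_Icc c d (\<lambda>t. W (Y t))" and acP: "abs_continuous_on_Icc c d (\<lambda>t. P (Y t))"
  if "abs_continuous_on_Icc c d Y" for Y
 proof -
  note AC_components[OF that]
  moreover have "abs_continuous_on_Icc c d (\<lambda>t. k_w \<alpha> (st_th (Y t)))" "abs_continuous_on_Icc c d (\<lambda>t. k_ph \<alpha> (st_th (Y t)))"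
   by (rule AC_lipschitz_comp[OF AC_components(3)[OF that]], simp add: dist_real_def, rule Bw Bp)+
  ultimately show "abs_continuous_on_Icc c d (\<lambda>t. W (Y t))" "abs_continuous_on_Icc c d (\<lambda>t. P (Y t))"
   unfolding W_def P_def by (auto intro!: AC_diff AC_mult)
 qed
 \<comment> \<open>The contact force is kept as a separate sixth argument \<open>n\<close>: the
   right-hand sides are then smooth on a bounded box, and the bracket enters only through the value
   of \<open>n\<close>.\<close>
 define \<zeta> where "\<zeta> x n = (st_y x, W x, st_th x, P x, st_v x, n)" for x and n :: real
 have "\<exists>R\<ge>0. \<forall>t\<in>{c..d}. \<bar>st_y (Y t)\<bar> \<le> R \<and> \<bar>st_w (Y t)\<bar> \<le> R \<and> \<bar>W (Y t)\<bar> \<le> R \<and> \<bar>st_th (Y t)\<bar> \<le> R \<and> \<bar>P (Y t)\<bar> \<le> R \<and> \<bar>st_v (Y t)\<bar> \<le> R"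
  if "abs_continuous_on_Icc c d Y" for Y
 proof -
  have b: "\<exists>R\<ge>0. \<forall>t\<in>{c..d}. \<bar>g t\<bar> \<le> R" if "abs_continuous_on_Icc c d g" for g :: "real \<Rightarrow> real"
  proof -
   have "bounded (g ` {c..d})"
    by (intro compact_imp_bounded compact_continuous_image AC_imp_continuous_on that) auto
   then show ?thesis by (auto simp: bounded_pos intro: less_imp_le)
  qed
  note ac = b[OF AC_components(1)[OF that]] b[OF AC_components(2)[OF that]] b[OF acW[OF that]]
    b[OF AC_components(3)[OF that]] b[OF acP[OF that]] b[OF AC_components(5)[OF that]]
  obtain r1 where r1: "r1 \<ge> 0" "\<forall>t\<in>{c..d}. \<bar>st_y (Y t)\<bar> \<le> r1" using ac(1) by blast
  obtain r2 where r2: "r2 \<ge> 0" "\<forall>t\<in>{c..d}. \<bar>st_w (Y t)\<bar> \<le> r2" using ac(2) by blast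
  obtain r3 where r3: "r3 \<ge> 0" "\<forall>t\<in>{c..d}. \<bar>W (Y t)\<bar> \<le> r3" using ac(3) by blast
  obtain r4 where r4: "r4 \<ge> 0" "\<forall>t\<in>{c..d}. \<bar>st_th (Y t)\<bar> \<le> r4" using ac(4) by blast
  obtain r5 where r5: "r5 \<ge> 0" "\<forall>t\<in>{c..d}. \<bar>P (Y t)\<bar> \<le> r5" using ac(5) by blast
  obtain r6 where r6: "r6 \<ge> 0" "\<forall>t\<in>{c..d}. \<bar>st_v (Y t)\<bar> \<le> r6" using ac(6) by blast
  define R where "R = r1 + r2 + r3 + r4 + r5 + r6"
  have R: "r1 \<le> R" "r2 \<le> R" "r3 \<le> R" "r4 \<le> R" "r5 \<le> R" "r6 \<le> R"
   using r1(1) r2(1) r3(1) r4(1) r5(1) r6(1) unfolding R_def by linarith+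
  show ?thesis
  proof (intro exI[of _ R] conjI ballI)
   show "R \<ge> 0" using R(1) r1(1) by linarith
  qed (use r1 r2 r3 r4 r5 r6 R in \<open>blast intro: order_trans\<close>)+
 qed
 note bound = this
 let ?bd = "\<lambda>Y R. \<forall>t\<in>{c..d}. \<bar>st_y (Y t)\<bar> \<le> R \<and> \<bar>st_w (Y t)\<bar> \<le> R \<and> \<bar>W (Y t)\<bar> \<le> R \<and> \<bar>st_th (Y t)\<bar> \<le> R \<and> \<bar>P (Y t)\<bar> \<le> R \<and> \<bar>st_v (Y t)\<bar> \<le> R"
 obtain RA where RA: "RA \<ge> 0" "?bd X RA" using bound[OF acX] by blast
 obtain RB where RB: "RB \<ge> 0" "?bd Z RB" using bound[OF acZ] by blast
 define R0 where "R0 = RA + RB"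
 have R0: "R0 \<ge> 0" using RA RB by (simp add: R0_def)
 have RX: "\<bar>st_y (X t)\<bar> \<le> R0 \<and> \<bar>st_w (X t)\<bar> \<le> R0 \<and> \<bar>W (X t)\<bar> \<le> R0 \<and> \<bar>st_th (X t)\<bar> \<le> R0 \<and> \<bar>P (X t)\<bar> \<le> R0 \<and> \<bar>st_v (X t)\<bar> \<le> R0"
  and RZ: "\<bar>st_y (Z t)\<bar> \<le> R0 \<and> \<bar>st_w (Z t)\<bar> \<le> R0 \<and> \<bar>W (Z t)\<bar> \<le> R0 \<and> \<bar>st_th (Z t)\<bar> \<le> R0 \<and> \<bar>P (Z t)\<bar> \<le> R0 \<and> \<bar>st_v (Z t)\<bar> \<le> R0"
  if "t \<in> {c..d}" for t
 proof -
  have "RA \<le> R0" "RB \<le> R0" using RA(1) RB(1) by (simp_all add: R0_def)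
  then show "\<bar>st_y (X t)\<bar> \<le> R0 \<and> \<bar>st_w (X t)\<bar> \<le> R0 \<and> \<bar>W (X t)\<bar> \<le> R0 \<and> \<bar>st_th (X t)\<bar> \<le> R0 \<and> \<bar>P (X t)\<bar> \<le> R0 \<and> \<bar>st_v (X t)\<bar> \<le> R0"
   and "\<bar>st_y (Z t)\<bar> \<le> R0 \<and> \<bar>st_w (Z t)\<bar> \<le> R0 \<and> \<bar>W (Z t)\<bar> \<le> R0 \<and> \<bar>st_th (Z t)\<bar> \<le> R0 \<and> \<bar>P (Z t)\<bar> \<le> R0 \<and> \<bar>st_v (Z t)\<bar> \<le> R0"
   using bspec[OF RA(2) that] bspec[OF RB(2) that] by (blast intro: order_trans)+
 qed
 define R where "R = R0 + (R0 / eps + \<delta> * R0) / eps"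
 have R: "R0 \<le> R" "(R0 / eps + \<delta> * R0) / eps \<le> R" "R \<ge> 0" using R0 par by (auto simp: R_def)
 have nfR: "\<bar>nf x\<bar> \<le> R" if "\<bar>st_y x\<bar> \<le> R0" "\<bar>st_w x\<bar> \<le> R0" for x
 proof -
  have "\<bar>nf x\<bar> \<le> (\<bar>st_y x\<bar> / eps + \<delta> * \<bar>st_w x\<bar>) / eps" unfolding nf_def by (rule normal_force_bound) (use par in auto)
  also have "\<dots> \<le> (R0 / eps + \<delta> * R0) / eps" using that par by (intro divide_right_mono add_mono mult_left_mono) auto
  finally show ?thesis using R by simp
 qed
 define S where "S = {(y :: real, W :: real, \<theta> :: real, P :: real, v :: real, n :: real). \<bar>y\<bar> \<le> R \<and> \<bar>W\<bar> \<le> R \<and> \<bar>\<theta>\<bar> \<le> R \<and> \<bar>P\<bar> \<le> R \<and> \<bar>v\<bar> \<le> R \<and> \<bar>n\<bar> \<le> R}"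
 let ?y = "\<lambda>z::real \<times> real \<times> real \<times> real \<times> real \<times> real. fst z"
 let ?W = "\<lambda>z::real \<times> real \<times> real \<times> real \<times> real \<times> real. fst (snd z)"
 let ?t = "\<lambda>z::real \<times> real \<times> real \<times> real \<times> real \<times> real. fst (snd (snd z))"
 let ?P = "\<lambda>z::real \<times> real \<times> real \<times> real \<times> real \<times> real. fst (snd (snd (snd z)))"
 let ?v = "\<lambda>z::real \<times> real \<times> real \<times> real \<times> real \<times> real. fst (snd (snd (snd (snd z))))"
 let ?n = "\<lambda>z::real \<times> real \<times> real \<times> real \<times> real \<times> real. snd (snd (snd (snd (snd z))))"
 have lipt: "\<bar>?t x - ?t y\<bar> \<le> dist x y" for x y
  unfolding dist_real_def[symmetric] by (intro order_trans[OF dist_fst_le] order_trans[OF dist_snd_le] order_refl)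
 have prj: "blip_on S ?y" "blip_on S ?W" "blip_on S ?t" "blip_on S ?P" "blip_on S ?v" "blip_on S ?n"
  by (rule blip_proj[where R = R, OF _ _ R(3)], force simp: S_def, unfold dist_real_def[symmetric],
    intro order_trans[OF dist_fst_le] order_trans[OF dist_snd_le] order_refl dist_fst_le)+
 note bk = blipk[where g = ?t and S = S, OF lipt] and bs = blip_sin[where f = ?t and S = S, OF lipt] blip_cos[where f = ?t and S = S, OF lipt]
 let ?ph = "\<lambda>z. ?P z + k_ph \<alpha> (?t z) * ?v z"
 let ?a = "\<lambda>z. - ((?ph z)\<^sup>2 * cos (?t z))"
 let ?b = "\<lambda>z. - 1 + (?ph z)\<^sup>2 * sin (?t z)"
 \<comment> \<open>\<open>G1\<close> to \<open>G4\<close> give the derivatives of \<open>y\<close>,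
   \<open>W\<close>, \<theta> and \<open>P\<close>; the derivative of \<open>v\<close> is
   \<open>G5 - s * G6\<close>, the only place where the slip sign is left.\<close>
 define G1 where "G1 z = ?W z + k_w \<alpha> (?t z) * ?v z" for z
 define G2 where "G2 z = ?b z - k_w \<alpha> (?t z) * ?a z - k_w' \<alpha> (?t z) * ?ph z * ?v z + ((1 + \<alpha>) / k_den \<alpha> (?t z)) * ?n z" for z
 define G3 where "G3 z = ?ph z" for z
 define G4 where "G4 z = - (k_ph \<alpha> (?t z) * ?a z) - k_ph' \<alpha> (?t z) * ?ph z * ?v z + (- (\<alpha> * cos (?t z)) / k_den \<alpha> (?t z)) * ?n z" for z
 define G5 where "G5 z = ?a z + \<alpha> * sin (?t z) * cos (?t z) * ?n z" for z
 define G6 where "G6 z = \<mu> * k_den \<alpha> (?t z) * ?n z" for z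
 have blipG: "blip_on S G1" "blip_on S G2" "blip_on S G3" "blip_on S G4" "blip_on S G5" "blip_on S G6"
  unfolding G1_def G2_def G3_def G4_def G5_def G6_def
  by (intro bk prj blip_add blip_diff blip_mult blip_minus blip_power2 bs blip_const)+
 obtain B1 where B1: "B1 \<ge> 0" and GL1: "\<And>x y. x \<in> S \<Longrightarrow> y \<in> S \<Longrightarrow> \<bar>G1 x - G1 y\<bar> \<le> B1 * dist x y"
  using blipG(1) unfolding blip_on_def by blast
 obtain B2 where B2: "B2 \<ge> 0" and GL2: "\<And>x y. x \<in> S \<Longrightarrow> y \<in> S \<Longrightarrow> \<bar>G2 x - G2 y\<bar> \<le> B2 * dist x y"
  using blipG(2) unfolding blip_on_def by blast
 obtain B3 where B3: "B3 \<ge> 0" and GL3: "\<And>x y. x \<in> S \<Longrightarrow> y \<in> S \<Longrightarrow> \<bar>G3 x - G3 y\<bar> \<le> B3 * dist x y"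
  using blipG(3) unfolding blip_on_def by blast
 obtain B4 where B4: "B4 \<ge> 0" and GL4: "\<And>x y. x \<in> S \<Longrightarrow> y \<in> S \<Longrightarrow> \<bar>G4 x - G4 y\<bar> \<le> B4 * dist x y"
  using blipG(4) unfolding blip_on_def by blast
 obtain B5 where B5: "B5 \<ge> 0" and GL5: "\<And>x y. x \<in> S \<Longrightarrow> y \<in> S \<Longrightarrow> \<bar>G5 x - G5 y\<bar> \<le> B5 * dist x y"
  using blipG(5) unfolding blip_on_def by blast
 obtain B6 where B6: "B6 \<ge> 0" and GL6: "\<And>x y. x \<in> S \<Longrightarrow> y \<in> S \<Longrightarrow> \<bar>G6 x - G6 y\<bar> \<le> B6 * dist x y"
  using blipG(6) unfolding blip_on_def by blast
 note B0 = B1 B2 B3 B4 B5 B6 and GL = GL1 GL2 GL3 GL4 GL5 GL6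
 define B where "B = B1 + B2 + B3 + B4 + B5 + B6"
 \<comment> \<open>Lipschitz constant of the force in terms of the coordinate distance
   \<open>\<sigma>\<close>: the force depends on \<open>y\<close> and \<open>w\<close>, and
   \<open>w\<close> is recovered as \<open>G1\<close>, with constant \<open>B1\<close>.\<close>
 define K0 where "K0 = (1 / eps + \<delta> * B1) / eps"
 define K where "K = B * (1 + K0)"
 have K00: "K0 \<ge> 0" using par B0 by (simp add: K0_def)
 have BB: "B1 \<le> B" "B2 \<le> B" "B3 \<le> B" "B4 \<le> B" "B5 + B6 \<le> B" "B \<ge> 0" using B0 by (auto simp: B_def)
 have K_nn: "K \<ge> 0" using K00 BB by (simp add: K_def)
 define \<Phi> where "\<Phi> t = (st_y (X t) - st_y (Z t)) * (st_y (X t) - st_y (Z t))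
   + (W (X t) - W (Z t)) * (W (X t) - W (Z t)) + (st_th (X t) - st_th (Z t)) * (st_th (X t) - st_th (Z t))
   + (P (X t) - P (Z t)) * (P (X t) - P (Z t)) + (st_v (X t) - st_v (Z t)) * (st_v (X t) - st_v (Z t))" for t
 have deriv: "\<exists>s. \<bar>s\<bar> \<le> 1 \<and> (st_v (Y t) > 0 \<longrightarrow> s = 1) \<and> (st_v (Y t) < 0 \<longrightarrow> s = - 1) \<and>
   ((\<lambda>t. st_y (Y t)) has_real_derivative G1 (\<zeta> (Y t) (nf (Y t)))) (at t within {c..d}) \<and>
   ((\<lambda>t. W (Y t)) has_real_derivative G2 (\<zeta> (Y t) (nf (Y t)))) (at t within {c..d}) \<and>
   ((\<lambda>t. st_th (Y t)) has_real_derivative G3 (\<zeta> (Y t) (nf (Y t)))) (at t within {c..d}) \<and>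
   ((\<lambda>t. P (Y t)) has_real_derivative G4 (\<zeta> (Y t) (nf (Y t)))) (at t within {c..d}) \<and>
   ((\<lambda>t. st_v (Y t)) has_real_derivative G5 (\<zeta> (Y t) (nf (Y t))) - s * G6 (\<zeta> (Y t) (nf (Y t)))) (at t within {c..d})"
  if D: "D \<in> filippov_field \<alpha> \<mu> \<delta> eps (Y t)" "(Y has_vector_derivative D) (at t within {c..d})" for Y D t
 proof -
  obtain y w \<theta> \<phi> v where Yt: "Y t = (y, w, \<theta>, \<phi>, v)" by (metis prod.exhaust)
  obtain s where s: "\<bar>s\<bar> \<le> 1" "v > 0 \<longrightarrow> s = 1" "v < 0 \<longrightarrow> s = - 1" "D = vfield \<alpha> \<mu> \<delta> eps s (Y t)"
   using D(1) unfolding filippov_field_iff Yt by auto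
  define n where "n = normal_force \<delta> eps y w"
  note c = has_vector_derivative_components[OF D(2)[unfolded s(4) Yt vfield.simps], folded n_def]
  have g: "G1 (\<zeta> (Y t) (nf (Y t))) = w"
   "G3 (\<zeta> (Y t) (nf (Y t))) = \<phi>"
   "G2 (\<zeta> (Y t) (nf (Y t))) = b_coeff \<theta> \<phi> - k_w \<alpha> \<theta> * a_coeff \<theta> \<phi> - k_w' \<alpha> \<theta> * \<phi> * v + (1 + \<alpha>) / k_den \<alpha> \<theta> * n"
   "G4 (\<zeta> (Y t) (nf (Y t))) = - (k_ph \<alpha> \<theta> * a_coeff \<theta> \<phi>) - k_ph' \<alpha> \<theta> * \<phi> * v + - (\<alpha> * cos \<theta>) / k_den \<alpha> \<theta> * n"
   "G5 (\<zeta> (Y t) (nf (Y t))) = a_coeff \<theta> \<phi> + \<alpha> * sin \<theta> * cos \<theta> * n"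
   "G6 (\<zeta> (Y t) (nf (Y t))) = \<mu> * k_den \<alpha> \<theta> * n"
   by (simp_all add: G1_def G2_def G3_def G4_def G5_def G6_def \<zeta>_def Yt nf_def n_def W_def P_def a_coeff_def b_coeff_def)
  have w: "((\<lambda>t. W (Y t)) has_real_derivative
    (b_coeff \<theta> \<phi> + p_coeff \<alpha> \<mu> s \<theta> * n) - (k_w' \<alpha> \<theta> * \<phi> * v + k_w \<alpha> \<theta> * (a_coeff \<theta> \<phi> + q_coeff \<alpha> \<mu> s \<theta> * n))) (at t within {c..d})"
   using DERIV_diff[OF c(2) DERIV_mult[OF k_w_deriv[OF par(1) c(3)] c(5)]] by (simp add: W_def Yt mult_ac add.commute)
  have p: "((\<lambda>t. P (Y t)) has_real_derivative
    (c_coeff \<alpha> \<mu> s \<theta> * n) - (k_ph' \<alpha> \<theta> * \<phi> * v + k_ph \<alpha> \<theta> * (a_coeff \<theta> \<phi> + q_coeff \<alpha> \<mu> s \<theta> * n))) (at t within {c..d})"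
   using DERIV_diff[OF c(4) DERIV_mult[OF k_ph_deriv[OF par(1) c(3)] c(5)]] by (simp add: P_def Yt mult_ac add.commute)
  have v: "a_coeff \<theta> \<phi> + q_coeff \<alpha> \<mu> s \<theta> * n = a_coeff \<theta> \<phi> + \<alpha> * sin \<theta> * cos \<theta> * n - s * (\<mu> * k_den \<alpha> \<theta> * n)"
   by (simp add: q_coeff_def k_den_def algebra_simps)
  have w': "(b_coeff \<theta> \<phi> + p_coeff \<alpha> \<mu> s \<theta> * n) - (k_w' \<alpha> \<theta> * \<phi> * v + k_w \<alpha> \<theta> * (a_coeff \<theta> \<phi> + q_coeff \<alpha> \<mu> s \<theta> * n))
    = b_coeff \<theta> \<phi> - k_w \<alpha> \<theta> * a_coeff \<theta> \<phi> - k_w' \<alpha> \<theta> * \<phi> * v + (1 + \<alpha>) / k_den \<alpha> \<theta> * n"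
   unfolding p_coeff_eq[OF par(1)] by (simp only: ring_distribs)
  have p': "(c_coeff \<alpha> \<mu> s \<theta> * n) - (k_ph' \<alpha> \<theta> * \<phi> * v + k_ph \<alpha> \<theta> * (a_coeff \<theta> \<phi> + q_coeff \<alpha> \<mu> s \<theta> * n))
    = - (k_ph \<alpha> \<theta> * a_coeff \<theta> \<phi>) - k_ph' \<alpha> \<theta> * \<phi> * v + - (\<alpha> * cos \<theta>) / k_den \<alpha> \<theta> * n"
   unfolding c_coeff_eq[OF par(1)] by (simp only: ring_distribs)
  show ?thesis
  proof (intro exI[of _ s] conjI)
   show "\<bar>s\<bar> \<le> 1" "st_v (Y t) > 0 \<longrightarrow> s = 1" "st_v (Y t) < 0 \<longrightarrow> s = - 1" using s by (simp_all add: Yt)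
  qed (unfold g, rule c(1), rule w[unfolded w'], rule c(3), rule p[unfolded p'], rule c(5)[unfolded v])
 qed
 \<comment> \<open>The constant 50 is 2 * 5 * 5: the factor 2 from differentiating squares, five
   terms bounded by \<open>K * \<sigma>\<^sup>2\<close> each, and
   \<open>\<sigma>\<^sup>2 \<le> 5 * \<Phi> t\<close> by Cauchy-Schwarz.\<close>
 have "\<Phi> d \<le> \<Phi> c * exp (50 * K * (d - c))"
 proof (rule AC_gronwall[OF cd])
  show "abs_continuous_on_Icc c d \<Phi>"
   unfolding \<Phi>_def
   by (intro AC_add AC_mult AC_diff acW acP AC_components acX acZ)
  show "negligible (N1 \<union> N2 \<union> {c, d})" using N1 N2 by auto
  fix t assume t: "t \<in> {c..d} - (N1 \<union> N2 \<union> {c, d})"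
  then have tI: "t \<in> {c<..<d}" "t \<in> {c..d}" by auto
  obtain DX where DX: "DX \<in> filippov_field \<alpha> \<mu> \<delta> eps (X t)" "(X has_vector_derivative DX) (at t within {c..d})" using N1(2)[of t] t by blast
  obtain DZ where DZ: "DZ \<in> filippov_field \<alpha> \<mu> \<delta> eps (Z t)" "(Z has_vector_derivative DZ) (at t within {c..d})" using N2(2)[of t] t by blast
  define zx zz where "zx = \<zeta> (X t) (nf (X t))" and "zz = \<zeta> (Z t) (nf (Z t))"
  obtain s where s: "\<bar>s\<bar> \<le> 1" "st_v (X t) > 0 \<longrightarrow> s = 1" "st_v (X t) < 0 \<longrightarrow> s = - 1" and
   dX: "((\<lambda>t. st_y (X t)) has_real_derivative G1 zx) (at t within {c..d})"
   "((\<lambda>t. W (X t)) has_real_derivative G2 zx) (at t within {c..d})"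
   "((\<lambda>t. st_th (X t)) has_real_derivative G3 zx) (at t within {c..d})"
   "((\<lambda>t. P (X t)) has_real_derivative G4 zx) (at t within {c..d})"
   "((\<lambda>t. st_v (X t)) has_real_derivative G5 zx - s * G6 zx) (at t within {c..d})"
   using deriv[OF DX] unfolding zx_def by blast
  obtain s' where s': "\<bar>s'\<bar> \<le> 1" "st_v (Z t) > 0 \<longrightarrow> s' = 1" "st_v (Z t) < 0 \<longrightarrow> s' = - 1" and
   dZ: "((\<lambda>t. st_y (Z t)) has_real_derivative G1 zz) (at t within {c..d})"
   "((\<lambda>t. W (Z t)) has_real_derivative G2 zz) (at t within {c..d})"
   "((\<lambda>t. st_th (Z t)) has_real_derivative G3 zz) (at t within {c..d})"
   "((\<lambda>t. P (Z t)) has_real_derivative G4 zz) (at t within {c..d})"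
   "((\<lambda>t. st_v (Z t)) has_real_derivative G5 zz - s' * G6 zz) (at t within {c..d})"
   using deriv[OF DZ] unfolding zz_def by blast
  define r1 where "r1 = st_y (X t) - st_y (Z t)"
  define r2 where "r2 = W (X t) - W (Z t)"
  define r3 where "r3 = st_th (X t) - st_th (Z t)"
  define r4 where "r4 = P (X t) - P (Z t)"
  define r5 where "r5 = st_v (X t) - st_v (Z t)"
  define \<sigma> where "\<sigma> = \<bar>r1\<bar> + \<bar>r2\<bar> + \<bar>r3\<bar> + \<bar>r4\<bar> + \<bar>r5\<bar>"
  have inS: "\<zeta> (X t) n \<in> S" "\<zeta> (Z t) n \<in> S" if "\<bar>n\<bar> \<le> R" for n
   using RX[OF tI(2)] RZ[OF tI(2)] R(1) that unfolding \<zeta>_def S_def mem_Collect_eq prod.case by (blast intro: order_trans)+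
  have dist\<zeta>: "dist (\<zeta> (X t) n) (\<zeta> (Z t) n') \<le> \<sigma> + \<bar>n - n'\<bar>" for n n'
  proof -
   have "dist (a1::real, a2::real, a3::real, a4::real, a5::real, a6::real) (b1, b2, b3, b4, b5, b6)
     \<le> \<bar>a1 - b1\<bar> + \<bar>a2 - b2\<bar> + \<bar>a3 - b3\<bar> + \<bar>a4 - b4\<bar> + \<bar>a5 - b5\<bar> + \<bar>a6 - b6\<bar>" for a1 a2 a3 a4 a5 a6 b1 b2 b3 b4 b5 b6
    using dist_Pair_le[of a1 "(a2, a3, a4, a5, a6)" b1 "(b2, b3, b4, b5, b6)"]
     dist_Pair_le[of a2 "(a3, a4, a5, a6)" b2 "(b3, b4, b5, b6)"]
     dist_Pair_le[of a3 "(a4, a5, a6)" b3 "(b4, b5, b6)"]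
     dist_Pair_le[of a4 "(a5, a6)" b4 "(b5, b6)"] dist_Pair_le[of a5 a6 b5 b6]
    unfolding dist_real_def by linarith
   then show ?thesis unfolding \<zeta>_def \<sigma>_def r1_def r2_def r3_def r4_def r5_def by blast
  qed
  have "\<bar>st_w (X t) - st_w (Z t)\<bar> \<le> B1 * \<sigma>"
  proof -
   have "st_w (X t) = G1 (\<zeta> (X t) 0)" "st_w (Z t) = G1 (\<zeta> (Z t) 0)"
    by (simp_all add: G1_def \<zeta>_def W_def)
   then have "\<bar>st_w (X t) - st_w (Z t)\<bar> \<le> B1 * dist (\<zeta> (X t) 0) (\<zeta> (Z t) 0)"
    using GL(1)[OF inS(1)[of 0] inS(2)[of 0]] R(3) by simp
   also have "\<dots> \<le> B1 * \<sigma>" using dist\<zeta>[of 0 0] B0 by (intro mult_left_mono) auto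
   finally show ?thesis .
  qed
  moreover have "\<bar>r1\<bar> \<le> \<sigma>" by (simp add: \<sigma>_def)
  moreover have "\<bar>nf (X t) - nf (Z t)\<bar> \<le> (\<bar>r1\<bar> / eps + \<delta> * \<bar>st_w (X t) - st_w (Z t)\<bar>) / eps"
   unfolding nf_def r1_def by (rule normal_force_lipschitz[OF par(4,3) same[OF tI(1)]])
  ultimately have "\<bar>nf (X t) - nf (Z t)\<bar> \<le> (\<sigma> / eps + \<delta> * (B1 * \<sigma>)) / eps"
   using par by (smt (verit) divide_right_mono mult_left_mono)
  also have "\<dots> = K0 * \<sigma>" by (simp add: K0_def add_divide_distrib distrib_right)
  finally have dn: "\<bar>nf (X t) - nf (Z t)\<bar> \<le> K0 * \<sigma>" .
  have zS: "zx \<in> S" "zz \<in> S" unfolding zx_def zz_def using inS nfR RX[OF tI(2)] RZ[OF tI(2)] by auto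
  have dz: "dist zx zz \<le> (1 + K0) * \<sigma>"
   using dist\<zeta>[of "nf (X t)" "nf (Z t)"] dn unfolding zx_def zz_def by (simp add: distrib_right)
  have \<sigma>0: "\<sigma> \<ge> 0" by (simp add: \<sigma>_def)
  have est: "\<bar>H zx - H zz\<bar> \<le> K * \<sigma>" if "\<bar>H zx - H zz\<bar> \<le> b * dist zx zz" "b \<le> B" for H :: "_ \<Rightarrow> real" and b
  proof -
   have "b * dist zx zz \<le> B * ((1 + K0) * \<sigma>)" using that(2) dz BB(6) by (intro mult_mono) auto
   then show ?thesis using that(1) by (simp add: K_def mult.assoc)
  qed
  have e: "\<bar>G1 zx - G1 zz\<bar> \<le> K * \<sigma>" "\<bar>G2 zx - G2 zz\<bar> \<le> K * \<sigma>" "\<bar>G3 zx - G3 zz\<bar> \<le> K * \<sigma>" "\<bar>G4 zx - G4 zz\<bar> \<le> K * \<sigma>"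
   using est[OF GL(1)[OF zS] BB(1)] est[OF GL(2)[OF zS] BB(2)] est[OF GL(3)[OF zS] BB(3)] est[OF GL(4)[OF zS] BB(4)] by auto
  have m: "r * g \<le> K * \<sigma>\<^sup>2" if "\<bar>r\<bar> \<le> \<sigma>" "\<bar>g\<bar> \<le> K * \<sigma>" for r g
  proof -
   have "r * g \<le> \<bar>r\<bar> * \<bar>g\<bar>" by (metis abs_ge_self abs_mult)
   also have "\<dots> \<le> \<sigma> * (K * \<sigma>)" using that \<sigma>0 by (intro mult_mono) auto
   finally show ?thesis by (simp add: power2_eq_square mult_ac)
  qed
  have G6nn: "G6 zx \<ge> 0" unfolding G6_def zx_def \<zeta>_def
   using par(2) k_den_ge[OF par(1), of "st_th (X t)"] normal_force_nonneg[OF par(4)]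
   by (auto simp: nf_def intro!: mult_nonneg_nonneg)
  \<comment> \<open>The slip sign is a monotone, set-valued function of \<open>v\<close>. Together
    with \<open>G6 \<ge> 0\<close> this gives the friction term the favourable sign, whatever values
    the two signs take on \<open>v = 0\<close>.\<close>
  have mono: "r5 * (s - s') \<ge> 0"
   using s s' unfolding r5_def by (smt (verit) mult_nonneg_nonneg mult_nonpos_nonpos)
  have "r5 * ((G5 zx - s * G6 zx) - (G5 zz - s' * G6 zz))
    = r5 * ((G5 zx - G5 zz) - s' * (G6 zx - G6 zz)) - r5 * (s - s') * G6 zx" by algebra
  also have "\<dots> \<le> r5 * ((G5 zx - G5 zz) - s' * (G6 zx - G6 zz))"
   using mult_nonneg_nonneg[OF mono G6nn] by simp
  also have "\<dots> \<le> K * \<sigma>\<^sup>2"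
  proof (rule m)
   have "\<bar>s' * (G6 zx - G6 zz)\<bar> \<le> 1 * \<bar>G6 zx - G6 zz\<bar>"
    unfolding abs_mult using s'(1) by (intro mult_right_mono) auto
   then have "\<bar>(G5 zx - G5 zz) - s' * (G6 zx - G6 zz)\<bar> \<le> (B5 + B6) * dist zx zz"
    using GL(5)[OF zS] GL(6)[OF zS] by (simp add: distrib_right)
   also have "\<dots> \<le> B * ((1 + K0) * \<sigma>)" using BB dz by (intro mult_mono) auto
   finally show "\<bar>(G5 zx - G5 zz) - s' * (G6 zx - G6 zz)\<bar> \<le> K * \<sigma>" by (simp add: K_def mult.assoc)
  qed (simp add: \<sigma>_def)
  finally have e5: "r5 * ((G5 zx - s * G6 zx) - (G5 zz - s' * G6 zz)) \<le> K * \<sigma>\<^sup>2" .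
  let ?D = "2 * (r1 * (G1 zx - G1 zz) + r2 * (G2 zx - G2 zz) + r3 * (G3 zx - G3 zz) + r4 * (G4 zx - G4 zz)
    + r5 * ((G5 zx - s * G6 zx) - (G5 zz - s' * G6 zz)))"
  have sq: "((\<lambda>t. (f t - g t) * (f t - g t)) has_real_derivative 2 * ((f t - g t) * (f' - g'))) (at t within {c..d})"
   if "(f has_real_derivative f') (at t within {c..d})" "(g has_real_derivative g') (at t within {c..d})" for f g f' g'
   using that by (auto intro!: derivative_eq_intros simp: algebra_simps)
  have "(\<Phi> has_real_derivative ?D) (at t within {c..d})"
   unfolding \<Phi>_def r1_def r2_def r3_def r4_def r5_def distrib_left
   by (intro DERIV_add sq dX dZ)
  moreover have "?D \<le> 50 * K * \<Phi> t"
  proof -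
   have "?D \<le> 2 * (K * \<sigma>\<^sup>2 + K * \<sigma>\<^sup>2 + K * \<sigma>\<^sup>2 + K * \<sigma>\<^sup>2 + K * \<sigma>\<^sup>2)"
    by (intro mult_left_mono add_mono e5 m e) (auto simp: \<sigma>_def)
   also have "\<dots> = 10 * K * \<sigma>\<^sup>2" by simp
   also have "\<dots> \<le> 10 * K * (5 * (\<bar>r1\<bar>\<^sup>2 + \<bar>r2\<bar>\<^sup>2 + \<bar>r3\<bar>\<^sup>2 + \<bar>r4\<bar>\<^sup>2 + \<bar>r5\<bar>\<^sup>2))"
    unfolding \<sigma>_def using K_nn by (intro mult_left_mono sum5_squares) auto
   also have "\<dots> = 50 * K * \<Phi> t" by (simp add: \<Phi>_def r1_def r2_def r3_def r4_def r5_def power2_eq_square)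
   finally show ?thesis .
  qed
  ultimately show "\<exists>D\<le>50 * K * \<Phi> t. (\<Phi> has_real_derivative D) (at t within {c..d})" by blast
 qed
 moreover have "\<Phi> c = 0" by (simp add: \<Phi>_def start)
 ultimately have "\<Phi> d \<le> 0" by simp
 then have z: "st_y (X d) - st_y (Z d) = 0" "W (X d) - W (Z d) = 0" "st_th (X d) - st_th (Z d) = 0" "P (X d) - P (Z d) = 0" "st_v (X d) - st_v (Z d) = 0"
  unfolding \<Phi>_def power2_eq_square[symmetric]
  by (smt (verit) zero_le_power2 power2_eq_iff zero_eq_power2)+
 then have "st_w (X d) = st_w (Z d)" "st_ph (X d) = st_ph (Z d)" by (simp_all add: W_def P_def)
 with z show ?thesis by (simp add: prod_eq_iff)
qed

section \<open>Departure from \<open>y = 0\<close> and continuation of uniqueness\<close>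

lemma AC_const: "abs_continuous_on_Icc a b (\<lambda>t. c)"
 by (rule AC_lipschitz[of 0]) (simp add: lipschitz_on_def)

lemma AC_ident: "abs_continuous_on_Icc a b (\<lambda>t::real. t)"
 by (rule AC_lipschitz[of 1]) (simp add: lipschitz_on_def)

lemma AC_increment_le:
 fixes g h :: "real \<Rightarrow> real"
 assumes "c \<le> d" "abs_continuous_on_Icc c d g" "abs_continuous_on_Icc c d h" "negligible N"
  and "\<And>t. t \<in> {c..d} - N \<Longrightarrow> \<exists>D E. (g has_real_derivative D) (at t within {c..d}) \<and>
   (h has_real_derivative E) (at t within {c..d}) \<and> D \<le> E"
 shows "g d - g c \<le> h d - h c"
proof -
 have "g d - h d \<le> g c - h c"
 proof (rule AC_nonincreasing[OF assms(1) AC_diff[OF assms(2,3)] assms(4)])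
  fix t assume "t \<in> {c..d} - N"
  then obtain D E where "(g has_real_derivative D) (at t within {c..d})"
   "(h has_real_derivative E) (at t within {c..d})" "D \<le> E" using assms(5) by blast
  then show "\<exists>D\<le>0. ((\<lambda>t. g t - h t) has_real_derivative D) (at t within {c..d})"
   by (intro exI[of _ "D - E"]) (auto intro!: DERIV_diff)
 qed
 then show ?thesis by simp
qed

lemma filippov_on_components:
 assumes "filippov_on (filippov_field \<alpha> \<mu> \<delta> eps) c d Y"
 obtains N where "negligible N"
  "\<And>t. t \<in> {c..d} - N \<Longrightarrow> \<exists>s. (st_v (Y t) > 0 \<longrightarrow> s = 1) \<and>
   ((\<lambda>t. st_y (Y t)) has_real_derivative st_w (Y t)) (at t within {c..d}) \<and>
   ((\<lambda>t. st_w (Y t)) has_real_derivative (b_coeff (st_th (Y t)) (st_ph (Y t))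
    + p_coeff \<alpha> \<mu> s (st_th (Y t)) * normal_force \<delta> eps (st_y (Y t)) (st_w (Y t)))) (at t within {c..d})"
proof -
 obtain N where N: "negligible N" "\<And>t. t \<in> {c..d} - N \<Longrightarrow> \<exists>D\<in>filippov_field \<alpha> \<mu> \<delta> eps (Y t). (Y has_vector_derivative D) (at t within {c..d})"
  using assms unfolding filippov_on_def by blast
 show ?thesis
 proof (rule that[OF N(1)])
  fix t assume "t \<in> {c..d} - N"
  then obtain D where D: "D \<in> filippov_field \<alpha> \<mu> \<delta> eps (Y t)" "(Y has_vector_derivative D) (at t within {c..d})"
   using N(2) by blast
  obtain y w \<theta> \<phi> v where Yt: "Y t = (y, w, \<theta>, \<phi>, v)" by (metis prod.exhaust)
  obtain s where s: "v > 0 \<longrightarrow> s = 1" "D = vfield \<alpha> \<mu> \<delta> eps s (Y t)"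
   using D(1) unfolding filippov_field_iff Yt by auto
  note c = has_vector_derivative_components[OF D(2)[unfolded s(2) Yt vfield.simps]]
  show "\<exists>s. (st_v (Y t) > 0 \<longrightarrow> s = 1) \<and>
   ((\<lambda>t. st_y (Y t)) has_real_derivative st_w (Y t)) (at t within {c..d}) \<and>
   ((\<lambda>t. st_w (Y t)) has_real_derivative (b_coeff (st_th (Y t)) (st_ph (Y t))
    + p_coeff \<alpha> \<mu> s (st_th (Y t)) * normal_force \<delta> eps (st_y (Y t)) (st_w (Y t)))) (at t within {c..d})"
   using s(1) c(1,2) by (intro exI[of _ s]) (simp add: Yt)
 qed
qed

lemma continuous_on_Icc_positive_right:
 fixes g :: "real \<Rightarrow> real"
 assumes "continuous_on {c..d} g" "c < d" "g c > 0"
 obtains \<eta> where "\<eta> > 0" "\<eta> \<le> d - c" "\<And>t. t \<in> {c..c+\<eta>} \<Longrightarrow> g t > g c / 2"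
proof -
 obtain r where "r > 0" and r: "\<And>t. t \<in> {c..d} \<Longrightarrow> dist t c < r \<Longrightarrow> dist (g t) (g c) < g c / 2"
  using assms unfolding continuous_on_iff by (metis atLeastAtMost_iff half_gt_zero less_imp_le order_refl)
 show ?thesis
 proof (rule that[of "min (r / 2) (d - c)"])
  fix t assume "t \<in> {c..c + min (r / 2) (d - c)}"
  then have "t \<in> {c..d}" "dist t c < r" using \<open>r > 0\<close> by (auto simp: dist_real_def)
  from r[OF this] show "g t > g c / 2" unfolding dist_real_def by linarith
 qed (use \<open>r > 0\<close> assms in auto)
qed

lemma filippov_forward_positive:
 assumes Y: "filippov_on (filippov_field \<alpha> \<mu> \<delta> eps) c d Y" and cd: "c < d"
  and x: "st_y (Y c) > 0 \<or> st_y (Y c) = 0 \<and> st_w (Y c) > 0"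
 shows "\<exists>\<eta>>0. \<eta> \<le> d - c \<and> (\<forall>t\<in>{c<..c+\<eta>}. st_y (Y t) > 0)"
proof -
 have ac: "abs_continuous_on_Icc c d Y" using Y by (simp add: filippov_on_def)
 note cont = AC_imp_continuous_on[OF AC_components(1)[OF ac]] AC_imp_continuous_on[OF AC_components(2)[OF ac]]
 show ?thesis
 proof (cases "st_y (Y c) > 0")
  case True
  from continuous_on_Icc_positive_right[OF cont(1) cd True]
  obtain \<eta> where "\<eta> > 0" "\<eta> \<le> d - c" "\<And>t. t \<in> {c..c+\<eta>} \<Longrightarrow> st_y (Y t) > st_y (Y c) / 2" by blast
  moreover have "st_y (Y t) > 0" if "t \<in> {c<..c+\<eta>}" for t
   using \<open>\<And>t. t \<in> {c..c+\<eta>} \<Longrightarrow> st_y (Y t) > st_y (Y c) / 2\<close>[of t] True that by auto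
  ultimately show ?thesis by blast
 next
  case False
  then have w0: "st_w (Y c) > 0" and y0: "st_y (Y c) = 0" using x by auto
  from continuous_on_Icc_positive_right[OF cont(2) cd w0]
  obtain \<eta> where \<eta>: "\<eta> > 0" "\<eta> \<le> d - c" "\<And>t. t \<in> {c..c+\<eta>} \<Longrightarrow> st_w (Y t) > st_w (Y c) / 2" by blast
  define m where "m = st_w (Y c) / 2"
  have "st_y (Y t) > 0" if t: "t \<in> {c<..c+\<eta>}" for t
  proof -
   have Yt: "filippov_on (filippov_field \<alpha> \<mu> \<delta> eps) c t Y"
    by (rule filippov_on_subinterval[OF Y]) (use t \<eta> in auto)
   obtain N where N: "negligible N" "\<And>s. s \<in> {c..t} - N \<Longrightarrow> ((\<lambda>t. st_y (Y t)) has_real_derivative st_w (Y s)) (at s within {c..t})"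
    using filippov_on_components[OF Yt] by metis
   have "m * t - m * c \<le> st_y (Y t) - st_y (Y c)"
   proof (rule AC_increment_le[OF _ AC_mult[OF AC_const AC_ident] _ N(1)])
    show "abs_continuous_on_Icc c t (\<lambda>t. st_y (Y t))"
     using Yt AC_components(1) by (auto simp: filippov_on_def)
    fix s assume s: "s \<in> {c..t} - N"
    have "((\<lambda>t. m * t) has_real_derivative m) (at s within {c..t})" by (auto intro!: derivative_eq_intros)
    then show "\<exists>D E. ((*) m has_real_derivative D) (at s within {c..t}) \<and> ((\<lambda>t. st_y (Y t)) has_real_derivative E) (at s within {c..t}) \<and> D \<le> E"
     using N(2)[OF s] \<eta>(3)[of s] s t by (intro exI[of _ m] exI[of _ "st_w (Y s)"]) (auto simp: m_def)
   qed (use t in auto)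
   moreover have "m * t - m * c > 0" using w0 t by (simp add: m_def)
   ultimately show ?thesis using y0 by linarith
  qed
  then show ?thesis using \<eta> by blast
 qed
qed

text \<open>In the first two alternatives continuity decides. In the third one \<open>y\<close> and
  \<open>w\<close> both vanish; while \<open>v > 0\<close> only the plus field acts, the force is
  nonnegative and \<open>p_plus \<le> 0\<close>, so \<open>w'\<close> is at most half of the initial
  \<open>b_coeff\<close>, whatever the force does. Hence \<open>w\<close>, and then
  \<open>y\<close>, becomes negative.\<close>

lemma filippov_forward_negative:
 assumes Y: "filippov_on (filippov_field \<alpha> \<mu> \<delta> eps) c d Y" and cd: "c < d" and eps: "eps > 0"
  and x: "st_y (Y c) < 0 \<or> st_y (Y c) = 0 \<and> st_w (Y c) < 0 \<or>
   st_y (Y c) = 0 \<and> st_w (Y c) = 0 \<and> st_v (Y c) > 0 \<and>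
   b_coeff (st_th (Y c)) (st_ph (Y c)) < 0 \<and> p_plus \<alpha> \<mu> (st_th (Y c)) < 0"
 shows "\<exists>\<eta>>0. \<eta> \<le> d - c \<and> (\<forall>t\<in>{c<..c+\<eta>}. st_y (Y t) < 0)"
proof -
 have ac: "abs_continuous_on_Icc c d Y" using Y by (simp add: filippov_on_def)
 note cont = AC_components[OF ac, THEN AC_imp_continuous_on]
 \<comment> \<open>One linear bound for \<open>w\<close> serves both starts on \<open>y = 0\<close>:
   \<open>n < 0\<close> if \<open>w\<close> starts negative, \<open>m < 0\<close> if
   \<open>w\<close> starts at zero.\<close>
 have neg: "\<exists>\<eta>>0. \<eta> \<le> d - c \<and> (\<forall>t\<in>{c<..c+\<eta>}. st_y (Y t) < 0)"
  if y0: "st_y (Y c) = 0" and \<eta>: "\<eta> > 0" "\<eta> \<le> d - c" and w: "\<And>t. t \<in> {c<..c+\<eta>} \<Longrightarrow> st_w (Y t) \<le> m * (t - c) + n"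
   and mn: "m < 0 \<and> n = 0 \<or> m = 0 \<and> n < 0" for \<eta> m n
 proof -
  have "st_y (Y t) < 0" if t: "t \<in> {c<..c+\<eta>}" for t
  proof -
   have Yt: "filippov_on (filippov_field \<alpha> \<mu> \<delta> eps) c t Y"
    by (rule filippov_on_subinterval[OF Y]) (use t \<eta> in auto)
   obtain N where N: "negligible N" "\<And>s. s \<in> {c..t} - N \<Longrightarrow> ((\<lambda>t. st_y (Y t)) has_real_derivative st_w (Y s)) (at s within {c..t})"
    using filippov_on_components[OF Yt] by metis
   let ?h = "\<lambda>t. m / 2 * ((t - c) * (t - c)) + n * t"
   have "st_y (Y t) - st_y (Y c) \<le> ?h t - ?h c"
   proof (rule AC_increment_le[where N = "N \<union> {c}"])
    show "abs_continuous_on_Icc c t (\<lambda>t. st_y (Y t))"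
     using Yt AC_components(1) by (auto simp: filippov_on_def)
    show "abs_continuous_on_Icc c t ?h"
     by (intro AC_add AC_mult AC_diff AC_const AC_ident)
    show "negligible (N \<union> {c})" using N(1) by simp
    fix s assume s: "s \<in> {c..t} - (N \<union> {c})"
    have "(?h has_real_derivative m * (s - c) + n) (at s within {c..t})" by (auto intro!: derivative_eq_intros simp: algebra_simps)
    then show "\<exists>D E. ((\<lambda>t. st_y (Y t)) has_real_derivative D) (at s within {c..t}) \<and> (?h has_real_derivative E) (at s within {c..t}) \<and> D \<le> E"
     using N(2)[of s] w[of s] s t by (intro exI[of _ "st_w (Y s)"] exI[of _ "m * (s - c) + n"]) auto
   qed (use t in auto)
   moreover have "?h t - ?h c < 0"
   proof -
    have "m / 2 * ((t - c) * (t - c)) \<le> 0" "m < 0 \<Longrightarrow> m / 2 * ((t - c) * (t - c)) < 0"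
     using mn t by (auto simp: mult_le_0_iff mult_less_0_iff zero_less_mult_iff)
    moreover have "n * (t - c) \<le> 0" "n < 0 \<Longrightarrow> n * (t - c) < 0" using mn t by (auto simp: mult_le_0_iff mult_less_0_iff)
    ultimately have "m / 2 * ((t - c) * (t - c)) + n * (t - c) < 0" using mn by fastforce
    then show ?thesis by (simp add: algebra_simps)
   qed
   ultimately show ?thesis using y0 by linarith
  qed
  then show ?thesis using \<eta> by blast
 qed
 consider "st_y (Y c) < 0" | "st_y (Y c) = 0" "st_w (Y c) < 0" |
  "st_y (Y c) = 0" "st_w (Y c) = 0" "st_v (Y c) > 0" "b_coeff (st_th (Y c)) (st_ph (Y c)) < 0" "p_plus \<alpha> \<mu> (st_th (Y c)) < 0"
  using x by blast
 then show ?thesis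
 proof cases
  case 1
  have "continuous_on {c..d} (\<lambda>t. - st_y (Y t))" by (intro continuous_on_minus cont)
  from continuous_on_Icc_positive_right[OF this cd] 1
  obtain \<eta> where "\<eta> > 0" "\<eta> \<le> d - c" "\<And>t. t \<in> {c..c+\<eta>} \<Longrightarrow> - st_y (Y t) > - st_y (Y c) / 2" by auto
  moreover have "st_y (Y t) < 0" if "t \<in> {c<..c+\<eta>}" for t
   using \<open>\<And>t. t \<in> {c..c+\<eta>} \<Longrightarrow> - st_y (Y t) > - st_y (Y c) / 2\<close>[of t] 1 that by auto
  ultimately show ?thesis by blast
 next
  case 2
  have "continuous_on {c..d} (\<lambda>t. - st_w (Y t))" by (intro continuous_on_minus cont)
  from continuous_on_Icc_positive_right[OF this cd] 2
  obtain \<eta> where \<eta>: "\<eta> > 0" "\<eta> \<le> d - c" "\<And>t. t \<in> {c..c+\<eta>} \<Longrightarrow> - st_w (Y t) > - st_w (Y c) / 2" by auto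
  show ?thesis
  proof (rule neg[OF 2(1) \<eta>(1,2), where m = 0 and n = "st_w (Y c) / 2"])
   show "st_w (Y t) \<le> 0 * (t - c) + st_w (Y c) / 2" if "t \<in> {c<..c+\<eta>}" for t
    using \<eta>(3)[of t] that by auto
  qed (use 2 in auto)
 next
  case 3
  have "continuous_on {c..d} (\<lambda>t. - b_coeff (st_th (Y t)) (st_ph (Y t)))"
   unfolding b_coeff_def by (intro continuous_intros cont)
  from continuous_on_Icc_positive_right[OF this cd] 3
  obtain \<eta>1 where \<eta>1: "\<eta>1 > 0" "\<eta>1 \<le> d - c" "\<And>t. t \<in> {c..c+\<eta>1} \<Longrightarrow> - b_coeff (st_th (Y t)) (st_ph (Y t)) > - b_coeff (st_th (Y c)) (st_ph (Y c)) / 2" by auto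
  have "continuous_on {c..d} (\<lambda>t. - p_plus \<alpha> \<mu> (st_th (Y t)))"
   unfolding p_coeff_def by (intro continuous_intros cont)
  from continuous_on_Icc_positive_right[OF this cd] 3
  obtain \<eta>2 where \<eta>2: "\<eta>2 > 0" "\<eta>2 \<le> d - c" "\<And>t. t \<in> {c..c+\<eta>2} \<Longrightarrow> - p_plus \<alpha> \<mu> (st_th (Y t)) > - p_plus \<alpha> \<mu> (st_th (Y c)) / 2" by auto
  from continuous_on_Icc_positive_right[OF cont(5) cd 3(3)]
  obtain \<eta>3 where \<eta>3: "\<eta>3 > 0" "\<eta>3 \<le> d - c" "\<And>t. t \<in> {c..c+\<eta>3} \<Longrightarrow> st_v (Y t) > st_v (Y c) / 2" by auto
  define \<eta> where "\<eta> = min \<eta>1 (min \<eta>2 \<eta>3)"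
  define m where "m = b_coeff (st_th (Y c)) (st_ph (Y c)) / 2"
  have \<eta>: "\<eta> > 0" "\<eta> \<le> d - c" using \<eta>1 \<eta>2 \<eta>3 by (auto simp: \<eta>_def)
  have r: "b_coeff (st_th (Y t)) (st_ph (Y t)) \<le> m" "p_plus \<alpha> \<mu> (st_th (Y t)) \<le> 0" "st_v (Y t) > 0" if "t \<in> {c..c+\<eta>}" for t
  proof -
   have "t \<in> {c..c+\<eta>1}" "t \<in> {c..c+\<eta>2}" "t \<in> {c..c+\<eta>3}" using that by (auto simp: \<eta>_def)
   from \<eta>1(3)[OF this(1)] \<eta>2(3)[OF this(2)] \<eta>3(3)[OF this(3)] 3(3-5)
   show "b_coeff (st_th (Y t)) (st_ph (Y t)) \<le> m" "p_plus \<alpha> \<mu> (st_th (Y t)) \<le> 0" "st_v (Y t) > 0"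
    unfolding m_def by linarith+
  qed
  show ?thesis
  proof (rule neg[OF 3(1) \<eta>, where m = m and n = 0])
   fix t assume t: "t \<in> {c<..c+\<eta>}"
   have Yt: "filippov_on (filippov_field \<alpha> \<mu> \<delta> eps) c t Y"
    by (rule filippov_on_subinterval[OF Y]) (use t \<eta> in auto)
   from filippov_on_components[OF this] obtain N where N: "negligible N"
    "\<And>s. s \<in> {c..t} - N \<Longrightarrow> \<exists>\<sigma>. (st_v (Y s) > 0 \<longrightarrow> \<sigma> = 1) \<and>
     ((\<lambda>t. st_w (Y t)) has_real_derivative (b_coeff (st_th (Y s)) (st_ph (Y s))
    + p_coeff \<alpha> \<mu> \<sigma> (st_th (Y s)) * normal_force \<delta> eps (st_y (Y s)) (st_w (Y s)))) (at s within {c..t})"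
    by metis
   have "st_w (Y t) - st_w (Y c) \<le> m * t - m * c"
   proof (rule AC_increment_le[OF _ _ AC_mult[OF AC_const AC_ident] N(1)])
    show "abs_continuous_on_Icc c t (\<lambda>t. st_w (Y t))"
     using Yt AC_components(2) by (auto simp: filippov_on_def)
    fix s assume s: "s \<in> {c..t} - N"
    then have sI: "s \<in> {c..c+\<eta>}" using t by auto
    have d: "((\<lambda>t. st_w (Y t)) has_real_derivative (b_coeff (st_th (Y s)) (st_ph (Y s))
     + p_plus \<alpha> \<mu> (st_th (Y s)) * normal_force \<delta> eps (st_y (Y s)) (st_w (Y s)))) (at s within {c..t})"
     using N(2)[OF s] r(3)[OF sI] by auto
    have le: "b_coeff (st_th (Y s)) (st_ph (Y s)) + p_plus \<alpha> \<mu> (st_th (Y s)) * normal_force \<delta> eps (st_y (Y s)) (st_w (Y s)) \<le> m"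
     using r[OF sI] normal_force_nonneg[OF eps, of \<delta> "st_y (Y s)" "st_w (Y s)"]
     by (smt (verit) mult_nonpos_nonneg)
    have "((\<lambda>t. m * t) has_real_derivative m) (at s within {c..t})" by (auto intro!: derivative_eq_intros)
    then show "\<exists>D E. ((\<lambda>t. st_w (Y t)) has_real_derivative D) (at s within {c..t}) \<and> ((*) m has_real_derivative E) (at s within {c..t}) \<and> D \<le> E"
     using d le by blast
   qed (use t in auto)
   then show "st_w (Y t) \<le> m * (t - c) + 0" using 3(2) by (simp add: algebra_simps)
  qed (use 3 in \<open>auto simp: m_def\<close>)
 qed
qed

text \<open>States from which every Filippov solution moves at once to one and the same side of
  \<open>y = 0\<close>. The last alternative covers the impact state with \<open>w = 0\<close>,
  which occurs as starting point when \<open>w0\<close> vanishes.\<close>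

definition nondegenerate :: "real \<Rightarrow> real \<Rightarrow> state \<Rightarrow> bool" where
 "nondegenerate \<alpha> \<mu> x \<longleftrightarrow> st_y x \<noteq> 0 \<or> st_w x \<noteq> 0 \<or>
   (st_v x > 0 \<and> b_coeff (st_th x) (st_ph x) < 0 \<and> p_plus \<alpha> \<mu> (st_th x) < 0)"

text \<open>After a nondegenerate state both solutions are on the same side of \<open>y = 0\<close>
  for a short open time interval, which is all that the one-sided comparison needs.\<close>

lemma filippov_locally_unique:
 assumes par: "\<alpha> > 0" "\<mu> > 0" "\<delta> > 0" "eps > 0" and cd: "c < d"
  and X: "filippov_on (filippov_field \<alpha> \<mu> \<delta> eps) c d X"
  and Z: "filippov_on (filippov_field \<alpha> \<mu> \<delta> eps) c d Z"
  and start: "X c = Z c" and nd: "nondegenerate \<alpha> \<mu> (X c)"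
 obtains \<eta> where "\<eta> > 0" "\<eta> \<le> d - c" "\<And>t. t \<in> {c..c+\<eta>} \<Longrightarrow> X t = Z t"
proof -
 have "\<exists>\<eta>>0. \<eta> \<le> d - c \<and> (\<forall>t\<in>{c<..c+\<eta>}. st_y (X t) \<le> 0 \<and> st_y (Z t) \<le> 0 \<or> st_y (X t) > 0 \<and> st_y (Z t) > 0)"
 proof (cases "st_y (X c) > 0 \<or> st_y (X c) = 0 \<and> st_w (X c) > 0")
  case True
  obtain \<eta>1 where "\<eta>1 > 0" "\<eta>1 \<le> d - c" "\<forall>t\<in>{c<..c+\<eta>1}. st_y (X t) > 0"
   using filippov_forward_positive[OF X cd True] by blast
  moreover obtain \<eta>2 where "\<eta>2 > 0" "\<eta>2 \<le> d - c" "\<forall>t\<in>{c<..c+\<eta>2}. st_y (Z t) > 0"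
   using filippov_forward_positive[OF Z cd True[unfolded start]] by blast
  ultimately show ?thesis by (intro exI[of _ "min \<eta>1 \<eta>2"]) auto
 next
  case False
  then have neg: "st_y (X c) < 0 \<or> st_y (X c) = 0 \<and> st_w (X c) < 0 \<or>
   st_y (X c) = 0 \<and> st_w (X c) = 0 \<and> st_v (X c) > 0 \<and>
   b_coeff (st_th (X c)) (st_ph (X c)) < 0 \<and> p_plus \<alpha> \<mu> (st_th (X c)) < 0"
   using nd unfolding nondegenerate_def by (auto simp: not_less)
  obtain \<eta>1 where "\<eta>1 > 0" "\<eta>1 \<le> d - c" "\<forall>t\<in>{c<..c+\<eta>1}. st_y (X t) < 0"
   using filippov_forward_negative[OF X cd par(4) neg] by blast
  moreover obtain \<eta>2 where "\<eta>2 > 0" "\<eta>2 \<le> d - c" "\<forall>t\<in>{c<..c+\<eta>2}. st_y (Z t) < 0"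
   using filippov_forward_negative[OF Z cd par(4) neg[unfolded start]] by blast
  ultimately show ?thesis by (intro exI[of _ "min \<eta>1 \<eta>2"]) (auto intro: less_imp_le)
 qed
 then obtain \<eta> where \<eta>: "\<eta> > 0" "\<eta> \<le> d - c"
  and same: "\<And>t. t \<in> {c<..c+\<eta>} \<Longrightarrow> st_y (X t) \<le> 0 \<and> st_y (Z t) \<le> 0 \<or> st_y (X t) > 0 \<and> st_y (Z t) > 0" by blast
 show ?thesis
 proof (rule that[OF \<eta>])
  fix t assume t: "t \<in> {c..c+\<eta>}"
  show "X t = Z t"
  proof (rule filippov_unique_one_sided[OF par, of c t X Z])
   show "filippov_on (filippov_field \<alpha> \<mu> \<delta> eps) c t X" "filippov_on (filippov_field \<alpha> \<mu> \<delta> eps) c t Z"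
    using filippov_on_subinterval[OF X order_refl] filippov_on_subinterval[OF Z order_refl] t \<eta> by auto
  qed (use t same start in auto)
 qed
qed

lemma filippov_solution_iff: "filippov_solution F x T X \<longleftrightarrow> X 0 = x \<and> filippov_on F 0 T X"
 by (simp add: filippov_solution_def filippov_on_def)

text \<open>The set of times up to which two solutions agree contains its supremum by continuity. If
  the supremum lay before the shorter horizon, local uniqueness could be restarted there;
  nondegeneracy is therefore asked only before \<open>T\<close>.\<close>

theorem filippov_forward_flowI:
 assumes par: "\<alpha> > 0" "\<mu> > 0" "\<delta> > 0" "eps > 0"
  and X: "filippov_solution (filippov_field \<alpha> \<mu> \<delta> eps) x T X"
  and nd: "\<And>t. 0 \<le> t \<Longrightarrow> t < T \<Longrightarrow> nondegenerate \<alpha> \<mu> (X t)"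
 shows "filippov_forward_flow (filippov_field \<alpha> \<mu> \<delta> eps) x T X"
 unfolding filippov_forward_flow_def
proof (intro conjI allI impI X)
 fix T' Z assume Z: "0 \<le> T' \<and> filippov_solution (filippov_field \<alpha> \<mu> \<delta> eps) x T' Z"
 define T0 where "T0 = min T T'"
 have X0: "filippov_on (filippov_field \<alpha> \<mu> \<delta> eps) 0 T0 X" and Z0: "filippov_on (filippov_field \<alpha> \<mu> \<delta> eps) 0 T0 Z"
  using X Z by (auto simp: filippov_solution_iff T0_def intro: filippov_on_subinterval)
 have start: "X 0 = Z 0" using X Z by (simp add: filippov_solution_iff)
 have cX: "continuous_on {0..T0} X" and cZ: "continuous_on {0..T0} Z"
  using X0 Z0 by (auto simp: filippov_on_def intro: AC_imp_continuous_on)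
 define S where "S = {t \<in> {0..T0}. \<forall>s\<in>{0..t}. X s = Z s}"
 show "\<forall>t\<in>{0..min T T'}. Z t = X t"
 proof (cases "T0 \<ge> 0")
  case True
  then have "0 \<in> S" using start by (simp add: S_def)
  have bdd: "bdd_above S" by (rule bdd_aboveI[of _ T0]) (auto simp: S_def)
  define m where "m = Sup S"
  have m0: "m \<ge> 0" using cSup_upper[OF \<open>0 \<in> S\<close> bdd] by (simp add: m_def)
  have mT: "m \<le> T0" unfolding m_def using \<open>0 \<in> S\<close> by (intro cSup_least) (auto simp: S_def)
  have before: "X s = Z s" if sm: "0 \<le> s" "s < m" for s
  proof -
   obtain t where "t \<in> S" "s < t" using sm(2) less_cSup_iff[OF _ bdd, of s] \<open>0 \<in> S\<close> unfolding m_def by blast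
   then show ?thesis using sm by (auto simp: S_def)
  qed
  have "X m = Z m"
  proof (cases "m = 0")
   case False
   have "continuous_on {0..m} (\<lambda>t. X t - Z t)"
    using continuous_on_subset[OF cX] continuous_on_subset[OF cZ] mT by (intro continuous_on_diff) auto
   moreover have "closure {0..<m} = {0..m}" using False m0 by simp
   moreover have "X t - Z t = 0" if "t \<in> {0..<m}" for t using before that by simp
   ultimately have "X m - Z m = 0"
    using continuous_constant_on_closure[of "{0..<m}" "\<lambda>t. X t - Z t" 0 m] m0 by auto
   then show ?thesis by simp
  qed (use start in simp)
  then have mS: "m \<in> S" using before m0 mT by (auto simp: S_def) (metis less_eq_real_def)
  have "m = T0"
  proof (rule ccontr)
   assume "m \<noteq> T0"
   then have lt: "m < T0" using mT by simp
   obtain \<eta> where \<eta>: "\<eta> > 0" "\<eta> \<le> T0 - m" "\<And>t. t \<in> {m..m+\<eta>} \<Longrightarrow> X t = Z t"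
   proof (rule filippov_locally_unique[OF par lt])
    show "filippov_on (filippov_field \<alpha> \<mu> \<delta> eps) m T0 X" "filippov_on (filippov_field \<alpha> \<mu> \<delta> eps) m T0 Z"
     using filippov_on_subinterval[OF X0 m0 order_refl] filippov_on_subinterval[OF Z0 m0 order_refl] by auto
    show "nondegenerate \<alpha> \<mu> (X m)" using nd[OF m0] lt by (simp add: T0_def)
   qed (use \<open>X m = Z m\<close> in auto)
   have "X s = Z s" if "s \<in> {0..m+\<eta>}" for s
    using that \<eta>(3)[of s] before[of s] by (cases "s < m") auto
   then have "m + \<eta> \<in> S" using \<eta> m0 by (auto simp: S_def)
   then have "m + \<eta> \<le> m" unfolding m_def by (intro cSup_upper bdd)
   then show False using \<eta> by simp
  qed
  then show ?thesis using mS by (auto simp: S_def T0_def)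
 qed (auto simp: T0_def)
qed

subsection \<open>The linear sliding oscillator\<close>

definition clip :: "real \<Rightarrow> real \<Rightarrow> real \<Rightarrow> real" where
 "clip lo hi x = max lo (min hi x)"

lemma clip_lipschitz: "\<bar>clip lo hi x - clip lo hi y\<bar> \<le> \<bar>x - y\<bar>"
 unfolding clip_def by linarith

lemma clip_eq: "lo \<le> x \<Longrightarrow> x \<le> hi \<Longrightarrow> clip lo hi x = x"
 by (simp add: clip_def)

lemma clip_bounds: "lo \<le> hi \<Longrightarrow> lo \<le> clip lo hi x \<and> clip lo hi x \<le> hi"
 by (simp add: clip_def)

lemma blip_clip:
 assumes "\<And>x y. \<bar>f x - f y\<bar> \<le> B * dist x y" "lo \<le> hi"
 shows "blip_on S (\<lambda>x. clip lo hi (f x))"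
 unfolding blip_on_def
proof (intro exI[of _ "\<bar>B\<bar> + \<bar>lo\<bar> + \<bar>hi\<bar>"] conjI ballI)
 fix x y
 have "\<bar>clip lo hi (f x) - clip lo hi (f y)\<bar> \<le> B * dist x y"
  using clip_lipschitz assms(1) order_trans by blast
 also have "\<dots> \<le> (\<bar>B\<bar> + \<bar>lo\<bar> + \<bar>hi\<bar>) * dist x y" by (intro mult_right_mono) auto
 finally show "\<bar>clip lo hi (f x) - clip lo hi (f y)\<bar> \<le> (\<bar>B\<bar> + \<bar>lo\<bar> + \<bar>hi\<bar>) * dist x y" .
next
 fix x show "\<bar>clip lo hi (f x)\<bar> \<le> \<bar>B\<bar> + \<bar>lo\<bar> + \<bar>hi\<bar>"
  using clip_bounds[OF assms(2), of "f x"] by linarith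
qed simp

lemma blip_imp_lipschitz:
 assumes "blip_on UNIV f"
 obtains L where "L-lipschitz_on UNIV f"
 using assms unfolding blip_on_def lipschitz_on_def dist_real_def by auto

text \<open>Characteristic polynomial of the oscillator \<open>y' = w\<close>,
  \<open>w' = - S * (y + d * w)\<close>, with the numbers \<xi> of the problem as roots. The ratio
  \<open>z = w / y\<close> satisfies the Riccati equation \<open>z' = - quad S d z\<close>.\<close>

definition quad :: "real \<Rightarrow> real \<Rightarrow> real \<Rightarrow> real" where
 "quad S d z = z\<^sup>2 + S * d * z + S"

text \<open>With \<open>P = - p_plus\<close> this is the unstable eigenvalue of the compression
  dynamics, the positive root of \<open>z\<^sup>2 = d * P * z + P\<close>.\<close>

definition lam :: "real \<Rightarrow> real \<Rightarrow> real" where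
 "lam P d = (d * P + sqrt (d\<^sup>2 * P\<^sup>2 + 4 * P)) / 2"

text \<open>Separation of variables in the Riccati equation: the ratio \<open>w / y\<close> starts
  sliding at \<open>lam P d\<close>, the unstable direction of compression, and at
  \<open>- 1 / d\<close> the contact force, a multiple of \<open>y + d * w\<close>,
  vanishes.\<close>

definition slide_time :: "real \<Rightarrow> real \<Rightarrow> real \<Rightarrow> real" where
 "slide_time S P d = integral {- 1 / d..lam P d} (\<lambda>z. 1 / quad S d z)"

text \<open>In \<open>z\<^sup>2 + S * (1 + d * z)\<close> both summands are nonnegative from
  \<open>- 1 / d\<close> on and do not vanish together. Thus real roots, if any, lie below the range
  of the sliding ratio, and the integrand of \<open>slide_time\<close> has no pole.\<close>

lemma quad_pos:
 assumes "S > 0" "d > 0" "z \<ge> - 1 / d"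
 shows "quad S d z > 0"
proof (cases "z \<ge> 0")
 case True
 then show ?thesis using assms unfolding quad_def by (intro add_nonneg_pos add_nonneg_nonneg) auto
next
 case False
 have "- 1 \<le> d * z" using assms(2,3) by (simp add: field_simps)
 then have "0 \<le> S * (1 + d * z)" using assms(1) by simp
 moreover have "z\<^sup>2 > 0" using False by simp
 moreover have "quad S d z = z\<^sup>2 + S * (1 + d * z)" by (simp add: quad_def algebra_simps)
 ultimately show ?thesis by linarith
qed

lemma lam_pos: "P > 0 \<Longrightarrow> d > 0 \<Longrightarrow> lam P d > 0"
 unfolding lam_def by (intro divide_pos_pos add_pos_nonneg) auto

lemma lam_root:
 assumes "P > 0"
 shows "(lam P d)\<^sup>2 = d * P * lam P d + P"
proof -
 have "(sqrt (d\<^sup>2 * P\<^sup>2 + 4 * P))\<^sup>2 = d\<^sup>2 * P\<^sup>2 + 4 * P" using assms by simp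
 then show ?thesis unfolding lam_def power_divide power2_sum by (simp add: field_simps power2_eq_square)
qed

lemma continuous_on_quad_inverse:
 assumes "S > 0" "d > 0"
 shows "continuous_on {- 1 / d..b} (\<lambda>z. 1 / quad S d z)"
proof -
 have "\<forall>z\<in>{- 1 / d..b}. quad S d z \<noteq> 0" using quad_pos[OF assms] by force
 then show ?thesis by (intro continuous_on_divide continuous_intros) (auto simp: quad_def intro!: continuous_intros)
qed

text \<open>Clipping the ratio to the interval from \<open>- 1 / d\<close> to \<open>lam P d\<close>
  makes the field Lipschitz and keeps it below a negative constant. The solution therefore descends
  to the lower end in finite time, and up to that time the clip is inactive.\<close>

lemma riccati:
 assumes par: "S > 0" "P > 0" "d > 0"
 obtains Z where "Z 0 = lam P d" "Z (slide_time S P d) = - 1 / d" "slide_time S P d > 0"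
  "\<And>t. t \<in> {0..slide_time S P d} \<Longrightarrow> (Z has_real_derivative - quad S d (Z t)) (at t within {0..slide_time S P d})"
  "\<And>t. t \<in> {0..slide_time S P d} \<Longrightarrow> - 1 / d \<le> Z t \<and> Z t \<le> lam P d"
  "\<And>t. 0 \<le> t \<Longrightarrow> t < slide_time S P d \<Longrightarrow> - 1 / d < Z t"
proof -
 define a b where "a = - 1 / d" and "b = lam P d"
 have ab: "a < b" using lam_pos[OF par(2,3)] par by (simp add: a_def b_def less_trans[of _ 0])
 define f where "f z = - quad S d (clip a b z)" for z
 have "blip_on UNIV f"
  unfolding f_def quad_def
  by (intro blip_minus blip_add blip_power2 blip_mult blip_const blip_clip[where B = 1]) (use ab in \<open>auto simp: dist_real_def\<close>)
 then obtain L where L: "L-lipschitz_on UNIV f" using blip_imp_lipschitz by blast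
 obtain Z where Z0: "Z 0 = b" and dZ: "\<And>t. t \<ge> 0 \<Longrightarrow> (Z has_vector_derivative f (Z t)) (at t within {0..})"
  using picard_lindeloef[OF L] by blast
 have clipab: "clip a b z \<in> {a..b}" for z using clip_bounds[of a b] ab by auto
 have "continuous_on {a..b} (quad S d)" unfolding quad_def by (intro continuous_intros)
 then obtain z0 where z0: "z0 \<in> {a..b}" "\<And>z. z \<in> {a..b} \<Longrightarrow> quad S d z0 \<le> quad S d z"
  using continuous_attains_inf[of "{a..b}" "quad S d"] ab by fastforce
 define m where "m = quad S d z0"
 have m0: "m > 0" using quad_pos[OF par(1,3)] z0(1) by (simp add: m_def a_def)
 have fm: "f z \<le> - m" for z using z0(2)[OF clipab] by (simp add: f_def m_def)
 have dZ': "(Z has_real_derivative f (Z t)) (at t within {u..v})" if "t \<in> {u..v}" "0 \<le> u" for t u v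
  unfolding has_real_derivative_iff_has_vector_derivative
  using has_vector_derivative_within_subset[OF dZ, of t "{u..v}"] that by auto
 have dec: "Z v - Z u \<le> - m * (v - u)" if "0 \<le> u" "u \<le> v" for u v
 proof -
  have "Z v + m * v \<le> Z u + m * u"
  proof (rule decreasing_from_derivative[OF that(2), of "\<lambda>t. Z t + m * t" "\<lambda>t. f (Z t) + m"])
   show "((\<lambda>t. Z t + m * t) has_real_derivative f (Z t) + m) (at t within {u..v})" if "t \<in> {u..v}" for t
    using dZ'[OF that] \<open>0 \<le> u\<close> by (auto intro!: derivative_eq_intros)
   show "f (Z t) + m \<le> 0" for t using fm[of "Z t"] by simp
  qed
  then show ?thesis by (simp add: algebra_simps)
 qed
 define T where "T = (b - a) / m"
 have T0: "T > 0" using ab m0 by (simp add: T_def)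
 have "Z T \<le> a" using dec[of 0 T] T0 m0 by (simp add: Z0 T_def)
 moreover have "continuous_on {0..T} Z"
  using dZ'[of _ 0 T] by (meson DERIV_continuous continuous_on_eq_continuous_within order_refl)
 ultimately obtain t1 where t1: "0 \<le> t1" "t1 \<le> T" "Z t1 = a"
  using IVT2'[of Z T a 0] ab T0 Z0 by auto
 have t1pos: "t1 > 0" using t1 Z0 ab by (cases "t1 = 0") auto
 have rng: "a \<le> Z t \<and> Z t \<le> b" if "t \<in> {0..t1}" for t
 proof -
  have "m * t \<ge> 0" "m * (t1 - t) \<ge> 0" using that m0 by auto
  then show ?thesis using dec[of 0 t] dec[of t t1] that t1 by (simp add: Z0)
 qed
 have strict: "a < Z t" if "0 \<le> t" "t < t1" for t
 proof -
  have "m * (t1 - t) > 0" using that m0 by auto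
  then show ?thesis using dec[of t t1] that t1 by (simp add: algebra_simps)
 qed
 have dZ1: "(Z has_real_derivative - quad S d (Z t)) (at t within {0..t1})" if "t \<in> {0..t1}" for t
  using dZ'[of t 0 t1] that rng[OF that] by (simp add: f_def clip_eq)
 \<comment> \<open>\<open>H\<close> is an antiderivative of \<open>1 / quad S d\<close>, so
   \<open>H (Z t) + t\<close> is constant along the solution; this identifies the hitting time with
   \<open>slide_time\<close>.\<close>
 define H where "H z = integral {a..z} (\<lambda>z. 1 / quad S d z)" for z
 have dH: "(H has_real_derivative 1 / quad S d z) (at z within {a..b})" if "z \<in> {a..b}" for z
  unfolding H_def has_real_derivative_iff_has_vector_derivative
  by (rule integral_has_vector_derivative[OF continuous_on_quad_inverse[OF par(1,3), of b, folded a_def] that])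
 have "H (Z t1) + t1 = H (Z 0) + 0"
 proof (rule antisym)
  have d: "((\<lambda>t. H (Z t) + t) has_real_derivative 0) (at t within {0..t1})" if t: "t \<in> {0..t1}" for t
  proof -
   have q: "quad S d (Z t) > 0" using quad_pos[OF par(1,3)] rng[OF t] by (simp add: a_def)
   have "(H has_real_derivative 1 / quad S d (Z t)) (at (Z t) within Z ` {0..t1})"
    by (rule DERIV_subset[OF dH]) (use rng t in auto)
   from DERIV_image_chain[OF this dZ1[OF t]]
   have "((\<lambda>t. H (Z t)) has_real_derivative - 1) (at t within {0..t1})" using q by (simp add: o_def)
   then show ?thesis by (auto intro!: derivative_eq_intros)
  qed
  show "H (Z t1) + t1 \<le> H (Z 0) + 0"
   by (rule decreasing_from_derivative[OF _ d]) (use t1 in auto)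
  show "H (Z 0) + 0 \<le> H (Z t1) + t1"
   by (rule increasing_from_derivative[OF _ d]) (use t1 in auto)
 qed
 moreover have "H (Z t1) = 0" by (simp add: H_def t1)
 ultimately have "t1 = slide_time S P d"
  by (simp add: Z0 H_def slide_time_def a_def b_def)
 then show ?thesis
  using that[of Z] Z0 t1 t1pos rng strict dZ1 by (simp add: a_def b_def)
qed

lemma slide_time_pos: "S > 0 \<Longrightarrow> P > 0 \<Longrightarrow> d > 0 \<Longrightarrow> slide_time S P d > 0"
 using riccati by metis

text \<open>The relation \<open>w = Z * y\<close> with the Riccati solution \<open>Z\<close>
  persists from time 0, and \<open>- 1 / d \<le> Z \<le> lam P d\<close> gives all sign statements.
  The final speed comes from a quadratic form with exact exponential decay, without solving the
  oscillator. The case \<open>y 0 = 0\<close> is the one to which imaginary parts of complex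
  solutions belong.\<close>

lemma linear_sliding:
 fixes y w :: "real \<Rightarrow> real"
 assumes par: "S > 0" "P > 0" "d > 0"
  and T: "T = slide_time S P d"
  and dy: "\<And>t. t \<in> {0..T} \<Longrightarrow> (y has_real_derivative w t) (at t within {0..T})"
  and dw: "\<And>t. t \<in> {0..T} \<Longrightarrow> (w has_real_derivative - S * (y t + d * w t)) (at t within {0..T})"
  and w0: "w 0 = lam P d * y 0"
 shows "y 0 = 0 \<Longrightarrow> t \<in> {0..T} \<Longrightarrow> y t = 0 \<and> w t = 0"
  and "y 0 \<noteq> 0 \<Longrightarrow> t \<in> {0..T} \<Longrightarrow> y 0 * y t > 0"
  and "y 0 \<noteq> 0 \<Longrightarrow> 0 \<le> t \<Longrightarrow> t < T \<Longrightarrow> y 0 * (y t + d * w t) > 0"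
  and "y T + d * w T = 0"
  and "y 0 \<noteq> 0 \<Longrightarrow> w T = - sgn (y 0) * (\<bar>w 0\<bar> * sqrt (1 + S / P) * exp (- (S * d * T / 2)))"
proof -
 obtain Z where Z: "Z 0 = lam P d" "Z T = - 1 / d" "T > 0"
  "\<And>t. t \<in> {0..T} \<Longrightarrow> (Z has_real_derivative - quad S d (Z t)) (at t within {0..T})"
  "\<And>t. t \<in> {0..T} \<Longrightarrow> - 1 / d \<le> Z t \<and> Z t \<le> lam P d"
  "\<And>t. 0 \<le> t \<Longrightarrow> t < T \<Longrightarrow> - 1 / d < Z t"
  using riccati[OF par] unfolding T by metis
 \<comment> \<open>\<open>D\<close> solves a homogeneous linear equation with coefficient
   \<open>- (S * d + Z)\<close>, which is bounded above because \<open>Z \<ge> - 1 / d\<close>; it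
   starts at zero and so remains zero.\<close>
 define D where "D t = w t - Z t * y t" for t
 have "D t * D t \<le> D 0 * D 0 * exp (2 / d * t)" if "t \<in> {0..T}" for t
 proof (rule gronwall[OF that])
  fix s assume s: "s \<in> {0..T}"
  have "(D has_real_derivative (- (S * d + Z s)) * D s) (at s within {0..T})"
   unfolding D_def quad_def
   by (rule derivative_eq_intros dw[OF s] dy[OF s] Z(4)[OF s, unfolded quad_def] refl)+
    (simp add: algebra_simps power2_eq_square)
  then show "((\<lambda>t. D t * D t) has_real_derivative (- 2 * (S * d + Z s)) * (D s * D s)) (at s within {0..T})"
   by (auto intro!: derivative_eq_intros simp: algebra_simps)
  have "- 2 * (S * d + Z s) \<le> 2 / d" 
  proof -
   have "S * d > 0" using par by simp
   moreover have "- (1 / d) \<le> Z s" using Z(5)[OF s] by simp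
   moreover have "2 / d = 2 * (1 / d)" by simp
   moreover have "- 2 * (S * d + Z s) = - 2 * (S * d) - 2 * Z s" by (simp add: algebra_simps)
   ultimately show ?thesis by linarith
  qed
  then show "(- 2 * (S * d + Z s)) * (D s * D s) \<le> 2 / d * (D s * D s)"
   by (intro mult_right_mono) auto
 qed
 moreover have "D 0 = 0" by (simp add: D_def Z w0)
 ultimately have "D t = 0" if "t \<in> {0..T}" for t
  using that by (metis mult_zero_left mult_eq_0_iff linorder_not_less not_real_square_gt_zero order_less_le)
 then have wZ: "w t = Z t * y t" if "t \<in> {0..T}" for t using that by (simp add: D_def)
 have dy2: "((\<lambda>t. y t * y t) has_real_derivative 2 * Z s * (y s * y s)) (at s within {0..T})" if s: "s \<in> {0..T}" for s
  using dy[OF s] by (auto intro!: derivative_eq_intros simp: wZ[OF s])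
 show "y t = 0 \<and> w t = 0" if "y 0 = 0" "t \<in> {0..T}"
 proof -
  have "y t * y t \<le> y 0 * y 0 * exp (2 * lam P d * t)"
  proof (rule gronwall[OF that(2) dy2])
   show "2 * Z s * (y s * y s) \<le> 2 * lam P d * (y s * y s)" if "s \<in> {0..T}" for s
    using Z(5)[OF that] by (intro mult_right_mono) auto
  qed
  then have "y t = 0" using that(1) by (metis mult_zero_left mult_eq_0_iff linorder_not_less not_real_square_gt_zero order_less_le)
  then show ?thesis using wZ[OF that(2)] by simp
 qed
 \<comment> \<open>The lower bound on \<open>Z\<close> limits the decay of \<open>y * y\<close> to
   an exponential rate, so \<open>y\<close> cannot reach zero.\<close>
 have nz: "y t \<noteq> 0" if "y 0 \<noteq> 0" "t \<in> {0..T}" for t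
 proof -
  have "- (y t * y t) \<le> - (y 0 * y 0) * exp (- 2 / d * t)"
  proof (rule gronwall[OF that(2), where g = "\<lambda>t. - (y t * y t)"])
   show "((\<lambda>t. - (y t * y t)) has_real_derivative - (2 * Z s * (y s * y s))) (at s within {0..T})" if "s \<in> {0..T}" for s
    by (rule DERIV_minus[OF dy2[OF that]])
   show "- (2 * Z s * (y s * y s)) \<le> - 2 / d * - (y s * y s)" if "s \<in> {0..T}" for s
   proof -
    have "(- 2 / d) * (y s * y s) \<le> (2 * Z s) * (y s * y s)" using Z(5)[OF that] by (intro mult_right_mono) auto
    then show ?thesis by simp
   qed
  qed
  moreover have "y 0 * y 0 * exp (- 2 / d * t) > 0"
   by (intro mult_pos_pos[of "y 0 * y 0"] exp_gt_zero) (metis that(1) not_real_square_gt_zero)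
  ultimately show ?thesis by auto
 qed
 have cy: "continuous_on {0..T} y"
  using dy by (meson DERIV_continuous continuous_on_eq_continuous_within)
 show pos: "y 0 * y t > 0" if y00: "y 0 \<noteq> 0" and tT: "t \<in> {0..T}" for t
 proof (rule ccontr)
  assume neg: "\<not> y 0 * y t > 0"
  have c: "continuous_on {0..t} (\<lambda>t. y 0 * y t)"
   using tT by (intro continuous_on_mult continuous_on_const continuous_on_subset[OF cy]) auto
  obtain s where "0 \<le> s" "s \<le> t" "y 0 * y s = 0"
   using IVT2'[of "\<lambda>t. y 0 * y t" t 0 0] neg tT c by (auto simp: not_less)
  then show False using nz[of s] y00 tT by auto
 qed
 show "y 0 * (y t + d * w t) > 0" if "y 0 \<noteq> 0" "0 \<le> t" "t < T"
 proof -
  have t: "t \<in> {0..T}" using that by auto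
  have "1 + d * Z t > 0" using Z(6)[OF that(2,3)] par by (simp add: field_simps)
  then have "y 0 * y t * (1 + d * Z t) > 0" using pos[OF that(1) t] by simp
  then show ?thesis using wZ[OF t] by (simp add: algebra_simps)
 qed
 have TT: "T \<in> {0..T}" using Z(3) by simp
 show end0: "y T + d * w T = 0" using wZ[OF TT] par by (simp add: Z)
 show "w T = - sgn (y 0) * (\<bar>w 0\<bar> * sqrt (1 + S / P) * exp (- (S * d * T / 2)))" if y0: "y 0 \<noteq> 0"
 proof -
  \<comment> \<open>This quadratic form satisfies \<open>E' = - (S * d) * E\<close> exactly. When
    the force vanishes, \<open>y = - d * w\<close> makes the last two terms cancel, so that
    \<open>E T\<close> is the square of the final speed.\<close>
  define E where "E t = w t * w t + S * d * (w t * y t) + S * (y t * y t)" for t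
  have dE: "((\<lambda>t. E t * exp (S * d * t)) has_real_derivative 0) (at s within {0..T})" if s: "s \<in> {0..T}" for s
  proof -
   have "(E has_real_derivative - (S * d) * E s) (at s within {0..T})"
    unfolding E_def
    by (rule derivative_eq_intros dw[OF s] dy[OF s] refl)+ (simp add: algebra_simps)
   then show ?thesis by (auto intro!: derivative_eq_intros simp: algebra_simps)
  qed
  have "E T * exp (S * d * T) = E 0"
  proof (rule antisym)
   show "E T * exp (S * d * T) \<le> E 0"
    using decreasing_from_derivative[OF _ dE] Z(3) by fastforce
   show "E 0 \<le> E T * exp (S * d * T)"
    using increasing_from_derivative[OF _ dE] Z(3) by fastforce
  qed
  moreover have "E T = (w T)\<^sup>2"
  proof -
   have yT: "y T = - d * w T" using end0 by simp
   show ?thesis unfolding E_def yT by (simp add: power2_eq_square)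
  qed
  \<comment> \<open>The initial direction enters through the quadratic equation for
    \<open>lam\<close>, which is the origin of the factor \<open>1 + S / P\<close>.\<close>
  moreover have "E 0 = (w 0)\<^sup>2 * (1 + S / P)"
  proof -
   define l where "l = lam P d"
   have "P * (l\<^sup>2 + S * d * l + S) = l\<^sup>2 * (P + S)"
    using lam_root[OF par(2), of d, folded l_def] by algebra
   then have "l\<^sup>2 + S * d * l + S = l\<^sup>2 * (1 + S / P)" using par by (simp add: field_simps)
   then have "(l\<^sup>2 + S * d * l + S) * (y 0)\<^sup>2 = l\<^sup>2 * (1 + S / P) * (y 0)\<^sup>2" by simp
   then show ?thesis unfolding E_def w0 l_def[symmetric] by (simp add: power2_eq_square algebra_simps)
  qed
  ultimately have "(w T)\<^sup>2 * exp (S * d * T) = (w 0)\<^sup>2 * (1 + S / P)" by simp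
  then have "(w T)\<^sup>2 * (exp (S * d * T) * exp (- (S * d * T))) = (w 0)\<^sup>2 * (1 + S / P) * exp (- (S * d * T))"
   by simp
  then have "(w T)\<^sup>2 = (w 0)\<^sup>2 * (1 + S / P) * exp (- (S * d * T))"
   by (simp flip: exp_add)
  also have "\<dots> = (\<bar>w 0\<bar> * sqrt (1 + S / P) * exp (- (S * d * T / 2)))\<^sup>2"
  proof -
   have "(sqrt (1 + S / P))\<^sup>2 = 1 + S / P" using par by (simp add: add_nonneg_nonneg)
   moreover have "(exp (- (S * d * T / 2)))\<^sup>2 = exp (- (S * d * T))" by (simp add: power2_eq_square flip: exp_add)
   ultimately show ?thesis by (simp only: power_mult_distrib power2_abs)
  qed
  finally have "\<bar>w T\<bar>\<^sup>2 = (\<bar>w 0\<bar> * sqrt (1 + S / P) * exp (- (S * d * T / 2)))\<^sup>2"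
   by (simp only: power2_abs)
  then have "\<bar>w T\<bar> = \<bar>w 0\<bar> * sqrt (1 + S / P) * exp (- (S * d * T / 2))"
   by (rule power2_eq_imp_eq) (use par in auto)
  moreover have "sgn (w T) = - sgn (y 0)"
  proof -
   have wT: "w T = - (y T / d)" using wZ[OF TT] by (simp add: Z)
   have "sgn (y T) = sgn (y 0)" using pos[OF y0 TT] by (auto simp: zero_less_mult_iff)
   moreover have "sgn (y T / d) = sgn (y T)" using par by (simp add: sgn_divide)
   ultimately show ?thesis unfolding wT sgn_minus by simp
  qed
  ultimately show ?thesis using sgn_mult_abs[of "w T"] by simp
 qed
qed

subsection \<open>A closed form for the coefficient of restitution\<close>

lemma lambda_plus_eq: "lambda_plus \<alpha> \<mu> d \<theta> = lam (- p_plus \<alpha> \<mu> \<theta>) d"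
 by (simp add: lambda_plus_def lam_def field_simps)

lemma S_w_pos: "\<alpha> > 0 \<Longrightarrow> \<mu> > 0 \<Longrightarrow> S_w \<alpha> \<mu> \<theta> > 0"
 by (simp add: S_w_eq add_pos_nonneg)

text \<open>Sum, product and distinctness are all that is used of the two roots, so overdamped and
  underdamped sliding need no case distinction.\<close>

lemma xi_properties:
 fixes \<alpha> \<mu> d \<theta> :: real
 assumes "\<alpha> > 0" "\<mu> > 0" "d > 0"
 defines "S \<equiv> S_w \<alpha> \<mu> \<theta>" and "\<xi> \<equiv> xi_plus \<alpha> \<mu> d \<theta>" and "\<eta> \<equiv> xi_minus \<alpha> \<mu> d \<theta>"
 shows "\<xi> + \<eta> = - of_real (S * d)" "\<xi> * \<eta> = of_real S"
  and "d \<noteq> 2 / sqrt S \<Longrightarrow> \<xi> \<noteq> \<eta>"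
proof -
 define c where "c = csqrt (of_real (d\<^sup>2 * S\<^sup>2 - 4 * S))"
 have S: "S > 0" using S_w_pos assms by simp
 have x: "\<xi> = - of_real (d * S / 2) + 1 / 2 * c" "\<eta> = - of_real (d * S / 2) - 1 / 2 * c"
  unfolding \<xi>_def \<eta>_def xi_plus_def xi_minus_def c_def S_def by auto
 show "\<xi> + \<eta> = - of_real (S * d)" by (simp add: x)
 have "\<xi> * \<eta> = (of_real (d * S / 2))\<^sup>2 - 1 / 4 * c\<^sup>2"
  unfolding x power2_eq_square by (simp add: algebra_simps)
 also have "\<dots> = of_real S" unfolding c_def power2_csqrt by (simp add: power_divide power_mult_distrib field_simps)
 finally show "\<xi> * \<eta> = of_real S" .
 assume d: "d \<noteq> 2 / sqrt S"
 have "c \<noteq> 0"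
 proof
  assume "c = 0"
  then have "d\<^sup>2 * S\<^sup>2 - 4 * S = 0" unfolding c_def csqrt_eq_0 of_real_eq_0_iff .
  then have "S * (d\<^sup>2 * S) = S * 4" by (simp add: power2_eq_square algebra_simps)
  then have "d\<^sup>2 * S = 4" using S by simp
  then have sqe: "(d * sqrt S)\<^sup>2 = 2\<^sup>2" using S by (simp add: power_mult_distrib)
  have "0 \<le> d * sqrt S" using S \<open>d > 0\<close> by (intro mult_nonneg_nonneg) simp_all
  then have "d * sqrt S = 2" by (rule power2_eq_imp_eq[OF sqe]) simp
  moreover have "sqrt S \<noteq> 0" using S by simp
  ultimately have "d = 2 / sqrt S" by (metis nonzero_mult_div_cancel_right)
  then show False using d by blast
 qed
 then show "\<xi> \<noteq> \<eta>" unfolding x by simp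
qed

text \<open>The sliding solution with \<open>y = 1\<close> and \<open>w = lam P d\<close> at time 0
  is written in the exponentials of the roots. Its imaginary part has zero initial data and vanishes
  up to time \<open>T\<close>, so the real statements of \<open>linear_sliding\<close> apply even to
  complex roots. The equation for \<open>tau_s\<close> says that \<open>y + d * w\<close> vanishes;
  its least positive root is therefore \<open>slide_time\<close>, and the value of \<open>w\<close>
  there is already known.\<close>

lemma e_formula_closed_form:
 assumes par: "\<alpha> > 0" "\<mu> > 0" "d > 0" and p: "p_plus \<alpha> \<mu> \<theta> < 0"
  and d: "d \<noteq> 2 / sqrt (S_w \<alpha> \<mu> \<theta>)"
 defines "S \<equiv> S_w \<alpha> \<mu> \<theta>" and "P \<equiv> - p_plus \<alpha> \<mu> \<theta>"
 shows "e_formula \<alpha> \<mu> d \<theta> = of_real (p_plus \<alpha> \<mu> \<theta> / q_plus \<alpha> \<mu> \<theta> * sqrt (1 + S / P) * exp (- (S * d * slide_time S P d / 2)))"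
proof -
 define \<xi> \<eta> where "\<xi> = xi_plus \<alpha> \<mu> d \<theta>" and "\<eta> = xi_minus \<alpha> \<mu> d \<theta>"
 define l where "l = lam P d"
 define T where "T = slide_time S P d"
 have S: "S > 0" and P: "P > 0" using S_w_pos par p by (auto simp: S_def P_def)
 have l: "l > 0" using lam_pos[OF P par(3)] by (simp add: l_def)
 have T: "T > 0" using slide_time_pos[OF S P par(3)] by (simp add: T_def)
 note xi = xi_properties[OF par, of \<theta>, folded S_def \<xi>_def \<eta>_def]
 have ne: "\<xi> \<noteq> \<eta>" using xi(3) d by (simp add: S_def)
 have nz: "\<xi> \<noteq> 0" "\<eta> \<noteq> 0" using xi(2) S by auto
 have sq: "\<xi>\<^sup>2 = - of_real S - of_real (S * d) * \<xi>" "\<eta>\<^sup>2 = - of_real S - of_real (S * d) * \<eta>"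
  using xi(1,2) by algebra+
 have "(of_real l - \<xi>) * (of_real l - \<eta>) = of_real (quad S d l)"
 proof -
  have "(of_real l - \<xi>) * (of_real l - \<eta>) = (of_real l)\<^sup>2 - (\<xi> + \<eta>) * of_real l + \<xi> * \<eta>" by algebra
  then show ?thesis unfolding xi(1,2) by (simp add: quad_def algebra_simps)
 qed
 moreover have "quad S d l > 0"
 proof (rule quad_pos[OF S par(3)])
  have "- 1 / d \<le> 0" using par(3) by simp
  then show "- 1 / d \<le> l" using l by linarith
 qed
 ultimately have "(of_real l - \<xi>) * (of_real l - \<eta>) \<noteq> 0" by (metis of_real_eq_0_iff less_irrefl)
 then have lnz: "of_real l - \<eta> \<noteq> 0" "of_real l - \<xi> \<noteq> 0" by (metis mult_zero_left mult_zero_right)+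
 define y where "y z = ((of_real l - \<eta>) * exp (\<xi> * z) - (of_real l - \<xi>) * exp (\<eta> * z)) / (\<xi> - \<eta>)" for z
 define w where "w z = ((of_real l - \<eta>) * \<xi> * exp (\<xi> * z) - (of_real l - \<xi>) * \<eta> * exp (\<eta> * z)) / (\<xi> - \<eta>)" for z
 have w'eq: "((of_real l - \<eta>) * \<xi>\<^sup>2 * exp (\<xi> * z) - (of_real l - \<xi>) * \<eta>\<^sup>2 * exp (\<eta> * z)) / (\<xi> - \<eta>) = - of_real S * (y z + of_real d * w z)" for z
 proof -
  have "(of_real l - \<eta>) * \<xi>\<^sup>2 * exp (\<xi> * z) - (of_real l - \<xi>) * \<eta>\<^sup>2 * exp (\<eta> * z) =
   - of_real S * (((of_real l - \<eta>) * exp (\<xi> * z) - (of_real l - \<xi>) * exp (\<eta> * z))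
    + of_real d * ((of_real l - \<eta>) * \<xi> * exp (\<xi> * z) - (of_real l - \<xi>) * \<eta> * exp (\<eta> * z)))"
   using sq unfolding of_real_mult by algebra
  then show ?thesis unfolding y_def w_def by (simp only: add_divide_distrib distrib_left times_divide_eq_right)
 qed
 have dexp: "((\<lambda>z. (A * exp (\<xi> * z) - B * exp (\<eta> * z)) / C) has_field_derivative (A * \<xi> * exp (\<xi> * z) - B * \<eta> * exp (\<eta> * z)) / C) (at z)" for A B C z
  by (rule DERIV_cdivide) (auto intro!: derivative_eq_intros)
 have dy: "((\<lambda>t. y (of_real t)) has_vector_derivative w (of_real t)) (at t within A)" for t A
  unfolding y_def w_def by (rule has_vector_derivative_real_field, rule dexp)
 have dw: "((\<lambda>t. w (of_real t)) has_vector_derivative - of_real S * (y (of_real t) + of_real d * w (of_real t))) (at t within A)" for t A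
  unfolding w'eq[symmetric] unfolding w_def power2_eq_square mult.assoc[of _ \<xi> \<xi>, symmetric] mult.assoc[of _ \<eta> \<eta>, symmetric]
  by (rule has_vector_derivative_real_field, rule dexp)
 have y0: "y 0 = 1" using ne by (simp add: y_def)
 have w0: "w 0 = of_real l"
 proof -
  have "(of_real l - \<eta>) * \<xi> - (of_real l - \<xi>) * \<eta> = of_real l * (\<xi> - \<eta>)" by algebra
  then show ?thesis using ne by (simp add: w_def)
 qed
 have reim: "((\<lambda>t. Re (y (of_real t))) has_real_derivative Re (w (of_real t))) (at t within A)"
  "((\<lambda>t. Im (y (of_real t))) has_real_derivative Im (w (of_real t))) (at t within A)"
  "((\<lambda>t. Re (w (of_real t))) has_real_derivative - S * (Re (y (of_real t)) + d * Re (w (of_real t)))) (at t within A)"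
  "((\<lambda>t. Im (w (of_real t))) has_real_derivative - S * (Im (y (of_real t)) + d * Im (w (of_real t)))) (at t within A)" for t A
  unfolding has_real_derivative_iff_has_vector_derivative
  using bounded_linear.has_vector_derivative[OF bounded_linear_Re dy, of t A] bounded_linear.has_vector_derivative[OF bounded_linear_Im dy, of t A]
   bounded_linear.has_vector_derivative[OF bounded_linear_Re dw, of t A] bounded_linear.has_vector_derivative[OF bounded_linear_Im dw, of t A]
  by simp_all
 note Lr = linear_sliding[OF S P par(3) T_def, of "\<lambda>t. Re (y (of_real t))" "\<lambda>t. Re (w (of_real t))", OF reim(1,3)]
 note Li = linear_sliding(1)[OF S P par(3) T_def, of "\<lambda>t. Im (y (of_real t))" "\<lambda>t. Im (w (of_real t))", OF reim(2,4)]
 have re0: "Re (w (of_real 0)) = lam P d * Re (y (of_real 0))" "Im (w (of_real 0)) = lam P d * Im (y (of_real 0))" "Im (y (of_real 0)) = 0" "Re (y (of_real 0)) = 1"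
  by (simp_all add: y0 w0 l_def)
 have im: "Im (y (of_real t)) = 0 \<and> Im (w (of_real t)) = 0" if "t \<in> {0..T}" for t
  using Li[OF re0(2,3) that] .
 define u where "u t = y (of_real t) + of_real d * w (of_real t)" for t
 have u_nz: "u t \<noteq> 0" if "0 \<le> t" "t < T" for t
 proof -
  have "Re (u t) > 0" using Lr(3)[OF re0(1) _ that] re0(4) by (simp add: u_def)
  then show ?thesis by auto
 qed
 have uT: "u T = 0" using Lr(4)[OF re0(1)] im[of T] T by (simp add: u_def complex_eq_iff)
 \<comment> \<open>After clearing denominators the equation says that \<open>w'\<close>, written in
   exponentials, vanishes, and by \<open>w'eq\<close> this derivative is \<open>- S\<close> times
   \<open>u\<close>.\<close>
 have eqiff: "exp ((\<xi> - \<eta>) * of_real t) = \<eta>\<^sup>2 * (of_real l - \<xi>) / (\<xi>\<^sup>2 * (of_real l - \<eta>)) \<longleftrightarrow> u t = 0" for t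
 proof -
  have "exp ((\<xi> - \<eta>) * of_real t) = exp (\<xi> * of_real t) / exp (\<eta> * of_real t)"
   by (simp add: exp_diff left_diff_distrib)
  then have "exp ((\<xi> - \<eta>) * of_real t) = \<eta>\<^sup>2 * (of_real l - \<xi>) / (\<xi>\<^sup>2 * (of_real l - \<eta>)) \<longleftrightarrow>
    exp (\<xi> * of_real t) * (\<xi>\<^sup>2 * (of_real l - \<eta>)) = \<eta>\<^sup>2 * (of_real l - \<xi>) * exp (\<eta> * of_real t)"
   using nz lnz by (simp add: frac_eq_eq)
  also have "\<dots> \<longleftrightarrow> ((of_real l - \<eta>) * \<xi>\<^sup>2 * exp (\<xi> * of_real t) - (of_real l - \<xi>) * \<eta>\<^sup>2 * exp (\<eta> * of_real t)) / (\<xi> - \<eta>) = 0"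
   using ne by (simp add: mult_ac)
  also have "\<dots> \<longleftrightarrow> u t = 0" unfolding w'eq u_def using S by simp
  finally show ?thesis .
 qed
 have tau: "tau_s \<alpha> \<mu> d \<theta> = T"
  unfolding tau_s_def lambda_plus_eq P_def[symmetric] l_def[symmetric] \<xi>_def[symmetric] \<eta>_def[symmetric] eqiff
 proof (rule Least_equality)
  show "T > 0 \<and> u T = 0" using T uT by simp
  show "T \<le> t" if "t > 0 \<and> u t = 0" for t using u_nz[of t] that by force
 qed
 have wT: "w (of_real T) = - of_real (l * sqrt (1 + S / P) * exp (- (S * d * T / 2)))"
 proof -
  have "Re (w (of_real T)) = - (l * sqrt (1 + S / P) * exp (- (S * d * T / 2)))"
   using Lr(5)[OF re0(1)] l by (simp add: re0(4) w0 y0)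
  then show ?thesis using im[of T] T by (simp add: complex_eq_iff)
 qed
 \<comment> \<open>At time \<open>T\<close> the vanishing of \<open>u\<close> expresses one
   exponential by the other. Inserted in \<open>w\<close>, this leaves the combination that occurs
   in \<open>e_formula\<close>, up to sign.\<close>
 have key: "\<eta> * w (of_real T) = - ((of_real l - \<eta>) * \<xi> * exp (\<xi> * of_real T))"
 proof -
  have "((of_real l - \<eta>) * \<xi>\<^sup>2 * exp (\<xi> * of_real T) - (of_real l - \<xi>) * \<eta>\<^sup>2 * exp (\<eta> * of_real T)) / (\<xi> - \<eta>) = 0"
   using uT unfolding w'eq u_def by simp
  then have e: "(of_real l - \<xi>) * \<eta>\<^sup>2 * exp (\<eta> * of_real T) = (of_real l - \<eta>) * \<xi>\<^sup>2 * exp (\<xi> * of_real T)" using ne by simp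
  have "\<eta> * (w (of_real T) * (\<xi> - \<eta>)) = (of_real l - \<eta>) * \<xi> * \<eta> * exp (\<xi> * of_real T) - (of_real l - \<xi>) * \<eta>\<^sup>2 * exp (\<eta> * of_real T)"
  proof -
   have "w (of_real T) * (\<xi> - \<eta>) = (of_real l - \<eta>) * \<xi> * exp (\<xi> * of_real T) - (of_real l - \<xi>) * \<eta> * exp (\<eta> * of_real T)"
    using ne by (simp add: w_def)
   then show ?thesis by (simp only: power2_eq_square right_diff_distrib mult_ac)
  qed
  also have "\<dots> = - ((of_real l - \<eta>) * \<xi> * exp (\<xi> * of_real T)) * (\<xi> - \<eta>)" unfolding e by algebra
  finally have "\<eta> * w (of_real T) * (\<xi> - \<eta>) = - ((of_real l - \<eta>) * \<xi> * exp (\<xi> * of_real T)) * (\<xi> - \<eta>)"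
   by (simp only: mult.assoc)
  then show ?thesis using ne by (metis mult_right_cancel right_minus_eq)
 qed
 have "e_formula \<alpha> \<mu> d \<theta> = ((of_real l - \<eta>) * \<xi> * exp (\<xi> * of_real T)) / \<eta> * of_real (p_plus \<alpha> \<mu> \<theta> / (q_plus \<alpha> \<mu> \<theta> * l))"
  unfolding e_formula_def tau lambda_plus_eq P_def[symmetric] l_def[symmetric] \<xi>_def[symmetric] \<eta>_def[symmetric] by (simp add: mult_ac)
 also have "(of_real l - \<eta>) * \<xi> * exp (\<xi> * of_real T) = \<eta> * of_real (l * sqrt (1 + S / P) * exp (- (S * d * T / 2)))"
  using key unfolding wT by simp
 also have "\<eta> * of_real (l * sqrt (1 + S / P) * exp (- (S * d * T / 2))) / \<eta> * of_real (p_plus \<alpha> \<mu> \<theta> / (q_plus \<alpha> \<mu> \<theta> * l))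
   = complex_of_real (l * sqrt (1 + S / P) * exp (- (S * d * T / 2)) * (p_plus \<alpha> \<mu> \<theta> / (q_plus \<alpha> \<mu> \<theta> * l)))"
  using nz by simp
 also have "l * sqrt (1 + S / P) * exp (- (S * d * T / 2)) * (p_plus \<alpha> \<mu> \<theta> / (q_plus \<alpha> \<mu> \<theta> * l))
  = p_plus \<alpha> \<mu> \<theta> / q_plus \<alpha> \<mu> \<theta> * sqrt (1 + S / P) * exp (- (S * d * T / 2))"
  using l by simp
 finally show ?thesis by (simp add: T_def)
qed

section \<open>Smoothness and monotonicity of the restitution coefficient in the damping\<close>

definition slide_kernel :: "real \<Rightarrow> real \<Rightarrow> real \<Rightarrow> real" where
 "slide_kernel S P s = integral {0..1} (\<lambda>t. 1 / (P * (t - (1 - t) * s)\<^sup>2 + S * t))"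

lemma slide_kernel_denominator_pos:
 fixes t :: real
 assumes "S > 0" "P > 0" "s > 0" "t \<in> {0..1}"
 shows "P * (t - (1 - t) * s)\<^sup>2 + S * t > 0"
proof (cases "t = 0")
 case False
 then have "S * t > 0" using assms by simp
 then show ?thesis using assms by (intro add_nonneg_pos) auto
qed (use assms in simp)

text \<open>For \<open>s = 1 / (d * lam P d)\<close> the equation of \<open>lam\<close> reads
  \<open>s\<^sup>2 + s = 1 / (P * d\<^sup>2)\<close>. Solving it displays the kernel parameter as an
  explicit function of \<open>d\<close> that extends holomorphically.\<close>

lemma inverse_d_lam:
 assumes "P > 0" "d > 0"
 shows "1 / (d * lam P d) = (sqrt (1 + 4 / (P * d\<^sup>2)) - 1) / 2"
proof -
 define l where "l = lam P d"
 have l: "l > 0" "l\<^sup>2 = d * P * l + P" using lam_pos[OF assms] lam_root[OF assms(1)] by (auto simp: l_def)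
 define s where "s = 1 / (d * l)"
 have s: "s > 0" using l assms by (simp add: s_def)
 have "1 + 4 / (P * d\<^sup>2) = (2 * s + 1)\<^sup>2"
 proof -
  have "4 / (P * d\<^sup>2) = 4 * (s\<^sup>2 + s)"
  proof -
   have "(s\<^sup>2 + s) * (d\<^sup>2 * l\<^sup>2) = 1 + d * l"
    using l(1) assms by (simp add: s_def field_simps power2_eq_square)
   also have "P * (1 + d * l) = l\<^sup>2" using l(2) by (simp add: algebra_simps)
   finally have "P * ((s\<^sup>2 + s) * (d\<^sup>2 * l\<^sup>2)) = l\<^sup>2"
    by (metis \<open>P * (1 + d * l) = l\<^sup>2\<close> \<open>(s\<^sup>2 + s) * (d\<^sup>2 * l\<^sup>2) = 1 + d * l\<close>)
   then have "(P * d\<^sup>2 * (s\<^sup>2 + s)) * l\<^sup>2 = 1 * l\<^sup>2" by (simp add: mult_ac)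
   then have "P * d\<^sup>2 * (s\<^sup>2 + s) = 1" using l(1) by simp
   then show ?thesis using assms by (simp add: field_simps)
  qed
  then show ?thesis by (simp add: power2_eq_square algebra_simps)
 qed
 then have "sqrt (1 + 4 / (P * d\<^sup>2)) = 2 * s + 1" using s by simp
 then show ?thesis by (simp add: s_def l_def)
qed

text \<open>An affine substitution carries the moving interval to \<open>{0..1}\<close>, and by the
  equation of \<open>lam\<close> the damping survives only in the parameter
  \<open>1 / (d * lam P d)\<close>. A fixed interval and one parameter are what differentiation
  under the integral requires.\<close>

lemma slide_time_kernel:
 assumes S: "S > 0" and P: "P > 0" and d: "d > 0"
 shows "d * slide_time S P d = slide_kernel S P (1 / (d * lam P d))"
proof -
 define l where "l = lam P d"
 have l: "l > 0" "l\<^sup>2 = d * P * l + P" using lam_pos[OF P d] lam_root[OF P] by (auto simp: l_def)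
 define m where "m = d * l"
 have m: "m > 0" using l d by (simp add: m_def)
 define g where "g t = (- 1 + (m + 1) * t) / d" for t
 have g01: "g 0 = - 1 / d" "g 1 = l" using d by (simp_all add: g_def m_def)
 have "((\<lambda>t. ((m + 1) / d) *\<^sub>R (1 / quad S d (g t))) has_integral (integral {g 0..g 1} (\<lambda>z. 1 / quad S d z))) {0..1}"
 proof (rule has_integral_substitution[where c = "- 1 / d" and d = l])
  show "g 0 \<le> g 1" using l d by (simp add: g01 order_trans[of _ 0])
  show "g ` {0..1} \<subseteq> {- 1 / d..l}"
  proof (rule image_subsetI)
   fix t :: real assume t: "t \<in> {0..1}"
   have "0 \<le> (m + 1) * t" "(m + 1) * t \<le> (m + 1) * 1" using t m by (auto intro!: mult_left_mono)
   then have "- 1 \<le> - 1 + (m + 1) * t" "- 1 + (m + 1) * t \<le> d * l" by (auto simp: m_def)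
   then show "g t \<in> {- 1 / d..l}" using d by (auto simp: g_def field_simps)
  qed
  show "continuous_on {- 1 / d..l} (\<lambda>z. 1 / quad S d z)" by (rule continuous_on_quad_inverse[OF S d])
  show "(g has_real_derivative (m + 1) / d) (at x within {0..1})" for x
   unfolding g_def using d by (auto intro!: derivative_eq_intros)
 qed simp
 then have "((\<lambda>t. d * (((m + 1) / d) *\<^sub>R (1 / quad S d (g t)))) has_integral d * slide_time S P d) {0..1}"
  by (intro has_integral_mult_right) (simp add: slide_time_def g01 l_def)
 moreover have "d * (((m + 1) / d) *\<^sub>R (1 / quad S d (g t))) = 1 / (P * (t - (1 - t) * (1 / m))\<^sup>2 + S * t)" for t
 proof -
  \<comment> \<open>The equation of \<open>lam\<close> in terms of \<open>m\<close>. It makes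
    \<open>quad\<close> at the substituted point a multiple of \<open>m + 1\<close>, which cancels
    against the Jacobian.\<close>
  have m2: "m\<^sup>2 = d\<^sup>2 * P * (m + 1)"
  proof -
   have "m\<^sup>2 = d\<^sup>2 * l\<^sup>2" by (simp add: m_def power_mult_distrib)
   also have "\<dots> = d\<^sup>2 * P * (m + 1)" unfolding l(2) by (simp add: m_def algebra_simps)
   finally show ?thesis .
  qed
  define X where "X = (m + 1) * t - 1"
  have "quad S d (g t) = X\<^sup>2 / d\<^sup>2 + S * (m + 1) * t"
  proof -
   have "g t = X / d" by (simp add: g_def X_def)
   then have "quad S d (g t) = X\<^sup>2 / d\<^sup>2 + S * X + S" using d by (simp add: quad_def power_divide)
   then show ?thesis by (simp add: X_def algebra_simps)
  qed
  also have "X\<^sup>2 / d\<^sup>2 = (m + 1) * (P * (X / m)\<^sup>2)"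
  proof -
   have "X\<^sup>2 / d\<^sup>2 = X\<^sup>2 * (P * (m + 1)) / m\<^sup>2" unfolding m2 using d P m by simp
   then show ?thesis by (simp add: power_divide mult_ac)
  qed
  also have "X / m = t - (1 - t) * (1 / m)" using m by (simp add: X_def field_simps)
  finally have "quad S d (g t) = (m + 1) * (P * (t - (1 - t) * (1 / m))\<^sup>2 + S * t)" by (simp add: algebra_simps)
  then show ?thesis using d m by simp
 qed
 ultimately show ?thesis unfolding slide_kernel_def by (simp add: integral_unique m_def l_def)
qed

text \<open>Holomorphic functions have derivatives of all orders. Along the real axis the imaginary
  part is constantly zero, so the complex derivative is real there and agrees with the real one; the
  relation between \<open>F\<close> and \<open>f\<close> thus passes to all iterated
  derivatives.\<close>

lemma smooth_on_open_from_holomorphic: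
 assumes loc: "\<And>x. x \<in> U \<Longrightarrow> \<exists>r>0. \<exists>F. F holomorphic_on ball (of_real x) r \<and>
   (\<forall>y. \<bar>y - x\<bar> < r \<longrightarrow> F (of_real y) = of_real (f y))"
 shows "smooth_on_open U f"
 unfolding smooth_on_open_def
proof (intro allI ballI)
 fix n x assume "x \<in> U"
 then obtain r F where r: "r > 0" and F: "F holomorphic_on ball (of_real x) r"
  and Ff: "\<And>y. \<bar>y - x\<bar> < r \<Longrightarrow> F (of_real y) = of_real (f y)" using loc by blast
 have step: "(g has_real_derivative deriv g y) (at y) \<and> deriv G (of_real y) = of_real (deriv g y)"
  if G: "G holomorphic_on ball (of_real x) r" and Gg: "\<And>y. \<bar>y - x\<bar> < r \<Longrightarrow> G (of_real y) = of_real (g y)"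
   and y: "\<bar>y - x\<bar> < r" for G g y
 proof -
  have yb: "complex_of_real y \<in> ball (of_real x) r" using y by (simp add: dist_norm abs_minus_commute flip: of_real_diff)
  have "(G has_field_derivative deriv G (of_real y)) (at (of_real y))"
   using holomorphic_derivI[OF G open_ball yb] .
  then have "((\<lambda>t. G (of_real t)) has_vector_derivative deriv G (of_real y)) (at y)"
   by (rule has_vector_derivative_real_field)
  then have v: "((\<lambda>t. complex_of_real (g t)) has_vector_derivative deriv G (of_real y)) (at y)"
  proof (rule has_vector_derivative_transform_within[of _ _ _ UNIV "r - \<bar>y - x\<bar>"])
   show "G (of_real t) = of_real (g t)" if "dist t y < r - \<bar>y - x\<bar>" for t
    using that by (intro Gg) (auto simp: dist_real_def)
  qed (use y in auto)
  have re: "(g has_real_derivative Re (deriv G (of_real y))) (at y)"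
   unfolding has_real_derivative_iff_has_vector_derivative
   using bounded_linear.has_vector_derivative[OF bounded_linear_Re v] by simp
  have "((\<lambda>t. 0::real) has_vector_derivative Im (deriv G (of_real y))) (at y)"
   using bounded_linear.has_vector_derivative[OF bounded_linear_Im v] by simp
  then have "Im (deriv G (of_real y)) = 0"
   using vector_derivative_unique_at has_vector_derivative_const by blast
  then show ?thesis using re DERIV_imp_deriv[OF re] by (simp add: complex_eq_iff)
 qed
 have all: "(deriv ^^ k) F holomorphic_on ball (of_real x) r \<and> (\<forall>y. \<bar>y - x\<bar> < r \<longrightarrow> (deriv ^^ k) F (of_real y) = of_real ((deriv ^^ k) f y))" for k
 proof (induction k)
  case 0
  show ?case using F Ff by simp
 next
  case (Suc k)
  then show ?case using step[of "(deriv ^^ k) F" "(deriv ^^ k) f"] by (auto intro: holomorphic_deriv)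
 qed
 show "(deriv ^^ n) f differentiable at x"
  using step[of "(deriv ^^ n) F" "(deriv ^^ n) f" x] all[of n] r
  by (auto simp: real_differentiable_def)
qed

text \<open>The Leibniz rule applies as soon as the denominator has no zero for complex
  \<open>s\<close> near \<open>s0\<close>. At \<open>s0\<close> it is real with a positive minimum
  \<open>c\<close> over the interval, and uniform continuity on a compact set keeps nearby values at
  distance less than \<open>c\<close>.\<close>

lemma slide_kernel_holomorphic:
 assumes par: "S > 0" "P > 0" "s0 > 0"
 obtains r F where "r > 0" "F holomorphic_on ball (complex_of_real s0) r"
  "\<And>s. s > 0 \<Longrightarrow> F (of_real s) = of_real (slide_kernel S P s)"
proof -
 define D where "D s t = of_real P * (of_real t - (1 - of_real t) * s)\<^sup>2 + of_real (S * t)" for s :: complex and t :: real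
 define F where "F s = integral (cbox 0 1) (\<lambda>t. 1 / D s t)" for s
 define K where "K = cball (complex_of_real s0) 1 \<times> {0..1::real}"
 have "continuous_on K (\<lambda>(s, t). D s t)"
  unfolding D_def case_prod_unfold by (intro continuous_intros)
 moreover have "compact K" unfolding K_def by (intro compact_Times) auto
 ultimately have uc: "uniformly_continuous_on K (\<lambda>(s, t). D s t)" by (rule compact_uniformly_continuous)
 have Dreal: "D (of_real s) t = of_real (P * (t - (1 - t) * s)\<^sup>2 + S * t)" for s t by (simp add: D_def)
 have "continuous_on {0..1::real} (\<lambda>t. P * (t - (1 - t) * s0)\<^sup>2 + S * t)" by (intro continuous_intros)
 then obtain t0 where t0: "t0 \<in> {0..1}" "\<And>t. t \<in> {0..1} \<Longrightarrow> P * (t0 - (1 - t0) * s0)\<^sup>2 + S * t0 \<le> P * (t - (1 - t) * s0)\<^sup>2 + S * t"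
  using continuous_attains_inf[of "{0..1::real}" "\<lambda>t. P * (t - (1 - t) * s0)\<^sup>2 + S * t"] by fastforce
 define c where "c = P * (t0 - (1 - t0) * s0)\<^sup>2 + S * t0"
 have c: "c > 0" unfolding c_def by (rule slide_kernel_denominator_pos[OF par t0(1)])
 obtain e where e: "e > 0" "\<And>x x'. x \<in> K \<Longrightarrow> x' \<in> K \<Longrightarrow> dist x' x < e \<Longrightarrow> dist ((\<lambda>(s, t). D s t) x') ((\<lambda>(s, t). D s t) x) < c"
  using uc c unfolding uniformly_continuous_on_def by metis
 define r where "r = min e 1"
 have Dnz: "D s t \<noteq> 0" if s: "s \<in> ball (of_real s0) r" and t: "t \<in> {0..1}" for s t
 proof
  assume D0: "D s t = 0"
  have "dist (D s t) (D (of_real s0) t) < c"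
   using e(2)[of "(of_real s0, t)" "(s, t)"] s t by (auto simp: K_def r_def dist_Pair_Pair dist_commute)
  moreover have "dist (D s t) (D (of_real s0) t) = P * (t - (1 - t) * s0)\<^sup>2 + S * t"
   unfolding D0 Dreal dist_norm using slide_kernel_denominator_pos[OF par t]
   by (simp del: of_real_add of_real_mult of_real_power of_real_diff)
  ultimately show False using t0(2)[OF t] by (simp add: c_def)
 qed
 have "F holomorphic_on ball (of_real s0) r"
  unfolding F_def
 proof (rule leibniz_rule_holomorphic[where fx = "\<lambda>s t. 2 * of_real P * (1 - of_real t) * (of_real t - (1 - of_real t) * s) / (D s t)\<^sup>2"])
  fix s and t :: real assume "s \<in> ball (complex_of_real s0) r" "t \<in> cbox 0 1"
  then have "D s t \<noteq> 0" using Dnz by simp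
  moreover have "((\<lambda>s. D s t) has_field_derivative - 2 * of_real P * (1 - of_real t) * (of_real t - (1 - of_real t) * s)) (at s within ball (of_real s0) r)"
   unfolding D_def by (rule derivative_eq_intros refl)+ (simp add: algebra_simps)
  ultimately have "((\<lambda>s. inverse (D s t)) has_field_derivative - (inverse (D s t) * (- 2 * of_real P * (1 - of_real t) * (of_real t - (1 - of_real t) * s)) * inverse (D s t))) (at s within ball (of_real s0) r)"
   by (intro DERIV_inverse')
  then show "((\<lambda>s. 1 / D s t) has_field_derivative 2 * of_real P * (1 - of_real t) * (of_real t - (1 - of_real t) * s) / (D s t)\<^sup>2) (at s within ball (of_real s0) r)"
   by (simp add: inverse_eq_divide power2_eq_square mult_ac)
 next
  fix s assume s: "s \<in> ball (complex_of_real s0) r"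
  have "continuous_on {0..1} (\<lambda>t. 1 / D s t)"
   using Dnz[OF s] by (intro continuous_intros) (auto simp: D_def intro!: continuous_intros)
  then show "(\<lambda>t. 1 / D s t) integrable_on cbox 0 1" using integrable_continuous_interval by simp
 next
  show "continuous_on (ball (of_real s0) r \<times> cbox 0 1) (\<lambda>(s, t). 2 * of_real P * (1 - of_real t) * (of_real t - (1 - of_real t) * s) / (D s t)\<^sup>2)"
   unfolding case_prod_unfold
   by (rule continuous_on_divide) (use Dnz in \<open>auto simp: D_def intro!: continuous_intros\<close>)
 qed auto
 moreover have "F (of_real s) = of_real (slide_kernel S P s)" if s: "s > 0" for s
 proof -
  have nz: "\<forall>t\<in>{0..1}. P * (t - (1 - t) * s)\<^sup>2 + S * t \<noteq> 0"
   using slide_kernel_denominator_pos[OF par(1,2) s] by force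
  have "continuous_on {0..1} (\<lambda>t. 1 / (P * (t - (1 - t) * s)\<^sup>2 + S * t))"
   using nz by (intro continuous_intros) auto
  then have "((\<lambda>t. 1 / (P * (t - (1 - t) * s)\<^sup>2 + S * t)) has_integral slide_kernel S P s) {0..1}"
   unfolding slide_kernel_def by (intro integrable_integral integrable_continuous_interval)
  then have "((\<lambda>t. complex_of_real (1 / (P * (t - (1 - t) * s)\<^sup>2 + S * t))) has_integral of_real (slide_kernel S P s)) {0..1}"
   by (rule has_integral_of_real)
  then show ?thesis unfolding F_def Dreal by (simp add: integral_unique)
 qed
 moreover have "r > 0" using e by (simp add: r_def)
 ultimately show ?thesis using that by blast
qed

text \<open>The coefficient of restitution as a function of the damping. The exponential is the
  square root of the decay of the quadratic form during sliding; \<open>c\<close> collects the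
  factors that come from compression and from the initial direction of sliding.\<close>

definition restitution :: "real \<Rightarrow> real \<Rightarrow> real \<Rightarrow> real \<Rightarrow> real" where
 "restitution c S P d = c * exp (- (S * d * slide_time S P d / 2))"

lemma restitution_locally_holomorphic:
 assumes par: "S > 0" "P > 0" "d0 > 0"
 shows "\<exists>r>0. \<exists>F. F holomorphic_on ball (of_real d0) r \<and>
   (\<forall>d. \<bar>d - d0\<bar> < r \<longrightarrow> F (of_real d) = of_real (restitution c S P d))"
proof -
 define \<sigma> where "\<sigma> d = (sqrt (1 + 4 / (P * d\<^sup>2)) - 1) / 2" for d
 have \<sigma>: "\<sigma> d > 0" if "d > 0" for d using that par by (simp add: \<sigma>_def)
 obtain r F where r: "r > 0" "F holomorphic_on ball (complex_of_real (\<sigma> d0)) r"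
  "\<And>s. s > 0 \<Longrightarrow> F (of_real s) = of_real (slide_kernel S P s)"
  using slide_kernel_holomorphic[OF par(1,2) \<sigma>[OF par(3)]] by blast
 define h where "h d = 1 + 4 / (of_real P * d\<^sup>2)" for d :: complex
 define sc where "sc d = (csqrt (h d) - 1) / 2" for d
 have hreal: "h (of_real d) = of_real (1 + 4 / (P * d\<^sup>2))" for d by (simp add: h_def)
 have pos: "1 + 4 / (P * d\<^sup>2) > 0" for d using par by (simp add: add_pos_nonneg)
 have screal: "sc (of_real d) = of_real (\<sigma> d)" for d
  unfolding sc_def hreal using pos[of d] by (simp add: \<sigma>_def flip: of_real_sqrt)
 \<comment> \<open>In the right half-plane \<open>csqrt\<close> is away from its branch cut, hence
   holomorphic.\<close>
 have nb: "z \<notin> \<real>\<^sub>\<le>\<^sub>0" if "Re z > 0" for z using that by (auto simp: complex_nonpos_Reals_iff)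
 have ch: "isCont h (of_real d0)" unfolding h_def using par by (intro continuous_intros) auto
 have csc: "isCont sc (of_real d0)" unfolding sc_def
  by (intro continuous_intros continuous_at_compose[OF ch, unfolded o_def] continuous_at_csqrt nb) (use pos in \<open>simp_all add: hreal\<close>)
 have "eventually (\<lambda>d. Re (h d) > 0) (nhds (of_real d0))"
 proof -
  have "((\<lambda>d. Re (h d)) \<longlongrightarrow> Re (h (of_real d0))) (nhds (of_real d0))"
   using ch by (intro tendsto_intros) (simp add: continuous_at tendsto_nhds_iff)
  then show ?thesis using pos[of d0] by (intro order_tendstoD(1)) (auto simp: hreal)
 qed
 moreover have "eventually (\<lambda>d. dist (sc d) (of_real (\<sigma> d0)) < r) (nhds (of_real d0))"
 proof -
  have "(sc \<longlongrightarrow> sc (of_real d0)) (nhds (of_real d0))"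
   using csc by (simp add: continuous_at tendsto_nhds_iff)
  then show ?thesis using tendstoD[of sc _ _ r] r(1) by (simp add: screal)
 qed
 moreover have "eventually (\<lambda>d. d \<noteq> 0) (nhds (complex_of_real d0))"
  using par t1_space_nhds[of "complex_of_real d0" 0] by simp
 ultimately have "eventually (\<lambda>d. Re (h d) > 0 \<and> dist (sc d) (of_real (\<sigma> d0)) < r \<and> d \<noteq> 0) (nhds (of_real d0))"
  by eventually_elim auto
 then obtain r1 where r1: "r1 > 0" "\<And>d. dist d (of_real d0) < r1 \<Longrightarrow> Re (h d) > 0 \<and> dist (sc d) (of_real (\<sigma> d0)) < r \<and> d \<noteq> 0"
  unfolding eventually_nhds_metric by blast
 define r2 where "r2 = min r1 d0"
 define E where "E d = of_real c * exp (- (of_real S * F (sc d) / 2))" for d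
 have "h holomorphic_on ball (of_real d0) r2"
  unfolding h_def using par r1(2) by (intro holomorphic_intros) (auto simp: r2_def dist_commute)
 then have "sc holomorphic_on ball (of_real d0) r2"
  unfolding sc_def using r1(2) by (intro holomorphic_intros nb) (auto simp: r2_def dist_commute)
 then have "(F \<circ> sc) holomorphic_on ball (of_real d0) r2"
  by (rule holomorphic_on_compose_gen[OF _ r(2)]) (use r1(2) in \<open>auto simp: r2_def dist_commute\<close>)
 then have "E holomorphic_on ball (of_real d0) r2"
  unfolding E_def o_def by (intro holomorphic_intros) auto
 moreover have "E (of_real d) = of_real (restitution c S P d)" if "\<bar>d - d0\<bar> < r2" for d
 proof -
  have d: "d > 0" using that by (auto simp: r2_def)
  have "F (sc (of_real d)) = of_real (d * slide_time S P d)"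
  proof -
   have "1 / (d * lam P d) = \<sigma> d" unfolding inverse_d_lam[OF par(2) d] \<sigma>_def ..
   then show ?thesis unfolding screal r(3)[OF \<sigma>[OF d]] slide_time_kernel[OF par(1,2) d] by simp
  qed
  then have "E (of_real d) = of_real c * exp (of_real (- (S * (d * slide_time S P d) / 2)))"
   unfolding E_def by simp
  also have "\<dots> = of_real (c * exp (- (S * (d * slide_time S P d) / 2)))"
   by (simp only: exp_of_real of_real_mult)
  finally show ?thesis by (simp only: restitution_def mult.assoc)
 qed
 ultimately show ?thesis using r1(1) par(3) by (intro exI[of _ r2]) (auto simp: r2_def)
qed

lemma restitution_smooth: "S > 0 \<Longrightarrow> P > 0 \<Longrightarrow> smooth_on_open {0<..} (restitution c S P)"
 by (rule smooth_on_open_from_holomorphic) (use restitution_locally_holomorphic in auto)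

lemma restitution_isCont:
 assumes "S > 0" "P > 0" "d > 0"
 shows "isCont (restitution c S P) d"
proof -
 have "restitution c S P differentiable at d"
  using restitution_smooth[OF assms(1,2)] assms(3) unfolding smooth_on_open_def
  by (metis funpow_0 greaterThan_iff)
 then show ?thesis using differentiable_imp_continuous_within by blast
qed

text \<open>With \<open>x = d * z\<close>, the number \<open>d * slide_time S P d\<close> is the
  integral of \<open>1 / (x\<^sup>2 / d\<^sup>2 + S * (x + 1))\<close> from \<open>- 1\<close> to
  \<open>d * lam P d\<close>. Both the integrand and the upper limit increase with \<open>d\<close>,
  so the exponent of the decay does too.\<close>

lemma restitution_antimono:
 assumes par: "S > 0" "P > 0" "c \<ge> 0"
 shows "antimono_on {0<..} (restitution c S P)"
proof (rule monotone_onI)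
 fix d d' :: real assume dd: "d \<in> {0<..}" "d' \<in> {0<..}" "d \<le> d'"
 define h where "h d x = 1 / (x\<^sup>2 / d\<^sup>2 + S * (x + 1))" for d x :: real
 have g: "d * slide_time S P d = integral {- 1..d * lam P d} (h d) \<and> h d integrable_on {- 1..d * lam P d}" if d: "d > 0" for d
 proof -
  have "((\<lambda>x. (1 / d) *\<^sub>R (1 / quad S d (x / d))) has_integral (integral {- 1 / d..(d * lam P d) / d} (\<lambda>z. 1 / quad S d z))) {- 1..d * lam P d}"
  proof (rule has_integral_substitution[where c = "- 1 / d" and d = "lam P d"])
   have "d * lam P d > 0" using lam_pos[OF par(2) d] d by simp
   then show l: "- 1 \<le> d * lam P d" by linarith
   then show "- 1 / d \<le> d * lam P d / d" using d by (intro divide_right_mono) auto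
   show "(\<lambda>x. x / d) ` {- 1..d * lam P d} \<subseteq> {- 1 / d..lam P d}" using d by (auto simp: field_simps)
   show "((\<lambda>x. x / d) has_real_derivative 1 / d) (at x within {- 1..d * lam P d})" for x
    using d by (auto intro!: derivative_eq_intros)
  qed (rule continuous_on_quad_inverse[OF par(1) d])
  then have "((\<lambda>x. d * ((1 / d) *\<^sub>R (1 / quad S d (x / d)))) has_integral d * slide_time S P d) {- 1..d * lam P d}"
   using d by (intro has_integral_mult_right) (simp add: slide_time_def)
  moreover have "d * ((1 / d) *\<^sub>R (1 / quad S d (x / d))) = h d x" for x
  proof -
   have "quad S d (x / d) = x\<^sup>2 / d\<^sup>2 + S * (x + 1)" using d by (simp add: quad_def power_divide distrib_left)
   then show ?thesis using d by (simp add: h_def)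
  qed
  ultimately show ?thesis by (auto simp: integral_unique has_integral_integrable)
 qed
 have d: "d > 0" "d' > 0" using dd by auto
 have pos: "x\<^sup>2 / e\<^sup>2 + S * (x + 1) > 0" if "x \<ge> - 1" "e > 0" for x e
  by (cases "x = 0") (use that par in \<open>auto intro!: add_pos_nonneg\<close>)
 have "lam P d \<le> lam P d'"
  unfolding lam_def using dd d par by (intro divide_right_mono add_mono mult_right_mono real_sqrt_le_mono power_mono) auto
 then have m: "d * lam P d \<le> d' * lam P d'" using d dd lam_pos[OF par(2) d(1)] by (intro mult_mono) auto
 have "d * slide_time S P d = integral {- 1..d * lam P d} (h d)" using g[OF d(1)] by simp
 also have "\<dots> \<le> integral {- 1..d * lam P d} (h d')"
 proof (rule integral_le)
  show "h d' integrable_on {- 1..d * lam P d}"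
   using g[OF d(2)] m by (auto intro: integrable_subinterval_real)
  show "h d x \<le> h d' x" if "x \<in> {- 1..d * lam P d}" for x
  proof -
   have "x\<^sup>2 / d'\<^sup>2 \<le> x\<^sup>2 / d\<^sup>2" using dd d by (intro divide_left_mono power_mono) auto
   then show ?thesis unfolding h_def using pos[of x d] pos[of x d'] that d by (intro divide_left_mono) auto
  qed
 qed (use g[OF d(1)] in simp)
 also have "\<dots> \<le> integral {- 1..d' * lam P d'} (h d')"
 proof (rule integral_subset_le)
  show "h d' integrable_on {- 1..d * lam P d}"
   using g[OF d(2)] m by (auto intro: integrable_subinterval_real)
  show "\<forall>x\<in>{- 1..d' * lam P d'}. 0 \<le> h d' x"
  proof
   show "0 \<le> h d' x" if "x \<in> {- 1..d' * lam P d'}" for x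
    unfolding h_def using pos[of x d'] that d by simp
  qed
 qed (use g[OF d(2)] m in auto)
 also have "\<dots> = d' * slide_time S P d'" using g[OF d(2)] by simp
 finally have "S * (d * slide_time S P d) \<le> S * (d' * slide_time S P d')" using par by simp
 then show "restitution c S P d' \<le> restitution c S P d"
  unfolding restitution_def using par by (intro mult_left_mono) (auto simp: mult.assoc)
qed

text \<open>The square root in the small-damping expansion is the prefactor of
  \<open>restitution\<close>: inserting the definition of \<open>S_w\<close> in
  \<open>1 + S / P\<close> cancels \<open>q_minus * p_plus\<close> in part, and the quotient of the
  negative numbers \<open>p_plus\<close> and \<open>q_plus\<close> is positive.\<close>

lemma restitution_constant:
 assumes "p_plus \<alpha> \<mu> \<theta> < 0" "q_plus \<alpha> \<mu> \<theta> < 0" "q_minus \<alpha> \<mu> \<theta> > 0"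
 shows "sqrt (p_plus \<alpha> \<mu> \<theta> * (p_minus \<alpha> \<mu> \<theta> - p_plus \<alpha> \<mu> \<theta>) / (q_plus \<alpha> \<mu> \<theta> * (q_minus \<alpha> \<mu> \<theta> - q_plus \<alpha> \<mu> \<theta>)))
  = p_plus \<alpha> \<mu> \<theta> / q_plus \<alpha> \<mu> \<theta> * sqrt (1 + S_w \<alpha> \<mu> \<theta> / (- p_plus \<alpha> \<mu> \<theta>))"
proof -
 define p p' q q' where "p = p_plus \<alpha> \<mu> \<theta>" and "p' = p_minus \<alpha> \<mu> \<theta>" and "q = q_plus \<alpha> \<mu> \<theta>" and "q' = q_minus \<alpha> \<mu> \<theta>"
 have *: "p < 0" "q < 0" "q' > 0" using assms by (auto simp: p_def q_def q'_def)
 have "p * (p' - p) / (q * (q' - q)) = (p / q)\<^sup>2 * (1 + ((q' * p - q * p') / (q' - q)) / (- p))"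
 proof -
  have "q' - q \<noteq> 0" "q \<noteq> 0" "p \<noteq> 0" using * by auto
  then show ?thesis by (simp add: divide_simps power2_eq_square) (simp add: algebra_simps)
 qed
 then have "sqrt (p * (p' - p) / (q * (q' - q))) = \<bar>p / q\<bar> * sqrt (1 + ((q' * p - q * p') / (q' - q)) / (- p))"
  by (simp add: real_sqrt_mult)
 also have "\<bar>p / q\<bar> = p / q" using * by (simp add: divide_nonpos_neg)
 finally show ?thesis unfolding S_w_def p_def p'_def q_def q'_def .
qed

text \<open>The closed form is continuous for all positive dampings and agrees with
  \<open>e_formula\<close> away from the double root, so it also provides the limit that defines
  \<open>e_coeff\<close> at the double root.\<close>

lemma e_coeff_eq_restitution:
 assumes par: "\<alpha> > 0" "\<mu> > 0" "d > 0" and p: "p_plus \<alpha> \<mu> \<theta> < 0"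
 shows "e_coeff \<alpha> \<mu> d \<theta> = restitution (p_plus \<alpha> \<mu> \<theta> / q_plus \<alpha> \<mu> \<theta> * sqrt (1 + S_w \<alpha> \<mu> \<theta> / (- p_plus \<alpha> \<mu> \<theta>)))
   (S_w \<alpha> \<mu> \<theta>) (- p_plus \<alpha> \<mu> \<theta>) d"
proof -
 let ?r = "restitution (p_plus \<alpha> \<mu> \<theta> / q_plus \<alpha> \<mu> \<theta> * sqrt (1 + S_w \<alpha> \<mu> \<theta> / (- p_plus \<alpha> \<mu> \<theta>)))
   (S_w \<alpha> \<mu> \<theta>) (- p_plus \<alpha> \<mu> \<theta>)"
 have S: "S_w \<alpha> \<mu> \<theta> > 0" using S_w_pos par by simp
 have eq: "Re (e_formula \<alpha> \<mu> x \<theta>) = ?r x" if "x > 0" "x \<noteq> 2 / sqrt (S_w \<alpha> \<mu> \<theta>)" for x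
  using e_formula_closed_form[OF par(1,2) that(1) p that(2)] by (simp add: restitution_def)
 show ?thesis
 proof (cases "d = 2 / sqrt (S_w \<alpha> \<mu> \<theta>)")
  case True
  have "?r \<midarrow>d\<rightarrow> ?r d" using restitution_isCont[OF S _ par(3)] p by (simp add: isCont_def)
  moreover have "eventually (\<lambda>x. ?r x = Re (e_formula \<alpha> \<mu> x \<theta>)) (at d)"
   unfolding eventually_at using par(3) eq True
   by (intro exI[of _ d]) (auto simp: dist_real_def)
  ultimately have "(\<lambda>x. Re (e_formula \<alpha> \<mu> x \<theta>)) \<midarrow>d\<rightarrow> ?r d" by (rule Lim_transform_eventually)
  then have "Lim (at d) (\<lambda>x. Re (e_formula \<alpha> \<mu> x \<theta>)) = ?r d" by (intro tendsto_Lim) auto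
  then show ?thesis using True by (simp add: e_coeff_def)
 qed (use eq[OF par(3)] in \<open>simp add: e_coeff_def\<close>)
qed

section \<open>Expansions for small and for large damping\<close>

lemma arctan_lipschitz: "\<bar>arctan x - arctan y\<bar> \<le> \<bar>x - y\<bar>"
proof -
 have *: "arctan v - arctan u \<le> v - u" if "u \<le> v" for u v :: real
 proof -
  have "arctan v - v \<le> arctan u - u"
  proof (rule DERIV_nonpos_imp_nonincreasing[OF that, of "\<lambda>x. arctan x - x"])
   fix x :: real
   have "inverse (1 + x\<^sup>2) - 1 \<le> 0" by (simp add: inverse_le_1_iff)
   moreover have "((\<lambda>x. arctan x - x) has_real_derivative inverse (1 + x\<^sup>2) - 1) (at x)"
    by (auto intro!: derivative_eq_intros)
   ultimately show "\<exists>D. ((\<lambda>x. arctan x - x) has_real_derivative D) (at x) \<and> D \<le> 0" by blast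
  qed
  then show ?thesis by simp
 qed
 have "arctan u \<le> arctan v" if "u \<le> v" for u v :: real using that by (simp add: arctan_le_iff)
 then show ?thesis using *[of x y] *[of y x] by (smt (verit))
qed

text \<open>Without its linear term \<open>quad\<close> is \<open>z\<^sup>2 + S\<close>, whose
  reciprocal integrates to arctangents. The linear term is a relative perturbation of size
  \<open>x\<close>, which costs \<open>pi * d\<close>; the rest of the error comes from the two
  endpoints of the interval.\<close>

lemma slide_time_small:
 assumes S: "S > 0" and P: "P > 0" and d: "d > 0" and small: "sqrt S * d \<le> 1"
 shows "\<bar>slide_time S P d - (pi - arctan (sqrt (S / P))) / sqrt S\<bar> \<le> (P / S + 1 + pi) * d"
proof -
 define \<omega> where "\<omega> = sqrt S"
 have \<omega>: "\<omega> > 0" "\<omega>\<^sup>2 = S" using S by (auto simp: \<omega>_def)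
 define l where "l = lam P d"
 have l: "l > 0" using lam_pos[OF P d] by (simp add: l_def)
 define A where "A = (arctan (l / \<omega>) + arctan (1 / (d * \<omega>))) / \<omega>"
 define A0 where "A0 = (pi - arctan (sqrt (S / P))) / \<omega>"
 have z0: "z\<^sup>2 + S > 0" for z using S by (simp add: add_nonneg_pos)
 have ld: "- 1 / d \<le> l" using l d by (meson divide_nonpos_pos less_imp_le neg_le_0_iff_le order_trans zero_le_one)
 have intA: "((\<lambda>z. 1 / (z\<^sup>2 + S)) has_integral A) {- 1 / d..l}"
 proof -
  have "((\<lambda>z. 1 / (z\<^sup>2 + S)) has_integral (arctan (l / \<omega>) / \<omega> - arctan ((- 1 / d) / \<omega>) / \<omega>)) {- 1 / d..l}"
  proof (rule fundamental_theorem_of_calculus[OF ld])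
   fix x
   have "((\<lambda>z. arctan (z / \<omega>) / \<omega>) has_real_derivative inverse (1 + (x / \<omega>)\<^sup>2) * (1 / \<omega>) / \<omega>) (at x within {- 1 / d..l})"
    using \<omega> by (auto intro!: derivative_eq_intros)
   moreover have "inverse (1 + (x / \<omega>)\<^sup>2) * (1 / \<omega>) / \<omega> = 1 / (x\<^sup>2 + S)"
   proof -
    have "(1 + (x / \<omega>)\<^sup>2) * \<omega>\<^sup>2 = x\<^sup>2 + S" 
    proof -
     have "(x / \<omega>)\<^sup>2 * \<omega>\<^sup>2 = x\<^sup>2" using \<omega>(1) by (simp add: power_divide)
     then show ?thesis unfolding distrib_right using \<omega>(2) by linarith
    qed
    moreover have "inverse (1 + (x / \<omega>)\<^sup>2) * (1 / \<omega>) / \<omega> = 1 / ((1 + (x / \<omega>)\<^sup>2) * \<omega>\<^sup>2)"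
     by (simp add: inverse_eq_divide power2_eq_square)
    ultimately show ?thesis by simp
   qed
   ultimately show "((\<lambda>z. arctan (z / \<omega>) / \<omega>) has_vector_derivative 1 / (x\<^sup>2 + S)) (at x within {- 1 / d..l})"
    by (simp add: has_real_derivative_iff_has_vector_derivative)
  qed
  moreover have "arctan ((- 1 / d) / \<omega>) = - arctan (1 / (d * \<omega>))" by (simp flip: arctan_minus)
  ultimately show ?thesis by (simp add: A_def add_divide_distrib)
 qed
 \<comment> \<open>The inequality of arithmetic and geometric means,
   \<open>2 * \<bar>\<omega> * z\<bar> \<le> z\<^sup>2 + S\<close>, bounds the linear term
   \<open>S * d * z\<close> by \<open>x\<close> times \<open>z\<^sup>2 + S\<close>, uniformly in
   \<open>z\<close>. The hypothesis \<open>small\<close> says that \<open>x\<close> is at most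
   1/2.\<close>
 define x where "x = \<omega> * d / 2"
 have x: "0 < x" "x \<le> 1 / 2" using \<omega> d small by (auto simp: x_def \<omega>_def)
 have Q: "(z\<^sup>2 + S) * (1 - x) \<le> quad S d z \<and> quad S d z \<le> (z\<^sup>2 + S) * (1 + x)" for z
 proof -
  have "S * d * z = x * (2 * (\<omega> * z))" unfolding x_def \<omega>(2)[symmetric] by (simp add: power2_eq_square)
  then have "\<bar>S * d * z\<bar> = x * (2 * \<bar>\<omega> * z\<bar>)" using x(1) by (simp only: abs_mult)
  moreover have "2 * \<bar>\<omega> * z\<bar> \<le> z\<^sup>2 + S"
   using zero_le_power2[of "\<omega> - z"] zero_le_power2[of "\<omega> + z"] \<omega>(2) by (simp add: power2_diff power2_sum abs_if)
  ultimately have "\<bar>S * d * z\<bar> \<le> x * (z\<^sup>2 + S)" using x(1) by simp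
  then show ?thesis unfolding quad_def by (simp add: algebra_simps abs_le_iff)
 qed
 have intT: "((\<lambda>z. 1 / quad S d z) has_integral slide_time S P d) {- 1 / d..l}"
  unfolding slide_time_def l_def
  by (intro integrable_integral integrable_continuous_interval continuous_on_quad_inverse S d)
 have A_nn: "A \<ge> 0" using has_integral_nonneg[OF intA] z0 by (simp add: less_imp_le)
 have up: "slide_time S P d \<le> A * (1 / (1 - x))"
 proof (rule has_integral_le[OF intT has_integral_mult_left[OF intA]])
  fix z assume z: "z \<in> {- 1 / d..l}"
  have "1 / quad S d z \<le> 1 / ((z\<^sup>2 + S) * (1 - x))"
   using Q[of z] z0[of z] x quad_pos[OF S d, of z] z by (intro divide_left_mono) (auto intro!: mult_pos_pos)
  then show "1 / quad S d z \<le> 1 / (z\<^sup>2 + S) * (1 / (1 - x))" by simp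
 qed
 have lo: "A * (1 / (1 + x)) \<le> slide_time S P d"
 proof (rule has_integral_le[OF has_integral_mult_left[OF intA] intT])
  fix z assume z: "z \<in> {- 1 / d..l}"
  have "1 / ((z\<^sup>2 + S) * (1 + x)) \<le> 1 / quad S d z"
   using Q[of z] z0[of z] x quad_pos[OF S d, of z] z by (intro divide_left_mono) (auto intro!: mult_pos_pos)
  then show "1 / (z\<^sup>2 + S) * (1 / (1 + x)) \<le> 1 / quad S d z" by simp
 qed
 have "1 / (1 - x) \<le> 1 + 2 * x"
 proof -
  have "0 \<le> x * (1 - 2 * x)" using x by simp
  then have "1 \<le> (1 + 2 * x) * (1 - x)" by (simp add: algebra_simps)
  then show ?thesis using x by (simp add: divide_le_eq)
 qed
 then have up': "slide_time S P d \<le> A + A * (2 * x)"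
  using up mult_left_mono[OF _ A_nn] by (fastforce simp: distrib_left)
 have "1 - 2 * x \<le> 1 / (1 + x)"
 proof -
  have "(1 - 2 * x) * (1 + x) \<le> 1" using x by (simp add: algebra_simps)
  then show ?thesis using x by (simp add: le_divide_eq)
 qed
 then have lo': "A - A * (2 * x) \<le> slide_time S P d"
  using lo mult_left_mono[OF _ A_nn] by (fastforce simp: right_diff_distrib)
 have "A \<le> pi / \<omega>"
  unfolding A_def using arctan_ubound[of "l / \<omega>"] arctan_ubound[of "1 / (d * \<omega>)"] \<omega> by (intro divide_right_mono) auto
 then have "A * (2 * x) \<le> pi / \<omega> * (2 * x)" using x by (intro mult_right_mono) auto
 also have "\<dots> = pi * d" using \<omega> by (simp add: x_def)
 finally have d1: "\<bar>slide_time S P d - A\<bar> \<le> pi * d" using up' lo' by linarith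
 \<comment> \<open>Replacing \<open>lam P d\<close> by \<open>sqrt P\<close> and the lower end
   \<open>- 1 / d\<close> by minus infinity moves the arguments of arctan by at most
   \<open>d * P / \<omega>\<close> and \<open>d * \<omega>\<close>.\<close>
 have "\<bar>A - A0\<bar> \<le> (P / S + 1) * d"
 proof -
  have "sqrt (S / P) = \<omega> / sqrt P" by (simp add: \<omega>_def real_sqrt_divide)
  moreover have "arctan (\<omega> / sqrt P) = pi / 2 - arctan (sqrt P / \<omega>)"
   using arctan_inverse[of "sqrt P / \<omega>"] \<omega> P by (simp add: divide_simps sgn_if)
  ultimately have "arctan (sqrt (S / P)) = pi / 2 - arctan (sqrt P / \<omega>)" by simp
  then have A0: "A0 = (pi / 2 + arctan (sqrt P / \<omega>)) / \<omega>" by (simp add: A0_def)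
  have "arctan (1 / (d * \<omega>)) = pi / 2 - arctan (d * \<omega>)"
   using arctan_inverse[of "d * \<omega>"] \<omega> d by (simp add: inverse_eq_divide sgn_if)
  then have "(A - A0) * \<omega> = (arctan (l / \<omega>) - arctan (sqrt P / \<omega>)) - arctan (d * \<omega>)"
  proof -
   have "A * \<omega> = arctan (l / \<omega>) + arctan (1 / (d * \<omega>))" "A0 * \<omega> = pi / 2 + arctan (sqrt P / \<omega>)"
    using \<omega>(1) by (simp_all add: A_def A0)
   then show ?thesis using \<open>arctan (1 / (d * \<omega>)) = pi / 2 - arctan (d * \<omega>)\<close> by (simp add: left_diff_distrib)
  qed
  then have "\<bar>A - A0\<bar> * \<omega> = \<bar>(arctan (l / \<omega>) - arctan (sqrt P / \<omega>)) - arctan (d * \<omega>)\<bar>"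
   using \<omega>(1) by (metis abs_mult abs_of_pos)
  also have "\<dots> \<le> \<bar>arctan (l / \<omega>) - arctan (sqrt P / \<omega>)\<bar> + \<bar>arctan (d * \<omega>)\<bar>" by linarith
  also have "\<dots> \<le> \<bar>l / \<omega> - sqrt P / \<omega>\<bar> + \<bar>d * \<omega>\<bar>"
  proof (rule add_mono[OF arctan_lipschitz])
   show "\<bar>arctan (d * \<omega>)\<bar> \<le> \<bar>d * \<omega>\<bar>" using arctan_lipschitz[of "d * \<omega>" 0] by simp
  qed
  also have "\<bar>l / \<omega> - sqrt P / \<omega>\<bar> \<le> d * P / \<omega>"
  proof -
   have "sqrt (4 * P) \<le> sqrt (d\<^sup>2 * P\<^sup>2 + 4 * P)" by simp
   moreover have "sqrt (d\<^sup>2 * P\<^sup>2 + 4 * P) \<le> d * P + sqrt (4 * P)"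
    using sqrt_add_le_add_sqrt[of "d\<^sup>2 * P\<^sup>2" "4 * P"] d P by (simp add: real_sqrt_mult)
   moreover have "sqrt (4 * P) = 2 * sqrt P" by (simp add: real_sqrt_mult)
   moreover have "d * P \<ge> 0" using d P by simp
   moreover have "2 * l = d * P + sqrt (d\<^sup>2 * P\<^sup>2 + 4 * P)" by (simp add: l_def lam_def)
   ultimately have "\<bar>l - sqrt P\<bar> \<le> d * P" unfolding abs_le_iff by linarith
   then have "\<bar>l - sqrt P\<bar> / \<omega> \<le> d * P / \<omega>" by (rule divide_right_mono) (use \<omega>(1) in simp)
   moreover have "\<bar>l / \<omega> - sqrt P / \<omega>\<bar> = \<bar>l - sqrt P\<bar> / \<omega>"
    unfolding diff_divide_distrib[symmetric] abs_divide using \<omega>(1) by simp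
   ultimately show ?thesis by simp
  qed
  also have "\<bar>d * \<omega>\<bar> = d * \<omega>" using d \<omega> by simp
  finally have "\<bar>A - A0\<bar> * \<omega> \<le> d * P / \<omega> + d * \<omega>" by simp
  then have "\<bar>A - A0\<bar> \<le> (d * P / \<omega> + d * \<omega>) / \<omega>" using \<omega> by (simp add: le_divide_eq)
  also have "\<dots> = (P / S + 1) * d" using \<omega> unfolding \<omega>(2)[symmetric] by (simp add: add_divide_distrib power2_eq_square distrib_right)
  finally show ?thesis .
 qed
 then have "\<bar>slide_time S P d - A0\<bar> \<le> pi * d + (P / S + 1) * d" using d1 by linarith
 then show ?thesis by (simp add: A0_def \<omega>_def algebra_simps)
qed

lemma exp_minus_quadratic:
 fixes x :: real
 assumes "x \<ge> 0"
 shows "\<bar>exp (- x) - (1 - x)\<bar> \<le> x\<^sup>2"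
proof -
 have "1 - x \<le> exp (- x)" using exp_ge_add_one_self[of "- x"] by simp
 moreover have "exp (- x) \<le> 1 - x + x\<^sup>2"
 proof -
  have q: "1 + x + x\<^sup>2 / 2 \<le> exp x" by (rule exp_lower_Taylor_quadratic[OF assms])
  have pos: "1 - x + x\<^sup>2 \<ge> 0"
  proof -
   have "0 \<le> (1 - 2 * x)\<^sup>2 + 3" by simp
   then show ?thesis by (simp add: power2_eq_square algebra_simps)
  qed
  have "1 \<le> (1 - x + x\<^sup>2) * (1 + x + x\<^sup>2 / 2)"
  proof -
   have "0 \<le> x\<^sup>2 / 2 + x\<^sup>2 * x / 2 + x\<^sup>2 * x\<^sup>2 / 2" using assms by simp
   moreover have "(1 - x + x\<^sup>2) * (1 + x + x\<^sup>2 / 2) = 1 + (x\<^sup>2 / 2 + x\<^sup>2 * x / 2 + x\<^sup>2 * x\<^sup>2 / 2)"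
    by (simp add: power2_eq_square field_simps)
   ultimately show ?thesis by simp
  qed
  also have "\<dots> \<le> (1 - x + x\<^sup>2) * exp x" by (rule mult_left_mono[OF q pos])
  finally have "1 * exp (- x) \<le> (1 - x + x\<^sup>2) * exp x * exp (- x)" by (rule mult_right_mono) simp
  then show ?thesis by (simp add: mult.assoc flip: exp_add)
 qed
 ultimately show ?thesis by linarith
qed

lemma restitution_small:
 assumes S: "S > 0" and P: "P > 0"
 shows "\<exists>r. r \<in> O[at_right 0](\<lambda>d. d\<^sup>2) \<and>
  (\<forall>\<^sub>F d in at_right 0. restitution c S P d = c * (1 - sqrt S / 2 * (pi - arctan (sqrt (S / P))) * d + r d))"
proof (intro exI conjI)
 define A0 where "A0 = (pi - arctan (sqrt (S / P))) / sqrt S"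
 let ?r = "\<lambda>d. exp (- (S * d * slide_time S P d / 2)) - (1 - sqrt S / 2 * (pi - arctan (sqrt (S / P))) * d)"
 show "\<forall>\<^sub>F d in at_right 0. restitution c S P d = c * (1 - sqrt S / 2 * (pi - arctan (sqrt (S / P))) * d + ?r d)"
  by (simp add: restitution_def)
 define C where "C = P / S + 1 + pi"
 have C: "C > 0" using S P by (simp add: C_def add_pos_pos)
 \<comment> \<open>Rewrites the coefficient of the expansion by \<open>S / sqrt S = sqrt S\<close>,
   so that it becomes the linear part of the exponent
   \<open>S * d * slide_time S P d / 2\<close>.\<close>
 have SA: "sqrt S / 2 * (pi - arctan (sqrt (S / P))) = S * A0 / 2"
 proof -
  have "S * A0 = (S / sqrt S) * (pi - arctan (sqrt (S / P)))" by (simp add: A0_def)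
  then show ?thesis using real_div_sqrt[of S] S by simp
 qed
 have "\<bar>?r d\<bar> \<le> ((S * (\<bar>A0\<bar> + C) / 2)\<^sup>2 + S * C / 2) * d\<^sup>2" if d: "d > 0" "sqrt S * d \<le> 1" "d \<le> 1" for d
 proof -
  define T where "T = slide_time S P d"
  have T: "T > 0" using slide_time_pos[OF S P d(1)] by (simp add: T_def)
  have TA: "\<bar>T - A0\<bar> \<le> C * d" using slide_time_small[OF S P d(1,2)] by (simp add: T_def A0_def C_def)
  define x where "x = S * d * T / 2"
  have x0: "x \<ge> 0" using S d T by (simp add: x_def)
  have Cd: "C * d \<le> C" using C d by simp
  then have "T \<le> \<bar>A0\<bar> + C" using TA by linarith
  define a where "a = S * (\<bar>A0\<bar> + C) / 2"
  have "x \<le> a * d" using S d \<open>T \<le> \<bar>A0\<bar> + C\<close> by (simp add: x_def a_def mult_ac)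
  then have "x\<^sup>2 \<le> (a * d)\<^sup>2" by (rule power_mono[OF _ x0])
  then have x2: "x\<^sup>2 \<le> a\<^sup>2 * d\<^sup>2" by (simp only: power_mult_distrib)
  have "?r d = (exp (- x) - (1 - x)) - S * d / 2 * (T - A0)"
   unfolding SA x_def T_def by (simp add: field_simps)
  then have "\<bar>?r d\<bar> \<le> \<bar>exp (- x) - (1 - x)\<bar> + \<bar>S * d / 2 * (T - A0)\<bar>" by linarith
  also have "\<bar>S * d / 2 * (T - A0)\<bar> = S * d / 2 * \<bar>T - A0\<bar>" using S d by (simp add: abs_mult)
  also have "\<dots> \<le> S * d / 2 * (C * d)" using S d TA by (intro mult_left_mono) auto
  finally have "\<bar>?r d\<bar> \<le> x\<^sup>2 + S * d / 2 * (C * d)" using exp_minus_quadratic[OF x0] by linarith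
  also have "\<dots> \<le> a\<^sup>2 * d\<^sup>2 + S * d / 2 * (C * d)" by (rule add_right_mono[OF x2])
  also have "S * d / 2 * (C * d) = S * C / 2 * d\<^sup>2" by (simp add: power2_eq_square)
  finally show ?thesis by (simp add: distrib_right a_def)
 qed
 moreover have "eventually (\<lambda>d. d > 0 \<and> sqrt S * d \<le> 1 \<and> d \<le> 1) (at_right 0)"
  unfolding eventually_at_right_field
  using S by (intro exI[of _ "min 1 (1 / sqrt S)"]) (auto simp: field_simps)
 ultimately have "\<forall>\<^sub>F d in at_right 0. norm (?r d) \<le> ((S * (\<bar>A0\<bar> + C) / 2)\<^sup>2 + S * C / 2) * norm (d\<^sup>2)"
  by (auto elim!: eventually_mono)
 then show "?r \<in> O[at_right 0](\<lambda>d. d\<^sup>2)" by (rule bigoI)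
qed

text \<open>With \<open>x = d * z\<close> the integrand is \<open>1 / D x\<close>, and for large
  \<open>k\<close> the roots of \<open>D\<close> separate. A factored polynomial \<open>D2\<close>
  with explicit logarithmic integral lies above \<open>D\<close> and differs from it by a relative
  error of at most \<open>3 / k\<close>; evaluating the logarithm at the upper limit produces
  \<open>T\<close>.\<close>

lemma slide_time_large:
 assumes S: "S > 0" and P: "P > 0" and d: "d > 0" and large: "S * d\<^sup>2 \<ge> 8"
 defines "k \<equiv> S * d\<^sup>2"
 defines "T \<equiv> 2 * ln k - ln ((P + S) / P)"
 shows "T \<le> S * d * slide_time S P d" "S * d * slide_time S P d \<le> (1 + 8 / k) * (T + 3 * S / (P * k))"
proof -
 have k: "k \<ge> 8" using large by (simp add: k_def)
 define m where "m = d * lam P d"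
 have m: "m > 0" using lam_pos[OF P d] d by (simp add: m_def)
 define D where "D x = x\<^sup>2 / k + (x + 1)" for x
 have intD: "((\<lambda>x. 1 / D x) has_integral S * d * slide_time S P d) {- 1..m}"
 proof -
  have "((\<lambda>x. (1 / d) *\<^sub>R (1 / quad S d (x / d))) has_integral (integral {- 1 / d..m / d} (\<lambda>z. 1 / quad S d z))) {- 1..m}"
  proof (rule has_integral_substitution[where c = "- 1 / d" and d = "lam P d"])
   show "- 1 \<le> m" using m by simp
   then show "- 1 / d \<le> m / d" using d by (intro divide_right_mono) auto
   show "(\<lambda>x. x / d) ` {- 1..m} \<subseteq> {- 1 / d..lam P d}" using d by (auto simp: m_def field_simps)
   show "((\<lambda>x. x / d) has_real_derivative 1 / d) (at x within {- 1..m})" for x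
    using d by (auto intro!: derivative_eq_intros)
  qed (rule continuous_on_quad_inverse[OF S d])
  then have "((\<lambda>x. (S * d) * ((1 / d) *\<^sub>R (1 / quad S d (x / d)))) has_integral (S * d) * slide_time S P d) {- 1..m}"
   using d by (intro has_integral_mult_right) (simp add: slide_time_def m_def)
  moreover have "(S * d) * ((1 / d) *\<^sub>R (1 / quad S d (x / d))) = 1 / D x" for x
  proof -
   have "quad S d (x / d) = S * D x" using d S by (simp add: quad_def D_def k_def power_divide distrib_left)
   then show ?thesis using d S by simp
  qed
  ultimately show ?thesis by simp
 qed
 \<comment> \<open>Its roots are \<open>- 1 - 1 / k\<close> and \<open>- 1 - k\<close>. The first
   one matches the root of \<open>D\<close> next to the lower limit \<open>- 1\<close> to the order
   that matters, the second one the remote root to leading order.\<close>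
 define D2 where "D2 x = (x + 1 + 1 / k) * (1 + (x + 1) / k)" for x
 \<comment> \<open>Normalising constant of the partial fractions of \<open>1 / D2\<close>.\<close>
 define c where "c = 1 / (1 - 1 / k\<^sup>2)"
 define U where "U = m + 1"
 define N where "N = (U * k + 1) / (1 + U / k)"
 have kk: "1 / k\<^sup>2 \<le> 1 / 64"
  using k power_mono[of 8 k 2] by (intro divide_left_mono) auto
 have D2pos: "D2 x > 0" if "x \<ge> - 1" for x
  unfolding D2_def using that k by (intro mult_pos_pos add_nonneg_pos add_pos_nonneg) auto
 have Dpos: "D x > 0" if "x \<ge> - 1" for x
 proof (cases "x = - 1")
  case False
  have "x\<^sup>2 / k \<ge> 0" using k by simp
  then show ?thesis unfolding D_def using that False by linarith
 qed (use k in \<open>simp add: D_def\<close>)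
 have DD: "D2 x - D x = (2 * (x + 1) + (x + 1) / k) / k" for x
  unfolding D2_def D_def using k by (simp add: field_simps power2_eq_square)
 have D_le: "D x \<le> D2 x" if "x \<ge> - 1" for x
 proof -
  have "0 \<le> (2 * (x + 1) + (x + 1) / k) / k" using that k by simp
  then show ?thesis using DD[of x] by linarith
 qed
 have D_ge: "D2 x * (1 - 3 / k) \<le> D x" if "x \<ge> - 1" for x
 proof -
  have "(x + 1) / k \<le> x + 1" using that k by (simp add: divide_le_eq mult_le_cancel_left1)
  moreover have "x + 1 \<le> D2 x"
  proof -
   have "(x + 1) * 1 \<le> (x + 1 + 1 / k) * (1 + (x + 1) / k)" using that k by (intro mult_mono) auto
   then show ?thesis by (simp add: D2_def)
  qed
  moreover have "a + b \<le> 3 * D2 x" if "a = 2 * (x + 1)" "b \<le> x + 1" for a b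
   using that \<open>x + 1 \<le> D2 x\<close> by (simp add: algebra_simps)
  ultimately have "2 * (x + 1) + (x + 1) / k \<le> 3 * D2 x" by blast
  then have "D2 x - D x \<le> 3 * D2 x / k" unfolding DD using k by (intro divide_right_mono) auto
  then show ?thesis by (simp add: algebra_simps)
 qed
 have Upos: "U > 0" using m by (simp add: U_def)
 have Npos: "N > 0" unfolding N_def using Upos k by (intro divide_pos_pos add_nonneg_pos add_pos_nonneg) auto
 have intD2: "((\<lambda>x. 1 / D2 x) has_integral c * ln N) {- 1..m}"
 proof -
  let ?F = "\<lambda>x. c * (ln (x + 1 + 1 / k) - ln (1 + (x + 1) / k))"
  have "((\<lambda>x. 1 / D2 x) has_integral (?F m - ?F (- 1))) {- 1..m}"
  proof (rule fundamental_theorem_of_calculus)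
   fix x assume x: "x \<in> {- 1..m}"
   have pos: "x + 1 + 1 / k > 0" "1 + (x + 1) / k > 0"
   proof -
    have "1 / k > 0" "(x + 1) / k \<ge> 0" using x k by auto
    moreover have "x + 1 \<ge> 0" using x by simp
    ultimately show "x + 1 + 1 / k > 0" "1 + (x + 1) / k > 0" by (auto simp only: add_nonneg_pos add_pos_nonneg zero_less_one)
   qed
   have "(?F has_real_derivative c * (1 / (x + 1 + 1 / k) - (1 / k) / (1 + (x + 1) / k))) (at x within {- 1..m})"
    using pos k by (auto intro!: derivative_eq_intros)
   moreover have "c * (1 / (x + 1 + 1 / k) - (1 / k) / (1 + (x + 1) / k)) = 1 / D2 x"
   proof -
    have "1 / (x + 1 + 1 / k) - (1 / k) / (1 + (x + 1) / k) = ((1 + (x + 1) / k) - (1 / k) * (x + 1 + 1 / k)) / D2 x"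
     unfolding D2_def using pos by (subst diff_frac_eq) (auto simp: mult_ac)
    also have "(1 + (x + 1) / k) - (1 / k) * (x + 1 + 1 / k) = 1 - 1 / k\<^sup>2"
     using k by (simp add: field_simps power2_eq_square)
    finally have "1 / (x + 1 + 1 / k) - (1 / k) / (1 + (x + 1) / k) = (1 - 1 / k\<^sup>2) / D2 x" .
    moreover have "1 - 1 / k\<^sup>2 \<noteq> 0" using kk by linarith
    moreover have "1 / b * (b / D2 x) = 1 / D2 x" if "b \<noteq> 0" for b using that by simp
    ultimately show ?thesis unfolding c_def by (simp only:)
   qed
   ultimately show "(?F has_vector_derivative 1 / D2 x) (at x within {- 1..m})"
    by (simp add: has_real_derivative_iff_has_vector_derivative)
  qed (use m in simp)
  moreover have "?F m - ?F (- 1) = c * ln N"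
  proof -
   have "ln N = ln (U * k + 1) - ln (1 + U / k)"
   proof -
    have "U * k > 0" "U / k > 0" using Upos k by simp_all
    then have "U * k + 1 > 0" "1 + U / k > 0" by linarith+
    then show ?thesis unfolding N_def by (rule ln_divide_pos)
   qed
   also have "U * k + 1 = (U + 1 / k) * k" using k by (simp add: field_simps)
   also have "ln ((U + 1 / k) * k) = ln (U + 1 / k) + ln k"
    using Upos k by (intro ln_mult_pos add_pos_pos) auto
   finally have "ln N = ln (U + 1 / k) + ln k - ln (1 + U / k)" .
   moreover have "ln (1 / k) = - ln k" using k by (simp add: ln_div)
   ultimately have "ln N = (ln (m + 1 + 1 / k) - ln (1 + (m + 1) / k)) - ln (1 / k)" by (simp add: U_def)
   moreover have "?F m - ?F (- 1) = c * ((ln (m + 1 + 1 / k) - ln (1 + (m + 1) / k)) - ln (1 / k))"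
    by (simp add: right_diff_distrib)
   ultimately show ?thesis by simp
  qed
  ultimately show ?thesis by simp
 qed
 have lo: "c * ln N \<le> S * d * slide_time S P d"
  by (rule has_integral_le[OF intD2 intD]) (use D2pos Dpos D_le in \<open>auto intro!: divide_left_mono mult_pos_pos\<close>)
 have k3: "1 - 3 / k > 0" using k by (simp add: field_simps)
 have up: "S * d * slide_time S P d \<le> c * ln N * (1 / (1 - 3 / k))"
 proof (rule has_integral_le[OF intD has_integral_mult_left[OF intD2]])
  fix x assume x: "x \<in> {- 1..m}"
  have "1 / D x \<le> 1 / (D2 x * (1 - 3 / k))"
  proof (rule frac_le)
   have x1: "x \<ge> - 1" using x by simp
   show "D2 x * (1 - 3 / k) \<le> D x" by (rule D_ge[OF x1])
   show "0 < D2 x * (1 - 3 / k)" by (rule mult_pos_pos[OF D2pos[OF x1] k3])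
  qed simp_all
  then show "1 / D x \<le> 1 / D2 x * (1 / (1 - 3 / k))" by simp
 qed
 have c1: "c \<ge> 1" using kk k by (simp add: c_def)
 \<comment> \<open>The bound \<open>k \<ge> 8\<close> is used here: it makes
   \<open>y \<le> 1 / 8\<close>, hence \<open>(1 + 8 * y) * (1 - 4 * y) \<ge> 1\<close>, and
   \<open>1 - 4 * y\<close> is below the product of the two correction factors.\<close>
 have cu: "c * (1 / (1 - 3 / k)) \<le> 1 + 8 / k"
 proof -
  define y where "y = 1 / k"
  have y: "0 < y" "y \<le> 1 / 8" using k by (auto simp: y_def field_simps)
  have "1 \<le> (1 + 8 * y) * (1 - 4 * y)"
  proof -
   have "0 \<le> 4 * y * (1 - 8 * y)" using y by simp
   then show ?thesis by (simp add: algebra_simps)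
  qed
  also have "1 - 4 * y \<le> (1 - y\<^sup>2) * (1 - 3 * y)"
  proof -
   have "0 \<le> y * (1 - y) + 3 * (y * y * y)" using y by simp
   then show ?thesis by (simp add: power2_eq_square algebra_simps)
  qed
  finally have main: "1 \<le> (1 + 8 * y) * ((1 - y\<^sup>2) * (1 - 3 * y))" using y by (simp add: mult_left_mono)
  have "y * y \<le> y * 1" using y by (intro mult_left_mono) auto
  then have "y\<^sup>2 < 1" using y unfolding power2_eq_square by linarith
  then have "1 / ((1 - y\<^sup>2) * (1 - 3 * y)) \<le> 1 + 8 * y"
   using main y by (subst divide_le_eq) (auto intro!: mult_pos_pos)
  then show ?thesis by (simp add: c_def y_def power_divide)
 qed
 \<comment> \<open>\<open>m\<close> is the positive root of \<open>m\<^sup>2 = x * m + x\<close>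
   with \<open>x = P * d\<^sup>2\<close>, hence between \<open>x\<close> and \<open>x + 1\<close>;
   moreover \<open>x = P * k / S\<close>.\<close>
 have Ulo: "U \<ge> P * k / S + 1" and Uup: "U \<le> P * k / S + 2"
 proof -
  have Pk: "P * k / S = P * d\<^sup>2" using S by (simp add: k_def)
  define x where "x = P * d\<^sup>2"
  have x: "x > 0" using P d by (simp add: x_def)
  have "m = (x + sqrt (x\<^sup>2 + 4 * x)) / 2"
  proof -
   have "x\<^sup>2 + 4 * x = d\<^sup>2 * (d\<^sup>2 * P\<^sup>2 + 4 * P)" by (simp add: x_def power2_eq_square algebra_simps)
   then have "sqrt (x\<^sup>2 + 4 * x) = d * sqrt (d\<^sup>2 * P\<^sup>2 + 4 * P)" using d by (simp add: real_sqrt_mult)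
   then show ?thesis by (simp add: m_def lam_def x_def power2_eq_square algebra_simps)
  qed
  moreover have "sqrt (x\<^sup>2 + 4 * x) \<ge> x" using x by (intro real_le_rsqrt) auto
  moreover have "sqrt (x\<^sup>2 + 4 * x) \<le> x + 2" using x by (intro real_le_lsqrt) (auto simp: power2_eq_square algebra_simps)
  ultimately show "U \<ge> P * k / S + 1" "U \<le> P * k / S + 2" unfolding Pk U_def x_def by auto
 qed
 have N2: "N = k * (U * k + 1) / (k + U)" unfolding N_def using k Upos by (simp add: field_simps)
 \<comment> \<open>This is the leading term of \<open>N\<close> when \<open>U\<close> is replaced by
   \<open>P * k / S\<close>. The actual \<open>N\<close> lies above it, and by at most a factor
   \<open>1 + 3 * S / (P * k)\<close>.\<close>
 have T_eq: "exp T = k\<^sup>2 * P / (P + S)"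
 proof -
  have "exp T = exp (ln (k\<^sup>2)) / exp (ln ((P + S) / P))" using k by (simp add: T_def exp_diff ln_realpow)
  then show ?thesis using k P S by (simp add: add_pos_pos)
 qed
 have N_lo: "exp T \<le> N"
 proof -
  have "k\<^sup>2 * P * (k + U) \<le> k * (U * k + 1) * (P + S)"
  proof -
   have "P * k \<le> S * U" using Ulo S by (simp add: field_simps)
   then have "k\<^sup>2 * (P * k) \<le> k\<^sup>2 * (S * U)" by (rule mult_left_mono) simp
   moreover have "0 \<le> k * (P + S)" using k P S by simp
   ultimately show ?thesis by (simp add: power2_eq_square algebra_simps)
  qed
  moreover have "k + U > 0" "P + S > 0" using k Upos P S by auto
  ultimately show ?thesis unfolding T_eq N2 by (simp add: pos_divide_le_eq pos_le_divide_eq mult.commute)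
 qed
 have "T \<le> ln N" using N_lo Npos by (metis ln_exp ln_le_cancel_iff exp_gt_zero)
 have T0: "0 \<le> ln N"
 proof -
  have "k + U \<le> k * (U * k + 1)"
  proof -
   have "U * 1 \<le> U * (k * k)" using Upos k mult_mono[of 1 k 1 k] by (intro mult_left_mono) auto
   then show ?thesis by (simp add: algebra_simps)
  qed
  then have "1 \<le> N" unfolding N2 using k Upos by (simp add: le_divide_eq)
  then show ?thesis by simp
 qed
 show "T \<le> S * d * slide_time S P d"
  using \<open>T \<le> ln N\<close> lo mult_right_mono[OF c1 T0] by linarith
 have N_up: "N \<le> exp T * (1 + 3 * S / (P * k))"
 proof -
  have "k * (U * k + 1) * (P + S) \<le> k\<^sup>2 * (P + 3 * S / k) * (k + U)"
  proof -
   have "S * U \<le> P * k + 2 * S" using Uup S by (simp add: field_simps)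
   then have "k\<^sup>2 * (S * U) \<le> k\<^sup>2 * (P * k + 2 * S)" by (rule mult_left_mono) simp
   moreover have "k * (P + S) \<le> k\<^sup>2 * S + k * (3 * S * U)"
   proof -
    have "P * 1 \<le> P * k" using P k by (intro mult_left_mono) auto
    moreover have "P * k \<le> S * U" using Ulo S by (simp add: field_simps)
    ultimately have "P \<le> S * U" by simp
    moreover have "S \<le> k * S" using k S by simp
    ultimately have "P + S \<le> k * S + 3 * (S * U)" using mult_pos_pos[OF S Upos] by linarith
    then have "k * (P + S) \<le> k * (k * S + 3 * (S * U))" using k by (intro mult_left_mono) auto
    then show ?thesis by (simp add: power2_eq_square algebra_simps)
   qed
   moreover have "k\<^sup>2 * (P + 3 * S / k) * (k + U) = k\<^sup>2 * P * (k + U) + 3 * S * k * (k + U)"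
    using k by (simp add: field_simps power2_eq_square)
   ultimately show ?thesis by (simp add: power2_eq_square algebra_simps)
  qed
  moreover have "a / b \<le> c / e" if "a * e \<le> c * b" "b > 0" "e > 0" for a b c e :: real
   using that by (simp add: divide_simps mult.commute)
  ultimately have "N \<le> k\<^sup>2 * (P + 3 * S / k) / (P + S)" unfolding N2 using k Upos P S by (metis add_pos_pos less_le_trans zero_less_numeral)
  also have "P + 3 * S / k = P * (1 + 3 * S / (P * k))" using P k by (simp add: field_simps)
  also have "k\<^sup>2 * (P * (1 + 3 * S / (P * k))) / (P + S) = exp T * (1 + 3 * S / (P * k))" unfolding T_eq by simp
  finally show ?thesis .
 qed
 have x3: "3 * S / (P * k) > 0" using S P k by simp
 have "ln N \<le> ln (exp T * (1 + 3 * S / (P * k)))" using N_up Npos by (intro ln_mono) auto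
 also have "\<dots> = T + ln (1 + 3 * S / (P * k))" using x3 by (simp add: ln_mult_pos)
 also have "\<dots> \<le> T + 3 * S / (P * k)" using ln_add_one_self_le_self[of "3 * S / (P * k)"] x3 by simp
 finally have lnN: "ln N \<le> T + 3 * S / (P * k)" .
 have "S * d * slide_time S P d \<le> (c * (1 / (1 - 3 / k))) * ln N" using up by (simp add: mult_ac)
 also have "\<dots> \<le> (1 + 8 / k) * (T + 3 * S / (P * k))"
  using cu lnN T0 k by (intro mult_mono) auto
 finally show "S * d * slide_time S P d \<le> (1 + 8 / k) * (T + 3 * S / (P * k))" .
qed

text \<open>The leading part \<open>T\<close> of the exponent turns into
  \<open>exp (- (T d / 2)) = sqrt ((P + S) / P) / (S * d\<^sup>2)\<close>, which is the power of the
  damping in the expansion and supplies the second square root of \<open>(P + S) / P\<close>. The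
  excess of the exponent over \<open>T\<close> lies between 0 and \<open>B\<close>, which is of the
  order of the stated remainder.\<close>

lemma restitution_large:
 assumes S: "S > 0" and P: "P > 0"
 shows "\<exists>r. r \<in> O[at_top](\<lambda>d. (1 / d\<^sup>2) * ln (1 / d)) \<and>
  (\<forall>\<^sub>F d in at_top. restitution (c * sqrt (1 + S / P)) S P d = c * ((P + S) / (P * S)) * (1 / d\<^sup>2) * (1 + r d))"
proof (intro exI conjI)
 define T where "T d = 2 * ln (S * d\<^sup>2) - ln ((P + S) / P)" for d
 define G where "G d = S * d * slide_time S P d" for d
 let ?r = "\<lambda>d. exp (- (G d - T d) / 2) - 1"
 have ev: "eventually (\<lambda>d. d > 0 \<and> S * d\<^sup>2 \<ge> 8) at_top"
 proof -
  have "eventually (\<lambda>d. S * d\<^sup>2 \<ge> 8) at_top" using S by real_asymp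
  then show ?thesis using eventually_gt_at_top[of 0] by eventually_elim auto
 qed
 have *: "restitution (c * sqrt (1 + S / P)) S P d = c * ((P + S) / (P * S)) * (1 / d\<^sup>2) * (1 + ?r d)" if d: "d > 0" "S * d\<^sup>2 \<ge> 8" for d
 proof -
  have e: "exp (- (T d / 2)) = sqrt ((P + S) / P) / (S * d\<^sup>2)"
  proof -
   have "exp (- (T d / 2)) = exp (ln ((P + S) / P) / 2 - ln (S * d\<^sup>2))" by (simp add: T_def field_simps)
   also have "\<dots> = exp (ln ((P + S) / P) / 2) / (S * d\<^sup>2)" using S d by (simp add: exp_diff)
   also have "exp (ln ((P + S) / P) / 2) = sqrt ((P + S) / P)"
   proof (rule real_sqrt_unique[symmetric])
    show "(exp (ln ((P + S) / P) / 2))\<^sup>2 = (P + S) / P"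
     using S P by (simp add: power2_eq_square add_pos_pos flip: exp_add)
   qed simp
   finally show ?thesis .
  qed
  have "exp (- (G d / 2)) = exp (- (T d / 2)) * (1 + ?r d)" by (simp add: diff_divide_distrib flip: exp_add)
  then have "restitution (c * sqrt (1 + S / P)) S P d = c * (sqrt (1 + S / P) * sqrt ((P + S) / P)) / (S * d\<^sup>2) * (1 + ?r d)"
   unfolding restitution_def G_def[symmetric] e by (simp add: mult_ac)
  also have "sqrt (1 + S / P) * sqrt ((P + S) / P) = (P + S) / P"
   using P S by (simp add: add_divide_distrib)
  finally show ?thesis by simp
 qed
 show "\<forall>\<^sub>F d in at_top. restitution (c * sqrt (1 + S / P)) S P d = c * ((P + S) / (P * S)) * (1 / d\<^sup>2) * (1 + ?r d)"
  using ev by eventually_elim (use * in blast)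
 define B where "B d = (1 + 8 / (S * d\<^sup>2)) * (T d + 3 * S / (P * (S * d\<^sup>2))) - T d" for d
 have "\<bar>?r d\<bar> \<le> \<bar>B d\<bar>" if d: "d > 0" "S * d\<^sup>2 \<ge> 8" for d
 proof -
  have l: "T d \<le> G d" and u: "G d - T d \<le> B d"
   using slide_time_large[OF S P d] by (auto simp: T_def G_def B_def)
  have "exp (- (G d - T d) / 2) \<le> 1" using l by simp
  moreover have "exp (- (G d - T d) / 2) \<ge> 1 + - (G d - T d) / 2" by (rule exp_ge_add_one_self)
  moreover have "\<bar>E - 1\<bar> \<le> \<bar>B d\<bar>" if "E \<le> 1" "E \<ge> 1 + - (G d - T d) / 2" for E
  proof -
   define u where "u = G d - T d"
   have "- (G d - T d) / 2 = - (u / 2)" unfolding u_def by (rule minus_divide_left[symmetric])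
   then have "1 - u / 2 \<le> E" using that(2) by linarith
   moreover have "0 \<le> u" "u \<le> B d" using l u by (auto simp: u_def)
   ultimately show ?thesis using that(1) by linarith
  qed
  ultimately show ?thesis by blast
 qed
 then have "?r \<in> O[at_top](B)"
  using ev by (intro bigoI[of _ 1]) (auto elim!: eventually_mono)
 also have "B \<in> O[at_top](\<lambda>d. (1 / d\<^sup>2) * ln (1 / d))"
  unfolding B_def T_def using S P by real_asymp
 finally show "?r \<in> O[at_top](\<lambda>d. (1 / d\<^sup>2) * ln (1 / d))" .
qed

subsection \<open>Truncated vector fields\<close>

lemma blip_onD:
 assumes "blip_on UNIV g"
 obtains B where "B \<ge> 0" "\<And>x. \<bar>g x\<bar> \<le> B" "\<And>x y. \<bar>g x - g y\<bar> \<le> B * dist x y"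
proof -
 from assms obtain B where "B \<ge> 0" "\<forall>x\<in>UNIV. \<bar>g x\<bar> \<le> B \<and> (\<forall>y\<in>UNIV. \<bar>g x - g y\<bar> \<le> B * dist x y)"
  unfolding blip_on_def by (elim exE conjE)
 then show ?thesis using that[of B] by simp
qed

lemma blip_comp:
 assumes "blip_on UNIV g" "\<And>x y. dist (h x) (h y) \<le> c * dist x y"
 shows "blip_on S (\<lambda>x. g (h x))"
proof -
 obtain B where B: "B \<ge> 0" "\<And>x. \<bar>g x\<bar> \<le> B" "\<And>x y. \<bar>g x - g y\<bar> \<le> B * dist x y"
  using blip_onD[OF assms(1)] by metis
 show ?thesis unfolding blip_on_def
 proof (intro exI[of _ "B + B * \<bar>c\<bar>"] conjI ballI)
  fix x y
  have "\<bar>g (h x) - g (h y)\<bar> \<le> B * dist (h x) (h y)" by (rule B(3))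
  also have "\<dots> \<le> B * (c * dist x y)" by (rule mult_left_mono[OF assms(2) B(1)])
  also have "\<dots> \<le> B * (\<bar>c\<bar> * dist x y)" by (intro mult_left_mono mult_right_mono B) auto
  also have "\<dots> \<le> (B + B * \<bar>c\<bar>) * dist x y" using B(1) by (simp add: algebra_simps)
  finally show "\<bar>g (h x) - g (h y)\<bar> \<le> (B + B * \<bar>c\<bar>) * dist x y" .
 next
  fix x show "\<bar>g (h x)\<bar> \<le> B + B * \<bar>c\<bar>" using B(2)[of "h x"] B(1) by (simp add: add_increasing2)
 qed (use B in auto)
qed

lemma state_dist_ge:
 fixes x y :: state
 shows "\<bar>st_y x - st_y y\<bar> \<le> dist x y" "\<bar>st_w x - st_w y\<bar> \<le> dist x y" "\<bar>st_th x - st_th y\<bar> \<le> dist x y"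
  "\<bar>st_ph x - st_ph y\<bar> \<le> dist x y" "\<bar>st_v x - st_v y\<bar> \<le> dist x y"
proof -
 note f = dist_fst_le and s = dist_snd_le
 show "\<bar>st_y x - st_y y\<bar> \<le> dist x y" using f[of x y] by (simp only: dist_real_def)
 show "\<bar>st_w x - st_w y\<bar> \<le> dist x y"
  using order_trans[OF f s[of x y]] by (simp only: dist_real_def)
 show "\<bar>st_th x - st_th y\<bar> \<le> dist x y"
  using order_trans[OF order_trans[OF f s] s[of x y]] by (simp only: dist_real_def)
 show "\<bar>st_ph x - st_ph y\<bar> \<le> dist x y"
  using order_trans[OF order_trans[OF order_trans[OF f s] s] s[of x y]] by (simp only: dist_real_def)
 show "\<bar>st_v x - st_v y\<bar> \<le> dist x y"
  using order_trans[OF order_trans[OF order_trans[OF s s] s] s[of x y]] by (simp only: dist_real_def)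
qed

lemma state_dist_le:
 "dist (a1, a2, a3, a4, a5) (b1, b2, b3, b4, b5 :: real) \<le> \<bar>a1 - b1\<bar> + \<bar>a2 - b2\<bar> + \<bar>a3 - b3\<bar> + \<bar>a4 - b4\<bar> + \<bar>a5 - b5\<bar>"
 for a1 a2 a3 a4 a5 b1 b2 b3 b4 :: real
proof -
 have "dist (a1, a2, a3, a4, a5) (b1, b2, b3, b4, b5) \<le> dist a1 b1 + (dist a2 b2 + (dist a3 b3 + (dist a4 b4 + dist a5 b5)))"
  by (rule order_trans[OF dist_Pair_le add_left_mono[OF order_trans[OF dist_Pair_le
   add_left_mono[OF order_trans[OF dist_Pair_le add_left_mono[OF dist_Pair_le]]]]]])
 then show ?thesis by (simp only: dist_real_def add.assoc)
qed

text \<open>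
 The coefficients \<open>B\<close>, \<open>E\<close>, \<open>A\<close> and \<open>P\<close>, \<open>R\<close>, \<open>Q\<close> belong to the equations for \<open>w\<close>, \<open>\<phi>\<close>, \<open>v\<close>, in the
 scaled variables \<open>y / eps\<close> and \<open>t / eps\<close>; clipping \<open>\<phi>\<close> and the contact force makes the field globally
 Lipschitz.
\<close>

locale truncated =
 fixes \<delta> lo M :: real and B E A :: "real \<Rightarrow> real \<Rightarrow> real" and P R Q :: "real \<Rightarrow> real"
 assumes loM: "lo \<le> M" and M: "M > 0"
  and blipB: "blip_on UNIV (\<lambda>x. B (fst x) (clip (- M) M (snd x)))"
  and blipE: "blip_on UNIV (\<lambda>x. E (fst x) (clip (- M) M (snd x)))"
  and blipA: "blip_on UNIV (\<lambda>x. A (fst x) (clip (- M) M (snd x)))"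
  and blipP: "blip_on UNIV P" and blipR: "blip_on UNIV R" and blipQ: "blip_on UNIV Q"
begin

text \<open>With \<open>lo = 0\<close> the clip reproduces the bracket in contact. In sliding
  \<open>lo\<close> is \<open>- M\<close>: the truncated force then stays linear through zero and
  the limit force changes sign at the end of sliding, which makes the end time a transversal
  zero.\<close>

definition force :: "state \<Rightarrow> real" where
 "force x = clip lo M (- st_y x - \<delta> * st_w x)"

definition phc :: "state \<Rightarrow> real" where
 "phc x = clip (- M) M (st_ph x)"

definition fld :: "real \<Rightarrow> state \<Rightarrow> state" where
 "fld eps x = (st_w x, eps * B (st_th x) (phc x) + P (st_th x) * force x, eps * phc x,
   eps * E (st_th x) (phc x) + R (st_th x) * force x, eps * A (st_th x) (phc x) + Q (st_th x) * force x)"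

lemma blip_fld:
 "blip_on UNIV force" "blip_on UNIV phc"
 "blip_on UNIV (\<lambda>x. B (st_th x) (phc x))" "blip_on UNIV (\<lambda>x. E (st_th x) (phc x))" "blip_on UNIV (\<lambda>x. A (st_th x) (phc x))"
 "blip_on UNIV (\<lambda>x::state. P (st_th x))" "blip_on UNIV (\<lambda>x::state. R (st_th x))" "blip_on UNIV (\<lambda>x::state. Q (st_th x))"
proof -
 have "\<bar>(- st_y x - \<delta> * st_w x) - (- st_y y - \<delta> * st_w y)\<bar> \<le> (1 + \<bar>\<delta>\<bar>) * dist x y" for x y :: state
 proof -
  have "(- st_y x - \<delta> * st_w x) - (- st_y y - \<delta> * st_w y) = - (st_y x - st_y y) - \<delta> * (st_w x - st_w y)" by algebra
  then have "\<bar>(- st_y x - \<delta> * st_w x) - (- st_y y - \<delta> * st_w y)\<bar> \<le> \<bar>st_y x - st_y y\<bar> + \<bar>\<delta>\<bar> * \<bar>st_w x - st_w y\<bar>"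
   using abs_triangle_ineq4[of "- (st_y x - st_y y)" "\<delta> * (st_w x - st_w y)"] by (simp only: abs_minus abs_mult)
  also have "\<dots> \<le> dist x y + \<bar>\<delta>\<bar> * dist x y" by (intro add_mono mult_left_mono state_dist_ge) auto
  finally show ?thesis by (simp add: distrib_right)
 qed
 then show "blip_on UNIV force" unfolding force_def using loM by (intro blip_clip)
 show "blip_on UNIV phc" unfolding phc_def using M state_dist_ge(4) by (intro blip_clip[where B = 1]) auto
 have pair: "dist (st_th x, st_ph x) (st_th y, st_ph y) \<le> 2 * dist x y" for x y :: state
  using dist_Pair_le[of "st_th x" "st_ph x" "st_th y" "st_ph y"] state_dist_ge(3,4)[of x y] by (simp add: dist_real_def)
 show "blip_on UNIV (\<lambda>x. B (st_th x) (phc x))" "blip_on UNIV (\<lambda>x. E (st_th x) (phc x))" "blip_on UNIV (\<lambda>x. A (st_th x) (phc x))"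
  using blip_comp[OF blipB pair] blip_comp[OF blipE pair] blip_comp[OF blipA pair] by (simp_all add: phc_def)
 have th: "dist (st_th x) (st_th y) \<le> 1 * dist x y" for x y :: state
  using state_dist_ge(3)[of x y] by (simp add: dist_real_def)
 show "blip_on UNIV (\<lambda>x::state. P (st_th x))" "blip_on UNIV (\<lambda>x::state. R (st_th x))" "blip_on UNIV (\<lambda>x::state. Q (st_th x))"
  by (intro blip_comp[OF _ th] blipP blipQ blipR)+
qed

lemma fld_lipschitz: obtains L where "L-lipschitz_on UNIV (fld eps)"
proof -
 have b: "blip_on UNIV (\<lambda>x. eps * B (st_th x) (phc x) + P (st_th x) * force x)" "blip_on UNIV (\<lambda>x. eps * phc x)"
   "blip_on UNIV (\<lambda>x. eps * E (st_th x) (phc x) + R (st_th x) * force x)" "blip_on UNIV (\<lambda>x. eps * A (st_th x) (phc x) + Q (st_th x) * force x)"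
  by (intro blip_add blip_mult blip_const blip_fld)+
 obtain B1 where B1: "B1 \<ge> 0" "\<And>x y. \<bar>(eps * B (st_th x) (phc x) + P (st_th x) * force x) - (eps * B (st_th y) (phc y) + P (st_th y) * force y)\<bar> \<le> B1 * dist x y"
  using blip_onD[OF b(1)] by metis
 obtain B2 where B2: "B2 \<ge> 0" "\<And>x y. \<bar>eps * phc x - eps * phc y\<bar> \<le> B2 * dist x y"
  using blip_onD[OF b(2)] by metis
 obtain B3 where B3: "B3 \<ge> 0" "\<And>x y. \<bar>(eps * E (st_th x) (phc x) + R (st_th x) * force x) - (eps * E (st_th y) (phc y) + R (st_th y) * force y)\<bar> \<le> B3 * dist x y"
  using blip_onD[OF b(3)] by metis
 obtain B4 where B4: "B4 \<ge> 0" "\<And>x y. \<bar>(eps * A (st_th x) (phc x) + Q (st_th x) * force x) - (eps * A (st_th y) (phc y) + Q (st_th y) * force y)\<bar> \<le> B4 * dist x y"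
  using blip_onD[OF b(4)] by metis
 have "(1 + B1 + B2 + B3 + B4)-lipschitz_on UNIV (fld eps)"
 proof (rule lipschitz_onI)
  fix x y :: state
  have "dist (fld eps x) (fld eps y) \<le> dist x y + B1 * dist x y + B2 * dist x y + B3 * dist x y + B4 * dist x y"
   unfolding fld_def
   by (rule order_trans[OF state_dist_le]) (intro add_mono B1 B2 B3 B4 state_dist_ge)
  then show "dist (fld eps x) (fld eps y) \<le> (1 + B1 + B2 + B3 + B4) * dist x y" by (simp add: distrib_right)
 qed (use B1 B2 B3 B4 in simp)
 then show ?thesis using that by blast
qed

lemma fld_perturbation: "\<exists>K\<ge>0. \<forall>eps\<ge>0. \<forall>x. norm (fld 0 x - fld eps x) \<le> K * eps"
proof -
 obtain B1 where B1: "B1 \<ge> 0" "\<And>x. \<bar>B (st_th x) (phc x)\<bar> \<le> B1" using blip_onD[OF blip_fld(3)] by metis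
 obtain B2 where B2: "B2 \<ge> 0" "\<And>x. \<bar>phc x\<bar> \<le> B2" using blip_onD[OF blip_fld(2)] by metis
 obtain B3 where B3: "B3 \<ge> 0" "\<And>x. \<bar>E (st_th x) (phc x)\<bar> \<le> B3" using blip_onD[OF blip_fld(4)] by metis
 obtain B4 where B4: "B4 \<ge> 0" "\<And>x. \<bar>A (st_th x) (phc x)\<bar> \<le> B4" using blip_onD[OF blip_fld(5)] by metis
 have "norm (fld 0 x - fld eps x) \<le> (B1 + B2 + B3 + B4) * eps" if eps: "eps \<ge> 0" for eps x
 proof -
  have "norm (fld 0 x - fld eps x) = dist (fld 0 x) (fld eps x)" by (simp add: dist_norm)
  also have "\<dots> \<le> 0 + eps * B1 + eps * B2 + eps * B3 + eps * B4"
   unfolding fld_def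
   by (rule order_trans[OF state_dist_le], intro add_mono)
    (use eps B1 B2 B3 B4 in \<open>auto simp: abs_mult mult_left_mono\<close>)
  finally show ?thesis by (simp add: algebra_simps)
 qed
 then show ?thesis using B1 B2 B3 B4 by (intro exI[of _ "B1 + B2 + B3 + B4"]) auto
qed

definition sol :: "real \<Rightarrow> state \<Rightarrow> (real \<Rightarrow> state) \<Rightarrow> bool" where
 "sol eps x X \<longleftrightarrow> X 0 = x \<and> (\<forall>t\<ge>0. (X has_vector_derivative fld eps (X t)) (at t within {0..}))"

lemma sol_exists: "\<exists>X. sol eps x X"
proof -
 obtain L where L: "L-lipschitz_on UNIV (fld eps)" by (rule fld_lipschitz)
 show ?thesis using picard_lindeloef[OF L, of x] unfolding sol_def by metis
qed

lemma sol_deriv: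
 assumes "sol eps x X" "t \<in> {u..v}" "0 \<le> u"
 shows "(X has_vector_derivative fld eps (X t)) (at t within {u..v})"
proof -
 have "(X has_vector_derivative fld eps (X t)) (at t within {0..})" using assms by (simp add: sol_def)
 then show ?thesis by (rule has_vector_derivative_within_subset) (use assms in auto)
qed

lemmas sol_components = has_vector_derivative_components[OF sol_deriv[unfolded fld_def]]

lemma sol_deriv_at:
 assumes "sol eps x X" "0 < t"
 shows "(X has_vector_derivative fld eps (X t)) (at t)"
proof -
 have "at t within {0..t + 1} = at t" by (rule at_within_Icc_at) (use assms in auto)
 moreover have "(X has_vector_derivative fld eps (X t)) (at t within {0..t + 1})"
  by (rule sol_deriv[OF assms(1)]) (use assms in auto)
 ultimately show ?thesis by (simp only:)
qed

lemma sol_continuous: assumes "sol eps x X" shows "continuous_on {0..T} X"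
 unfolding continuous_on_eq_continuous_within
proof
 fix t assume "t \<in> {0..T}"
 from sol_deriv[OF assms this order_refl] show "continuous (at t within {0..T}) X"
  by (rule has_vector_derivative_continuous)
qed

lemma continuous_on_fld: "continuous_on S (fld eps)"
proof -
 obtain L where L: "L-lipschitz_on UNIV (fld eps)" by (rule fld_lipschitz)
 then show ?thesis using lipschitz_on_continuous_on continuous_on_subset by blast
qed

lemma sol_lipschitz: assumes "sol eps x X" shows "\<exists>L. L-lipschitz_on {0..T} X"
proof -
 have "continuous_on {0..T} (\<lambda>t. fld eps (X t))"
  by (rule continuous_on_compose2[OF continuous_on_fld sol_continuous[OF assms]]) auto
 then have "bounded ((\<lambda>t. fld eps (X t)) ` {0..T})" by (intro compact_imp_bounded compact_continuous_image) auto
 then obtain C where C: "C > 0" "\<And>t. t \<in> {0..T} \<Longrightarrow> norm (fld eps (X t)) \<le> C"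
  unfolding bounded_pos by auto
 have "C-lipschitz_on {0..T} X"
 proof (rule bounded_derivative_imp_lipschitz)
  show "(X has_derivative (\<lambda>h. h *\<^sub>R fld eps (X t))) (at t within {0..T})" if "t \<in> {0..T}" for t
   using sol_deriv[OF assms that order_refl] unfolding has_vector_derivative_def .
  show "onorm (\<lambda>h. h *\<^sub>R fld eps (X t)) \<le> C" if "t \<in> {0..T}" for t
  proof (rule onorm_le)
   fix h :: real
   have "norm (h *\<^sub>R fld eps (X t)) = norm (fld eps (X t)) * norm h" by simp
   also have "\<dots> \<le> C * norm h" by (rule mult_right_mono[OF C(2)[OF that] norm_ge_zero])
   finally show "norm (h *\<^sub>R fld eps (X t)) \<le> C * norm h" .
  qed
 qed (use C in auto)
 then show ?thesis by blast
qed

text \<open>Continuous dependence on a fixed scaled time interval, with a field perturbed by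
  \<open>O(eps)\<close> and converging initial states. It serves flight, sliding and release; in
  compression the interval would grow with \<open>ln (1 / eps)\<close>.\<close>

lemma sol_limit:
 assumes X0: "\<And>t. t \<in> {0..T} \<Longrightarrow> (X0 has_vector_derivative fld 0 (X0 t)) (at t within {0..T})"
  and X: "eventually (\<lambda>eps. sol eps (x eps) (X eps)) (at_right 0)"
  and x: "(x \<longlongrightarrow> X0 0) (at_right 0)"
 shows "uniform_limit {0..T} X X0 (at_right 0)"
proof -
 obtain L where L: "L-lipschitz_on UNIV (fld 0)" by (rule fld_lipschitz)
 obtain K where K: "\<And>eps x. eps \<ge> 0 \<Longrightarrow> norm (fld 0 x - fld eps x) \<le> K * eps" using fld_perturbation by blast
 define C where "C = exp ((2 * L + 1) * T)"
 have "((\<lambda>eps. ((norm (X0 0 - x eps))\<^sup>2 + (K * eps)\<^sup>2) * C) \<longlongrightarrow> ((norm (X0 0 - X0 0))\<^sup>2 + (K * 0)\<^sup>2) * C) (at_right 0)"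
  by (intro tendsto_intros x)
 then have lim: "((\<lambda>eps. ((norm (X0 0 - x eps))\<^sup>2 + (K * eps)\<^sup>2) * C) \<longlongrightarrow> 0) (at_right 0)" by simp
 show ?thesis
 proof (rule uniform_limitI)
  fix e :: real assume e: "e > 0"
  have "eventually (\<lambda>eps. ((norm (X0 0 - x eps))\<^sup>2 + (K * eps)\<^sup>2) * C < e\<^sup>2) (at_right 0)"
   using order_tendstoD(2)[OF lim, of "e\<^sup>2"] e by simp
  with X eventually_at_right_less[of "0::real"]
  show "\<forall>\<^sub>F eps in at_right 0. \<forall>t\<in>{0..T}. dist (X eps t) (X0 t) < e"
  proof eventually_elim
   case (elim eps)
   show ?case
   proof
    fix t assume t: "t \<in> {0..T}"
    have "(norm (X0 t - X eps t))\<^sup>2 \<le> ((norm (X0 0 - X eps 0))\<^sup>2 + (K * eps)\<^sup>2) * exp ((2 * L + 1) * T)"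
     by (rule ode_comparison[OF L X0 sol_deriv[OF elim(1)] _ t]) (use K elim(2) in auto)
    then have "(norm (X0 t - X eps t))\<^sup>2 < e\<^sup>2" using elim(1,3) by (simp add: C_def sol_def)
    then show "dist (X eps t) (X0 t) < e" using e by (simp add: dist_norm norm_minus_commute power_less_imp_less_base)
   qed
  qed
 qed
qed

end

subsection \<open>Events and limits\<close>

lemma first_zero:
 fixes h :: "real \<Rightarrow> real"
 assumes "continuous_on {0..T} h" "T > 0" "h 0 > 0" "h T \<le> 0"
 shows "\<exists>t. 0 < t \<and> t \<le> T \<and> h t = 0 \<and> (\<forall>s. 0 \<le> s \<longrightarrow> s < t \<longrightarrow> h s > 0)"
proof -
 define Z where "Z = {t \<in> {0..T}. h t = 0}"
 have "closed Z" unfolding Z_def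
  using continuous_closed_preimage[OF assms(1), of "{0}"] by (simp add: vimage_def Int_def conj_commute)
 moreover have "bounded Z" by (rule bounded_subset[of "{0..T}"]) (auto simp: Z_def)
 ultimately have "compact Z" by (simp add: compact_eq_bounded_closed)
 moreover have "Z \<noteq> {}" using IVT2'[of h T 0 0] assms by (auto simp: Z_def)
 ultimately obtain t where t: "t \<in> Z" "\<And>s. s \<in> Z \<Longrightarrow> t \<le> s" by (metis compact_attains_inf)
 then have tZ: "0 \<le> t" "t \<le> T" "h t = 0" by (simp_all add: Z_def)
 show ?thesis
 proof (intro exI[of _ t] conjI allI impI)
  show "0 < t" using tZ assms(3) by (metis less_eq_real_def less_irrefl)
  fix s assume s: "0 \<le> s" "s < t"
  show "h s > 0"
  proof (rule ccontr)
   assume "\<not> h s > 0"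
   then have hs: "h s \<le> 0" by simp
   have "continuous_on {0..s} h" by (rule continuous_on_subset[OF assms(1)]) (use s tZ in auto)
   then obtain r where r: "0 \<le> r" "r \<le> s" "h r = 0"
    using IVT2'[OF hs less_imp_le[OF assms(3)] s(1)] by blast
   then have "r \<in> Z" using s tZ by (simp add: Z_def)
   then show False using t(2)[of r] s r by linarith
  qed
 qed (use tZ in auto)
qed

text \<open>The limit function is bounded away from zero on every interval that ends before \<tau>,
  so a uniformly close function has no zero there, and it is negative at any fixed time after
  \<tau>, so a zero must already have occurred. A sign change of the limit is thus what makes the
  event times converge.\<close>

lemma first_zero_limit:
 fixes h :: "real \<Rightarrow> real \<Rightarrow> real"
 assumes cont: "eventually (\<lambda>eps. continuous_on {0..T} (h eps)) (at_right 0)"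
  and lim: "uniform_limit {0..T} h h0 (at_right 0)" and c0: "continuous_on {0..T} h0"
  and \<tau>: "0 < \<tau>" "\<tau> < T"
  and pos: "\<And>t. 0 \<le> t \<Longrightarrow> t < \<tau> \<Longrightarrow> h0 t > 0" and neg: "\<And>t. \<tau> < t \<Longrightarrow> t \<le> T \<Longrightarrow> h0 t < 0"
 obtains S where "(S \<longlongrightarrow> \<tau>) (at_right 0)"
  "eventually (\<lambda>eps. 0 < S eps \<and> S eps \<le> T \<and> h eps (S eps) = 0 \<and> (\<forall>s. 0 \<le> s \<longrightarrow> s < S eps \<longrightarrow> h eps s > 0)) (at_right 0)"
proof -
 have pt: "((\<lambda>eps. h eps t) \<longlongrightarrow> h0 t) (at_right 0)" if "t \<in> {0..T}" for t
  using tendsto_uniform_limitI[OF lim that] .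
 have "eventually (\<lambda>eps. h eps 0 > 0) (at_right 0)" using order_tendstoD(1)[OF pt[of 0] pos[of 0]] \<tau> by simp
 moreover have "eventually (\<lambda>eps. h eps T < 0) (at_right 0)" using order_tendstoD(2)[OF pt[of T] neg[of T]] \<tau> by simp
 ultimately have "eventually (\<lambda>eps. \<exists>S. 0 < S \<and> S \<le> T \<and> h eps S = 0 \<and> (\<forall>s. 0 \<le> s \<longrightarrow> s < S \<longrightarrow> h eps s > 0)) (at_right 0)"
  using cont
 proof eventually_elim
  case (elim eps)
  have T: "T > 0" using \<tau> by simp
  show ?case by (rule first_zero[where h = "h eps" and T = T, OF elim(3) T elim(1) less_imp_le[OF elim(2)]])
 qed
 then obtain S where S: "eventually (\<lambda>eps. 0 < S eps \<and> S eps \<le> T \<and> h eps (S eps) = 0 \<and> (\<forall>s. 0 \<le> s \<longrightarrow> s < S eps \<longrightarrow> h eps s > 0)) (at_right 0)"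
  unfolding eventually_ex by blast
 have "(S \<longlongrightarrow> \<tau>) (at_right 0)"
 proof (rule order_tendstoI)
  fix a assume a: "a < \<tau>"
  define b where "b = max a 0"
  have b: "0 \<le> b" "b < \<tau>" "a \<le> b" using a \<tau> by (auto simp: b_def)
  have "continuous_on {0..b} h0" using continuous_on_subset[OF c0] b \<tau> by auto
  then obtain z where z: "z \<in> {0..b}" "\<And>t. t \<in> {0..b} \<Longrightarrow> h0 z \<le> h0 t"
   using continuous_attains_inf[of "{0..b}" h0] b by fastforce
  have "h0 z > 0" using pos z b by auto
  with uniform_limitD[OF lim] have "eventually (\<lambda>eps. \<forall>t\<in>{0..T}. dist (h eps t) (h0 t) < h0 z) (at_right 0)" by blast
  with S show "eventually (\<lambda>eps. a < S eps) (at_right 0)"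
  proof eventually_elim
   case (elim eps)
   show ?case
   proof (rule ccontr)
    assume "\<not> a < S eps"
    then have "S eps \<in> {0..b}" "S eps \<in> {0..T}" using elim(1) b by auto
    then have "dist (h eps (S eps)) (h0 (S eps)) < h0 z" "h0 z \<le> h0 (S eps)" using elim(2) z(2) by auto
    then show False using elim(1) by (simp add: dist_real_def abs_less_iff)
   qed
  qed
 next
  fix a assume a: "\<tau> < a"
  define b where "b = min a T"
  have b: "\<tau> < b" "b \<le> T" "b \<le> a" using a \<tau> by (auto simp: b_def)
  have "eventually (\<lambda>eps. h eps b < 0) (at_right 0)" using order_tendstoD(2)[OF pt[of b] neg[OF b(1,2)]] b \<tau> by auto
  with S show "eventually (\<lambda>eps. S eps < a) (at_right 0)"
  proof eventually_elim
   case (elim eps)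
   have "b \<ge> 0" using b \<tau> by linarith
   then have "b < S eps \<Longrightarrow> 0 < h eps b" using elim(1) by blast
   then have "\<not> b < S eps" using elim(2) by linarith
   moreover have "b \<noteq> S eps"
   proof
    assume "b = S eps"
    then show False using elim by simp
   qed
   ultimately show ?case using b(3) by linarith
  qed
 qed
 then show ?thesis using S that by blast
qed

lemma uniform_limit_at_event:
 fixes X :: "real \<Rightarrow> real \<Rightarrow> 'a::metric_space"
 assumes lim: "uniform_limit {0..T} X X0 (at_right 0)" and c0: "continuous_on {0..T} X0"
  and S: "(S \<longlongrightarrow> \<tau>) (at_right 0)" "eventually (\<lambda>eps. 0 \<le> S eps \<and> S eps \<le> T) (at_right 0)" and \<tau>: "\<tau> \<in> {0..T}"
 shows "((\<lambda>eps. X eps (S eps)) \<longlongrightarrow> X0 \<tau>) (at_right 0)"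
proof (rule tendstoI)
 fix e :: real assume e: "e > 0"
 have "((\<lambda>eps. X0 (S eps)) \<longlongrightarrow> X0 \<tau>) (at_right 0)"
 proof (rule continuous_on_tendsto_compose[OF c0 S(1) \<tau>])
  show "eventually (\<lambda>eps. S eps \<in> {0..T}) (at_right 0)" using S(2) by eventually_elim auto
 qed
 then have "eventually (\<lambda>eps. dist (X0 (S eps)) (X0 \<tau>) < e / 2) (at_right 0)" using e by (intro tendstoD) auto
 moreover have "eventually (\<lambda>eps. \<forall>t\<in>{0..T}. dist (X eps t) (X0 t) < e / 2) (at_right 0)"
  using e by (intro uniform_limitD[OF lim]) auto
 ultimately show "eventually (\<lambda>eps. dist (X eps (S eps)) (X0 \<tau>) < e) (at_right 0)"
  using S(2)
 proof eventually_elim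
  case (elim eps)
  then have "dist (X eps (S eps)) (X0 (S eps)) < e / 2" by auto
  then show ?case using elim(1) dist_triangle[of "X eps (S eps)" "X0 \<tau>" "X0 (S eps)"] by linarith
 qed
qed

subsection \<open>Concatenation and rescaling of solution pieces\<close>

text \<open>The field in the time \<open>t / eps\<close> with \<open>y / eps\<close> as first
  coordinate. In these variables the bracket is \<open>eps * normal_force\<close>, of order one, and
  gravity and centrifugal terms carry the factor \<open>eps\<close>.\<close>

definition sfield :: "real \<Rightarrow> real \<Rightarrow> real \<Rightarrow> real \<Rightarrow> real \<Rightarrow> state \<Rightarrow> state" where
 "sfield \<alpha> \<mu> \<delta> eps s x = (let f = bracket (st_y x) (- st_y x - \<delta> * st_w x); \<theta> = st_th x; \<phi> = st_ph x in
  (st_w x, eps * b_coeff \<theta> \<phi> + p_coeff \<alpha> \<mu> s \<theta> * f, eps * \<phi>, c_coeff \<alpha> \<mu> s \<theta> * f,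
   eps * a_coeff \<theta> \<phi> + q_coeff \<alpha> \<mu> s \<theta> * f))"

definition slip_sign :: "real \<Rightarrow> state \<Rightarrow> bool" where
 "slip_sign s x \<longleftrightarrow> \<bar>s\<bar> \<le> 1 \<and> (st_v x > 0 \<longrightarrow> s = 1) \<and> (st_v x < 0 \<longrightarrow> s = - 1)"

text \<open>A Lipschitz path that satisfies the inclusion off a finite set: enough for a Filippov
  solution, and stable under concatenation, which only adds the junctions as exceptional
  times.\<close>

definition piece :: "real \<Rightarrow> real \<Rightarrow> real \<Rightarrow> real \<Rightarrow> real \<Rightarrow> (real \<Rightarrow> state) \<Rightarrow> bool" where
 "piece \<alpha> \<mu> \<delta> eps T X \<longleftrightarrow> 0 \<le> T \<and> (\<exists>L. L-lipschitz_on {0..T} X) \<and>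
   (\<exists>N. finite N \<and> (\<forall>t\<in>{0<..<T} - N. \<exists>s. slip_sign s (X t) \<and>
    (X has_vector_derivative sfield \<alpha> \<mu> \<delta> eps s (X t)) (at t)))"

definition concat_at :: "real \<Rightarrow> (real \<Rightarrow> 'a) \<Rightarrow> (real \<Rightarrow> 'a) \<Rightarrow> real \<Rightarrow> 'a" where
 "concat_at T X Y t = (if t \<le> T then X t else Y (t - T))"

lemma piece_concat:
 assumes X: "piece \<alpha> \<mu> \<delta> eps T X" and Y: "piece \<alpha> \<mu> \<delta> eps T' Y" and eq: "X T = Y 0"
 shows "piece \<alpha> \<mu> \<delta> eps (T + T') (concat_at T X Y)"
proof -
 obtain L N where T: "0 \<le> T" and L: "L-lipschitz_on {0..T} X" and N: "finite N"
   "\<And>t. t \<in> {0<..<T} - N \<Longrightarrow> \<exists>s. slip_sign s (X t) \<and> (X has_vector_derivative sfield \<alpha> \<mu> \<delta> eps s (X t)) (at t)"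
  using X unfolding piece_def by blast
 obtain L' N' where T': "0 \<le> T'" and L': "L'-lipschitz_on {0..T'} Y" and N': "finite N'"
   "\<And>t. t \<in> {0<..<T'} - N' \<Longrightarrow> \<exists>s. slip_sign s (Y t) \<and> (Y has_vector_derivative sfield \<alpha> \<mu> \<delta> eps s (Y t)) (at t)"
  using Y unfolding piece_def by blast
 have "(max L L')-lipschitz_on {T..T + T'} (\<lambda>t. Y (t - T))"
 proof (rule lipschitz_onI)
  fix x y assume "x \<in> {T..T + T'}" "y \<in> {T..T + T'}"
  then have "dist (Y (x - T)) (Y (y - T)) \<le> L' * dist (x - T) (y - T)" by (intro lipschitz_onD[OF L']) auto
  also have "\<dots> \<le> max L L' * dist x y" by (simp add: dist_real_def mult_right_mono)
  finally show "dist (Y (x - T)) (Y (y - T)) \<le> max L L' * dist x y" .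
 qed (use lipschitz_on_nonneg[OF L] in auto)
 moreover have "(max L L')-lipschitz_on {0..T} X" by (rule lipschitz_on_mono[OF L]) auto
 ultimately have "(max L L')-lipschitz_on {0..T + T'} (\<lambda>t. if t \<le> T then X t else Y (t - T))"
  using eq by (intro lipschitz_on_concat) auto
 then have lip: "(max L L')-lipschitz_on {0..T + T'} (concat_at T X Y)" by (simp add: concat_at_def[abs_def])
 have dd: "\<exists>s. slip_sign s (concat_at T X Y t) \<and> (concat_at T X Y has_vector_derivative sfield \<alpha> \<mu> \<delta> eps s (concat_at T X Y t)) (at t)"
  if t: "t \<in> {0<..<T + T'} - (N \<union> {T} \<union> (\<lambda>t. t + T) ` N')" for t
 proof (cases "t < T")
  case True
  then obtain s where s: "slip_sign s (X t)" "(X has_vector_derivative sfield \<alpha> \<mu> \<delta> eps s (X t)) (at t)" using N(2)[of t] t by auto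
  have "(concat_at T X Y has_vector_derivative sfield \<alpha> \<mu> \<delta> eps s (X t)) (at t)"
   by (rule has_vector_derivative_transform_within[OF s(2), of "T - t"]) (use True in \<open>auto simp: concat_at_def dist_real_def\<close>)
  then show ?thesis using s(1) True by (auto simp: concat_at_def)
 next
  case False
  then have tT: "t > T" using t by auto
  have "t - T \<notin> N'" using t by force
  then obtain s where s: "slip_sign s (Y (t - T))" "(Y has_vector_derivative sfield \<alpha> \<mu> \<delta> eps s (Y (t - T))) (at (t - T))" using N'(2)[of "t - T"] t tT by auto
  have "((\<lambda>t. t - T) has_vector_derivative 1) (at t)" by (auto intro!: derivative_eq_intros)
  from vector_diff_chain_at[OF this s(2)]
  have "((\<lambda>t. Y (t - T)) has_vector_derivative sfield \<alpha> \<mu> \<delta> eps s (Y (t - T))) (at t)" by (simp add: o_def)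
  then have "(concat_at T X Y has_vector_derivative sfield \<alpha> \<mu> \<delta> eps s (Y (t - T))) (at t)"
   by (rule has_vector_derivative_transform_within[where d = "t - T"]) (use tT in \<open>auto simp: concat_at_def dist_real_def\<close>)
  then show ?thesis using s(1) tT by (auto simp: concat_at_def)
 qed
 have fin: "finite (N \<union> {T} \<union> (\<lambda>t. t + T) ` N')" using N(1) N'(1) by simp
 have "\<exists>N. finite N \<and> (\<forall>t\<in>{0<..<T + T'} - N. \<exists>s. slip_sign s (concat_at T X Y t) \<and>
   (concat_at T X Y has_vector_derivative sfield \<alpha> \<mu> \<delta> eps s (concat_at T X Y t)) (at t))"
  by (intro exI[of _ "N \<union> {T} \<union> (\<lambda>t. t + T) ` N'"] conjI ballI fin) (rule dd)
 moreover have "0 \<le> T + T'" using T T' by simp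
 ultimately show ?thesis unfolding piece_def using lip by (intro conjI) (assumption | rule exI)+
qed

definition unscale :: "real \<Rightarrow> state \<Rightarrow> state" where
 "unscale eps x = (eps * st_y x, snd x)"

lemma unscale_sfield:
 assumes "eps > 0"
 shows "(1 / eps) *\<^sub>R (eps * st_y (sfield \<alpha> \<mu> \<delta> eps s x), snd (sfield \<alpha> \<mu> \<delta> eps s x)) = vfield \<alpha> \<mu> \<delta> eps s (unscale eps x)"
proof -
 obtain y w \<theta> \<phi> v where x: "x = (y, w, \<theta>, \<phi>, v)" by (metis prod.exhaust)
 have "bracket (eps * y) f = bracket y f" for f using assms by (simp add: bracket_def zero_less_mult_iff)
 then show ?thesis using assms
  by (simp add: x unscale_def sfield_def Let_def normal_force_def field_simps)
qed

lemma piece_filippov_solution: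
 assumes X: "piece \<alpha> \<mu> \<delta> eps T X" and eps: "eps > 0"
 shows "filippov_solution (filippov_field \<alpha> \<mu> \<delta> eps) (unscale eps (X 0)) (eps * T) (\<lambda>t. unscale eps (X (t / eps)))"
proof -
 obtain L N where T: "0 \<le> T" and L: "L-lipschitz_on {0..T} X" and N: "finite N"
   "\<And>t. t \<in> {0<..<T} - N \<Longrightarrow> \<exists>s. slip_sign s (X t) \<and> (X has_vector_derivative sfield \<alpha> \<mu> \<delta> eps s (X t)) (at t)"
  using X unfolding piece_def by blast
 let ?Z = "\<lambda>t. unscale eps (X (t / eps))"
 have ud: "dist (unscale eps x) (unscale eps y) \<le> (eps + 1) * dist x y" for x y
 proof -
  have "dist (unscale eps x) (unscale eps y) \<le> dist (eps * st_y x) (eps * st_y y) + dist (snd x) (snd y)"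
   unfolding unscale_def by (rule dist_Pair_le)
  also have "dist (eps * st_y x) (eps * st_y y) = eps * \<bar>st_y x - st_y y\<bar>"
   using eps by (simp add: dist_real_def abs_mult flip: right_diff_distrib)
  also have "\<dots> \<le> eps * dist x y" using eps by (intro mult_left_mono state_dist_ge) auto
  also have "dist (snd x) (snd y) \<le> dist x y" by (rule dist_snd_le)
  finally show ?thesis by (simp add: distrib_right)
 qed
 have "((eps + 1) * L / eps)-lipschitz_on {0..eps * T} ?Z"
 proof (rule lipschitz_onI)
  fix x y assume "x \<in> {0..eps * T}" "y \<in> {0..eps * T}"
  then have xy: "x / eps \<in> {0..T}" "y / eps \<in> {0..T}" using eps by (auto simp: field_simps)
  have "dist (?Z x) (?Z y) \<le> (eps + 1) * dist (X (x / eps)) (X (y / eps))" by (rule ud)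
  also have "\<dots> \<le> (eps + 1) * (L * dist (x / eps) (y / eps))" using eps lipschitz_onD[OF L xy] by (intro mult_left_mono) auto
  also have "dist (x / eps) (y / eps) = dist x y / eps" using eps by (simp add: dist_real_def flip: diff_divide_distrib)
  finally show "dist (?Z x) (?Z y) \<le> (eps + 1) * L / eps * dist x y" by simp
 qed (use lipschitz_on_nonneg[OF L] eps in simp)
 then have ac: "abs_continuous_on_Icc 0 (eps * T) ?Z" by (rule AC_lipschitz)
 have "\<exists>D\<in>filippov_field \<alpha> \<mu> \<delta> eps (?Z t). (?Z has_vector_derivative D) (at t within {0..eps * T})"
  if t: "t \<in> {0..eps * T} - ({0, eps * T} \<union> (\<lambda>t. eps * t) ` N)" for t
 proof -
  have "t / eps \<notin> N" using t eps by force
  moreover have "t / eps \<in> {0<..<T}" using t eps by (auto simp: field_simps)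
  ultimately obtain s where s: "slip_sign s (X (t / eps))" and d: "(X has_vector_derivative sfield \<alpha> \<mu> \<delta> eps s (X (t / eps))) (at (t / eps))"
   using N(2)[of "t / eps"] by auto
  have "((\<lambda>t. t / eps) has_real_derivative 1 / eps) (at t)"
   by (rule DERIV_cdivide[OF DERIV_ident])
  then have "((\<lambda>t. t / eps) has_vector_derivative 1 / eps) (at t)"
   by (simp only: has_real_derivative_iff_has_vector_derivative)
  from vector_diff_chain_at[OF this d]
  have d1: "((\<lambda>t. X (t / eps)) has_vector_derivative (1 / eps) *\<^sub>R sfield \<alpha> \<mu> \<delta> eps s (X (t / eps))) (at t)" by (simp add: o_def)
  have "bounded_linear (unscale eps)"
   unfolding unscale_def
   by (intro bounded_linear_Pair bounded_linear_const_mult bounded_linear_fst bounded_linear_snd)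
  from bounded_linear.has_vector_derivative[OF this d1]
  have "(?Z has_vector_derivative unscale eps ((1 / eps) *\<^sub>R sfield \<alpha> \<mu> \<delta> eps s (X (t / eps)))) (at t)" .
  also have "unscale eps ((1 / eps) *\<^sub>R sfield \<alpha> \<mu> \<delta> eps s (X (t / eps))) = vfield \<alpha> \<mu> \<delta> eps s (?Z t)"
   unfolding unscale_sfield[OF eps, symmetric] by (simp add: unscale_def)
  finally have d2: "(?Z has_vector_derivative vfield \<alpha> \<mu> \<delta> eps s (?Z t)) (at t within {0..eps * T})"
   by (rule has_vector_derivative_at_within)
  have "vfield \<alpha> \<mu> \<delta> eps s (?Z t) \<in> filippov_field \<alpha> \<mu> \<delta> eps (?Z t)"
   unfolding filippov_field_iff using s by (intro exI[of _ s]) (simp add: slip_sign_def unscale_def)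
  then show ?thesis using d2 by blast
 qed
 moreover have "negligible ({0, eps * T} \<union> (\<lambda>t. eps * t) ` N)" using N(1) by (intro negligible_finite) simp
 ultimately have "\<exists>N. negligible N \<and> (\<forall>t\<in>{0..eps * T} - N. \<exists>D\<in>filippov_field \<alpha> \<mu> \<delta> eps (?Z t). (?Z has_vector_derivative D) (at t within {0..eps * T}))"
  by blast
 moreover have "?Z 0 = unscale eps (X 0)" by simp
 ultimately show ?thesis unfolding filippov_solution_def using ac by (intro conjI)
qed

subsection \<open>The compression phase with positive slip\<close>

lemma increasing_on_subinterval:
 fixes g :: "real \<Rightarrow> real"
 assumes "\<And>t. t \<in> {0..H} \<Longrightarrow> (g has_real_derivative g' t) (at t within {0..H})"
  and "0 \<le> r" "r \<le> s" "s \<le> H" "\<And>t. r \<le> t \<Longrightarrow> t \<le> s \<Longrightarrow> g' t \<ge> 0"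
 shows "g r \<le> g s"
proof (rule increasing_from_derivative[OF assms(3)])
 show "(g has_real_derivative g' t) (at t within {r..s})" if "t \<in> {r..s}" for t
  by (rule DERIV_subset[OF assms(1)]) (use that assms in auto)
 show "0 \<le> g' t" if "t \<in> {r..s}" for t using assms(5)[of t] that by simp
qed

text \<open>Over times of order \<open>ln (1 / eps)\<close> a Gronwall bound would lose a power of
  \<open>eps\<close>. Comparing an increment with a multiple of the impulse \<open>F\<close> gives
  an error that grows only linearly in time, with the factor \<open>e\<close>.\<close>

lemma increment_approximation:
 fixes g F c h f :: "real \<Rightarrow> real"
 assumes S: "0 \<le> S" "S \<le> H" and e: "e \<ge> 0"
  and dg: "\<And>t. t \<in> {0..H} \<Longrightarrow> (g has_real_derivative e * c t + h t * f t) (at t within {0..H})"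
  and dF: "\<And>t. t \<in> {0..H} \<Longrightarrow> (F has_real_derivative f t) (at t within {0..H})"
  and F0: "F 0 = 0"
  and c: "\<And>t. 0 \<le> t \<Longrightarrow> t \<le> S \<Longrightarrow> \<bar>c t\<bar> \<le> C" and h: "\<And>t. 0 \<le> t \<Longrightarrow> t \<le> S \<Longrightarrow> \<bar>h t - h0\<bar> \<le> \<eta>"
  and f: "\<And>t. 0 \<le> t \<Longrightarrow> t \<le> S \<Longrightarrow> f t \<ge> 0"
 shows "\<bar>g S - g 0 - h0 * F S\<bar> \<le> e * C * S + \<eta> * F S"
proof -
 have 1: "e * C * 0 + (h0 + \<eta>) * F 0 - g 0 \<le> e * C * S + (h0 + \<eta>) * F S - g S"
 proof (rule increasing_on_subinterval[OF _ order_refl S, of "\<lambda>t. e * C * t + (h0 + \<eta>) * F t - g t"])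
  show "((\<lambda>t. e * C * t + (h0 + \<eta>) * F t - g t) has_real_derivative e * C + (h0 + \<eta>) * f t - (e * c t + h t * f t)) (at t within {0..H})"
   if "t \<in> {0..H}" for t
   by (rule derivative_eq_intros dg[OF that] dF[OF that] refl)+ simp
  fix t assume t: "0 \<le> t" "t \<le> S"
  have "e * c t \<le> e * C" using c[OF t] e by (intro mult_left_mono) auto
  moreover have "h t * f t \<le> (h0 + \<eta>) * f t" using h[OF t] f[OF t] by (intro mult_right_mono) auto
  ultimately show "0 \<le> e * C + (h0 + \<eta>) * f t - (e * c t + h t * f t)" by linarith
 qed
 have 2: "g 0 + e * C * 0 - (h0 - \<eta>) * F 0 \<le> g S + e * C * S - (h0 - \<eta>) * F S"
 proof (rule increasing_on_subinterval[OF _ order_refl S, of "\<lambda>t. g t + e * C * t - (h0 - \<eta>) * F t"])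
  show "((\<lambda>t. g t + e * C * t - (h0 - \<eta>) * F t) has_real_derivative (e * c t + h t * f t) + e * C - (h0 - \<eta>) * f t) (at t within {0..H})"
   if "t \<in> {0..H}" for t
   by (rule derivative_eq_intros dg[OF that] dF[OF that] refl)+ simp
  fix t assume t: "0 \<le> t" "t \<le> S"
  have "e * (- C) \<le> e * c t" using c[OF t] e by (intro mult_left_mono) auto
  moreover have "(h0 - \<eta>) * f t \<le> h t * f t" using h[OF t] f[OF t] by (intro mult_right_mono) auto
  ultimately show "0 \<le> (e * c t + h t * f t) + e * C - (h0 - \<eta>) * f t" by simp
 qed
 have "(h0 + \<eta>) * F S = h0 * F S + \<eta> * F S" "(h0 - \<eta>) * F S = h0 * F S - \<eta> * F S" by (simp_all add: algebra_simps)
 then show ?thesis using 1 2 F0 by (simp add: abs_le_iff)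
qed

lemma stable_coordinate_upper:
 fixes D :: "real \<Rightarrow> real"
 assumes S: "0 \<le> S" "S \<le> H" and \<beta>: "\<beta> > 0"
  and dD: "\<And>t. t \<in> {0..H} \<Longrightarrow> (D has_real_derivative D' t) (at t within {0..H})"
  and D': "\<And>t. 0 \<le> t \<Longrightarrow> t \<le> S \<Longrightarrow> D' t \<le> - \<beta> * D t + \<kappa>" and \<kappa>: "\<kappa> \<ge> 0"
 shows "D S \<le> \<bar>D 0\<bar> + \<kappa> / \<beta>"
proof -
 have "exp (\<beta> * 0) * (\<kappa> / \<beta> - D 0) \<le> exp (\<beta> * S) * (\<kappa> / \<beta> - D S)"
 proof (rule increasing_on_subinterval[OF _ order_refl S, of "\<lambda>t. exp (\<beta> * t) * (\<kappa> / \<beta> - D t)"])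
  show "((\<lambda>t. exp (\<beta> * t) * (\<kappa> / \<beta> - D t)) has_real_derivative exp (\<beta> * t) * (\<kappa> - \<beta> * D t - D' t)) (at t within {0..H})"
   if "t \<in> {0..H}" for t
   by (rule derivative_eq_intros dD[OF that] refl)+ (use \<beta> in \<open>simp add: field_simps\<close>)
  show "0 \<le> exp (\<beta> * t) * (\<kappa> - \<beta> * D t - D' t)" if "0 \<le> t" "t \<le> S" for t
   using D'[OF that] by (intro mult_nonneg_nonneg) auto
 qed
 then have "exp (- (\<beta> * S)) * (\<kappa> / \<beta> - D 0) \<le> exp (- (\<beta> * S)) * (exp (\<beta> * S) * (\<kappa> / \<beta> - D S))"
  by (intro mult_left_mono) auto
 also have "\<dots> = \<kappa> / \<beta> - D S" by (simp add: exp_minus)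
 finally have "D S \<le> \<kappa> / \<beta> - exp (- (\<beta> * S)) * (\<kappa> / \<beta> - D 0)" by simp
 moreover have "- \<bar>D 0\<bar> \<le> exp (- (\<beta> * S)) * (\<kappa> / \<beta> - D 0)"
 proof -
  have "exp (- (\<beta> * S)) * \<bar>D 0\<bar> \<le> 1 * \<bar>D 0\<bar>" using \<beta> S by (intro mult_right_mono) auto
  moreover have "exp (- (\<beta> * S)) * (- \<bar>D 0\<bar>) \<le> exp (- (\<beta> * S)) * (\<kappa> / \<beta> - D 0)"
  proof (intro mult_left_mono)
   have "\<kappa> / \<beta> \<ge> 0" using \<kappa> \<beta> by simp
   then show "- \<bar>D 0\<bar> \<le> \<kappa> / \<beta> - D 0" by linarith
  qed simp
  ultimately show ?thesis by simp
 qed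
 ultimately show ?thesis by linarith
qed

text \<open>The bound does not depend on the length of the interval, because the defect is damped at
  the rate \<beta>. It is what keeps \<open>y - w / \<lambda>\<close> small during the long
  compression, where \<lambda> is the unstable eigenvalue.\<close>

lemma stable_coordinate:
 fixes D :: "real \<Rightarrow> real"
 assumes S: "0 \<le> S" "S \<le> H" and \<beta>: "\<beta> > 0"
  and dD: "\<And>t. t \<in> {0..H} \<Longrightarrow> (D has_real_derivative D' t) (at t within {0..H})"
  and D': "\<And>t. 0 \<le> t \<Longrightarrow> t \<le> S \<Longrightarrow> \<bar>D' t + \<beta> * D t\<bar> \<le> \<kappa>" and \<kappa>: "\<kappa> \<ge> 0"
 shows "\<bar>D S\<bar> \<le> \<bar>D 0\<bar> + \<kappa> / \<beta>"
proof -
 have "D S \<le> \<bar>D 0\<bar> + \<kappa> / \<beta>"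
 proof (rule stable_coordinate_upper[OF S \<beta> dD _ \<kappa>])
  show "D' t \<le> - \<beta> * D t + \<kappa>" if "0 \<le> t" "t \<le> S" for t using D'[OF that] by (simp add: abs_le_iff)
 qed
 moreover have "- D S \<le> \<bar>- D 0\<bar> + \<kappa> / \<beta>"
 proof (rule stable_coordinate_upper[OF S \<beta> DERIV_minus[OF dD] _ \<kappa>])
  show "- D' t \<le> - \<beta> * - D t + \<kappa>" if "0 \<le> t" "t \<le> S" for t using D'[OF that] by (simp add: abs_le_iff)
 qed
 ultimately show ?thesis by simp
qed

text \<open>In terms of the depth \<open>X = - y\<close>, the speed \<open>u = - w\<close> and the
  impulse \<open>F\<close>, the speed is at least a multiple of \<open>F\<close>, so
  \<open>F\<close> grows exponentially from a seed of order \<open>eps\<close>, while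
  \<open>v > 0\<close> forces \<open>F \<le> V2 / qm\<close>. By \<open>grow\<close> both cannot
  last up to \<open>H\<close>, so \<open>v\<close> vanishes before. The term \<open>KF * F t\<close>
  allows for \<phi> changing with the impulse, which may destroy the sign of \<open>b\<close>;
  \<open>M1\<close> to \<open>M3\<close> keep the upper clip inactive.\<close>

lemma compression_estimates:
 fixes X u v F f P Q b a :: "real \<Rightarrow> real"
 assumes dX: "\<And>t. t \<in> {0..H} \<Longrightarrow> (X has_real_derivative u t) (at t within {0..H})"
  and du: "\<And>t. t \<in> {0..H} \<Longrightarrow> (u has_real_derivative - (eps * b t) + P t * f t) (at t within {0..H})"
  and dv: "\<And>t. t \<in> {0..H} \<Longrightarrow> (v has_real_derivative eps * a t - Q t * f t) (at t within {0..H})"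
  and dF: "\<And>t. t \<in> {0..H} \<Longrightarrow> (F has_real_derivative f t) (at t within {0..H})"
  and f: "\<And>t. t \<in> {0..H} \<Longrightarrow> f t = clip 0 M (X t + \<delta> * u t)"
  and init: "X 0 = 0" "u 0 \<ge> 0" "F 0 = 0" "v 0 > 0"
  and P: "\<And>t. t \<in> {0..H} \<Longrightarrow> Pm \<le> P t \<and> P t \<le> PM" and Q: "\<And>t. t \<in> {0..H} \<Longrightarrow> qm \<le> Q t"
  and bB: "\<And>t. t \<in> {0..H} \<Longrightarrow> \<bar>b t\<bar> \<le> BB" and aB: "\<And>t. t \<in> {0..H} \<Longrightarrow> \<bar>a t\<bar> \<le> BA"
  and bm: "\<And>t. t \<in> {0..H} \<Longrightarrow> b t \<le> - bm + KF * F t"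
  and pos: "eps > 0" "\<delta> > 0" "Pm > 0" "qm > 0" "bm > 0" "KF \<ge> 0" "M > 0" "H \<ge> 1"
  and sm1: "eps * KF * H \<le> Pm / 2" and sm2: "v 0 + eps * BA * H \<le> V2" and sm3: "\<delta> * (eps * bm * H) \<le> 1"
  and sm4: "u 0 + eps * BB * H + PM * (V2 / qm) \<le> Um" and sm5: "2 / (Pm * \<delta>) * (eps * BB * H) \<le> 1"
  and M1: "\<delta> * Pm / 2 * (V2 / qm) + 1 \<le> M" and M2: "Um * \<delta> \<le> M" and M3: "(2 / (Pm * \<delta>) + \<delta>) * Um + 1 \<le> M"
  and grow: "\<delta> * eps * bm / 2 * exp (\<delta> * Pm / 2 * (H - 1)) > V2 / qm"
 shows "\<exists>S. 0 < S \<and> S \<le> H \<and> v S = 0 \<and> (\<forall>s. 0 \<le> s \<longrightarrow> s < S \<longrightarrow> v s > 0) \<and> (\<forall>s. 0 < s \<longrightarrow> s \<le> S \<longrightarrow> X s > 0) \<and>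
   (\<forall>s. 0 \<le> s \<longrightarrow> s \<le> S \<longrightarrow> 0 \<le> u s \<and> u s \<le> Um \<and> 0 \<le> X s \<and> X s \<le> M \<and> f s = X s + \<delta> * u s \<and> 0 \<le> F s \<and> F s \<le> V2 / qm)"
proof -
 have f0: "f t \<ge> 0" "f t \<le> M" if "t \<in> {0..H}" for t
  using f[OF that] clip_bounds[of 0 M] pos(7) by auto
 have Fmono: "F r \<le> F s" if "0 \<le> r" "r \<le> s" "s \<le> H" for r s
  by (rule increasing_on_subinterval[OF dF that]) (use f0 that in auto)
 have Fnn: "F s \<ge> 0" if "0 \<le> s" "s \<le> H" for s using Fmono[OF order_refl that] init by simp
 have ulow: "eps * bm * s + Pm / 2 * F s \<le> u s" if s: "0 \<le> s" "s \<le> H" for s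
 proof -
  \<comment> \<open>The impulse in the bound for \<open>b\<close> is frozen at its value at the end
    time \<open>s\<close>, the largest one, so that \<open>G\<close> has a nonnegative derivative;
    \<open>sm1\<close> then lets half of \<open>Pm * F s\<close> absorb the last term.\<close>
  define G where "G r = u r - eps * bm * r - Pm * F r + eps * KF * F s * r" for r
  have "G 0 \<le> G s"
  proof (rule increasing_on_subinterval[OF _ order_refl s])
   show "(G has_real_derivative (- (eps * b t) + P t * f t) - eps * bm - Pm * f t + eps * KF * F s) (at t within {0..H})" if "t \<in> {0..H}" for t
    unfolding G_def by (rule derivative_eq_intros du[OF that] dF[OF that] refl)+ simp
   fix t assume t: "0 \<le> t" "t \<le> s"
   then have tH: "t \<in> {0..H}" using s by simp
   have "KF * F t \<le> KF * F s" using Fmono[OF t s(2)] pos by (intro mult_left_mono) auto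
   then have "b t \<le> - bm + KF * F s" using bm[OF tH] by linarith
   then have "eps * b t \<le> eps * (- bm + KF * F s)" using pos by (intro mult_left_mono) auto
   moreover have "Pm * f t \<le> P t * f t" using P[OF tH] f0[OF tH] by (intro mult_right_mono) auto
   ultimately show "0 \<le> (- (eps * b t) + P t * f t) - eps * bm - Pm * f t + eps * KF * F s" by (simp add: algebra_simps)
  qed
  then have "eps * bm * s + Pm * F s - eps * KF * F s * s \<le> u s" using init by (simp add: G_def)
  moreover have "(eps * KF * s) * F s \<le> (Pm / 2) * F s"
  proof (rule mult_right_mono[OF _ Fnn[OF s]])
   have "eps * KF * s \<le> eps * KF * H" using s pos by (intro mult_left_mono) auto
   then show "eps * KF * s \<le> Pm / 2" using sm1 by simp
  qed
  ultimately show ?thesis by (simp add: mult_ac)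
 qed
 have unn: "u s \<ge> 0" if s: "0 \<le> s" "s \<le> H" for s
 proof -
  have "0 \<le> eps * bm * s" "0 \<le> Pm / 2 * F s" using pos s Fnn[OF s] by auto
  then show ?thesis using ulow[OF s] by linarith
 qed
 have Xlow: "eps * bm / 2 * s\<^sup>2 \<le> X s" if s: "0 \<le> s" "s \<le> H" for s
 proof -
  have "X 0 - eps * bm / 2 * 0\<^sup>2 \<le> X s - eps * bm / 2 * s\<^sup>2"
  proof (rule increasing_on_subinterval[OF _ order_refl s, of "\<lambda>t. X t - eps * bm / 2 * t\<^sup>2"])
   show "((\<lambda>t. X t - eps * bm / 2 * t\<^sup>2) has_real_derivative u t - eps * bm * t) (at t within {0..H})" if "t \<in> {0..H}" for t
    by (rule derivative_eq_intros dX[OF that] refl)+ simp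
   fix t assume t: "0 \<le> t" "t \<le> s"
   then have "0 \<le> Pm / 2 * F t" using pos s Fnn[of t] by auto
   then show "0 \<le> u t - eps * bm * t" using ulow[of t] t s by simp
  qed
  then show ?thesis using init by simp
 qed
 have Xnn: "X s \<ge> 0" if s: "0 \<le> s" "s \<le> H" for s
 proof -
  have "0 \<le> eps * bm / 2 * s\<^sup>2" using pos by simp
  then show ?thesis using Xlow[OF s] by linarith
 qed
 have Xpos: "X s > 0" if s: "0 < s" "s \<le> H" for s
 proof -
  have "0 < eps * bm / 2 * s\<^sup>2" using pos s by simp
  then show ?thesis using Xlow[of s] s by linarith
 qed
 have vup: "v s \<le> v 0 + eps * BA * s - qm * F s" if s: "0 \<le> s" "s \<le> H" for s
 proof -
  have "eps * BA * 0 - qm * F 0 - v 0 \<le> eps * BA * s - qm * F s - v s"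
  proof (rule increasing_on_subinterval[OF _ order_refl s, of "\<lambda>t. eps * BA * t - qm * F t - v t"])
   show "((\<lambda>t. eps * BA * t - qm * F t - v t) has_real_derivative eps * BA - qm * f t - (eps * a t - Q t * f t)) (at t within {0..H})" if "t \<in> {0..H}" for t
    by (rule derivative_eq_intros dv[OF that] dF[OF that] refl)+ simp
   fix t assume t: "0 \<le> t" "t \<le> s"
   then have tH: "t \<in> {0..H}" using s by simp
   have "eps * a t \<le> eps * BA" using aB[OF tH] pos by (intro mult_left_mono) auto
   moreover have "qm * f t \<le> Q t * f t" using Q[OF tH] f0[OF tH] by (intro mult_right_mono) auto
   ultimately show "0 \<le> eps * BA - qm * f t - (eps * a t - Q t * f t)" by linarith
  qed
  then show ?thesis using init by simp
 qed
 have BA0: "BA \<ge> 0" using aB[of 0] pos(8) by force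
 have BB0: "BB \<ge> 0" using bB[of 0] pos(8) by force
 have Fup: "F s \<le> V2 / qm" if s: "0 \<le> s" "s \<le> H" and v: "v s \<ge> 0" for s
 proof -
  have "eps * BA * s \<le> eps * BA * H" using s pos BA0 by (intro mult_left_mono) auto
  then have "qm * F s \<le> V2" using vup[OF s] v sm2 by linarith
  then show ?thesis using pos by (simp add: field_simps)
 qed
 define k where "k = \<delta> * Pm / 2"
 have k: "k > 0" using pos by (simp add: k_def)
 \<comment> \<open>If \<open>v\<close> stayed positive up to \<open>H\<close>, the impulse would be
   bounded and the force unclipped from below, so \<open>F' \<ge> k * F\<close>; growth from the
   value at time 1 then exceeds the bound.\<close>
 have "\<exists>s. 0 \<le> s \<and> s \<le> H \<and> v s \<le> 0"
 proof (rule ccontr)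
  assume "\<not> ?thesis"
  then have vpos: "v s > 0" if "0 \<le> s" "s \<le> H" for s using that by (meson not_le)
  have FM: "F s \<le> V2 / qm" if "0 \<le> s" "s \<le> H" for s using Fup[OF that] vpos[OF that] by simp
  have flow: "\<delta> * eps * bm * s + k * F s \<le> f s" if s: "0 \<le> s" "s \<le> H" for s
  proof -
   have "\<delta> * (eps * bm * s + Pm / 2 * F s) \<le> \<delta> * u s" using ulow[OF s] pos by (intro mult_left_mono) auto
   then have 1: "\<delta> * eps * bm * s + k * F s \<le> X s + \<delta> * u s" using Xnn[OF s] by (simp add: k_def algebra_simps)
   have "k * F s \<le> k * (V2 / qm)" using FM[OF s] k by (intro mult_left_mono) auto
   moreover have "\<delta> * (eps * bm * s) \<le> \<delta> * (eps * bm * H)" using s pos by (intro mult_left_mono) auto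
   moreover have "\<delta> * eps * bm * s = \<delta> * (eps * bm * s)" by simp
   ultimately have 2: "\<delta> * eps * bm * s + k * F s \<le> M" using sm3 M1 unfolding k_def by linarith
   have "f s = clip 0 M (X s + \<delta> * u s)" using f[of s] s by simp
   then show ?thesis using 1 2 unfolding clip_def by linarith
  qed
  \<comment> \<open>The seed of the exponential growth: gravity alone produces a speed of at least
    \<open>eps * bm * s\<close>, hence through damping a force, and an impulse of order
    \<open>eps\<close> after one unit of time.\<close>
  have F1: "\<delta> * eps * bm / 2 \<le> F 1"
  proof -
   have "F 0 - \<delta> * eps * bm / 2 * 0\<^sup>2 \<le> F 1 - \<delta> * eps * bm / 2 * 1\<^sup>2"
   proof (rule increasing_on_subinterval[OF _ order_refl zero_le_one pos(8), of "\<lambda>t. F t - \<delta> * eps * bm / 2 * t\<^sup>2"])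
    show "((\<lambda>t. F t - \<delta> * eps * bm / 2 * t\<^sup>2) has_real_derivative f t - \<delta> * eps * bm * t) (at t within {0..H})" if "t \<in> {0..H}" for t
     by (rule derivative_eq_intros dF[OF that] refl)+ simp
    fix t :: real assume t: "0 \<le> t" "t \<le> 1"
    then have "0 \<le> k * F t" using k Fnn[of t] pos by auto
    then show "0 \<le> f t - \<delta> * eps * bm * t" using flow[of t] t pos(8) by simp
   qed
   then show ?thesis using init by simp
  qed
  have "exp (- k * 1) * F 1 \<le> exp (- k * H) * F H"
  proof (rule increasing_on_subinterval[OF _ zero_le_one pos(8) order_refl, of "\<lambda>t. exp (- k * t) * F t"])
   show "((\<lambda>t. exp (- k * t) * F t) has_real_derivative exp (- k * t) * (f t - k * F t)) (at t within {0..H})" if "t \<in> {0..H}" for t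
    by (rule derivative_eq_intros dF[OF that] refl)+ (simp add: algebra_simps)
   fix t assume t: "1 \<le> t" "t \<le> H"
   have "0 \<le> \<delta> * eps * bm * t" using pos t by simp
   then have "k * F t \<le> f t" using flow[of t] t by simp
   then show "0 \<le> exp (- k * t) * (f t - k * F t)" by simp
  qed
  then have "exp (k * H) * (exp (- k * 1) * F 1) \<le> exp (k * H) * (exp (- k * H) * F H)" by (intro mult_left_mono) auto
  also have "\<dots> = F H" by (simp add: exp_minus)
  also have "exp (k * H) * (exp (- k * 1) * F 1) = F 1 * exp (k * (H - 1))"
   by (simp add: right_diff_distrib exp_diff exp_minus field_simps)
  finally have "F 1 * exp (k * (H - 1)) \<le> F H" .
  moreover have "\<delta> * eps * bm / 2 * exp (k * (H - 1)) \<le> F 1 * exp (k * (H - 1))" using F1 by (intro mult_right_mono) auto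
  moreover have "F H \<le> V2 / qm" using FM[of H] pos(8) by simp
  ultimately show False using grow unfolding k_def by linarith
 qed
 then obtain s1 where s1: "0 \<le> s1" "s1 \<le> H" "v s1 \<le> 0" by blast
 have "s1 \<noteq> 0"
 proof
  assume "s1 = 0" then show False using s1(3) init(4) by simp
 qed
 then have s1p: "s1 > 0" using s1(1) by simp
 have "continuous_on {0..H} v" using dv by (meson DERIV_continuous continuous_on_eq_continuous_within)
 then have "continuous_on {0..s1} v" by (rule continuous_on_subset) (use s1 in auto)
 from first_zero[OF this s1p init(4) s1(3)] obtain S where S: "0 < S" "S \<le> s1" "v S = 0"
  and vS: "\<forall>s. 0 \<le> s \<longrightarrow> s < S \<longrightarrow> v s > 0" by blast
 have SH: "S \<le> H" using S s1 by simp
 have FS: "F s \<le> V2 / qm" if s: "0 \<le> s" "s \<le> S" for s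
 proof (rule Fup)
  show "v s \<ge> 0" using vS s S(3) by (cases "s < S") (auto simp: less_imp_le)
 qed (use s SH in auto)
 have PM: "PM \<ge> 0" using P[of 0] pos by force
 have uS: "u s \<le> Um" if s: "0 \<le> s" "s \<le> S" for s
 proof -
  have sH: "s \<le> H" using s SH by simp
  have "eps * BB * 0 + PM * F 0 - u 0 \<le> eps * BB * s + PM * F s - u s"
  proof (rule increasing_on_subinterval[OF _ order_refl s(1) sH, of "\<lambda>t. eps * BB * t + PM * F t - u t"])
   show "((\<lambda>t. eps * BB * t + PM * F t - u t) has_real_derivative eps * BB + PM * f t - (- (eps * b t) + P t * f t)) (at t within {0..H})" if "t \<in> {0..H}" for t
    by (rule derivative_eq_intros du[OF that] dF[OF that] refl)+ simp
   fix t assume t: "0 \<le> t" "t \<le> s"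
   then have tH: "t \<in> {0..H}" using sH by simp
   have "eps * (- b t) \<le> eps * BB" using bB[OF tH] pos by (intro mult_left_mono) auto
   moreover have "P t * f t \<le> PM * f t" using P[OF tH] f0[OF tH] by (intro mult_right_mono) auto
   ultimately show "0 \<le> eps * BB + PM * f t - (- (eps * b t) + P t * f t)" by simp
  qed
  moreover have "eps * BB * s \<le> eps * BB * H" using sH pos BB0 by (intro mult_left_mono) auto
  moreover have "PM * F s \<le> PM * (V2 / qm)" using FS[OF s] PM by (intro mult_left_mono) auto
  ultimately show ?thesis using sm4 init by simp
 qed
 \<comment> \<open>Depth is controlled by speed: \<open>P * f\<close> contributes at least
   \<open>Pm * \<delta> * u\<close> to the growth of the speed, so \<kappa> times the speed grows
   faster than the depth, up to a gravity term of order \<open>eps * H\<close>.\<close>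
 define \<kappa> where "\<kappa> = 2 / (Pm * \<delta>)"
 have \<kappa>: "\<kappa> > 0" using pos by (simp add: \<kappa>_def)
 have XS: "X s \<le> \<kappa> * u s + \<kappa> * (eps * BB * H)" if s: "0 \<le> s" "s \<le> S" for s
 proof -
  have sH: "s \<le> H" using s SH by simp
  have "\<kappa> * u 0 + \<kappa> * eps * BB * 0 - X 0 \<le> \<kappa> * u s + \<kappa> * eps * BB * s - X s"
  proof (rule increasing_on_subinterval[OF _ order_refl s(1) sH, of "\<lambda>t. \<kappa> * u t + \<kappa> * eps * BB * t - X t"])
   show "((\<lambda>t. \<kappa> * u t + \<kappa> * eps * BB * t - X t) has_real_derivative \<kappa> * (- (eps * b t) + P t * f t) + \<kappa> * eps * BB - u t) (at t within {0..H})" if "t \<in> {0..H}" for t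
    by (rule derivative_eq_intros du[OF that] dX[OF that] refl)+ simp
   fix t assume t: "0 \<le> t" "t \<le> s"
   then have tH: "t \<in> {0..H}" and tS: "t \<le> S" using sH s by auto
   have "\<kappa> * eps * b t \<le> \<kappa> * eps * BB" using bB[OF tH] pos \<kappa> by (intro mult_left_mono) auto
   moreover have "u t \<le> \<kappa> * (P t * f t)"
   proof -
    have "\<kappa> * Pm * f t \<le> \<kappa> * (P t * f t)"
     unfolding mult.assoc using P[OF tH] f0[OF tH] \<kappa> by (intro mult_left_mono mult_right_mono) auto
    moreover have "\<kappa> * Pm = 2 / \<delta>" using pos by (simp add: \<kappa>_def)
    moreover have "u t \<le> 2 / \<delta> * f t"
    proof -
     have "\<delta> * u t \<le> f t"
     proof -
      have "\<delta> * u t \<le> \<delta> * Um" using uS[of t] t tS pos by (intro mult_left_mono) auto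
      then have "\<delta> * u t \<le> M" using M2 by (simp add: mult.commute)
      moreover have "\<delta> * u t \<le> X t + \<delta> * u t" using Xnn[of t] t sH by simp
      ultimately show ?thesis using f[OF tH] unfolding clip_def by linarith
     qed
     then have "u t \<le> f t / \<delta>" using pos by (simp add: field_simps)
     also have "\<dots> \<le> 2 / \<delta> * f t" using f0[OF tH] pos by (simp add: field_simps)
     finally show ?thesis .
    qed
    ultimately show ?thesis by simp
   qed
   ultimately show "0 \<le> \<kappa> * (- (eps * b t) + P t * f t) + \<kappa> * eps * BB - u t" by (simp add: algebra_simps)
  qed
  moreover have "\<kappa> * (eps * BB * s) \<le> \<kappa> * (eps * BB * H)" using sH pos BB0 \<kappa> by (intro mult_left_mono) auto
  moreover have "0 \<le> \<kappa> * u 0" using \<kappa> init by simp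
  moreover have "\<kappa> * eps * BB * s = \<kappa> * (eps * BB * s)" by simp
  ultimately show ?thesis using init(1) by linarith
 qed
 have fS: "X s \<le> M \<and> f s = X s + \<delta> * u s" if s: "0 \<le> s" "s \<le> S" for s
 proof -
  have sH: "s \<le> H" using s SH by simp
  have "\<kappa> * u s \<le> \<kappa> * Um" "\<delta> * u s \<le> \<delta> * Um" using uS[OF s] \<kappa> pos by (auto intro!: mult_left_mono)
  moreover have "(\<kappa> + \<delta>) * Um = \<kappa> * Um + \<delta> * Um" by (simp add: distrib_right)
  ultimately have M': "X s + \<delta> * u s \<le> M" using XS[OF s] sm5 M3 unfolding \<kappa>_def[symmetric] by linarith
  have "0 \<le> \<delta> * u s" using unn[OF s(1) sH] pos by simp
  then show ?thesis using M' Xnn[OF s(1) sH] f[of s] s sH by (simp add: clip_eq)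
 qed
 show ?thesis
 proof (intro exI[of _ S] conjI allI impI)
  show "0 < S" "S \<le> H" "v S = 0" using S SH by auto
  show "v s > 0" if "0 \<le> s" "s < S" for s using vS that by blast
  show "X s > 0" if "0 < s" "s \<le> S" for s using Xpos[of s] that SH by simp
  fix s assume s: "0 \<le> s" "s \<le> S"
  have sH: "s \<le> H" using s SH by simp
  show "0 \<le> u s" by (rule unn[OF s(1) sH])
  show "u s \<le> Um" by (rule uS[OF s])
  show "0 \<le> X s" by (rule Xnn[OF s(1) sH])
  show "X s \<le> M" "f s = X s + \<delta> * u s" using fS[OF s] by auto
  show "0 \<le> F s" by (rule Fnn[OF s(1) sH])
  show "F s \<le> V2 / qm" by (rule FS[OF s])
 qed
qed

lemma tendsto_eps_ln: "((\<lambda>eps::real. eps * (C * ln (1 / eps))) \<longlongrightarrow> 0) (at_right 0)"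
proof -
 have "((\<lambda>eps::real. eps * ln (1 / eps)) \<longlongrightarrow> 0) (at_right 0)" by real_asymp
 then have "((\<lambda>eps::real. C * (eps * ln (1 / eps))) \<longlongrightarrow> C * 0) (at_right 0)" by (intro tendsto_intros)
 then show ?thesis by (simp add: mult_ac)
qed

text \<open>For the horizon \<open>2 / k * ln (1 / eps)\<close> the exponential is of order 1 over
  the square of \<open>eps\<close>. One power compensates the seed of order \<open>eps\<close>, the
  other one beats any constant.\<close>

lemma eventually_growth:
 assumes "k > 0" "c > 0"
 shows "eventually (\<lambda>eps::real. c * eps * exp (k * (2 / k * ln (1 / eps) - 1)) > C) (at_right 0)"
proof -
 define eps0 where "eps0 = c * exp (- k) / (\<bar>C\<bar> + 1)"
 have eps0: "eps0 > 0" using assms by (simp add: eps0_def add_nonneg_pos)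
 have "c * eps * exp (k * (2 / k * ln (1 / eps) - 1)) > C" if eps: "eps > 0" "eps < eps0" for eps
 proof -
  have "k * (2 / k * ln (1 / eps) - 1) = ln (1 / eps) + ln (1 / eps) - k" using assms by (simp add: field_simps)
  then have "exp (k * (2 / k * ln (1 / eps) - 1)) = exp (ln (1 / eps)) * exp (ln (1 / eps)) * exp (- k)"
   by (simp only: exp_add[symmetric] diff_conv_add_uminus)
  also have "exp (ln (1 / eps)) = 1 / eps" using eps by (intro exp_ln) simp
  finally have "exp (k * (2 / k * ln (1 / eps) - 1)) = (1 / eps) * (1 / eps) * exp (- k)" .
  then have "c * eps * exp (k * (2 / k * ln (1 / eps) - 1)) = c * exp (- k) / eps" using eps by simp
  moreover have "\<bar>C\<bar> + 1 < c * exp (- k) / eps"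
  proof -
   have "eps * (\<bar>C\<bar> + 1) < c * exp (- k)" using eps(2) unfolding eps0_def by (simp add: pos_less_divide_eq add_nonneg_pos)
   then show ?thesis using eps by (simp add: pos_less_divide_eq mult.commute)
  qed
  ultimately show ?thesis by linarith
 qed
 then show ?thesis unfolding eventually_at_right_field using eps0 by blast
qed

lemma tendsto_components:
 fixes x :: "real \<Rightarrow> state"
 assumes "(x \<longlongrightarrow> (y, w, \<theta>, \<phi>, v)) F"
 shows "((\<lambda>eps. st_y (x eps)) \<longlongrightarrow> y) F" "((\<lambda>eps. st_w (x eps)) \<longlongrightarrow> w) F" "((\<lambda>eps. st_th (x eps)) \<longlongrightarrow> \<theta>) F"
  "((\<lambda>eps. st_ph (x eps)) \<longlongrightarrow> \<phi>) F" "((\<lambda>eps. st_v (x eps)) \<longlongrightarrow> v) F"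
 using tendsto_fst[OF assms] tendsto_fst[OF tendsto_snd[OF assms]] tendsto_fst[OF tendsto_snd[OF tendsto_snd[OF assms]]]
  tendsto_fst[OF tendsto_snd[OF tendsto_snd[OF tendsto_snd[OF assms]]]] tendsto_snd[OF tendsto_snd[OF tendsto_snd[OF tendsto_snd[OF assms]]]]
 by simp_all

context truncated
begin

lemma phc_bound: "\<bar>phc x\<bar> \<le> M"
 using clip_bounds[of "- M" M "st_ph x"] M by (simp add: phc_def abs_le_iff)

lemma sol_th_bound:
 assumes "sol eps x X" "eps \<ge> 0" "0 \<le> s" "s \<le> H"
 shows "\<bar>st_th (X s) - st_th x\<bar> \<le> eps * M * s"
proof -
 have "\<bar>st_th (X s) - st_th (X 0) - 0 * 0\<bar> \<le> eps * M * s + 0 * 0"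
  by (rule increment_approximation[where f = "\<lambda>_. 0" and F = "\<lambda>_. 0" and h = "\<lambda>_. 0" and c = "\<lambda>t. phc (X t)" and H = H])
   (use assms sol_components(3)[OF assms(1), of _ 0 H] phc_bound in auto)
 then show ?thesis using assms(1) by (simp add: sol_def)
qed

definition compressed :: "(real \<Rightarrow> state) \<Rightarrow> real \<Rightarrow> bool" where
 "compressed X S \<longleftrightarrow> 0 < S \<and> st_v (X S) = 0 \<and> (\<forall>s. 0 \<le> s \<longrightarrow> s < S \<longrightarrow> st_v (X s) > 0) \<and>
   (\<forall>s. 0 < s \<longrightarrow> s \<le> S \<longrightarrow> st_y (X s) < 0) \<and>
   (\<forall>s. 0 \<le> s \<longrightarrow> s \<le> S \<longrightarrow> \<bar>st_y (X s)\<bar> \<le> M \<and> \<bar>st_w (X s)\<bar> \<le> M \<and> \<bar>st_ph (X s)\<bar> \<le> M \<and>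
    force (X s) = - st_y (X s) - \<delta> * st_w (X s) \<and> force (X s) \<ge> 0)"

text \<open>\<open>v\<close> reaches zero when the impulse equals \<open>Fs\<close> in the limit,
  and the changes of \<open>w\<close> and \<phi> are the corresponding multiples of
  \<open>Fs\<close>. The depth follows because the state is attracted to the unstable direction, on
  which \<open>y\<close> is \<open>w\<close> divided by the eigenvalue.\<close>

lemma compression_phase:
 fixes x :: "real \<Rightarrow> state" and X :: "real \<Rightarrow> real \<Rightarrow> state"
 assumes lo: "lo = 0" and E0: "\<And>\<theta> \<phi>. E \<theta> \<phi> = 0"
  and \<delta>: "\<delta> > 0" and neg: "P \<theta>0 < 0" "Q \<theta>0 < 0" "B \<theta>0 \<phi>0 < 0" and v0: "v0 > 0"
  and Pm: "Pm = - P \<theta>0 / 2" and qm: "qm = - Q \<theta>0 / 2" and Fm: "Fm = 2 * v0 / qm"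
  and Um: "Um = 3 * Pm * Fm + 1" and RM: "RM = \<bar>R \<theta>0\<bar> + 1"
  and M1: "\<delta> * Pm / 2 * Fm + 1 \<le> M" and M2: "Um * \<delta> \<le> M" and M3: "(2 / (Pm * \<delta>) + \<delta>) * Um + 1 \<le> M"
  and M4: "\<bar>\<phi>0\<bar> + 1 + RM * Fm \<le> M" and M5: "Um \<le> M"
  and ev: "eventually (\<lambda>eps. sol eps (x eps) (X eps) \<and> st_y (x eps) = 0 \<and> st_w (x eps) \<le> 0) (at_right 0)"
  and x: "(x \<longlongrightarrow> (0, 0, \<theta>0, \<phi>0, v0)) (at_right 0)"
 defines "Fs \<equiv> v0 / (- Q \<theta>0)"
 shows "\<exists>S C. C > 0 \<and> eventually (\<lambda>eps. S eps \<le> C * ln (1 / eps) \<and> compressed (X eps) (S eps)) (at_right 0) \<and>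
   ((\<lambda>eps. X eps (S eps)) \<longlongrightarrow> (P \<theta>0 * Fs / lam (- P \<theta>0) \<delta>, P \<theta>0 * Fs, \<theta>0, \<phi>0 + R \<theta>0 * Fs, 0)) (at_right 0)"
proof -
 have pos1: "Pm > 0" "qm > 0" "RM > 0" using neg by (auto simp: Pm qm RM)
 then have Fm0: "Fm > 0" using v0 by (simp add: Fm)
 have "0 < 3 * Pm * Fm" using pos1 Fm0 by simp
 then have "Um > 0" unfolding Um by linarith
 note pos = pos1(1,2) Fm0 this pos1(3)
 have V2: "2 * v0 / qm = Fm" by (simp add: Fm)
 \<comment> \<open>Half of the initial value, as for \<open>Pm\<close> and \<open>qm\<close>; the
   other half is the margin within which the coefficients may drift.\<close>
 define bm where "bm = - B \<theta>0 \<phi>0 / 2"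
 have bm: "bm > 0" using neg by (simp add: bm_def)
 define k where "k = \<delta> * Pm / 2"
 have k: "k > 0" using pos \<delta> by (simp add: k_def)
 define C where "C = 2 / k"
 define H where "H eps = C * ln (1 / eps)" for eps :: real
 have C: "C > 0" using k by (simp add: C_def)
 obtain LP where LP: "LP \<ge> 0" "\<And>a b. \<bar>P a - P b\<bar> \<le> LP * \<bar>a - b\<bar>" using blip_onD[OF blipP] unfolding dist_real_def by metis
 obtain LQ where LQ: "LQ \<ge> 0" "\<And>a b. \<bar>Q a - Q b\<bar> \<le> LQ * \<bar>a - b\<bar>" using blip_onD[OF blipQ] unfolding dist_real_def by metis
 obtain LR where LR: "LR \<ge> 0" "\<And>a b. \<bar>R a - R b\<bar> \<le> LR * \<bar>a - b\<bar>" using blip_onD[OF blipR] unfolding dist_real_def by metis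
 obtain LB where LB: "LB \<ge> 0" "\<And>x. \<bar>B (fst x) (clip (- M) M (snd x))\<bar> \<le> LB"
  "\<And>x y. \<bar>B (fst x) (clip (- M) M (snd x)) - B (fst y) (clip (- M) M (snd y))\<bar> \<le> LB * dist x y" using blip_onD[OF blipB] by metis
 obtain BA where BA: "BA \<ge> 0" "\<And>x. \<bar>A (fst x) (clip (- M) M (snd x))\<bar> \<le> BA" using blip_onD[OF blipA] by metis
 \<comment> \<open>\<phi> moves by at most \<open>RM\<close> times the impulse and \<open>B\<close>
   by at most \<open>LB\<close> times that. So \<open>B\<close> may lose its sign late in
   compression, but only once the impulse is of order one.\<close>
 define KF where "KF = LB * RM"
 have KF: "KF \<ge> 0" using LB pos by (simp add: KF_def)
 \<comment> \<open>Bounds the drift of \<theta> over the whole horizon, which is small since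
   \<open>eps * ln (1 / eps)\<close> tends to 0.\<close>
 define e1 where "e1 eps = \<bar>st_th (x eps) - \<theta>0\<bar> + eps * (M * H eps)" for eps
 define pbar where "pbar = - P \<theta>0"
 have pbar: "pbar > 0" using neg by (simp add: pbar_def)
 define l where "l = lam pbar \<delta>"
 have l: "l > 0" "l\<^sup>2 = \<delta> * pbar * l + pbar" using lam_pos[OF pbar \<delta>] lam_root[OF pbar] by (auto simp: l_def)
 define \<rho> where "\<rho> = 1 / l"
 have \<rho>: "\<rho> > 0" using l by (simp add: \<rho>_def)
 have \<rho>eq: "1 - \<rho> * pbar * \<delta> = \<rho> * \<rho> * pbar"
 proof -
  have "l * l = \<delta> * pbar * l + pbar" using l(2) by (simp add: power2_eq_square)
  then have "(l * l) / (l * l) = (\<delta> * pbar * l + pbar) / (l * l)" by simp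
  then show ?thesis using l(1) by (simp add: \<rho>_def add_divide_distrib algebra_simps)
 qed
 \<comment> \<open>All error bounds of the stage added up, so that every limit below rests on one
   vanishing quantity: increments of \<open>v\<close>, \<open>w\<close>, \<phi>, the drift of
   \<theta>, and the distance from the unstable direction.\<close>
 define er where "er eps = eps * ((BA + LB) * H eps) + (LQ + LP + LR) * Fm * e1 eps + e1 eps + \<rho> * \<bar>st_w (x eps)\<bar>
   + (eps * LB + LP * M * e1 eps) / pbar" for eps
 note xc = tendsto_components[OF x]
 have eH: "((\<lambda>eps. eps * (c * H eps)) \<longlongrightarrow> 0) (at_right 0)" for c
  using tendsto_eps_ln[of "c * C"] by (simp add: H_def mult_ac)
 have e0: "((\<lambda>eps::real. eps) \<longlongrightarrow> 0) (at_right 0)" by (rule tendsto_ident_at)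
 have le1: "(e1 \<longlongrightarrow> 0) (at_right 0)"
 proof -
  have "((\<lambda>eps. \<bar>st_th (x eps) - \<theta>0\<bar> + eps * (M * H eps)) \<longlongrightarrow> \<bar>\<theta>0 - \<theta>0\<bar> + 0) (at_right 0)"
   by (intro tendsto_intros xc eH)
  then show ?thesis by (simp add: e1_def[abs_def])
 qed
 have ler: "(er \<longlongrightarrow> 0) (at_right 0)"
 proof -
  have "((\<lambda>eps. eps * ((BA + LB) * H eps) + (LQ + LP + LR) * Fm * e1 eps + e1 eps + \<rho> * \<bar>st_w (x eps)\<bar>
   + (eps * LB + LP * M * e1 eps) / pbar) \<longlongrightarrow> 0 + (LQ + LP + LR) * Fm * 0 + 0 + \<rho> * \<bar>0\<bar> + (0 * LB + LP * M * 0) / pbar) (at_right 0)"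
   by (intro tendsto_intros xc eH le1 e0) (use pbar in simp)
  then show ?thesis by (simp add: er_def[abs_def])
 qed
 have small: "eventually (\<lambda>eps. g eps < c) (at_right 0)" if "(g \<longlongrightarrow> g0) (at_right 0)" "g0 < c" for g :: "real \<Rightarrow> real" and g0 c
  using order_tendstoD(2)[OF that] .
 define good where "good eps S Fv \<longleftrightarrow> 0 < S \<and> S \<le> C * ln (1 / eps) \<and> st_v (X eps S) = 0 \<and>
   (\<forall>s. 0 \<le> s \<longrightarrow> s < S \<longrightarrow> st_v (X eps s) > 0) \<and> (\<forall>s. 0 < s \<longrightarrow> s \<le> S \<longrightarrow> st_y (X eps s) < 0) \<and>
   (\<forall>s. 0 \<le> s \<longrightarrow> s \<le> S \<longrightarrow> \<bar>st_y (X eps s)\<bar> \<le> M \<and> \<bar>st_w (X eps s)\<bar> \<le> M \<and> \<bar>st_ph (X eps s)\<bar> \<le> M \<and>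
    force (X eps s) = - st_y (X eps s) - \<delta> * st_w (X eps s) \<and> force (X eps s) \<ge> 0) \<and>
   \<bar>st_v (X eps S) - st_v (x eps) - Q \<theta>0 * Fv\<bar> \<le> er eps \<and>
   \<bar>st_w (X eps S) - st_w (x eps) - P \<theta>0 * Fv\<bar> \<le> er eps \<and>
   \<bar>st_ph (X eps S) - st_ph (x eps) - R \<theta>0 * Fv\<bar> \<le> er eps \<and>
   \<bar>st_th (X eps S) - \<theta>0\<bar> \<le> er eps \<and>
   \<bar>st_y (X eps S) - \<rho> * st_w (X eps S)\<bar> \<le> er eps" for eps S Fv
 have "eventually (\<lambda>eps. \<exists>S Fv. good eps S Fv) (at_right 0)"
 proof -
  have c1: "eventually (\<lambda>eps. LP * e1 eps < Pm) (at_right 0)" by (rule small[OF tendsto_mult_left[OF le1]]) (use pos in simp)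
  have c2: "eventually (\<lambda>eps. LQ * e1 eps < qm) (at_right 0)" by (rule small[OF tendsto_mult_left[OF le1]]) (use pos in simp)
  have c3: "eventually (\<lambda>eps. LR * e1 eps < 1) (at_right 0)" by (rule small[OF tendsto_mult_left[OF le1]]) simp
  have lph: "((\<lambda>eps. \<bar>st_ph (x eps) - \<phi>0\<bar>) \<longlongrightarrow> \<bar>\<phi>0 - \<phi>0\<bar>) (at_right 0)" by (intro tendsto_intros xc)
  have c4: "eventually (\<lambda>eps. LB * (e1 eps + \<bar>st_ph (x eps) - \<phi>0\<bar>) < bm) (at_right 0)"
   by (rule small[OF tendsto_mult_left[OF tendsto_add[OF le1 lph]]]) (use bm in simp)
  have c5: "eventually (\<lambda>eps. \<bar>st_ph (x eps) - \<phi>0\<bar> < 1) (at_right 0)" by (rule small[OF lph]) simp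
  have c6: "eventually (\<lambda>eps. eps * (KF * H eps) < Pm / 2) (at_right 0)" by (rule small[OF eH]) (use pos in simp)
  have c7: "eventually (\<lambda>eps. st_v (x eps) + eps * (BA * H eps) < 2 * v0) (at_right 0)"
   by (rule small[OF tendsto_add[OF xc(5) eH]]) (use v0 in simp)
  have c8: "eventually (\<lambda>eps. eps * (\<delta> * bm * H eps) < 1) (at_right 0)" by (rule small[OF eH]) simp
  have c9: "eventually (\<lambda>eps. - st_w (x eps) + eps * (LB * H eps) < 1) (at_right 0)"
   by (rule small[OF tendsto_add[OF tendsto_minus[OF xc(2)] eH]]) simp
  have c10: "eventually (\<lambda>eps. eps * (2 / (Pm * \<delta>) * LB * H eps) < 1) (at_right 0)" by (rule small[OF eH]) simp
  have c11: "eventually (\<lambda>eps::real. \<delta> * bm / 2 * eps * exp (k * (2 / k * ln (1 / eps) - 1)) > Fm) (at_right 0)"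
   by (rule eventually_growth) (use k \<delta> bm in auto)
  have c12: "eventually (\<lambda>eps. H eps \<ge> 1) (at_right 0)"
   unfolding H_def using C by real_asymp
  have c13: "eventually (\<lambda>eps. st_v (x eps) > 0) (at_right 0)" using order_tendstoD(1)[OF xc(5) v0] .
  show ?thesis
   using ev c1 c2 c3 c4 c5 c6 c7 c8 c9 c10 c11 c12 c13 eventually_at_right_less[of "0::real"]
  proof eventually_elim
   case (elim eps)
   have eps: "eps > 0" and H1: "H eps \<ge> 1" using elim by auto
   have X: "sol eps (x eps) (X eps)" and X0: "X eps 0 = x eps" and y0: "st_y (x eps) = 0" and w0: "st_w (x eps) \<le> 0"
    using elim(1) by (auto simp: sol_def)
   note d = sol_components[OF X _ order_refl]
   define f where "f t = force (X eps t)" for t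
   define F where "F t = integral {0..t} f" for t
   have fc: "f t = clip 0 M (- st_y (X eps t) - \<delta> * st_w (X eps t))" for t
   proof -
    have "f t = clip lo M (- st_y (X eps t) - \<delta> * st_w (X eps t))" unfolding f_def force_def ..
    also have "\<dots> = clip 0 M (- st_y (X eps t) - \<delta> * st_w (X eps t))" by (rule arg_cong[OF lo])
    finally show ?thesis .
   qed
   have f0: "0 \<le> f t" "f t \<le> M" for t using clip_bounds[of 0 M] M by (auto simp: fc)
   have cf: "continuous_on {0..H eps} f"
   proof -
    note cX = sol_continuous[OF X, of "H eps"]
    have "continuous_on {0..H eps} (\<lambda>t. max 0 (min M (- st_y (X eps t) - \<delta> * st_w (X eps t))))"
     by (intro continuous_intros cX)
    then show ?thesis by (simp add: fc[abs_def] clip_def)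
   qed
   have dF: "(F has_real_derivative f t) (at t within {0..H eps})" if "t \<in> {0..H eps}" for t
    unfolding F_def has_real_derivative_iff_has_vector_derivative by (rule integral_has_vector_derivative[OF cf that])
   have F0: "F 0 = 0" by (simp add: F_def)
   have th: "\<bar>st_th (X eps t) - \<theta>0\<bar> \<le> e1 eps" if t: "t \<in> {0..H eps}" for t
   proof -
    have "\<bar>st_th (X eps t) - st_th (x eps)\<bar> \<le> eps * M * t"
     by (rule sol_th_bound[OF X, where H = "H eps"]) (use t eps in auto)
    also have "\<dots> \<le> eps * M * H eps" using t eps M by (intro mult_left_mono) auto
    finally show ?thesis unfolding e1_def by (simp add: mult.assoc)
   qed
   have Pth: "\<bar>P (st_th (X eps t)) - P \<theta>0\<bar> \<le> LP * e1 eps" if t: "t \<in> {0..H eps}" for t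
    by (rule order_trans[OF LP(2) mult_left_mono[OF th[OF t] LP(1)]])
   have Qth: "\<bar>Q (st_th (X eps t)) - Q \<theta>0\<bar> \<le> LQ * e1 eps" if t: "t \<in> {0..H eps}" for t
    by (rule order_trans[OF LQ(2) mult_left_mono[OF th[OF t] LQ(1)]])
   have Rth: "\<bar>R (st_th (X eps t)) - R \<theta>0\<bar> \<le> LR * e1 eps" if t: "t \<in> {0..H eps}" for t
    by (rule order_trans[OF LR(2) mult_left_mono[OF th[OF t] LR(1)]])
   have dph: "((\<lambda>t. st_ph (X eps t)) has_real_derivative eps * 0 + R (st_th (X eps t)) * f t) (at t within {0..H eps})" if t: "t \<in> {0..H eps}" for t
    using d(4)[OF t] by (simp add: E0 f_def)
   have ph: "\<bar>st_ph (X eps s) - st_ph (x eps)\<bar> \<le> RM * F s" if s: "0 \<le> s" "s \<le> H eps" for s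
   proof -
    have "\<bar>st_ph (X eps s) - st_ph (X eps 0) - 0 * F s\<bar> \<le> eps * 0 * s + RM * F s"
    proof (rule increment_approximation[OF s less_imp_le[OF eps] dph dF F0])
     show "\<bar>R (st_th (X eps t)) - 0\<bar> \<le> RM" if "0 \<le> t" "t \<le> s" for t
      using Rth[of t] that s elim(4) unfolding RM by auto
    qed (use f0 in auto)
    then show ?thesis by (simp add: X0)
   qed
   have bB: "\<bar>B (st_th (X eps t)) (phc (X eps t))\<bar> \<le> LB" for t
    using LB(2)[of "(st_th (X eps t), st_ph (X eps t))"] by (simp add: phc_def)
   have aB: "\<bar>A (st_th (X eps t)) (phc (X eps t))\<bar> \<le> BA" for t
    using BA(2)[of "(st_th (X eps t), st_ph (X eps t))"] by (simp add: phc_def)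
   have phi0M: "clip (- M) M \<phi>0 = \<phi>0"
   proof (rule clip_eq)
    have "0 \<le> RM * Fm" using pos by simp
    then show "- M \<le> \<phi>0" "\<phi>0 \<le> M" using M4 by linarith+
   qed
   have bmin: "B (st_th (X eps t)) (phc (X eps t)) \<le> - bm + KF * F t" if t: "t \<in> {0..H eps}" for t
   proof -
    have "\<bar>B (st_th (X eps t)) (phc (X eps t)) - B \<theta>0 \<phi>0\<bar> \<le> LB * dist (st_th (X eps t), st_ph (X eps t)) (\<theta>0, \<phi>0)"
     using LB(3)[of "(st_th (X eps t), st_ph (X eps t))" "(\<theta>0, \<phi>0)"] by (simp add: phc_def phi0M)
    also have "\<dots> \<le> LB * ((e1 eps + \<bar>st_ph (x eps) - \<phi>0\<bar>) + RM * F t)"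
    proof (rule mult_left_mono[OF _ LB(1)])
     have "dist (st_th (X eps t), st_ph (X eps t)) (\<theta>0, \<phi>0) \<le> \<bar>st_th (X eps t) - \<theta>0\<bar> + \<bar>st_ph (X eps t) - \<phi>0\<bar>"
      using dist_Pair_le unfolding dist_real_def[symmetric] by blast
     moreover have "\<bar>st_ph (X eps t) - \<phi>0\<bar> \<le> \<bar>st_ph (X eps t) - st_ph (x eps)\<bar> + \<bar>st_ph (x eps) - \<phi>0\<bar>" by linarith
     moreover have "\<bar>st_ph (X eps t) - st_ph (x eps)\<bar> \<le> RM * F t" using ph[of t] t by simp
     ultimately show "dist (st_th (X eps t), st_ph (X eps t)) (\<theta>0, \<phi>0) \<le> (e1 eps + \<bar>st_ph (x eps) - \<phi>0\<bar>) + RM * F t"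
      using th[OF t] by linarith
    qed
    also have "\<dots> = LB * (e1 eps + \<bar>st_ph (x eps) - \<phi>0\<bar>) + KF * F t" by (simp add: KF_def distrib_left)
    finally have "\<bar>B (st_th (X eps t)) (phc (X eps t)) - B \<theta>0 \<phi>0\<bar> \<le> bm + KF * F t" using elim(5) by linarith
    moreover have "B \<theta>0 \<phi>0 = - 2 * bm" by (simp add: bm_def)
    ultimately show ?thesis by linarith
   qed
   have Prange: "Pm \<le> - P (st_th (X eps t)) \<and> - P (st_th (X eps t)) \<le> 3 * Pm" if t: "t \<in> {0..H eps}" for t
   proof -
    have "P \<theta>0 = - 2 * Pm" by (simp add: Pm)
    then show ?thesis using Pth[OF t] elim(2) by linarith
   qed
   have Qrange: "qm \<le> - Q (st_th (X eps t))" if t: "t \<in> {0..H eps}" for t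
   proof -
    have "Q \<theta>0 = - 2 * qm" by (simp add: qm)
    then show ?thesis using Qth[OF t] elim(3) by linarith
   qed
   have dX: "((\<lambda>t. - st_y (X eps t)) has_real_derivative - st_w (X eps t)) (at t within {0..H eps})" if t: "t \<in> {0..H eps}" for t
    by (rule DERIV_minus[OF d(1)[OF t]])
   have du: "((\<lambda>t. - st_w (X eps t)) has_real_derivative - (eps * B (st_th (X eps t)) (phc (X eps t))) + - P (st_th (X eps t)) * f t) (at t within {0..H eps})" if t: "t \<in> {0..H eps}" for t
    using DERIV_minus[OF d(2)[OF t]] by (simp add: f_def)
   have dv: "((\<lambda>t. st_v (X eps t)) has_real_derivative eps * A (st_th (X eps t)) (phc (X eps t)) - - Q (st_th (X eps t)) * f t) (at t within {0..H eps})" if t: "t \<in> {0..H eps}" for t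
    using d(5)[OF t] by (simp add: f_def)
   have kH: "\<delta> * eps * bm / 2 * exp (\<delta> * Pm / 2 * (H eps - 1)) > 2 * v0 / qm"
    using elim(12) unfolding V2 k_def[symmetric] H_def C_def by (simp add: mult_ac)
   have "\<exists>S. 0 < S \<and> S \<le> H eps \<and> st_v (X eps S) = 0 \<and> (\<forall>s. 0 \<le> s \<longrightarrow> s < S \<longrightarrow> st_v (X eps s) > 0) \<and> (\<forall>s. 0 < s \<longrightarrow> s \<le> S \<longrightarrow> - st_y (X eps s) > 0) \<and>
    (\<forall>s. 0 \<le> s \<longrightarrow> s \<le> S \<longrightarrow> 0 \<le> - st_w (X eps s) \<and> - st_w (X eps s) \<le> Um \<and> 0 \<le> - st_y (X eps s) \<and> - st_y (X eps s) \<le> M \<and>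
     f s = - st_y (X eps s) + \<delta> * - st_w (X eps s) \<and> 0 \<le> F s \<and> F s \<le> 2 * v0 / qm)"
   proof (rule compression_estimates[OF dX du dv dF _ _ _ F0 _ Prange Qrange bB aB bmin eps \<delta> pos(1,2) bm KF M H1 _ _ _ _ _ _ M2 M3 kH])
    show "f t = clip 0 M (- st_y (X eps t) + \<delta> * - st_w (X eps t))" for t by (simp add: fc)
    show "- st_y (X eps 0) = 0" "0 \<le> - st_w (X eps 0)" "0 < st_v (X eps 0)" using y0 w0 elim(14) by (simp_all add: X0)
    show "eps * KF * H eps \<le> Pm / 2" using elim(7) by (simp add: mult.assoc)
    show "st_v (X eps 0) + eps * BA * H eps \<le> 2 * v0" using elim(8) by (simp add: X0 mult.assoc)
    show "\<delta> * (eps * bm * H eps) \<le> 1" using elim(9) by (simp add: mult_ac)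
    show "- st_w (X eps 0) + eps * LB * H eps + 3 * Pm * (2 * v0 / qm) \<le> Um" using elim(10) unfolding V2 Um by (simp add: X0 mult.assoc)
    show "2 / (Pm * \<delta>) * (eps * LB * H eps) \<le> 1" using elim(11) by (simp add: mult_ac)
    show "\<delta> * Pm / 2 * (2 * v0 / qm) + 1 \<le> M" using M1 unfolding V2 .
   qed
   then obtain S where S: "0 < S" "S \<le> H eps" "st_v (X eps S) = 0" and vS: "\<And>s. 0 \<le> s \<Longrightarrow> s < S \<Longrightarrow> st_v (X eps s) > 0"
    and yS: "\<And>s. 0 < s \<Longrightarrow> s \<le> S \<Longrightarrow> - st_y (X eps s) > 0"
    and bS: "\<And>s. 0 \<le> s \<Longrightarrow> s \<le> S \<Longrightarrow> 0 \<le> - st_w (X eps s) \<and> - st_w (X eps s) \<le> Um \<and> 0 \<le> - st_y (X eps s) \<and> - st_y (X eps s) \<le> M \<and>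
     f s = - st_y (X eps s) + \<delta> * - st_w (X eps s) \<and> 0 \<le> F s \<and> F s \<le> Fm"
    unfolding V2 by blast
   have S0: "0 \<le> S" using S by simp
   have FS: "0 \<le> F S" "F S \<le> Fm" using bS[of S] S by auto
   have e1nn: "e1 eps \<ge> 0" unfolding e1_def using eps M H1 by (intro add_nonneg_nonneg mult_nonneg_nonneg) auto
   have HS: "eps * c * S \<le> eps * (c * H eps)" if "c \<ge> 0" for c
    using S eps that by (simp add: mult.assoc mult_left_mono)
   have LF: "L * e1 eps * F S \<le> L * Fm * e1 eps" if "L \<ge> 0" for L
    using FS e1nn that mult_left_mono[OF FS(2), of "L * e1 eps"] by (simp add: mult_ac)
   define T1 where "T1 = eps * ((BA + LB) * H eps)"
   define T2 where "T2 = (LQ + LP + LR) * Fm * e1 eps"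
   define T4 where "T4 = \<rho> * \<bar>st_w (x eps)\<bar>"
   define T5 where "T5 = (eps * LB + LP * M * e1 eps) / pbar"
   have er: "er eps = T1 + T2 + e1 eps + T4 + T5" by (simp add: er_def T1_def T2_def T4_def T5_def)
   have T: "T1 = eps * (BA * H eps) + eps * (LB * H eps)" "T2 = LQ * Fm * e1 eps + LP * Fm * e1 eps + LR * Fm * e1 eps"
    by (simp_all add: T1_def T2_def algebra_simps)
   have nn: "0 \<le> eps * (BA * H eps)" "0 \<le> eps * (LB * H eps)" "0 \<le> LQ * Fm * e1 eps" "0 \<le> LP * Fm * e1 eps" "0 \<le> LR * Fm * e1 eps" "0 \<le> T4" "0 \<le> T5"
    using eps BA(1) LB(1) LQ(1) LP(1) LR(1) pos e1nn H1 \<rho> pbar M by (auto simp: T4_def T5_def intro!: mult_nonneg_nonneg divide_nonneg_nonneg add_nonneg_nonneg)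
   have tS: "t \<in> {0..H eps}" if "0 \<le> t" "t \<le> S" for t using that S by auto
   have av: "\<bar>st_v (X eps S) - st_v (x eps) - Q \<theta>0 * F S\<bar> \<le> er eps"
   proof -
    have "\<bar>st_v (X eps S) - st_v (X eps 0) - Q \<theta>0 * F S\<bar> \<le> eps * BA * S + LQ * e1 eps * F S"
    proof (rule increment_approximation[OF S0 S(2) less_imp_le[OF eps] _ dF F0])
     show "((\<lambda>t. st_v (X eps t)) has_real_derivative eps * A (st_th (X eps t)) (phc (X eps t)) + Q (st_th (X eps t)) * f t) (at t within {0..H eps})" if t: "t \<in> {0..H eps}" for t
      using d(5)[OF t] by (simp add: f_def)
    qed (use f0 aB Qth tS in auto)
    then show ?thesis unfolding er T X0 using HS[OF BA(1)] LF[OF LQ(1)] nn e1nn by linarith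
   qed
   have aw: "\<bar>st_w (X eps S) - st_w (x eps) - P \<theta>0 * F S\<bar> \<le> er eps"
   proof -
    have "\<bar>st_w (X eps S) - st_w (X eps 0) - P \<theta>0 * F S\<bar> \<le> eps * LB * S + LP * e1 eps * F S"
    proof (rule increment_approximation[OF S0 S(2) less_imp_le[OF eps] _ dF F0])
     show "((\<lambda>t. st_w (X eps t)) has_real_derivative eps * B (st_th (X eps t)) (phc (X eps t)) + P (st_th (X eps t)) * f t) (at t within {0..H eps})" if t: "t \<in> {0..H eps}" for t
      using d(2)[OF t] by (simp add: f_def)
    qed (use f0 bB Pth tS in auto)
    then show ?thesis unfolding er T X0 using HS[OF LB(1)] LF[OF LP(1)] nn e1nn by linarith
   qed
   have aph: "\<bar>st_ph (X eps S) - st_ph (x eps) - R \<theta>0 * F S\<bar> \<le> er eps"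
   proof -
    have "\<bar>st_ph (X eps S) - st_ph (X eps 0) - R \<theta>0 * F S\<bar> \<le> eps * 0 * S + LR * e1 eps * F S"
     by (rule increment_approximation[OF S0 S(2) less_imp_le[OF eps] dph dF F0]) (use f0 Rth tS in auto)
    then show ?thesis unfolding er T X0 using LF[OF LR(1)] nn e1nn by linarith
   qed
   have ath: "\<bar>st_th (X eps S) - \<theta>0\<bar> \<le> er eps"
    using th[OF tS[OF S0 order_refl]] unfolding er T using nn by linarith
   \<comment> \<open>Frozen at \<theta>0 the stable coordinate decays exactly; gravity and the drift
     of \<open>P\<close> remain as a defect, whose size \<open>T5\<close> does not grow with the
     logarithmic duration.\<close>
   have aD: "\<bar>st_y (X eps S) - \<rho> * st_w (X eps S)\<bar> \<le> er eps"
   proof -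
    let ?D = "\<lambda>t. st_y (X eps t) - \<rho> * st_w (X eps t)"
    let ?D' = "\<lambda>t. st_w (X eps t) - \<rho> * (eps * B (st_th (X eps t)) (phc (X eps t)) + P (st_th (X eps t)) * f t)"
    have "\<bar>?D S\<bar> \<le> \<bar>?D 0\<bar> + \<rho> * (eps * LB + LP * M * e1 eps) / (\<rho> * pbar)"
    proof (rule stable_coordinate[OF S0 S(2)])
     show "\<rho> * pbar > 0" using \<rho> pbar by simp
     show "(?D has_real_derivative ?D' t) (at t within {0..H eps})" if t: "t \<in> {0..H eps}" for t
      unfolding f_def by (intro DERIV_diff DERIV_cmult d(1)[OF t] d(2)[OF t])
     show "\<rho> * (eps * LB + LP * M * e1 eps) \<ge> 0" using \<rho> eps LB LP M e1nn by simp
     fix t assume t: "0 \<le> t" "t \<le> S"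
     define w y b p where "w = st_w (X eps t)" and "y = st_y (X eps t)" and "b = B (st_th (X eps t)) (phc (X eps t))" and "p = P (st_th (X eps t))"
     have ft: "f t = - y - \<delta> * w" using bS[OF t] by (simp add: w_def y_def)
     have "?D' t + \<rho> * pbar * ?D t = - \<rho> * (eps * b) - \<rho> * ((p + pbar) * f t) + w * (1 - \<rho> * pbar * \<delta> - \<rho> * \<rho> * pbar)"
      unfolding w_def[symmetric] y_def[symmetric] b_def[symmetric] p_def[symmetric] ft by (simp add: algebra_simps)
     also have "\<dots> = - (\<rho> * (eps * b + (p + pbar) * f t))" unfolding \<rho>eq by (simp add: algebra_simps)
     finally have "\<bar>?D' t + \<rho> * pbar * ?D t\<bar> = \<rho> * \<bar>eps * b + (p + pbar) * f t\<bar>" using \<rho> by (simp add: abs_mult)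
     also have "\<dots> \<le> \<rho> * (eps * LB + LP * M * e1 eps)"
     proof (rule mult_left_mono)
      have "\<bar>eps * b\<bar> \<le> eps * LB" using bB[of t] eps by (simp add: abs_mult b_def)
      moreover have "\<bar>(p + pbar) * f t\<bar> \<le> LP * e1 eps * M"
       unfolding abs_mult using Pth[OF tS[OF t]] f0[of t] LP(1) e1nn by (intro mult_mono) (auto simp: p_def pbar_def)
      moreover have "LP * e1 eps * M = LP * M * e1 eps" by simp
      ultimately show "\<bar>eps * b + (p + pbar) * f t\<bar> \<le> eps * LB + LP * M * e1 eps" by linarith
     qed (use \<rho> in simp)
     finally show "\<bar>?D' t + \<rho> * pbar * ?D t\<bar> \<le> \<rho> * (eps * LB + LP * M * e1 eps)" .
    qed
    moreover have "\<rho> * (eps * LB + LP * M * e1 eps) / (\<rho> * pbar) = T5" using \<rho> by (simp add: T5_def)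
    moreover have "\<bar>?D 0\<bar> = T4" using \<rho> by (simp add: X0 y0 T4_def abs_mult)
    ultimately show ?thesis unfolding er T using nn e1nn by linarith
   qed
   have bounds: "\<bar>st_y (X eps s)\<bar> \<le> M \<and> \<bar>st_w (X eps s)\<bar> \<le> M \<and> \<bar>st_ph (X eps s)\<bar> \<le> M \<and>
    force (X eps s) = - st_y (X eps s) - \<delta> * st_w (X eps s) \<and> force (X eps s) \<ge> 0" if s: "0 \<le> s" "s \<le> S" for s
   proof -
    have "\<bar>st_ph (X eps s) - st_ph (x eps)\<bar> \<le> RM * F s" using ph[OF s(1)] s S by simp
    also have "\<dots> \<le> RM * Fm" using bS[OF s] pos by (intro mult_left_mono) auto
    finally have "\<bar>st_ph (X eps s)\<bar> \<le> M" using M4 elim(6) by linarith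
    moreover have "\<bar>st_y (X eps s)\<bar> \<le> M" "\<bar>st_w (X eps s)\<bar> \<le> M" using bS[OF s] M5 by (simp_all add: abs_le_iff)
    ultimately show ?thesis using bS[OF s] f0[of s] by (simp add: f_def)
   qed
   have "good eps S (F S)"
   proof -
    have "st_y (X eps s) < 0" if "0 < s" "s \<le> S" for s using yS[OF that] by simp
    then show ?thesis unfolding good_def
     using S(1) S(2)[unfolded H_def] S(3) vS bounds av aw aph ath aD by blast
   qed
   then show ?case by blast
  qed
 qed
 then obtain S Fv where good: "eventually (\<lambda>eps. good eps (S eps) (Fv eps)) (at_right 0)"
  unfolding eventually_ex by blast
 have null: "(g \<longlongrightarrow> 0) (at_right 0)" if "eventually (\<lambda>eps. \<bar>g eps\<bar> \<le> er eps) (at_right 0)" for g :: "real \<Rightarrow> real"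
  by (rule Lim_null_comparison[OF _ ler]) (use that in simp)
 define rv where "rv eps = st_v (X eps (S eps)) - st_v (x eps) - Q \<theta>0 * Fv eps" for eps
 define rw where "rw eps = st_w (X eps (S eps)) - st_w (x eps) - P \<theta>0 * Fv eps" for eps
 define rp where "rp eps = st_ph (X eps (S eps)) - st_ph (x eps) - R \<theta>0 * Fv eps" for eps
 define rt where "rt eps = st_th (X eps (S eps)) - \<theta>0" for eps
 define rD where "rD eps = st_y (X eps (S eps)) - \<rho> * st_w (X eps (S eps))" for eps
 have r0: "(rv \<longlongrightarrow> 0) (at_right 0)" "(rw \<longlongrightarrow> 0) (at_right 0)" "(rp \<longlongrightarrow> 0) (at_right 0)" "(rt \<longlongrightarrow> 0) (at_right 0)" "(rD \<longlongrightarrow> 0) (at_right 0)"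
  by (rule null, rule eventually_mono[OF good], unfold good_def rv_def rw_def rp_def rt_def rD_def, blast)+
 have vS0: "eventually (\<lambda>eps. st_v (X eps (S eps)) = 0) (at_right 0)"
  using good by eventually_elim (simp add: good_def)
 have Q0: "Q \<theta>0 \<noteq> 0" using neg by simp
 \<comment> \<open>At the end of the stage \<open>v\<close> vanishes, so its increment relation can
   be solved for the impulse.\<close>
 have "((\<lambda>eps. (- st_v (x eps) - rv eps) / Q \<theta>0) \<longlongrightarrow> (- v0 - 0) / Q \<theta>0) (at_right 0)"
  by (intro tendsto_intros xc r0 Q0)
 then have "((\<lambda>eps. (- st_v (x eps) - rv eps) / Q \<theta>0) \<longlongrightarrow> Fs) (at_right 0)" by (simp add: Fs_def)
 moreover have "eventually (\<lambda>eps. (- st_v (x eps) - rv eps) / Q \<theta>0 = Fv eps) (at_right 0)"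
  using vS0 by eventually_elim (use Q0 in \<open>simp add: rv_def\<close>)
 ultimately have lF: "(Fv \<longlongrightarrow> Fs) (at_right 0)" by (rule Lim_transform_eventually)
 have lw: "((\<lambda>eps. st_w (X eps (S eps))) \<longlongrightarrow> P \<theta>0 * Fs) (at_right 0)"
 proof -
  have "((\<lambda>eps. st_w (x eps) + P \<theta>0 * Fv eps + rw eps) \<longlongrightarrow> 0 + P \<theta>0 * Fs + 0) (at_right 0)" by (intro tendsto_intros xc r0 lF)
  then show ?thesis by (simp add: rw_def)
 qed
 have lp: "((\<lambda>eps. st_ph (X eps (S eps))) \<longlongrightarrow> \<phi>0 + R \<theta>0 * Fs) (at_right 0)"
 proof -
  have "((\<lambda>eps. st_ph (x eps) + R \<theta>0 * Fv eps + rp eps) \<longlongrightarrow> \<phi>0 + R \<theta>0 * Fs + 0) (at_right 0)" by (intro tendsto_intros xc r0 lF)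
  then show ?thesis by (simp add: rp_def)
 qed
 have lt: "((\<lambda>eps. st_th (X eps (S eps))) \<longlongrightarrow> \<theta>0) (at_right 0)"
 proof -
  have "((\<lambda>eps. \<theta>0 + rt eps) \<longlongrightarrow> \<theta>0 + 0) (at_right 0)" by (intro tendsto_intros r0)
  then show ?thesis by (simp add: rt_def)
 qed
 have ly: "((\<lambda>eps. st_y (X eps (S eps))) \<longlongrightarrow> P \<theta>0 * Fs / l) (at_right 0)"
 proof -
  have "((\<lambda>eps. \<rho> * st_w (X eps (S eps)) + rD eps) \<longlongrightarrow> \<rho> * (P \<theta>0 * Fs) + 0) (at_right 0)" by (intro tendsto_intros lw r0)
  then show ?thesis by (simp add: rD_def \<rho>_def)
 qed
 have lv: "((\<lambda>eps. st_v (X eps (S eps))) \<longlongrightarrow> 0) (at_right 0)"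
  by (rule Lim_transform_eventually[OF tendsto_const]) (use vS0 in eventually_elim, simp)
 have "((\<lambda>eps. (st_y (X eps (S eps)), st_w (X eps (S eps)), st_th (X eps (S eps)), st_ph (X eps (S eps)), st_v (X eps (S eps)))) \<longlongrightarrow>
   (P \<theta>0 * Fs / l, P \<theta>0 * Fs, \<theta>0, \<phi>0 + R \<theta>0 * Fs, 0)) (at_right 0)"
  by (intro tendsto_Pair ly lw lt lp lv)
 then have lim: "((\<lambda>eps. X eps (S eps)) \<longlongrightarrow> (P \<theta>0 * Fs / lam (- P \<theta>0) \<delta>, P \<theta>0 * Fs, \<theta>0, \<phi>0 + R \<theta>0 * Fs, 0)) (at_right 0)"
  by (simp add: l_def pbar_def)
 show ?thesis
 proof (intro exI[of _ S] exI[of _ C] conjI C lim)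
  show "eventually (\<lambda>eps. S eps \<le> C * ln (1 / eps) \<and> compressed (X eps) (S eps)) (at_right 0)"
   by (rule eventually_mono[OF good]) (unfold good_def compressed_def, blast)
 qed
qed

end

section \<open>Free flight, sliding and release\<close>

definition flight :: "real \<Rightarrow> real \<Rightarrow> real \<Rightarrow> (real \<Rightarrow> state) \<Rightarrow> real \<Rightarrow> bool" where
 "flight \<theta>0 \<phi>0 r X T \<longleftrightarrow> 0 \<le> T \<and> st_y (X T) = 0 \<and> st_w (X T) \<le> 0 \<and> (T > 0 \<longrightarrow> st_w (X T) < 0) \<and>
   (\<forall>s. 0 < s \<longrightarrow> s < T \<longrightarrow> st_y (X s) > 0) \<and>
   (\<forall>s. 0 \<le> s \<longrightarrow> s \<le> T \<longrightarrow> \<bar>st_y (X s)\<bar> \<le> 1 \<and> \<bar>st_w (X s)\<bar> \<le> 1 \<and> st_ph (X s) = \<phi>0 \<and>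
    st_v (X s) > 0 \<and> \<bar>st_th (X s) - \<theta>0\<bar> < r)"

context truncated
begin

lemma sol_piece:
 assumes "sol eps x X" "0 \<le> T"
  and "\<And>t. 0 < t \<Longrightarrow> t < T \<Longrightarrow> \<exists>s. slip_sign s (X t) \<and> fld eps (X t) = sfield \<alpha> \<mu> \<delta>' eps s (X t)"
 shows "piece \<alpha> \<mu> \<delta>' eps T X"
 unfolding piece_def
proof (intro conjI exI[of _ "{}"] ballI)
 fix t assume "t \<in> {0<..<T} - {}"
 then have t: "0 < t" "t < T" by auto
 obtain s where s: "slip_sign s (X t)" "fld eps (X t) = sfield \<alpha> \<mu> \<delta>' eps s (X t)" using assms(3)[OF t] by blast
 show "\<exists>s. slip_sign s (X t) \<and> (X has_vector_derivative sfield \<alpha> \<mu> \<delta>' eps s (X t)) (at t)"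
  using s sol_deriv_at[OF assms(1) t(1)] by (intro exI[of _ s]) simp
qed (use assms sol_lipschitz in auto)

text \<open>The scaled limit problem is stationary, so the path stays close to its start over any
  bounded scaled time. The return itself is visible only at order \<open>eps\<close>:
  \<open>w\<close> starts below \<open>Kw * eps\<close> and falls at a rate of at least
  \<open>eps * bm\<close>, whence a duration independent of \<open>eps\<close>.\<close>

lemma free_flight:
 fixes X :: "real \<Rightarrow> real \<Rightarrow> state"
 assumes zero: "\<And>\<theta>. P \<theta> = 0" "\<And>\<theta>. R \<theta> = 0" "\<And>\<theta>. Q \<theta> = 0" "\<And>\<theta> \<phi>. E \<theta> \<phi> = 0"
  and neg: "B \<theta>0 \<phi>0 < 0" and \<phi>0: "\<bar>\<phi>0\<bar> \<le> M" and v0: "v0 > 0" and Kw: "Kw \<ge> 0" and r: "r > 0"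
  and w0: "eventually (\<lambda>eps. \<bar>w0 eps\<bar> \<le> Kw * eps) (at_right 0)"
  and X: "eventually (\<lambda>eps. sol eps (0, w0 eps, \<theta>0, \<phi>0, v0) (X eps)) (at_right 0)"
 shows "\<exists>T C. eventually (\<lambda>eps. T eps \<le> C \<and> flight \<theta>0 \<phi>0 r (X eps) (T eps)) (at_right 0) \<and>
   ((\<lambda>eps. X eps (T eps)) \<longlongrightarrow> (0, 0, \<theta>0, \<phi>0, v0)) (at_right 0)"
proof -
 define bm where "bm = - B \<theta>0 \<phi>0 / 2"
 have bm: "bm > 0" using neg by (simp add: bm_def)
 \<comment> \<open>A parabola with initial slope \<open>Kw * eps\<close> and curvature
   \<open>- eps * bm\<close> has returned at \<open>2 * Kw / bm\<close>; the added 1 makes the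
   inequality strict.\<close>
 define C where "C = 2 * Kw / bm + 1"
 have C: "C > 0" "2 * Kw < bm * C" using bm Kw by (auto simp: C_def field_simps add_nonneg_pos)
 obtain LB where LB: "LB \<ge> 0"
  "\<And>x y. \<bar>B (fst x) (clip (- M) M (snd x)) - B (fst y) (clip (- M) M (snd y))\<bar> \<le> LB * dist x y" using blip_onD[OF blipB] by metis
 have LB2: "\<bar>B \<theta> \<phi>0 - B \<theta>0 \<phi>0\<bar> \<le> LB * \<bar>\<theta> - \<theta>0\<bar>" for \<theta>
  using LB(2)[of "(\<theta>, \<phi>0)" "(\<theta>0, \<phi>0)"] \<phi>0 by (simp add: clip_eq abs_le_iff dist_Pair_Pair dist_real_def)
 define e where "e = Min {1, v0, r, bm / (LB + 1)}"
 have e: "e > 0" "e \<le> 1" "e \<le> v0" "e \<le> r" "e \<le> bm / (LB + 1)" using v0 r bm LB(1) unfolding e_def by auto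
 have lw: "(w0 \<longlongrightarrow> 0) (at_right 0)"
 proof (rule Lim_null_comparison)
  show "eventually (\<lambda>eps. norm (w0 eps) \<le> Kw * eps) (at_right 0)" using w0 by simp
  have "((\<lambda>eps. Kw * eps) \<longlongrightarrow> Kw * 0) (at_right 0)" by (intro tendsto_intros)
  then show "((\<lambda>eps. Kw * eps) \<longlongrightarrow> 0) (at_right 0)" by simp
 qed
 have ul: "uniform_limit {0..C} X (\<lambda>_. (0, 0, \<theta>0, \<phi>0, v0)) (at_right 0)"
 proof (rule sol_limit[OF _ X])
  have "fld 0 (0, 0, \<theta>0, \<phi>0, v0) = 0" by (simp add: fld_def zero zero_prod_def)
  then show "((\<lambda>_. (0, 0, \<theta>0, \<phi>0, v0)) has_vector_derivative fld 0 (0, 0, \<theta>0, \<phi>0, v0)) (at t within {0..C})" for t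
   by simp
  show "((\<lambda>eps. (0, w0 eps, \<theta>0, \<phi>0, v0)) \<longlongrightarrow> (0, 0, \<theta>0, \<phi>0, v0)) (at_right 0)" by (intro tendsto_intros lw)
 qed
 have "eventually (\<lambda>eps. \<exists>T\<le>C. flight \<theta>0 \<phi>0 r (X eps) T) (at_right 0)"
  using X w0 uniform_limitD[OF ul e(1)] eventually_at_right_less[of "0::real"]
 proof eventually_elim
  case (elim eps)
  then have sl: "sol eps (0, w0 eps, \<theta>0, \<phi>0, v0) (X eps)" and w0: "\<bar>w0 eps\<bar> \<le> Kw * eps" and eps: "eps > 0"
   and close: "\<And>t. t \<in> {0..C} \<Longrightarrow> dist (X eps t) (0, 0, \<theta>0, \<phi>0, v0) < e" by auto
  have X0: "X eps 0 = (0, w0 eps, \<theta>0, \<phi>0, v0)" using sl by (simp add: sol_def)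
  note d = sol_components[OF sl _ order_refl]
  have cl: "\<bar>st_y (X eps t)\<bar> < e" "\<bar>st_w (X eps t)\<bar> < e" "\<bar>st_th (X eps t) - \<theta>0\<bar> < e" "\<bar>st_v (X eps t) - v0\<bar> < e"
   if t: "t \<in> {0..C}" for t
   using le_less_trans[OF state_dist_ge(1) close[OF t]] le_less_trans[OF state_dist_ge(2) close[OF t]]
    le_less_trans[OF state_dist_ge(3) close[OF t]] le_less_trans[OF state_dist_ge(5) close[OF t]] by simp_all
  have ph: "st_ph (X eps t) = \<phi>0" if t: "t \<in> {0..C}" for t
  proof -
   have "\<bar>st_ph (X eps t) - st_ph (X eps 0) - 0 * 0\<bar> \<le> 0 * 0 * t + 0 * 0"
    by (rule increment_approximation[where f = "\<lambda>_. 0" and F = "\<lambda>_. 0" and h = "\<lambda>_. 0" and c = "\<lambda>t. 0" and H = C])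
     (use t d(4)[of _ C] zero in auto)
   then show ?thesis using X0 by simp
  qed
  have dw: "((\<lambda>t. st_w (X eps t)) has_real_derivative eps * B (st_th (X eps t)) \<phi>0) (at t within {0..C})" if t: "t \<in> {0..C}" for t
   using d(2)[OF t] ph[OF t] \<phi>0 by (simp add: zero phc_def clip_eq abs_le_iff)
  have dy: "((\<lambda>t. st_y (X eps t)) has_real_derivative st_w (X eps t)) (at t within {0..C})" if t: "t \<in> {0..C}" for t
   using d(1)[OF t] .
  have Bm: "B (st_th (X eps t)) \<phi>0 \<le> - bm" if t: "t \<in> {0..C}" for t
  proof -
   have "\<bar>B (st_th (X eps t)) \<phi>0 - B \<theta>0 \<phi>0\<bar> \<le> LB * \<bar>st_th (X eps t) - \<theta>0\<bar>" by (rule LB2)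
   also have "\<dots> \<le> LB * (bm / (LB + 1))" using cl(3)[OF t] e(5) LB(1) by (intro mult_left_mono) auto
   also have "\<dots> \<le> bm" using bm LB(1) by (simp add: field_simps)
   finally show ?thesis unfolding bm_def by linarith
  qed
  have wdec: "st_w (X eps t) + eps * bm * t \<le> st_w (X eps s) + eps * bm * s" if st: "0 \<le> s" "s \<le> t" "t \<le> C" for s t
  proof -
   have "- (st_w (X eps s) + eps * bm * s) \<le> - (st_w (X eps t) + eps * bm * t)"
   proof (rule increasing_on_subinterval[OF _ st, of "\<lambda>t. - (st_w (X eps t) + eps * bm * t)"])
    show "((\<lambda>t. - (st_w (X eps t) + eps * bm * t)) has_real_derivative - (eps * B (st_th (X eps t)) \<phi>0 + eps * bm)) (at t within {0..C})" if "t \<in> {0..C}" for t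
     by (rule derivative_eq_intros dw that refl)+ simp
    show "0 \<le> - (eps * B (st_th (X eps t')) \<phi>0 + eps * bm)" if "s \<le> t'" "t' \<le> t" for t'
    proof -
     have "eps * B (st_th (X eps t')) \<phi>0 \<le> eps * - bm" using Bm[of t'] that st eps by (intro mult_left_mono) auto
     then show ?thesis by simp
    qed
   qed
   then show ?thesis by linarith
  qed
  have cX: "continuous_on {0..C} (X eps)" by (rule sol_continuous[OF sl])
  have bnd: "\<bar>st_y (X eps s)\<bar> \<le> 1 \<and> \<bar>st_w (X eps s)\<bar> \<le> 1 \<and> st_ph (X eps s) = \<phi>0 \<and> st_v (X eps s) > 0 \<and> \<bar>st_th (X eps s) - \<theta>0\<bar> < r"
   if s: "s \<in> {0..C}" for s
   using cl[OF s] ph[OF s] e by auto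
  \<comment> \<open>Without upward initial velocity the flight has length zero. Otherwise the
    landing velocity has to be strictly negative, since the landing state is required to be
    nondegenerate.\<close>
  show ?case
  proof (cases "w0 eps > 0")
   case False
   then show ?thesis using X0 C bnd[of 0] by (intro exI[of _ 0]) (auto simp: flight_def)
  next
   case True
   have wC: "st_w (X eps C) \<le> 0"
   proof -
    have "Kw * eps * 2 \<le> eps * bm * C" using C(2) eps by (simp add: mult.assoc mult.commute[of eps])
    moreover have "Kw * eps \<ge> 0" using Kw eps by simp
    ultimately show ?thesis using wdec[of 0 C] C w0 X0 True by simp
   qed
   have cw: "continuous_on {0..C} (\<lambda>t. st_w (X eps t))" and cy: "continuous_on {0..C} (\<lambda>t. st_y (X eps t))"
    by (intro continuous_intros cX)+
   obtain tm where tm: "0 < tm" "tm \<le> C" "st_w (X eps tm) = 0" "\<And>s. 0 \<le> s \<Longrightarrow> s < tm \<Longrightarrow> st_w (X eps s) > 0"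
    using first_zero[OF cw C(1) _ wC] X0 True by auto
   have ypos: "st_y (X eps t) > 0" if t: "0 < t" "t \<le> tm" for t
   proof -
    have "st_y (X eps 0) < st_y (X eps t)"
    proof (rule DERIV_pos_imp_increasing_open[OF t(1)])
     show "continuous_on {0..t} (\<lambda>t. st_y (X eps t))" by (rule continuous_on_subset[OF cy]) (use t tm in auto)
     show "\<exists>y. ((\<lambda>t. st_y (X eps t)) has_real_derivative y) (at s) \<and> 0 < y" if s: "0 < s" "s < t" for s
     proof (intro exI conjI)
      show "((\<lambda>t. st_y (X eps t)) has_real_derivative st_w (X eps s)) (at s)"
       using dy[of s] s t tm by (simp add: at_within_Icc_at)
      show "0 < st_w (X eps s)" using tm(4) s t by simp
     qed
    qed
    then show ?thesis using X0 by simp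
   qed
   have yC: "st_y (X eps C) \<le> 0"
   proof -
    have "w0 eps * 0 - eps * bm * 0\<^sup>2 / 2 - st_y (X eps 0) \<le> w0 eps * C - eps * bm * C\<^sup>2 / 2 - st_y (X eps C)"
    proof (rule increasing_on_subinterval[of C "\<lambda>t. w0 eps * t - eps * bm * t\<^sup>2 / 2 - st_y (X eps t)", OF _ order_refl less_imp_le[OF C(1)] order_refl])
     show "((\<lambda>t. w0 eps * t - eps * bm * t\<^sup>2 / 2 - st_y (X eps t)) has_real_derivative w0 eps - eps * bm * t - st_w (X eps t)) (at t within {0..C})" if "t \<in> {0..C}" for t
     proof -
      have "((\<lambda>t. w0 eps * t - eps * bm * t\<^sup>2 / 2) has_real_derivative w0 eps - eps * bm * t) (at t within {0..C})"
       by (auto intro!: derivative_eq_intros)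
      from DERIV_diff[OF this dy[OF that]] show ?thesis .
     qed
     show "0 \<le> w0 eps - eps * bm * t - st_w (X eps t)" if "0 \<le> t" "t \<le> C" for t
      using wdec[OF order_refl that] X0 by simp
    qed
    then have "st_y (X eps C) \<le> C * (w0 eps - eps * bm * C / 2)" using X0 by (simp add: power2_eq_square algebra_simps)
    also have "\<dots> \<le> 0"
    proof (rule mult_nonneg_nonpos)
     have "Kw * eps * 2 \<le> eps * bm * C" using C(2) eps by (simp add: mult.assoc mult.commute[of eps])
     then show "w0 eps - eps * bm * C / 2 \<le> 0" using w0 by simp
    qed (use C in simp)
    finally show ?thesis .
   qed
   have tmC: "tm < C" using ypos[of tm] tm yC by (cases "tm = C") auto
   \<comment> \<open>\<open>y\<close> vanishes at take-off, so its first zero is sought only from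
     the apex time \<open>tm\<close> on, where \<open>y\<close> is positive.\<close>
   have ch: "continuous_on {0..C - tm} (\<lambda>t. st_y (X eps (tm + t)))"
    by (rule continuous_on_compose2[OF cy]) (use tm in \<open>auto intro!: continuous_intros\<close>)
   obtain t2 where t2: "0 < t2" "t2 \<le> C - tm" "st_y (X eps (tm + t2)) = 0" "\<And>s. 0 \<le> s \<Longrightarrow> s < t2 \<Longrightarrow> st_y (X eps (tm + s)) > 0"
    using first_zero[OF ch] tmC ypos[of tm] tm yC by auto
   define T where "T = tm + t2"
   have T: "0 < T" "T \<le> C" "tm < T" "st_y (X eps T) = 0" using tm t2 by (auto simp: T_def)
   have Tp: "st_y (X eps s) > 0" if s: "0 < s" "s < T" for s
   proof (cases "s \<le> tm")
    case False
    then show ?thesis using t2(4)[of "s - tm"] s by (simp add: T_def)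
   qed (use ypos s in auto)
   have "eps * bm * tm < eps * bm * T" using T eps bm by simp
   then have wT: "st_w (X eps T) < 0" using wdec[of tm T] tm T by simp
   show ?thesis
    unfolding flight_def by (intro exI[of _ T] conjI allI impI) (use T Tp wT bnd in auto)
  qed
 qed
 then obtain T where T: "eventually (\<lambda>eps. T eps \<le> C \<and> flight \<theta>0 \<phi>0 r (X eps) (T eps)) (at_right 0)"
  unfolding eventually_ex by blast
 have "((\<lambda>eps. X eps (T eps)) \<longlongrightarrow> (0, 0, \<theta>0, \<phi>0, v0)) (at_right 0)"
 proof (rule tendstoI)
  fix e :: real assume "e > 0"
  from T uniform_limitD[OF ul this] show "eventually (\<lambda>eps. dist (X eps (T eps)) (0, 0, \<theta>0, \<phi>0, v0) < e) (at_right 0)"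
   by eventually_elim (auto simp: flight_def)
 qed
 with T show ?thesis by (intro exI[of _ T] exI[of _ C] conjI)
qed

text \<open>In the application \<open>qq\<close> is
  \<open>- \<sigma> * q_coeff \<alpha> \<mu> \<sigma>\<close> and \<open>aa\<close> is
  \<open>\<sigma> * a_coeff\<close>: the strict inequality says that the field on the side \<sigma>
  points towards \<open>v = 0\<close>, and equality at \<open>S\<close> that it has become
  tangent.\<close>

definition slid :: "(real \<Rightarrow> real) \<Rightarrow> (real \<Rightarrow> real \<Rightarrow> real) \<Rightarrow> real \<Rightarrow> real \<Rightarrow> real \<Rightarrow> (real \<Rightarrow> state) \<Rightarrow> real \<Rightarrow> bool" where
 "slid qq aa \<theta>0 r eps X S \<longleftrightarrow> 0 < S \<and>
   qq (st_th (X S)) * force (X S) = eps * aa (st_th (X S)) (phc (X S)) \<and>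
   (\<forall>s. 0 \<le> s \<longrightarrow> s < S \<longrightarrow> qq (st_th (X s)) * force (X s) > eps * aa (st_th (X s)) (phc (X s))) \<and>
   (\<forall>s. 0 \<le> s \<longrightarrow> s \<le> S \<longrightarrow> st_y (X s) < 0 \<and> \<bar>st_y (X s)\<bar> \<le> M \<and> \<bar>st_w (X s)\<bar> \<le> M \<and> \<bar>st_ph (X s)\<bar> \<le> M \<and>
    st_v (X s) = 0 \<and> \<bar>st_th (X s) - \<theta>0\<bar> < r \<and> force (X s) = - st_y (X s) - \<delta> * st_w (X s))"

lemma sliding_phase:
 fixes X :: "real \<Rightarrow> real \<Rightarrow> state" and qq :: "real \<Rightarrow> real" and aa :: "real \<Rightarrow> real \<Rightarrow> real"
 assumes lo: "lo = - M" and zero: "\<And>\<theta>. Q \<theta> = 0" "\<And>\<theta> \<phi>. A \<theta> \<phi> = 0" and \<delta>: "\<delta> > 0" and P0: "P \<theta>0 > 0" and r: "r > 0"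
  and qq: "blip_on UNIV qq" "qq \<theta>0 > 0" and aa: "blip_on UNIV (\<lambda>x. aa (fst x) (clip (- M) M (snd x)))"
  and T: "0 < T" "T < T1"
  and dy: "\<And>t. t \<in> {0..T1} \<Longrightarrow> (yl has_real_derivative wl t) (at t within {0..T1})"
  and dw: "\<And>t. t \<in> {0..T1} \<Longrightarrow> (wl has_real_derivative - P \<theta>0 * (yl t + \<delta> * wl t)) (at t within {0..T1})"
  and u: "\<And>t. 0 \<le> t \<Longrightarrow> t < T \<Longrightarrow> yl t + \<delta> * wl t < 0" "\<And>t. T < t \<Longrightarrow> t \<le> T1 \<Longrightarrow> yl t + \<delta> * wl t > 0"
  and yneg: "\<And>t. t \<in> {0..T1} \<Longrightarrow> yl t < 0"
  and bnd: "\<And>t. t \<in> {0..T1} \<Longrightarrow> \<bar>yl t\<bar> + \<delta> * \<bar>wl t\<bar> + (1 + \<delta>) \<le> M \<and> \<bar>wl t\<bar> + 1 \<le> M \<and>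
   \<bar>\<phi>1 + R \<theta>0 / P \<theta>0 * (wl t - wl 0)\<bar> + 1 \<le> M"
  and X: "eventually (\<lambda>eps. sol eps (x eps) (X eps) \<and> st_v (x eps) = 0) (at_right 0)"
  and x: "(x \<longlongrightarrow> (yl 0, wl 0, \<theta>0, \<phi>1, 0)) (at_right 0)"
 shows "\<exists>S. eventually (\<lambda>eps. S eps \<le> T1 \<and> slid qq aa \<theta>0 r eps (X eps) (S eps)) (at_right 0) \<and>
   ((\<lambda>eps. X eps (S eps)) \<longlongrightarrow> (yl T, wl T, \<theta>0, \<phi>1 + R \<theta>0 / P \<theta>0 * (wl T - wl 0), 0)) (at_right 0)"
proof -
 \<comment> \<open>In the limit the derivatives of \<open>w\<close> and \<phi> are proportional to
   the same force, so the change of \<phi> is \<open>R \<theta>0 / P \<theta>0\<close> times that of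
   \<open>w\<close>.\<close>
 define Xb where "Xb t = (yl t, wl t, \<theta>0, \<phi>1 + R \<theta>0 / P \<theta>0 * (wl t - wl 0), 0 :: real)" for t
 have T1: "T1 > 0" "T \<in> {0..T1}" using T by auto
 have fb: "force (Xb t) = - yl t - \<delta> * wl t" if t: "t \<in> {0..T1}" for t
 proof -
  have "\<bar>\<delta> * wl t\<bar> = \<delta> * \<bar>wl t\<bar>" using \<delta> by (simp add: abs_mult)
  then have "- M \<le> - yl t - \<delta> * wl t" "- yl t - \<delta> * wl t \<le> M" using bnd[OF t] \<delta> by linarith+
  then have "clip (- M) M (- yl t - \<delta> * wl t) = - yl t - \<delta> * wl t" by (rule clip_eq)
  moreover have "force (Xb t) = clip lo M (- yl t - \<delta> * wl t)" by (simp add: force_def Xb_def)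
  ultimately show ?thesis by (simp only: lo)
 qed
 have dX: "(Xb has_vector_derivative fld 0 (Xb t)) (at t within {0..T1})" if t: "t \<in> {0..T1}" for t
 proof -
  have f: "fld 0 (Xb t) = (wl t, P \<theta>0 * (- yl t - \<delta> * wl t), 0, R \<theta>0 * (- yl t - \<delta> * wl t), 0)"
   using fb[OF t] by (simp add: fld_def zero) (simp add: Xb_def)
  have d4: "((\<lambda>t. \<phi>1 + R \<theta>0 / P \<theta>0 * (wl t - wl 0)) has_real_derivative R \<theta>0 * (- yl t - \<delta> * wl t)) (at t within {0..T1})"
   by (rule derivative_eq_intros dw t refl)+ (use P0 in \<open>simp add: field_simps\<close>)
  have d2: "(wl has_real_derivative P \<theta>0 * (- yl t - \<delta> * wl t)) (at t within {0..T1})"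
   by (rule DERIV_cong[OF dw[OF t]]) (simp add: algebra_simps)
  show ?thesis unfolding f unfolding Xb_def
   by (intro has_vector_derivative_Pair has_vector_derivative_const)
    (use dy[OF t] d2 d4 in \<open>simp_all add: has_real_derivative_iff_has_vector_derivative\<close>)
 qed
 have cb: "continuous_on {0..T1} Xb"
  unfolding continuous_on_eq_continuous_within using has_vector_derivative_continuous[OF dX] by blast
 have Xs: "eventually (\<lambda>eps. sol eps (x eps) (X eps)) (at_right 0)" using X by eventually_elim simp
 have ul: "uniform_limit {0..T1} X Xb (at_right 0)"
  by (rule sol_limit[OF dX Xs]) (use x in \<open>simp_all add: Xb_def\<close>)
 define h where "h eps t = qq (st_th (X eps t)) * force (X eps t) - eps * aa (st_th (X eps t)) (phc (X eps t))" for eps t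
 have bq: "blip_on UNIV (\<lambda>x::state. qq (st_th x))"
  by (rule blip_comp[OF qq(1), where c = 1]) (use state_dist_ge(3) in \<open>simp add: dist_real_def\<close>)
 have pair: "dist (st_th x, st_ph x) (st_th y, st_ph y) \<le> 2 * dist x y" for x y :: state
  using dist_Pair_le[of "st_th x" "st_ph x" "st_th y" "st_ph y"] state_dist_ge(3,4)[of x y] by (simp add: dist_real_def)
 have ba: "blip_on UNIV (\<lambda>x. aa (st_th x) (phc x))" using blip_comp[OF aa pair] by (simp add: phc_def)
 have bqf: "blip_on UNIV (\<lambda>x. qq (st_th x) * force x)" by (intro blip_mult bq blip_fld)
 obtain K1 where K1: "K1 \<ge> 0" "\<And>x y. \<bar>qq (st_th x) * force x - qq (st_th y) * force y\<bar> \<le> K1 * dist x y" using blip_onD[OF bqf] by metis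
 obtain K2 where K2: "K2 \<ge> 0" "\<And>x. \<bar>aa (st_th x) (phc x)\<bar> \<le> K2" using blip_onD[OF ba] by metis
 have ulh: "uniform_limit {0..T1} h (\<lambda>t. qq \<theta>0 * (- yl t - \<delta> * wl t)) (at_right 0)"
 proof (rule uniform_limitI)
  fix e :: real assume e: "e > 0"
  have e0: "((\<lambda>eps::real. eps * K2) \<longlongrightarrow> 0 * K2) (at_right 0)" by (intro tendsto_intros)
  have "eventually (\<lambda>eps. eps * K2 < e / 2) (at_right 0)" using order_tendstoD(2)[OF e0, of "e / 2"] e by simp
  moreover have "e / (2 * (K1 + 1)) > 0" using e K1 by simp
  note uniform_limitD[OF ul this]
  ultimately show "\<forall>\<^sub>F eps in at_right 0. \<forall>t\<in>{0..T1}. dist (h eps t) (qq \<theta>0 * (- yl t - \<delta> * wl t)) < e"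
   using eventually_at_right_less[of "0::real"]
  proof eventually_elim
   case (elim eps)
   show ?case
   proof
    fix t assume t: "t \<in> {0..T1}"
    have "\<bar>qq (st_th (X eps t)) * force (X eps t) - qq (st_th (Xb t)) * force (Xb t)\<bar> \<le> K1 * dist (X eps t) (Xb t)" by (rule K1)
    also have "\<dots> \<le> K1 * (e / (2 * (K1 + 1)))" using elim(2) t K1 by (intro mult_left_mono) (auto intro: less_imp_le)
    also have "\<dots> \<le> e / 2" using e K1 by (simp add: field_simps)
    finally have 1: "\<bar>qq (st_th (X eps t)) * force (X eps t) - qq (st_th (Xb t)) * force (Xb t)\<bar> \<le> e / 2" .
    have 2: "\<bar>eps * aa (st_th (X eps t)) (phc (X eps t))\<bar> \<le> eps * K2" using elim(3) K2 by (simp add: abs_mult mult_left_mono)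
    have 3: "qq (st_th (Xb t)) * force (Xb t) = qq \<theta>0 * (- yl t - \<delta> * wl t)" using fb[OF t] by (simp add: Xb_def)
    show "dist (h eps t) (qq \<theta>0 * (- yl t - \<delta> * wl t)) < e"
     using 1 2 elim(1) unfolding dist_real_def h_def 3 by linarith
   qed
  qed
 qed
 have cf: "continuous_on S (\<lambda>x. qq (st_th x) * force x)" "continuous_on S (\<lambda>x. aa (st_th x) (phc x))" for S :: "state set"
 proof -
  obtain L where L: "L-lipschitz_on UNIV (\<lambda>x. qq (st_th x) * force x)" by (rule blip_imp_lipschitz[OF bqf])
  show "continuous_on S (\<lambda>x. qq (st_th x) * force x)"
   by (rule continuous_on_subset[OF lipschitz_on_continuous_on[OF L] subset_UNIV])
  obtain L' where L': "L'-lipschitz_on UNIV (\<lambda>x. aa (st_th x) (phc x))" by (rule blip_imp_lipschitz[OF ba])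
  show "continuous_on S (\<lambda>x. aa (st_th x) (phc x))"
   by (rule continuous_on_subset[OF lipschitz_on_continuous_on[OF L'] subset_UNIV])
 qed
 have ch: "eventually (\<lambda>eps. continuous_on {0..T1} (h eps)) (at_right 0)"
  using Xs
 proof eventually_elim
  case (elim eps)
  note cX = sol_continuous[OF elim, of T1]
  have "continuous_on {0..T1} (\<lambda>t. qq (st_th (X eps t)) * force (X eps t))" "continuous_on {0..T1} (\<lambda>t. aa (st_th (X eps t)) (phc (X eps t)))"
   by (rule continuous_on_compose2[OF cf(1) cX subset_UNIV], rule continuous_on_compose2[OF cf(2) cX subset_UNIV])
  then show ?case unfolding h_def by (intro continuous_on_diff continuous_on_mult_left)
 qed
 have cu: "continuous_on {0..T1} yl" "continuous_on {0..T1} wl"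
  unfolding continuous_on_eq_continuous_within using DERIV_continuous[OF dy] DERIV_continuous[OF dw] by blast+
 have "continuous_on {0..T1} (\<lambda>t. qq \<theta>0 * (- yl t - \<delta> * wl t))" by (intro continuous_intros cu)
 then obtain S where S: "(S \<longlongrightarrow> T) (at_right 0)"
   "eventually (\<lambda>eps. 0 < S eps \<and> S eps \<le> T1 \<and> h eps (S eps) = 0 \<and> (\<forall>s. 0 \<le> s \<longrightarrow> s < S eps \<longrightarrow> h eps s > 0)) (at_right 0)"
 proof (rule first_zero_limit[OF ch ulh _ T])
  show "0 < qq \<theta>0 * (- yl t - \<delta> * wl t)" if "0 \<le> t" "t < T" for t
   using u(1)[OF that] qq(2) by (intro mult_pos_pos) auto
  show "qq \<theta>0 * (- yl t - \<delta> * wl t) < 0" if "T < t" "t \<le> T1" for t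
   using u(2)[OF that] qq(2) by (intro mult_pos_neg) auto
 qed
 obtain z where z: "z \<in> {0..T1}" "\<And>t. t \<in> {0..T1} \<Longrightarrow> yl t \<le> yl z"
  using continuous_attains_sup[of "{0..T1}" yl] cu T1 by fastforce
 \<comment> \<open>The distance to the limit path at which \<open>y\<close> stays negative, \<theta>
   stays within \<open>r\<close>, and the margins of 1 in \<open>bnd\<close> keep the clips
   inactive.\<close>
 define e where "e = Min {1, r, - yl z}"
 have e: "e > 0" "e \<le> 1" "e \<le> r" "e \<le> - yl z" using r yneg[OF z(1)] unfolding e_def by auto
 have ev: "eventually (\<lambda>eps. S eps \<le> T1 \<and> slid qq aa \<theta>0 r eps (X eps) (S eps)) (at_right 0)"
  using X S(2) uniform_limitD[OF ul e(1)]
 proof eventually_elim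
  case (elim eps)
  then have sl: "sol eps (x eps) (X eps)" and v0: "st_v (x eps) = 0" and close: "\<And>t. t \<in> {0..T1} \<Longrightarrow> dist (X eps t) (Xb t) < e" by auto
  have main: "st_y (X eps s) < 0 \<and> \<bar>st_y (X eps s)\<bar> \<le> M \<and> \<bar>st_w (X eps s)\<bar> \<le> M \<and> \<bar>st_ph (X eps s)\<bar> \<le> M \<and>
    st_v (X eps s) = 0 \<and> \<bar>st_th (X eps s) - \<theta>0\<bar> < r \<and> force (X eps s) = - st_y (X eps s) - \<delta> * st_w (X eps s)"
   if s: "s \<in> {0..T1}" for s
  proof -
   have cl: "\<bar>st_y (X eps s) - yl s\<bar> < e" "\<bar>st_w (X eps s) - wl s\<bar> < e" "\<bar>st_th (X eps s) - \<theta>0\<bar> < e"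
    "\<bar>st_ph (X eps s) - (\<phi>1 + R \<theta>0 / P \<theta>0 * (wl s - wl 0))\<bar> < e"
    using le_less_trans[OF state_dist_ge(1) close[OF s]] le_less_trans[OF state_dist_ge(2) close[OF s]]
     le_less_trans[OF state_dist_ge(3) close[OF s]] le_less_trans[OF state_dist_ge(4) close[OF s]] by (simp_all add: Xb_def)
   have v: "st_v (X eps s) = 0"
   proof -
    have "\<bar>st_v (X eps s) - st_v (X eps 0) - 0 * 0\<bar> \<le> 0 * 0 * s + 0 * 0"
     by (rule increment_approximation[where f = "\<lambda>_. 0" and F = "\<lambda>_. 0" and h = "\<lambda>_. 0" and c = "\<lambda>t. 0" and H = T1])
      (use s sol_components(5)[OF sl _ order_refl, of _ T1] zero in auto)
    then show ?thesis using sl v0 by (simp add: sol_def)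
   qed
   have dwl: "\<bar>\<delta> * st_w (X eps s)\<bar> \<le> \<delta> * \<bar>wl s\<bar> + \<delta>"
   proof -
    have "\<bar>\<delta> * st_w (X eps s)\<bar> = \<delta> * \<bar>st_w (X eps s)\<bar>" using \<delta> by (simp add: abs_mult)
    also have "\<dots> \<le> \<delta> * (\<bar>wl s\<bar> + 1)" using cl(2) e(2) \<delta> by (intro mult_left_mono) auto
    finally show ?thesis by (simp add: distrib_left)
   qed
   have n: "\<delta> * \<bar>wl s\<bar> \<ge> 0" using \<delta> by simp
   note b = bnd[OF s]
   have "- M \<le> - st_y (X eps s) - \<delta> * st_w (X eps s)" "- st_y (X eps s) - \<delta> * st_w (X eps s) \<le> M"
    using dwl cl(1) e(2) b by linarith+
   then have "clip (- M) M (- st_y (X eps s) - \<delta> * st_w (X eps s)) = - st_y (X eps s) - \<delta> * st_w (X eps s)" by (rule clip_eq)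
   moreover have "force (X eps s) = clip lo M (- st_y (X eps s) - \<delta> * st_w (X eps s))" by (simp add: force_def)
   ultimately have f: "force (X eps s) = - st_y (X eps s) - \<delta> * st_w (X eps s)" by (simp only: lo)
   have "st_y (X eps s) < 0" using cl(1) e(4) z(2)[OF s] by linarith
   moreover have "\<bar>st_y (X eps s)\<bar> \<le> M" using cl(1) e(2) b n \<delta> by linarith
   moreover have "\<bar>st_w (X eps s)\<bar> \<le> M" using cl(2) e(2) b by linarith
   moreover have "\<bar>st_ph (X eps s)\<bar> \<le> M" using cl(4) e(2) b by linarith
   ultimately show ?thesis using f v cl(3) e(3) by simp
  qed
  show ?case unfolding slid_def
  proof (intro conjI)
   show "\<forall>s. 0 \<le> s \<longrightarrow> s \<le> S eps \<longrightarrow> st_y (X eps s) < 0 \<and> \<bar>st_y (X eps s)\<bar> \<le> M \<and> \<bar>st_w (X eps s)\<bar> \<le> M \<and> \<bar>st_ph (X eps s)\<bar> \<le> M \<and>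
    st_v (X eps s) = 0 \<and> \<bar>st_th (X eps s) - \<theta>0\<bar> < r \<and> force (X eps s) = - st_y (X eps s) - \<delta> * st_w (X eps s)"
    by (intro allI impI main) (use elim(2) in auto)
  qed (use elim(2) in \<open>auto simp: h_def\<close>)
 qed
 have "eventually (\<lambda>eps. 0 \<le> S eps \<and> S eps \<le> T1) (at_right 0)" using S(2) by eventually_elim auto
 from uniform_limit_at_event[OF ul cb S(1) this T1(2)]
 have "((\<lambda>eps. X eps (S eps)) \<longlongrightarrow> (yl T, wl T, \<theta>0, \<phi>1 + R \<theta>0 / P \<theta>0 * (wl T - wl 0), 0)) (at_right 0)" by (simp add: Xb_def)
 with ev show ?thesis by (intro exI[of _ S] conjI)
qed

end

context truncated
begin

definition released :: "real \<Rightarrow> (real \<Rightarrow> state) \<Rightarrow> real \<Rightarrow> bool" where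
 "released \<sigma> X S \<longleftrightarrow> 0 < S \<and> st_y (X S) = 0 \<and> (\<forall>s. 0 \<le> s \<longrightarrow> s < S \<longrightarrow> st_y (X s) < 0) \<and>
   (\<forall>s. 0 \<le> s \<longrightarrow> s \<le> S \<longrightarrow> \<bar>st_y (X s)\<bar> \<le> M \<and> \<bar>st_w (X s)\<bar> \<le> M \<and> \<bar>st_ph (X s)\<bar> \<le> M \<and>
    \<sigma> * st_v (X s) \<ge> 0 \<and> force (X s) = max (- st_y (X s) - \<delta> * st_w (X s)) 0)"

text \<open>
 When sliding ends, the normal acceleration \<open>eps A + Q force\<close> on the side \<open>\<sigma>\<close> vanishes. The force
 then decreases at a rate of order one while \<open>A\<close> and \<open>Q\<close> drift only at rate \<open>eps\<close>, so \<open>\<sigma> v\<close> cannot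
 become negative.
\<close>

lemma release_phase:
 fixes X :: "real \<Rightarrow> real \<Rightarrow> state"
 assumes lo: "lo = 0" and zero: "\<And>\<theta> \<phi>. E \<theta> \<phi> = 0" and \<delta>: "\<delta> > 0" and r: "r > 0"
  and \<sigma>: "\<bar>\<sigma>\<bar> = 1" and Q0: "\<sigma> * Q \<theta>0 < 0" and A0: "\<And>\<theta> \<phi>. \<bar>\<theta> - \<theta>0\<bar> < r \<Longrightarrow> \<sigma> * A \<theta> \<phi> \<ge> 0"
  and e': "e' > 0" and bnd: "\<delta> * e' + 1 \<le> M" "e' + 1 \<le> M" "\<bar>\<phi>2\<bar> + 1 \<le> M" "\<delta> * e' + \<delta> * (e' + 1) + 1 \<le> M"
  and X: "eventually (\<lambda>eps. sol eps (x eps) (X eps) \<and> st_v (x eps) = 0 \<and> - st_y (x eps) - \<delta> * st_w (x eps) \<ge> 0 \<and>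
    Q (st_th (x eps)) * (- st_y (x eps) - \<delta> * st_w (x eps)) = - (eps * A (st_th (x eps)) (phc (x eps)))) (at_right 0)"
  and x: "(x \<longlongrightarrow> (- (\<delta> * e'), e', \<theta>0, \<phi>2, 0)) (at_right 0)"
 shows "\<exists>S. eventually (\<lambda>eps. S eps \<le> \<delta> + 1 \<and> released \<sigma> (X eps) (S eps)) (at_right 0) \<and>
   ((\<lambda>eps. X eps (S eps)) \<longlongrightarrow> (0, e', \<theta>0, \<phi>2, 0)) (at_right 0)"
proof -
 define T1 where "T1 = \<delta> + 1"
 have T1: "T1 > 0" "\<delta> < T1" "\<delta> \<in> {0..T1}" using \<delta> by (auto simp: T1_def)
 \<comment> \<open>The limit motion is free of force: \<open>w\<close> stays at \<open>e'\<close>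
   and \<open>y\<close> rises from \<open>- (\<delta> * e')\<close>, where the force vanishes, so
   that contact ends at the scaled time \<delta>.\<close>
 define Xb where "Xb t = (- (\<delta> * e') + e' * t, e', \<theta>0, \<phi>2, 0 :: real)" for t
 have frc: "force z = max 0 (min M (- st_y z - \<delta> * st_w z))" for z
 proof -
  have "force z = clip lo M (- st_y z - \<delta> * st_w z)" unfolding force_def ..
  also have "\<dots> = clip 0 M (- st_y z - \<delta> * st_w z)" by (rule arg_cong[OF lo])
  finally show ?thesis by (simp add: clip_def)
 qed
 have dX: "(Xb has_vector_derivative fld 0 (Xb t)) (at t within {0..T1})" if t: "t \<in> {0..T1}" for t
 proof -
  have "e' * t \<ge> 0" using e' t by simp
  then have "force (Xb t) = 0" using M by (simp add: frc Xb_def)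
  then have f: "fld 0 (Xb t) = (e', 0, 0, 0, 0)" by (simp add: fld_def) (simp add: Xb_def)
  have "((\<lambda>t. - (\<delta> * e') + e' * t) has_real_derivative e') (at t within {0..T1})"
   by (rule derivative_eq_intros refl)+ simp
  then show ?thesis unfolding f unfolding Xb_def
   by (intro has_vector_derivative_Pair has_vector_derivative_const) (simp add: has_real_derivative_iff_has_vector_derivative)
 qed
 have cb: "continuous_on {0..T1} Xb"
  unfolding continuous_on_eq_continuous_within using has_vector_derivative_continuous[OF dX] by blast
 have Xs: "eventually (\<lambda>eps. sol eps (x eps) (X eps)) (at_right 0)" using X by eventually_elim simp
 have ul: "uniform_limit {0..T1} X Xb (at_right 0)"
  by (rule sol_limit[OF dX Xs]) (use x in \<open>simp_all add: Xb_def\<close>)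
 define h where "h eps t = - st_y (X eps t)" for eps t
 have ulh: "uniform_limit {0..T1} h (\<lambda>t. \<delta> * e' - e' * t) (at_right 0)"
 proof (rule uniform_limitI)
  fix e :: real assume "e > 0"
  from uniform_limitD[OF ul this] show "\<forall>\<^sub>F eps in at_right 0. \<forall>t\<in>{0..T1}. dist (h eps t) (\<delta> * e' - e' * t) < e"
  proof eventually_elim
   case (elim eps)
   show ?case
   proof
    fix t assume t: "t \<in> {0..T1}"
    have "\<bar>st_y (X eps t) - st_y (Xb t)\<bar> < e" using le_less_trans[OF state_dist_ge(1) bspec[OF elim t]] .
    then show "dist (h eps t) (\<delta> * e' - e' * t) < e" by (simp add: h_def Xb_def dist_real_def abs_less_iff)
   qed
  qed
 qed
 have ch: "eventually (\<lambda>eps. continuous_on {0..T1} (h eps)) (at_right 0)"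
  using Xs
 proof eventually_elim
  case (elim eps)
  note cX = sol_continuous[OF elim, of T1]
  show ?case unfolding h_def by (intro continuous_intros cX)
 qed
 obtain S where S: "(S \<longlongrightarrow> \<delta>) (at_right 0)"
   "eventually (\<lambda>eps. 0 < S eps \<and> S eps \<le> T1 \<and> h eps (S eps) = 0 \<and> (\<forall>s. 0 \<le> s \<longrightarrow> s < S eps \<longrightarrow> h eps s > 0)) (at_right 0)"
 proof (rule first_zero_limit[OF ch ulh _ \<delta> T1(2)])
  show "continuous_on {0..T1} (\<lambda>t. \<delta> * e' - e' * t)" by (intro continuous_intros)
  show "0 < \<delta> * e' - e' * t" if "0 \<le> t" "t < \<delta>" for t
   using mult_strict_left_mono[OF that(2) e'] by (simp add: mult.commute)
  show "\<delta> * e' - e' * t < 0" if "\<delta> < t" "t \<le> T1" for t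
   using mult_strict_left_mono[OF that(1) e'] by (simp add: mult.commute)
 qed
 obtain LB where LB: "LB \<ge> 0" "\<And>x. \<bar>B (fst x) (clip (- M) M (snd x))\<bar> \<le> LB" using blip_onD[OF blipB] by metis
 obtain LA where LA: "LA \<ge> 0" "\<And>x y. \<bar>A (fst x) (clip (- M) M (snd x)) - A (fst y) (clip (- M) M (snd y))\<bar> \<le> LA * dist x y"
  "\<And>x. \<bar>A (fst x) (clip (- M) M (snd x))\<bar> \<le> LA" using blip_onD[OF blipA] by metis
 obtain LP where LP: "LP \<ge> 0" "\<And>a. \<bar>P a\<bar> \<le> LP" using blip_onD[OF blipP] by metis
 obtain LR where LR: "LR \<ge> 0" "\<And>a. \<bar>R a\<bar> \<le> LR" using blip_onD[OF blipR] by metis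
 obtain LQ where LQ: "LQ \<ge> 0" "\<And>a b. \<bar>Q a - Q b\<bar> \<le> LQ * \<bar>a - b\<bar>" using blip_onD[OF blipQ] unfolding dist_real_def by metis
 define q0 where "q0 = - (\<sigma> * Q \<theta>0) / 2"
 have q0: "q0 > 0" using Q0 by (simp add: q0_def)
 \<comment> \<open>Guaranteed rate of decrease of the unclipped force \<open>g\<close>: in the limit
   \<open>g' = - e'\<close>, and the corrections are kept below half of it.\<close>
 define c0 where "c0 = e' / 2"
 have c0: "c0 > 0" using e' by (simp add: c0_def)
 have sb: "\<bar>\<sigma> * z\<bar> = \<bar>z\<bar>" for z using \<sigma> by (simp add: abs_mult)
 have pe: "e' / (8 * \<delta> * (LP + 1)) > 0" "e' / 4 > 0" "q0 / (LQ + 1) > 0" using e' \<delta> LP(1) q0 LQ(1) by auto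
 have canc: "a * (b * (z / (8 * c * a) / b)) = z / (8 * c)" if "a > 0" "b > 0" "c > 0" for a b c z :: real
  using that by (simp add: field_simps)
 define m where "m = e' / (8 * \<delta> * (LP + 1)) / (1 + \<delta>)"
 have "m > 0" unfolding m_def by (rule divide_pos_pos[OF pe(1)]) (use \<delta> in simp)
 moreover define m4 m6 where "m4 = e' / 4" and "m6 = q0 / (LQ + 1)"
 moreover have "m4 > 0" "m6 > 0" using pe by (auto simp: m4_def m6_def)
 moreover define e where "e = Min {1, r, m4, m, m6}"
 ultimately have "e > 0" "e \<le> 1" "e \<le> r" "e \<le> m4" "e \<le> m" "e \<le> m6" using r by simp_all
 then have e: "e > 0" "e \<le> 1" "e \<le> r" "e \<le> e' / 4" "e \<le> e' / (8 * \<delta> * (LP + 1)) / (1 + \<delta>)" "e \<le> q0 / (LQ + 1)"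
  by (simp_all only: m_def m4_def m6_def)
 have t0: "((\<lambda>eps. \<delta> * (eps * LB)) \<longlongrightarrow> \<delta> * (0 * LB)) (at_right 0)"
  by (intro tendsto_intros)
 have s0: "eventually (\<lambda>eps. \<delta> * (eps * LB) < e' / 8) (at_right 0)" using order_tendstoD(2)[OF t0, of "e' / 8"] e' by simp
 \<comment> \<open>\<open>eps * eps * K * t\<close> collects the drift of \<open>eps * A\<close>,
   through \<theta> and \<phi>, and the drift of \<open>Q\<close> times the initial force, itself of
   order \<open>eps\<close>. Being of second order, it is beaten by the decrease
   \<open>q0 * c0 * t\<close> of the friction term.\<close>
 define K where "K = LA * (M + LR * (LA / q0)) + LQ * M * (LA / q0)"
 have t2: "((\<lambda>eps. eps * eps * K) \<longlongrightarrow> 0 * 0 * K) (at_right 0)" by (intro tendsto_intros)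
 have s1: "eventually (\<lambda>eps. eps * eps * K < q0 * c0) (at_right 0)" using order_tendstoD(2)[OF t2, of "q0 * c0"] q0 c0 by simp
 have ev: "eventually (\<lambda>eps. S eps \<le> \<delta> + 1 \<and> released \<sigma> (X eps) (S eps)) (at_right 0)"
  using X S(2) uniform_limitD[OF ul e(1)] s0 s1 eventually_at_right_less[of "0::real"]
 proof eventually_elim
  case (elim eps)
  then have sl: "sol eps (x eps) (X eps)" and v0: "st_v (x eps) = 0" and close: "\<And>t. t \<in> {0..T1} \<Longrightarrow> dist (X eps t) (Xb t) < e"
   and eps: "eps > 0" by auto
  define g where "g t = - st_y (X eps t) - \<delta> * st_w (X eps t)" for t
  define a where "a t = A (st_th (X eps t)) (phc (X eps t))" for t
  have X0: "X eps 0 = x eps" using sl by (simp add: sol_def)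
  have g0: "g 0 \<ge> 0" and bal: "Q (st_th (X eps 0)) * g 0 = - (eps * a 0)" using elim(1) X0 by (auto simp: g_def a_def)
  note d = sol_components[OF sl _ order_refl]
  have cl: "\<bar>st_y (X eps s) - (- (\<delta> * e') + e' * s)\<bar> < e" "\<bar>st_w (X eps s) - e'\<bar> < e" "\<bar>st_th (X eps s) - \<theta>0\<bar> < e"
    "\<bar>st_ph (X eps s) - \<phi>2\<bar> < e" if s: "s \<in> {0..T1}" for s
   using le_less_trans[OF state_dist_ge(1) close[OF s]] le_less_trans[OF state_dist_ge(2) close[OF s]]
     le_less_trans[OF state_dist_ge(3) close[OF s]] le_less_trans[OF state_dist_ge(4) close[OF s]] by (simp_all add: Xb_def)
  have gup: "g s \<le> (1 + \<delta>) * e" if s: "s \<in> {0..T1}" for s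
  proof -
   have "\<delta> * (e' - st_w (X eps s)) \<le> \<delta> * e" using cl(2)[OF s] \<delta> by (intro mult_left_mono) auto
   then have "\<delta> * e' - \<delta> * st_w (X eps s) \<le> \<delta> * e" by (simp add: right_diff_distrib)
   moreover have "e' * s \<ge> 0" using e' s by simp
   ultimately show ?thesis using cl(1)[OF s] unfolding g_def distrib_right by linarith
  qed
  have eM: "(1 + \<delta>) * e \<le> M"
  proof -
   have "(1 + \<delta>) * e \<le> (1 + \<delta>) * (e' / (8 * \<delta> * (LP + 1)) / (1 + \<delta>))" using e(5) \<delta> by (intro mult_left_mono) auto
   moreover have "(1 + \<delta>) * e \<le> 1 + \<delta>" using e(2) \<delta> by (simp add: mult_left_le)
   moreover have "\<delta> * (e' + 1) = \<delta> * e' + \<delta>" by (simp add: distrib_left)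
   moreover have "\<delta> * e' \<ge> 0" using \<delta> e' by simp
   ultimately show ?thesis using bnd(4) by linarith
  qed
  have fg: "force (X eps s) = max (g s) 0" if s: "s \<in> {0..T1}" for s
   using gup[OF s] eM by (simp add: frc g_def)
  have fup: "force (X eps s) \<le> (1 + \<delta>) * e" if s: "s \<in> {0..T1}" for s
   using gup[OF s] fg[OF s] \<delta> e(1) by simp
  have f0: "force z \<ge> 0" for z by (simp add: frc)
  define g' where "g' t = - st_w (X eps t) - \<delta> * (eps * B (st_th (X eps t)) (phc (X eps t)) + P (st_th (X eps t)) * force (X eps t))" for t
  have dg: "(g has_real_derivative g' t) (at t within {0..T1})" if t: "t \<in> {0..T1}" for t
   unfolding g_def g'_def by (intro derivative_intros DERIV_cmult d that)
  have g'le: "g' t \<le> - c0" if t: "t \<in> {0..T1}" for t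
  proof -
   have "\<bar>B (st_th (X eps t)) (phc (X eps t))\<bar> \<le> LB" using LB(2)[of "(st_th (X eps t), st_ph (X eps t))"] by (simp add: phc_def)
   then have "- B (st_th (X eps t)) (phc (X eps t)) \<le> LB" by linarith
   then have "eps * - B (st_th (X eps t)) (phc (X eps t)) \<le> eps * LB" using eps by (intro mult_left_mono) auto
   then have "\<delta> * (eps * - B (st_th (X eps t)) (phc (X eps t))) \<le> \<delta> * (eps * LB)" by (rule mult_left_mono) (use \<delta> in simp)
   then have 1: "- (\<delta> * (eps * B (st_th (X eps t)) (phc (X eps t)))) \<le> e' / 8" using elim(4) by simp
   have "- P (st_th (X eps t)) * force (X eps t) \<le> LP * ((1 + \<delta>) * e)"
    using LP(2)[of "st_th (X eps t)"] fup[OF t] f0 LP(1) by (intro mult_mono) auto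
   also have "\<dots> \<le> (LP + 1) * ((1 + \<delta>) * (e' / (8 * \<delta> * (LP + 1)) / (1 + \<delta>)))"
    using e(1,5) \<delta> LP(1) by (intro mult_mono mult_left_mono) auto
   also have "\<dots> = e' / (8 * \<delta>)" by (rule canc) (use \<delta> LP(1) in auto)
   finally have "\<delta> * (- P (st_th (X eps t)) * force (X eps t)) \<le> \<delta> * (e' / (8 * \<delta>))" using \<delta> by (intro mult_left_mono) auto
   then have 2: "- (\<delta> * (P (st_th (X eps t)) * force (X eps t))) \<le> e' / 8" using \<delta> by simp
   have 3: "- st_w (X eps t) \<le> - e' + e' / 4" using cl(2)[OF t] e(4) by linarith
   show ?thesis using 1 2 3 by (simp add: g'_def c0_def distrib_left)
  qed
  have gdec: "g t \<le> g 0 - c0 * t" if t: "0 \<le> t" "t \<le> T1" for t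
  proof -
   have "- (g 0 + c0 * 0) \<le> - (g t + c0 * t)"
   proof (rule increasing_on_subinterval[of T1 "\<lambda>t. - (g t + c0 * t)", OF _ order_refl t])
    show "((\<lambda>t. - (g t + c0 * t)) has_real_derivative - (g' s + c0)) (at s within {0..T1})" if "s \<in> {0..T1}" for s
     by (rule derivative_eq_intros dg that refl)+ simp
    show "0 \<le> - (g' s + c0)" if "0 \<le> s" "s \<le> t" for s using g'le[of s] that t by simp
   qed
   then show ?thesis by simp
  qed
  have th: "\<bar>st_th (X eps t) - st_th (X eps 0)\<bar> \<le> eps * M * t" if t: "0 \<le> t" "t \<le> T1" for t
   using sol_th_bound[OF sl less_imp_le[OF eps] t] X0 by simp
  have Qq: "- (\<sigma> * Q (st_th (X eps t))) \<ge> q0" if t: "t \<in> {0..T1}" for t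
  proof -
   have "\<bar>Q (st_th (X eps t)) - Q \<theta>0\<bar> \<le> LQ * \<bar>st_th (X eps t) - \<theta>0\<bar>" by (rule LQ)
   also have "\<dots> \<le> LQ * (q0 / (LQ + 1))" using cl(3)[OF t] e(6) LQ(1) by (intro mult_left_mono) auto
   also have "\<dots> \<le> q0" using q0 LQ(1) by (simp add: field_simps)
   finally have "\<bar>\<sigma> * (Q (st_th (X eps t)) - Q \<theta>0)\<bar> \<le> q0" unfolding sb .
   then show ?thesis unfolding q0_def right_diff_distrib by linarith
  qed
  \<comment> \<open>The balance at the end of sliding equates \<open>Q\<close> times the force with
    a term of order \<open>eps\<close>, and \<open>Q\<close> is bounded away from zero.\<close>
  have g0b: "g 0 \<le> LA / q0 * eps"
  proof -
   have 0: "0 \<in> {0..T1}" using T1 by simp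
   have "q0 * g 0 \<le> - (\<sigma> * Q (st_th (X eps 0))) * g 0" by (rule mult_right_mono[OF Qq[OF 0] g0])
   also have "\<dots> = - (\<sigma> * (Q (st_th (X eps 0)) * g 0))" by simp
   also have "\<dots> = \<sigma> * (eps * a 0)" unfolding bal by simp
   also have "\<dots> \<le> \<bar>eps * a 0\<bar>" using sb[of "eps * a 0"] by linarith
   also have "\<dots> = eps * \<bar>a 0\<bar>" using eps by (simp add: abs_mult)
   also have "\<dots> \<le> eps * LA" using LA(3)[of "(st_th (X eps 0), st_ph (X eps 0))"] eps by (intro mult_left_mono) (auto simp: a_def phc_def)
   finally show ?thesis using q0 by (simp add: field_simps)
  qed
  have fb: "force (X eps t) \<le> LA / q0 * eps" if t: "t \<in> {0..T1}" for t
  proof -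
   have "c0 * t \<ge> 0" using c0 t by simp
   then have "g t \<le> LA / q0 * eps" using gdec[of t] g0b t by simp
   moreover have "LA / q0 * eps \<ge> 0" using LA q0 eps by simp
   ultimately show ?thesis using fg[OF t] by simp
  qed
  have ph: "\<bar>st_ph (X eps t) - st_ph (X eps 0)\<bar> \<le> eps * (LR * (LA / q0)) * t" if t: "0 \<le> t" "t \<le> T1" for t
  proof -
   have "\<bar>st_ph (X eps t) - st_ph (X eps 0) - 0 * 0\<bar> \<le> 1 * (eps * (LR * (LA / q0))) * t + 0 * 0"
   proof (rule increment_approximation[where f = "\<lambda>_. 0" and F = "\<lambda>_. 0" and h = "\<lambda>_. 0" and c = "\<lambda>t. R (st_th (X eps t)) * force (X eps t)", OF t])
    show "\<bar>R (st_th (X eps s)) * force (X eps s)\<bar> \<le> eps * (LR * (LA / q0))" if "0 \<le> s" "s \<le> t" for s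
    proof -
     have "\<bar>R (st_th (X eps s)) * force (X eps s)\<bar> = \<bar>R (st_th (X eps s))\<bar> * force (X eps s)" using f0 by (simp add: abs_mult)
     also have "\<dots> \<le> LR * (LA / q0 * eps)" using LR fb[of s] that t f0 by (intro mult_mono) auto
     finally show ?thesis by (simp add: mult_ac)
    qed
   qed (use d(4)[of _ T1] zero in auto)
   then show ?thesis by simp
  qed
  \<comment> \<open>Once \<open>g\<close> is nonpositive the force is zero and the sign of
    \<open>A\<close> decides. Before that, the balance at time 0 and the decrease of
    \<open>g\<close> leave \<open>q0 * c0 * t - eps * eps * K * t\<close> as a lower bound.\<close>
  have main: "0 \<le> \<sigma> * (eps * a t + Q (st_th (X eps t)) * force (X eps t))" if t: "t \<in> {0..T1}" for t
  proof (cases "g t \<le> 0")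
   case True
   have "\<sigma> * a t \<ge> 0" unfolding a_def by (rule A0) (use cl(3)[OF t] e(3) in linarith)
   then have "eps * (\<sigma> * a t) \<ge> 0" using eps by simp
   then show ?thesis using fg[OF t] True by (simp add: max_def mult_ac)
  next
   case False
   then have f: "force (X eps t) = g t" using fg[OF t] by simp
   have gt: "g t \<le> g 0 - c0 * t" using gdec t by simp
   have tt: "0 \<le> t" "t \<le> T1" using t by auto
   define qt where "qt = - (\<sigma> * Q (st_th (X eps t)))"
   define qs where "qs = - (\<sigma> * Q (st_th (X eps 0)))"
   have qt: "qt \<ge> q0" using Qq[OF t] by (simp add: qt_def)
   have qd: "qt \<le> qs + LQ * (eps * M * t)"
   proof -
    have "\<bar>Q (st_th (X eps t)) - Q (st_th (X eps 0))\<bar> \<le> LQ * \<bar>st_th (X eps t) - st_th (X eps 0)\<bar>" by (rule LQ)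
    also have "\<dots> \<le> LQ * (eps * M * t)" by (rule mult_left_mono[OF th[OF tt] LQ(1)])
    finally have "\<bar>\<sigma> * (Q (st_th (X eps t)) - Q (st_th (X eps 0)))\<bar> \<le> LQ * (eps * M * t)" unfolding sb .
    then show ?thesis unfolding qt_def qs_def right_diff_distrib by linarith
   qed
   have ad: "\<sigma> * a t \<ge> \<sigma> * a 0 - LA * (eps * M * t + eps * (LR * (LA / q0)) * t)"
   proof -
    have "\<bar>a t - a 0\<bar> \<le> LA * dist (st_th (X eps t), st_ph (X eps t)) (st_th (X eps 0), st_ph (X eps 0))"
     using LA(2)[of "(st_th (X eps t), st_ph (X eps t))" "(st_th (X eps 0), st_ph (X eps 0))"] by (simp add: a_def phc_def)
    also have "\<dots> \<le> LA * (eps * M * t + eps * (LR * (LA / q0)) * t)"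
     by (intro mult_left_mono LA order_trans[OF dist_Pair_le] add_mono) (use th[OF tt] ph[OF tt] in \<open>simp_all add: dist_real_def\<close>)
    finally have "\<bar>\<sigma> * (a t - a 0)\<bar> \<le> LA * (eps * M * t + eps * (LR * (LA / q0)) * t)" unfolding sb .
    then show ?thesis unfolding right_diff_distrib by linarith
   qed
   have bal': "qs * g 0 = eps * (\<sigma> * a 0)"
   proof -
    have "qs * g 0 = - (\<sigma> * (Q (st_th (X eps 0)) * g 0))" by (simp add: qs_def)
    then show ?thesis unfolding bal by simp
   qed
   have "qt * g t \<le> qt * (g 0 - c0 * t)" using gt qt q0 by (intro mult_left_mono) auto
   also have "\<dots> = qt * g 0 - qt * (c0 * t)" by (simp add: right_diff_distrib)
   also have "\<dots> \<le> (qs + LQ * (eps * M * t)) * g 0 - q0 * (c0 * t)"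
    using qd g0 qt c0 tt by (intro diff_mono mult_right_mono) auto
   also have "\<dots> = eps * (\<sigma> * a 0) + LQ * (eps * M * t) * g 0 - q0 * (c0 * t)" by (simp add: distrib_right bal')
   also have "\<dots> \<le> eps * (\<sigma> * a 0) + LQ * (eps * M * t) * (LA / q0 * eps) - q0 * (c0 * t)"
   proof -
    have "LQ * (eps * M * t) \<ge> 0" using LQ(1) eps M tt by simp
    from mult_left_mono[OF g0b this] show ?thesis by linarith
   qed
   finally have 1: "qt * g t \<le> eps * (\<sigma> * a 0) + LQ * (eps * M * t) * (LA / q0 * eps) - q0 * (c0 * t)" .
   have 2: "eps * (\<sigma> * a t) \<ge> eps * (\<sigma> * a 0 - LA * (eps * M * t + eps * (LR * (LA / q0)) * t))"
    using ad eps by (intro mult_left_mono) auto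
   have 3: "eps * eps * K * t \<le> q0 * c0 * t" using elim(5) tt by (intro mult_right_mono) auto
   have 4: "eps * eps * K * t = LQ * (eps * M * t) * (LA / q0 * eps) + eps * (LA * (eps * M * t + eps * (LR * (LA / q0)) * t))"
    unfolding K_def by (simp add: algebra_simps)
   have "\<sigma> * (eps * a t + Q (st_th (X eps t)) * force (X eps t)) = eps * (\<sigma> * a t) - qt * g t" by (simp add: f qt_def algebra_simps)
   then show ?thesis using 1 2 3 4 unfolding right_diff_distrib by (simp only: mult.assoc)
  qed
  have vpos: "\<sigma> * st_v (X eps t) \<ge> 0" if t: "0 \<le> t" "t \<le> T1" for t
  proof -
   have "\<sigma> * st_v (X eps 0) \<le> \<sigma> * st_v (X eps t)"
   proof (rule increasing_on_subinterval[of T1 "\<lambda>t. \<sigma> * st_v (X eps t)", OF _ order_refl t])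
    show "((\<lambda>t. \<sigma> * st_v (X eps t)) has_real_derivative \<sigma> * (eps * a s + Q (st_th (X eps s)) * force (X eps s))) (at s within {0..T1})" if "s \<in> {0..T1}" for s
     unfolding a_def by (intro DERIV_cmult d that)
   qed (use main t in auto)
   then show ?thesis using v0 X0 by simp
  qed
  have b5: "\<bar>st_y (X eps s)\<bar> \<le> M \<and> \<bar>st_w (X eps s)\<bar> \<le> M \<and> \<bar>st_ph (X eps s)\<bar> \<le> M \<and>
    \<sigma> * st_v (X eps s) \<ge> 0 \<and> force (X eps s) = max (- st_y (X eps s) - \<delta> * st_w (X eps s)) 0" if s: "0 \<le> s" "s \<le> T1" for s
  proof -
   have s': "s \<in> {0..T1}" using s by simp
   have "e' * s \<le> e' * (\<delta> + 1)" using s e' by (intro mult_left_mono) (auto simp: T1_def)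
   then have es: "e' * s \<le> \<delta> * e' + e'" by (simp add: algebra_simps)
   have es0: "e' * s \<ge> 0" using e' s by simp
   have "\<bar>st_w (X eps s)\<bar> \<le> M" "\<bar>st_ph (X eps s)\<bar> \<le> M" using cl(2,4)[OF s'] e(2) e' bnd by linarith+
   moreover have "\<bar>st_y (X eps s)\<bar> \<le> M" using cl(1)[OF s'] e(2) es es0 bnd(1,2) by linarith
   moreover have "force (X eps s) = max (- st_y (X eps s) - \<delta> * st_w (X eps s)) 0" using fg[OF s'] by (simp add: g_def)
   ultimately show ?thesis using vpos[OF s] by simp
  qed
  show ?case unfolding released_def
  proof (intro conjI)
   show "\<forall>s. 0 \<le> s \<longrightarrow> s \<le> S eps \<longrightarrow> \<bar>st_y (X eps s)\<bar> \<le> M \<and> \<bar>st_w (X eps s)\<bar> \<le> M \<and> \<bar>st_ph (X eps s)\<bar> \<le> M \<and>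
    \<sigma> * st_v (X eps s) \<ge> 0 \<and> force (X eps s) = max (- st_y (X eps s) - \<delta> * st_w (X eps s)) 0"
    by (intro allI impI b5) (use elim(2) in auto)
  qed (use elim(2) in \<open>auto simp: h_def T1_def\<close>)
 qed
 have "eventually (\<lambda>eps. 0 \<le> S eps \<and> S eps \<le> T1) (at_right 0)" using S(2) by eventually_elim auto
 from uniform_limit_at_event[OF ul cb S(1) this T1(3)]
 have "((\<lambda>eps. X eps (S eps)) \<longlongrightarrow> (0, e', \<theta>0, \<phi>2, 0)) (at_right 0)" by (simp add: Xb_def mult.commute)
 with ev show ?thesis by (intro exI[of _ S] conjI)
qed

end

section \<open>Assembly of the four stages\<close>

lemma damped_oscillator_exists:
 obtains y w :: "real \<Rightarrow> real" where "y 0 = y0" "w 0 = w0"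
  "\<And>t u v. t \<in> {u..v} \<Longrightarrow> 0 \<le> u \<Longrightarrow> (y has_real_derivative w t) (at t within {u..v})"
  "\<And>t u v. t \<in> {u..v} \<Longrightarrow> 0 \<le> u \<Longrightarrow> (w has_real_derivative - S * (y t + d * w t)) (at t within {u..v})"
proof -
 define f where "f x = (snd x, - S * (fst x + d * snd x))" for x :: "real \<times> real"
 have "bounded_linear f" unfolding f_def
  by (intro bounded_linear_Pair bounded_linear_const_mult bounded_linear_add bounded_linear_fst bounded_linear_snd)
 then interpret bounded_linear f .
 obtain B where B: "B \<ge> 0" "\<And>x. norm (f x) \<le> norm x * B" using nonneg_bounded by blast
 have "B-lipschitz_on UNIV f"
  by (rule lipschitz_onI) (use B in \<open>simp_all add: dist_norm mult.commute flip: diff\<close>)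
 then obtain X where X: "X 0 = (y0, w0)" "\<And>t. t \<ge> 0 \<Longrightarrow> (X has_vector_derivative f (X t)) (at t within {0..})"
  using picard_lindeloef[of B f "(y0, w0)"] by metis
 have d: "(X has_vector_derivative f (X t)) (at t within {u..v})" if "t \<in> {u..v}" "0 \<le> u" for t u v
  using X(2)[of t] by (rule has_vector_derivative_within_subset) (use that in auto)
 show ?thesis
 proof (rule that[of "\<lambda>t. fst (X t)" "\<lambda>t. snd (X t)"])
  show "((\<lambda>t. fst (X t)) has_real_derivative snd (X t)) (at t within {u..v})" if "t \<in> {u..v}" "0 \<le> u" for t u v
   using bounded_linear.has_vector_derivative[OF bounded_linear_fst d[OF that]]
   by (simp add: has_real_derivative_iff_has_vector_derivative f_def)
  show "((\<lambda>t. snd (X t)) has_real_derivative - S * (fst (X t) + d * snd (X t))) (at t within {u..v})" if "t \<in> {u..v}" "0 \<le> u" for t u v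
   using bounded_linear.has_vector_derivative[OF bounded_linear_snd d[OF that]]
   by (simp add: has_real_derivative_iff_has_vector_derivative f_def)
 qed (use X(1) in auto)
qed

lemma concat_at_ball:
 assumes "\<And>t. 0 \<le> t \<Longrightarrow> t \<le> T \<Longrightarrow> \<Phi> (X t)" "\<And>t. 0 \<le> t \<Longrightarrow> t \<le> T' \<Longrightarrow> \<Phi> (Y t)" "0 \<le> t" "t \<le> T + T'"
 shows "\<Phi> (concat_at T X Y t)"
 using assms(1)[of t] assms(2)[of "t - T"] assms(3,4) by (cases "t \<le> T") (auto simp: concat_at_def)

text \<open>Only the flight may have length zero. Before the final time \<open>y\<close> vanishes
  only at the start and at landing, and \<open>nd\<close> and \<open>w0\<close> settle these
  instants. \<open>\<Phi>\<close> stands for any pointwise property valid along each stage.\<close>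

lemma chain_pieces:
 assumes p: "piece \<alpha> \<mu> \<delta> eps T0 X0" "piece \<alpha> \<mu> \<delta> eps T1 X1" "piece \<alpha> \<mu> \<delta> eps T2 X2" "piece \<alpha> \<mu> \<delta> eps T3 X3"
  and T: "0 \<le> T0" "0 < T1" "0 < T2" "0 < T3"
  and j: "X1 0 = X0 T0" "X2 0 = X1 T1" "X3 0 = X2 T2"
  and nd: "nondegenerate \<alpha> \<mu> (X0 0)" and w0: "T0 > 0 \<longrightarrow> st_w (X0 T0) < 0" and y00: "st_y (X0 0) = 0" "st_y (X0 T0) = 0"
  and y0: "\<forall>s. 0 < s \<longrightarrow> s < T0 \<longrightarrow> st_y (X0 s) > 0" and y1: "\<forall>s. 0 < s \<longrightarrow> s \<le> T1 \<longrightarrow> st_y (X1 s) < 0"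
  and y2: "\<forall>s. 0 \<le> s \<longrightarrow> s \<le> T2 \<longrightarrow> st_y (X2 s) < 0" and y3: "\<forall>s. 0 \<le> s \<longrightarrow> s < T3 \<longrightarrow> st_y (X3 s) < 0"
  and b: "\<forall>s. 0 \<le> s \<longrightarrow> s \<le> T0 \<longrightarrow> \<Phi> (X0 s)" "\<forall>s. 0 \<le> s \<longrightarrow> s \<le> T1 \<longrightarrow> \<Phi> (X1 s)"
   "\<forall>s. 0 \<le> s \<longrightarrow> s \<le> T2 \<longrightarrow> \<Phi> (X2 s)" "\<forall>s. 0 \<le> s \<longrightarrow> s \<le> T3 \<longrightarrow> \<Phi> (X3 s)"
 defines "Y \<equiv> concat_at T0 X0 (concat_at T1 X1 (concat_at T2 X2 X3))" and "\<tau> \<equiv> T0 + (T1 + (T2 + T3))"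
 shows "piece \<alpha> \<mu> \<delta> eps \<tau> Y" "Y 0 = X0 0" "Y \<tau> = X3 T3" "\<And>t. 0 \<le> t \<Longrightarrow> t \<le> T0 \<Longrightarrow> st_y (Y t) \<ge> 0"
  "\<And>t. T0 < t \<Longrightarrow> t < \<tau> \<Longrightarrow> st_y (Y t) < 0" "\<And>t. 0 \<le> t \<Longrightarrow> t < \<tau> \<Longrightarrow> nondegenerate \<alpha> \<mu> (Y t)"
  "\<And>t. 0 \<le> t \<Longrightarrow> t \<le> \<tau> \<Longrightarrow> \<Phi> (Y t)"
proof -
 note y0 = y0[rule_format] and y1 = y1[rule_format] and y2 = y2[rule_format] and y3 = y3[rule_format] and b = b[rule_format]
 show "piece \<alpha> \<mu> \<delta> eps \<tau> Y"
  unfolding Y_def \<tau>_def by (intro piece_concat p) (use T j in \<open>auto simp: concat_at_def\<close>)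
 show "Y 0 = X0 0" using T by (simp add: Y_def concat_at_def)
 show "Y \<tau> = X3 T3" using T by (simp add: Y_def \<tau>_def concat_at_def)
 show nn: "st_y (Y t) \<ge> 0" if "0 \<le> t" "t \<le> T0" for t
 proof -
  have "t = 0 \<or> t = T0 \<or> (0 < t \<and> t < T0)" using that by linarith
  then show ?thesis using y00 y0[of t] that by (auto simp: Y_def concat_at_def)
 qed
 show neg: "st_y (Y t) < 0" if t: "T0 < t" "t < \<tau>" for t
 proof (cases "t - T0 \<le> T1")
  case True
  then show ?thesis using y1[of "t - T0"] t by (simp add: Y_def concat_at_def)
 next
  case 1: False
  show ?thesis
  proof (cases "t - T0 - T1 \<le> T2")
   case True
   then show ?thesis using y2[of "t - T0 - T1"] t 1 by (simp add: Y_def concat_at_def)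
  next
   case False
   then show ?thesis using y3[of "t - T0 - T1 - T2"] t 1 by (simp add: Y_def concat_at_def \<tau>_def)
  qed
 qed
 show "nondegenerate \<alpha> \<mu> (Y t)" if t: "0 \<le> t" "t < \<tau>" for t
 proof -
  consider "t = 0" | "0 < t" "t < T0" | "t = T0" "T0 > 0" | "T0 < t" using t by linarith
  then show ?thesis
  proof cases
   case 1
   then show ?thesis using nd T by (simp add: Y_def concat_at_def)
  next
   case 2
   then show ?thesis using y0[of t] by (simp add: Y_def concat_at_def nondegenerate_def)
  next
   case 3
   then show ?thesis using w0 by (simp add: Y_def concat_at_def nondegenerate_def)
  next
   case 4
   then show ?thesis using neg[OF 4 t(2)] by (simp add: nondegenerate_def)
  qed
 qed
 show "\<Phi> (Y t)" if "0 \<le> t" "t \<le> \<tau>" for t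
  unfolding Y_def
  by (rule concat_at_ball[where T' = "T1 + (T2 + T3)"], rule b, assumption+, rule concat_at_ball[where T' = "T2 + T3"],
   rule b, assumption+, rule concat_at_ball, rule b, assumption+, rule b, assumption+) (use that in \<open>simp_all add: \<tau>_def\<close>)
qed

lemma blip_coeffs:
 assumes "\<alpha> > 0" "\<mu> > 0" "M > 0"
 shows "blip_on UNIV (\<lambda>x. b_coeff (fst x) (clip (- M) M (snd x)))" "blip_on UNIV (\<lambda>x. a_coeff (fst x) (clip (- M) M (snd x)))"
  "blip_on UNIV (p_coeff \<alpha> \<mu> s)" "blip_on UNIV (q_coeff \<alpha> \<mu> s)" "blip_on UNIV (c_coeff \<alpha> \<mu> s)"
  "blip_on UNIV (S_w \<alpha> \<mu>)" "blip_on UNIV (S_phi \<alpha> \<mu>)"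
  "blip_on UNIV (\<lambda>x. b_coeff (fst x) (clip (- M) M (snd x)) - k_w \<alpha> (fst x) * a_coeff (fst x) (clip (- M) M (snd x)))"
  "blip_on UNIV (\<lambda>x. - (k_ph \<alpha> (fst x) * a_coeff (fst x) (clip (- M) M (snd x))))"
proof -
 have f: "\<bar>fst x - fst y\<bar> \<le> dist x y" and s: "\<bar>snd x - snd y\<bar> \<le> 1 * dist x y" for x y :: "real \<times> real"
  using dist_fst_le[of x y] dist_snd_le[of x y] by (simp_all add: dist_real_def)
 have i: "\<bar>x - y\<bar> \<le> dist x y" for x y :: real by (simp add: dist_real_def)
 have "blip_on UNIV (\<lambda>x::real \<times> real. clip (- M) M (snd x))" by (rule blip_clip[OF s]) (use assms in simp)
 note sc = this blip_sin[of fst, OF f] blip_cos[of fst, OF f]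
 show b: "blip_on UNIV (\<lambda>x. b_coeff (fst x) (clip (- M) M (snd x)))"
  unfolding b_coeff_def by (intro blip_add blip_mult blip_power2 blip_const sc)
 show a: "blip_on UNIV (\<lambda>x. a_coeff (fst x) (clip (- M) M (snd x)))"
  unfolding a_coeff_def by (intro blip_minus blip_mult blip_power2 blip_const sc)
 note sc = blip_sin[of "\<lambda>x. x", OF i] blip_cos[of "\<lambda>x. x", OF i]
 show "blip_on UNIV (p_coeff \<alpha> \<mu> s)" unfolding p_coeff_def[abs_def] by (intro blip_diff blip_add blip_mult blip_power2 blip_const sc)
 show "blip_on UNIV (q_coeff \<alpha> \<mu> s)" unfolding q_coeff_def[abs_def] by (intro blip_diff blip_add blip_mult blip_power2 blip_const sc)
 show "blip_on UNIV (c_coeff \<alpha> \<mu> s)" unfolding c_coeff_def[abs_def] by (intro blip_minus blip_diff blip_add blip_mult blip_power2 blip_const sc)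
 show "blip_on UNIV (S_w \<alpha> \<mu>)" "blip_on UNIV (S_phi \<alpha> \<mu>)"
  using blip_k(5,6)[OF assms(1), of "\<lambda>x. x" UNIV, OF i] by (simp_all add: k_den_def S_w_eq[OF assms(1,2), abs_def] S_phi_eq[OF assms(1,2), abs_def])
 show "blip_on UNIV (\<lambda>x. b_coeff (fst x) (clip (- M) M (snd x)) - k_w \<alpha> (fst x) * a_coeff (fst x) (clip (- M) M (snd x)))"
  "blip_on UNIV (\<lambda>x. - (k_ph \<alpha> (fst x) * a_coeff (fst x) (clip (- M) M (snd x))))"
  by (intro blip_diff blip_minus blip_mult a b blip_k assms f)+
qed

text \<open>The convex combination of the two one-sided fields that keeps \<open>v\<close> constant.\<close>

lemma sliding_sfield:
 assumes par: "\<alpha> > 0" "\<mu> > 0" and f: "f > 0" and y: "st_y x \<le> 0" and fe: "f = - st_y x - \<delta> * st_w x"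
  and \<sigma>: "\<sigma> = 1 \<or> \<sigma> = - 1" and q: "\<sigma> * q_coeff \<alpha> \<mu> (- \<sigma>) (st_th x) > 0"
  and a: "\<sigma> * a_coeff (st_th x) (st_ph x) \<ge> 0" and eps: "eps > 0"
  and h: "- \<sigma> * q_coeff \<alpha> \<mu> \<sigma> (st_th x) * f > eps * (\<sigma> * a_coeff (st_th x) (st_ph x))"
 shows "\<exists>s. \<bar>s\<bar> \<le> 1 \<and> sfield \<alpha> \<mu> \<delta> eps s x =
  (st_w x, eps * (b_coeff (st_th x) (st_ph x) - k_w \<alpha> (st_th x) * a_coeff (st_th x) (st_ph x)) + S_w \<alpha> \<mu> (st_th x) * f,
   eps * st_ph x, eps * - (k_ph \<alpha> (st_th x) * a_coeff (st_th x) (st_ph x)) + S_phi \<alpha> \<mu> (st_th x) * f, 0)"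
proof -
 define \<theta> A where "\<theta> = st_th x" and "A = a_coeff (st_th x) (st_ph x)"
 define k where "k = k_den \<alpha> \<theta>"
 have k: "k \<ge> 1" using k_den_ge[OF par(1)] by (simp add: k_def)
 have qe: "q_coeff \<alpha> \<mu> s \<theta> = \<alpha> * sin \<theta> * cos \<theta> - s * \<mu> * k" for s by (simp add: q_coeff_def k_def k_den_def)
 define D where "D = \<mu> * k * f"
 have D: "D > 0" using par k f by (simp add: D_def)
 define N where "N = eps * A + \<alpha> * sin \<theta> * cos \<theta> * f"
 \<comment> \<open>The sign for which \<open>q_coeff\<close> times the force balances
   \<open>eps * A\<close>. Each side of \<open>v = 0\<close> gives one half of
   \<open>\<bar>s\<bar> \<le> 1\<close>: \<open>N1\<close> is the hypothesis \<open>h\<close> for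
   the side \<sigma>, and \<open>N2\<close> follows for the other side from the signs of
   \<open>q_coeff\<close> and \<open>a_coeff\<close>.\<close>
 define s where "s = N / D"
 have s2: "\<sigma> * \<sigma> = 1" using \<sigma> by auto
 have N1: "\<sigma> * N < D"
 proof -
  have "- \<sigma> * q_coeff \<alpha> \<mu> \<sigma> \<theta> * f = (\<sigma> * \<sigma>) * D - \<sigma> * (\<alpha> * sin \<theta> * cos \<theta> * f)" by (simp add: qe D_def algebra_simps)
  then show ?thesis using h s2 by (simp add: N_def A_def \<theta>_def distrib_left mult_ac)
 qed
 have N2: "- D < \<sigma> * N"
 proof -
  have "\<sigma> * q_coeff \<alpha> \<mu> (- \<sigma>) \<theta> * f > 0" using q f by (simp add: \<theta>_def)
  also have "\<sigma> * q_coeff \<alpha> \<mu> (- \<sigma>) \<theta> * f = (\<sigma> * \<sigma>) * D + \<sigma> * (\<alpha> * sin \<theta> * cos \<theta> * f)" by (simp add: qe D_def algebra_simps)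
  finally have "0 < D + \<sigma> * (\<alpha> * sin \<theta> * cos \<theta> * f)" using s2 by simp
  moreover have "eps * (\<sigma> * A) \<ge> 0" using a eps by (simp add: A_def)
  then have "\<sigma> * (eps * A) \<ge> 0" by (simp add: mult_ac)
  ultimately show ?thesis unfolding N_def distrib_left by linarith
 qed
 have "\<bar>N\<bar> \<le> D" using N1 N2 \<sigma> by auto
 then have s1: "\<bar>s\<bar> \<le> 1" using D by (simp add: s_def)
 have qf: "q_coeff \<alpha> \<mu> s \<theta> * f = - eps * A"
 proof -
  have "s * D = N" using D by (simp add: s_def)
  then have "s * (\<mu> * k * f) = eps * A + \<alpha> * sin \<theta> * cos \<theta> * f" unfolding N_def D_def .
  then show ?thesis unfolding qe by algebra
 qed
 have pf: "p_coeff \<alpha> \<mu> s \<theta> * f = S_w \<alpha> \<mu> \<theta> * f - k_w \<alpha> \<theta> * (eps * A)"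
  and cf: "c_coeff \<alpha> \<mu> s \<theta> * f = S_phi \<alpha> \<mu> \<theta> * f - k_ph \<alpha> \<theta> * (eps * A)"
 proof -
  have "p_coeff \<alpha> \<mu> s \<theta> * f = S_w \<alpha> \<mu> \<theta> * f + k_w \<alpha> \<theta> * (q_coeff \<alpha> \<mu> s \<theta> * f)"
   unfolding p_coeff_eq[OF par(1)] S_w_eq[OF par] k_den_def[symmetric] by (simp add: distrib_right)
  then show "p_coeff \<alpha> \<mu> s \<theta> * f = S_w \<alpha> \<mu> \<theta> * f - k_w \<alpha> \<theta> * (eps * A)" unfolding qf by simp
  have "c_coeff \<alpha> \<mu> s \<theta> * f = S_phi \<alpha> \<mu> \<theta> * f + k_ph \<alpha> \<theta> * (q_coeff \<alpha> \<mu> s \<theta> * f)"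
   unfolding c_coeff_eq[OF par(1)] S_phi_eq[OF par] k_den_def[symmetric] by (simp add: algebra_simps)
  then show "c_coeff \<alpha> \<mu> s \<theta> * f = S_phi \<alpha> \<mu> \<theta> * f - k_ph \<alpha> \<theta> * (eps * A)" unfolding qf by simp
 qed
 have br: "bracket (st_y x) (- st_y x - \<delta> * st_w x) = f" using y f fe by (simp add: bracket_def)
 have "sfield \<alpha> \<mu> \<delta> eps s x = (st_w x, eps * b_coeff \<theta> (st_ph x) + p_coeff \<alpha> \<mu> s \<theta> * f, eps * st_ph x, c_coeff \<alpha> \<mu> s \<theta> * f, eps * A + q_coeff \<alpha> \<mu> s \<theta> * f)"
  by (simp add: sfield_def Let_def br \<theta>_def A_def)
 also have "\<dots> = (st_w x, eps * (b_coeff \<theta> (st_ph x) - k_w \<alpha> \<theta> * A) + S_w \<alpha> \<mu> \<theta> * f, eps * st_ph x,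
   eps * - (k_ph \<alpha> \<theta> * A) + S_phi \<alpha> \<mu> \<theta> * f, 0)"
  unfolding pf cf qf by (simp add: right_diff_distrib mult.left_commute)
 finally show ?thesis using s1 unfolding \<theta>_def A_def by blast
qed

text \<open>Convergence of the end time of sliding needs the limit solution beyond \<open>T\<close>,
  with a contact force of the opposite sign. Since \<open>y + d * w\<close> has the derivative
  \<open>w T > 0\<close> at \<open>T\<close>, such an extension exists.\<close>

lemma sliding_limit_solution:
 assumes par: "S > 0" "P > 0" "d > 0" and y1: "y1 < 0"
 defines "T \<equiv> slide_time S P d"
 obtains y w :: "real \<Rightarrow> real" and T1 where "y 0 = y1" "w 0 = lam P d * y1" "0 < T" "T < T1"
  "\<And>t. t \<in> {0..T1} \<Longrightarrow> (y has_real_derivative w t) (at t within {0..T1})"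
  "\<And>t. t \<in> {0..T1} \<Longrightarrow> (w has_real_derivative - S * (y t + d * w t)) (at t within {0..T1})"
  "\<And>t. 0 \<le> t \<Longrightarrow> t < T \<Longrightarrow> y t + d * w t < 0" "\<And>t. T < t \<Longrightarrow> t \<le> T1 \<Longrightarrow> y t + d * w t > 0"
  "\<And>t. t \<in> {0..T1} \<Longrightarrow> y t < 0" "y T = - (d * w T)" "w T = - (lam P d * y1) * sqrt (1 + S / P) * exp (- (S * d * T / 2))"
  "w T > 0"
proof -
 obtain y w :: "real \<Rightarrow> real" where 0: "y 0 = y1" "w 0 = lam P d * y1"
  and dy: "\<And>t u v. t \<in> {u..v} \<Longrightarrow> 0 \<le> u \<Longrightarrow> (y has_real_derivative w t) (at t within {u..v})"
  and dw: "\<And>t u v. t \<in> {u..v} \<Longrightarrow> 0 \<le> u \<Longrightarrow> (w has_real_derivative - S * (y t + d * w t)) (at t within {u..v})"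
  using damped_oscillator_exists[of y1 "lam P d * y1" S d] by metis
 have w0: "w 0 = lam P d * y 0" using 0 by simp
 have ne: "y 0 \<noteq> 0" using 0 y1 by simp
 have "(y has_real_derivative w t) (at t within {0..T})" "(w has_real_derivative - S * (y t + d * w t)) (at t within {0..T})"
  if "t \<in> {0..T}" for t by (rule dy[OF that order_refl], rule dw[OF that order_refl])
 note ls = linear_sliding[OF par T_def[THEN meta_eq_to_obj_eq] this w0]
 have T: "T > 0" unfolding T_def by (rule slide_time_pos[OF par])
 have yneg: "y t < 0" if "t \<in> {0..T}" for t
  using ls(2)[OF _ _ ne that] 0 y1 by (simp add: zero_less_mult_iff)
 have uneg: "y t + d * w t < 0" if "0 \<le> t" "t < T" for t
  using ls(3)[OF _ _ ne that] 0 y1 by (simp add: zero_less_mult_iff)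
 have yT: "y T + d * w T = 0" by (rule ls(4))
 have l: "lam P d > 0" by (rule lam_pos[OF par(2,3)])
 have wT: "w T = - (lam P d * y1) * sqrt (1 + S / P) * exp (- (S * d * T / 2))"
  using ls(5)[OF _ _ ne] y1 l by (simp add: 0 abs_mult mult.assoc)
 have "lam P d * y1 < 0" using l y1 by (simp add: mult_pos_neg)
 moreover have "sqrt (1 + S / P) > 0" using par by (simp add: add_pos_pos)
 ultimately have wTp: "w T > 0" unfolding wT by (intro mult_pos_pos) auto
 have cont: "continuous_on {T..T + 1} y" "continuous_on {T..T + 1} w"
  unfolding continuous_on_eq_continuous_within using DERIV_continuous[OF dy[OF _ less_imp_le[OF T]]] DERIV_continuous[OF dw[OF _ less_imp_le[OF T]]] by blast+
 \<comment> \<open>Positivity of \<open>m\<close> means that \<open>y\<close> is negative and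
   \<open>y + d * w\<close> increasing; at \<open>T\<close> the second entry reduces to
   \<open>w T\<close>, and continuity preserves positivity for a while.\<close>
 define m where "m t = min (- y t) (w t + d * (- S * (y t + d * w t)))" for t
 have "continuous_on {T..T + 1} m" unfolding m_def by (intro continuous_intros cont)
 moreover have mT: "m T > 0" using yneg[of T] T wTp by (simp add: m_def yT)
 ultimately obtain \<eta> where \<eta>: "\<eta> > 0" "\<eta> \<le> T + 1 - T" "\<And>t. t \<in> {T..T + \<eta>} \<Longrightarrow> m t > m T / 2"
  using continuous_on_Icc_positive_right[of T "T + 1" m] by auto
 define T1 where "T1 = T + \<eta>"
 have T1: "T < T1" "T1 \<le> T + 1" using \<eta> by (auto simp: T1_def)
 have mpos: "m t > 0" if "T \<le> t" "t \<le> T1" for t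
  using \<eta>(3)[of t] that mT by (simp add: T1_def)
 have upos: "y t + d * w t > 0" if t: "T < t" "t \<le> T1" for t
 proof -
  have "y T + d * w T < y t + d * w t"
  proof (rule DERIV_pos_imp_increasing_open[OF t(1)])
   show "continuous_on {T..t} (\<lambda>t. y t + d * w t)"
    by (intro continuous_intros continuous_on_subset[OF cont(1)] continuous_on_subset[OF cont(2)]) (use t T1 in auto)
   fix s assume s: "T < s" "s < t"
   have at: "at s within {0..t} = at s" using s T by (intro at_within_Icc_at) auto
   have "((\<lambda>t. y t + d * w t) has_real_derivative w s + d * (- S * (y s + d * w s))) (at s)"
    using DERIV_add[OF dy[of s 0 t] DERIV_cmult[OF dw[of s 0 t], of d]] s T unfolding at by simp
   moreover have "w s + d * (- S * (y s + d * w s)) > 0" using mpos[of s] s t by (simp add: m_def)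
   ultimately show "\<exists>z. ((\<lambda>t. y t + d * w t) has_real_derivative z) (at s) \<and> z > 0" by blast
  qed
  then show ?thesis using yT by simp
 qed
 have yneg': "y t < 0" if "t \<in> {0..T1}" for t
  using yneg[of t] mpos[of t] that by (cases "t \<le> T") (auto simp: m_def)
 show ?thesis
  by (rule that[of y w T1, OF 0 T T1(1) dy[OF _ order_refl] dw[OF _ order_refl] uneg upos yneg' _ wT wTp]) (use yT in auto)
qed

lemma sfield_free: "st_y x > 0 \<Longrightarrow> sfield \<alpha> \<mu> \<delta> eps s x =
  (st_w x, eps * b_coeff (st_th x) (st_ph x), eps * st_ph x, 0, eps * a_coeff (st_th x) (st_ph x))"
 by (simp add: sfield_def bracket_def Let_def)

lemma sfield_contact: "st_y x \<le> 0 \<Longrightarrow> f = max (- st_y x - \<delta> * st_w x) 0 \<Longrightarrow> sfield \<alpha> \<mu> \<delta> eps s x =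
  (st_w x, eps * b_coeff (st_th x) (st_ph x) + p_coeff \<alpha> \<mu> s (st_th x) * f, eps * st_ph x,
   c_coeff \<alpha> \<mu> s (st_th x) * f, eps * a_coeff (st_th x) (st_ph x) + q_coeff \<alpha> \<mu> s (st_th x) * f)"
 by (simp add: sfield_def bracket_def Let_def)

definition impact_path :: "real \<Rightarrow> real \<Rightarrow> real \<Rightarrow> real \<Rightarrow> real \<Rightarrow> state \<Rightarrow> real \<Rightarrow> (real \<Rightarrow> state) \<Rightarrow> bool" where
 "impact_path \<alpha> \<mu> \<delta> eps K x \<tau> Y \<longleftrightarrow> piece \<alpha> \<mu> \<delta> eps \<tau> Y \<and> Y 0 = x \<and> st_y (Y \<tau>) = 0 \<and>
   (\<exists>t1. 0 \<le> t1 \<and> t1 < \<tau> \<and> (\<forall>t. 0 \<le> t \<longrightarrow> t \<le> t1 \<longrightarrow> st_y (Y t) \<ge> 0) \<and> (\<forall>t. t1 < t \<longrightarrow> t < \<tau> \<longrightarrow> st_y (Y t) < 0)) \<and>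
   (\<forall>t. 0 \<le> t \<longrightarrow> t < \<tau> \<longrightarrow> nondegenerate \<alpha> \<mu> (Y t)) \<and>
   (\<forall>t. 0 \<le> t \<longrightarrow> t \<le> \<tau> \<longrightarrow> \<bar>st_y (Y t)\<bar> \<le> K \<and> \<bar>st_w (Y t)\<bar> \<le> K)"

text \<open>The limits of the stages compose: flight leaves the state unchanged, compression
  delivers the impulse \<open>Fs\<close> and thereby \<open>w1\<close> and the first part of the
  change of \<phi>, sliding turns \<open>w1\<close> into the rebound speed and adds the part
  proportional to the change of \<open>w\<close>, and release affects only \<open>y\<close>.\<close>

lemma impact_trajectory:
 assumes par: "\<alpha> > 0" "\<mu> > 0" "\<delta> > 0" and v0: "v0 > 0" and Kw: "Kw \<ge> 0" "eventually (\<lambda>eps. \<bar>w0 eps\<bar> \<le> Kw * eps) (at_right 0)"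
  and p: "p_plus \<alpha> \<mu> \<theta>0 < 0" and b: "b_coeff \<theta>0 \<phi>0 < 0" and q: "q_plus \<alpha> \<mu> \<theta>0 < 0" "q_minus \<alpha> \<mu> \<theta>0 > 0"
  and a: "a_coeff \<theta>0 \<phi>0 \<noteq> 0"
 shows "\<exists>\<tau> Y K. K > 0 \<and> eventually (\<lambda>eps. impact_path \<alpha> \<mu> \<delta> eps K (0, w0 eps, \<theta>0, \<phi>0, v0) (\<tau> eps) (Y eps) \<and> \<tau> eps \<le> K + K * ln (1 / eps)) (at_right 0) \<and>
  ((\<lambda>eps. Y eps (\<tau> eps)) \<longlongrightarrow> (0, e_coeff \<alpha> \<mu> \<delta> \<theta>0 * v0, \<theta>0,
   \<phi>0 + (- (c_plus \<alpha> \<mu> \<theta>0 / q_plus \<alpha> \<mu> \<theta>0) + S_phi \<alpha> \<mu> \<theta>0 / S_w \<alpha> \<mu> \<theta>0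
    * (e_coeff \<alpha> \<mu> \<delta> \<theta>0 + p_plus \<alpha> \<mu> \<theta>0 / q_plus \<alpha> \<mu> \<theta>0)) * v0, 0)) (at_right 0)"
proof -
 define Fs where "Fs = v0 / (- q_plus \<alpha> \<mu> \<theta>0)"
 have Fs: "Fs > 0" unfolding Fs_def by (rule divide_pos_pos) (use v0 q in auto)
 define Pn where "Pn = - p_plus \<alpha> \<mu> \<theta>0"
 define S where "S = S_w \<alpha> \<mu> \<theta>0"
 define Sp where "Sp = S_phi \<alpha> \<mu> \<theta>0"
 have Pn: "Pn > 0" using p by (simp add: Pn_def)
 have S: "S > 0" unfolding S_def by (rule S_w_pos[OF par(1,2)])
 define l where "l = lam Pn \<delta>"
 have l: "l > 0" unfolding l_def by (rule lam_pos[OF Pn par(3)])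
 define w1 where "w1 = p_plus \<alpha> \<mu> \<theta>0 * Fs"
 define y1 where "y1 = w1 / l"
 have w1: "w1 < 0" unfolding w1_def by (rule mult_neg_pos[OF p Fs])
 have y1: "y1 < 0" unfolding y1_def by (rule divide_neg_pos[OF w1 l])
 have ly: "lam Pn \<delta> * y1 = w1" using l by (simp add: y1_def l_def[symmetric])
 define T where "T = slide_time S Pn \<delta>"
 obtain yl wl T1 where L0: "yl 0 = y1" "wl 0 = w1" and T: "0 < T" "T < T1"
  and dy: "\<And>t. t \<in> {0..T1} \<Longrightarrow> (yl has_real_derivative wl t) (at t within {0..T1})"
  and dw: "\<And>t. t \<in> {0..T1} \<Longrightarrow> (wl has_real_derivative - S * (yl t + \<delta> * wl t)) (at t within {0..T1})"
  and u: "\<And>t. 0 \<le> t \<Longrightarrow> t < T \<Longrightarrow> yl t + \<delta> * wl t < 0" "\<And>t. T < t \<Longrightarrow> t \<le> T1 \<Longrightarrow> yl t + \<delta> * wl t > 0"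
  and yneg: "\<And>t. t \<in> {0..T1} \<Longrightarrow> yl t < 0" and yT: "yl T = - (\<delta> * wl T)"
  and wT: "wl T = - w1 * sqrt (1 + S / Pn) * exp (- (S * \<delta> * T / 2))" and wTp: "wl T > 0"
  by (rule sliding_limit_solution[OF S Pn par(3) y1, unfolded ly, folded T_def]) blast
 define e' where "e' = wl T"
 have e': "e' > 0" using wTp by (simp add: e'_def)
 define \<phi>1 where "\<phi>1 = \<phi>0 + c_plus \<alpha> \<mu> \<theta>0 * Fs"
 define \<phi>2 where "\<phi>2 = \<phi>1 + Sp / S * (wl T - wl 0)"
 have ev': "e' = e_coeff \<alpha> \<mu> \<delta> \<theta>0 * v0"
 proof -
  have "- w1 = p_plus \<alpha> \<mu> \<theta>0 / q_plus \<alpha> \<mu> \<theta>0 * v0" using q by (simp add: w1_def Fs_def)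
  then show ?thesis
   unfolding e_coeff_eq_restitution[OF par p] restitution_def e'_def wT
   by (simp add: S_def Pn_def T_def mult_ac)
 qed
 have \<phi>2: "\<phi>2 = \<phi>0 + (- (c_plus \<alpha> \<mu> \<theta>0 / q_plus \<alpha> \<mu> \<theta>0) + S_phi \<alpha> \<mu> \<theta>0 / S_w \<alpha> \<mu> \<theta>0
    * (e_coeff \<alpha> \<mu> \<delta> \<theta>0 + p_plus \<alpha> \<mu> \<theta>0 / q_plus \<alpha> \<mu> \<theta>0)) * v0"
 proof -
  have 1: "- w1 = p_plus \<alpha> \<mu> \<theta>0 / q_plus \<alpha> \<mu> \<theta>0 * v0" "c_plus \<alpha> \<mu> \<theta>0 * Fs = - (c_plus \<alpha> \<mu> \<theta>0 / q_plus \<alpha> \<mu> \<theta>0) * v0"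
   using q by (simp_all add: w1_def Fs_def)
  have "wl T - wl 0 = e_coeff \<alpha> \<mu> \<delta> \<theta>0 * v0 + - w1" using ev' L0 by (simp add: e'_def)
  then have 2: "wl T - wl 0 = (e_coeff \<alpha> \<mu> \<delta> \<theta>0 + p_plus \<alpha> \<mu> \<theta>0 / q_plus \<alpha> \<mu> \<theta>0) * v0" unfolding 1 by (simp only: distrib_right)
  have "\<phi>0 + - c * v0 + x * (g * v0) = \<phi>0 + (- c + x * g) * v0" for c x g by (simp add: algebra_simps)
  then show ?thesis unfolding \<phi>2_def \<phi>1_def 1 2 Sp_def[symmetric] S_def[symmetric] .
 qed
 have cont: "continuous_on {0..T1} yl" "continuous_on {0..T1} wl"
  unfolding continuous_on_eq_continuous_within using DERIV_continuous[OF dy] DERIV_continuous[OF dw] by blast+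
 have bb: "bounded (yl ` {0..T1})" "bounded (wl ` {0..T1})"
  by (intro compact_imp_bounded compact_continuous_image cont compact_Icc)+
 obtain k1 where k1: "\<forall>x\<in>yl ` {0..T1}. norm x \<le> k1" using bb(1) unfolding bounded_iff by (elim exE)
 obtain k2 where k2: "\<forall>x\<in>wl ` {0..T1}. norm x \<le> k2" using bb(2) unfolding bounded_iff by (elim exE)
 have k: "\<bar>yl t\<bar> \<le> k1" "\<bar>wl t\<bar> \<le> k2" if "t \<in> {0..T1}" for t using k1 k2 that by auto
 have k2: "k2 \<ge> 0" "k1 \<ge> 0" using k(1)[of 0] k(2)[of 0] T by auto
 define Pm where "Pm = - p_plus \<alpha> \<mu> \<theta>0 / 2"
 define qm where "qm = - q_plus \<alpha> \<mu> \<theta>0 / 2"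
 define Fm where "Fm = 2 * v0 / qm"
 define Um where "Um = 3 * Pm * Fm + 1"
 define RM where "RM = \<bar>c_plus \<alpha> \<mu> \<theta>0\<bar> + 1"
 have pos: "Pm > 0" "qm > 0" "RM > 0" using p q by (auto simp: Pm_def qm_def RM_def)
 have Fm: "Fm > 0" unfolding Fm_def by (rule divide_pos_pos) (use v0 pos in auto)
 have Um: "Um > 0" unfolding Um_def using pos Fm by (simp add: add_pos_pos)
 define m1 m2 m3 m4 m5 m6 m7 where "m1 = \<delta> * Pm / 2 * Fm" and "m2 = Um * \<delta>" and "m3 = (2 / (Pm * \<delta>) + \<delta>) * Um"
  and "m4 = RM * Fm" and "m5 = \<delta> * k2" and "m6 = \<bar>Sp / S\<bar> * (2 * k2)" and "m7 = \<delta> * e'"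
 have m: "m1 \<ge> 0" "m2 \<ge> 0" "m3 \<ge> 0" "m4 \<ge> 0" "m5 \<ge> 0" "m6 \<ge> 0" "m7 \<ge> 0"
  using par pos Fm Um k2 e' unfolding m1_def m2_def m3_def m4_def m5_def m6_def m7_def by simp_all
 \<comment> \<open>All levels that the four stages ask for, added up. They are computed from limit
   data, so that \<open>M\<close> does not depend on \<open>eps\<close>.\<close>
 define M where "M = m1 + m2 + m3 + m4 + m5 + m6 + 2 * m7 + k1 + k2 + Um + \<delta> + e' + \<bar>\<phi>0\<bar> + \<bar>\<phi>1\<bar> + \<bar>\<phi>2\<bar> + 2"
 have M: "M > 0" "M \<ge> 1" "\<bar>\<phi>0\<bar> \<le> M" "m1 + 1 \<le> M" "m2 \<le> M" "m3 + 1 \<le> M" "\<bar>\<phi>0\<bar> + 1 + m4 \<le> M" "Um \<le> M" "k1 + m5 + (1 + \<delta>) \<le> M" "k2 + 1 \<le> M"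
   "\<bar>\<phi>1\<bar> + m6 + 1 \<le> M" "m7 + 1 \<le> M" "e' + 1 \<le> M" "\<bar>\<phi>2\<bar> + 1 \<le> M" "m7 + (m7 + \<delta>) + 1 \<le> M"
  using m k2 Um par(3) e' abs_ge_zero[of \<phi>0] abs_ge_zero[of \<phi>1] abs_ge_zero[of \<phi>2] unfolding M_def by linarith+
 \<comment> \<open>The sign of \<open>a_coeff\<close> is that of \<open>- cos \<theta>\<close>,
   whatever value \<phi> takes unless it vanishes. Although \<phi> changes by order one during the
   impact, the hypothesis at the start therefore fixes the side of release, on which only a weak
   inequality is required.\<close>
 define \<sigma> :: real where "\<sigma> = - sgn (cos \<theta>0)"
 have c0: "cos \<theta>0 \<noteq> 0" using a by (auto simp: a_coeff_def)
 have \<sigma>: "\<sigma> = 1 \<or> \<sigma> = - 1" "\<bar>\<sigma>\<bar> = 1" "\<sigma> * \<sigma> = 1" using c0 by (auto simp: \<sigma>_def sgn_if)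
 have \<sigma>c: "- \<sigma> * cos \<theta>0 > 0" using c0 by (auto simp: \<sigma>_def sgn_if)
 have \<sigma>q: "\<sigma> * q_coeff \<alpha> \<mu> \<sigma> \<theta>0 < 0" "\<sigma> * q_coeff \<alpha> \<mu> (- \<sigma>) \<theta>0 > 0" using \<sigma>(1) q by auto
 obtain r where r: "r > 0" and near: "\<And>\<theta>. \<bar>\<theta> - \<theta>0\<bar> < r \<Longrightarrow> - \<sigma> * cos \<theta> > 0"
  "\<And>\<theta>. \<bar>\<theta> - \<theta>0\<bar> < r \<Longrightarrow> \<sigma> * q_coeff \<alpha> \<mu> \<sigma> \<theta> < 0" "\<And>\<theta>. \<bar>\<theta> - \<theta>0\<bar> < r \<Longrightarrow> \<sigma> * q_coeff \<alpha> \<mu> (- \<sigma>) \<theta> > 0"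
 proof -
  have "isCont (\<lambda>\<theta>. - \<sigma> * cos \<theta>) \<theta>0" "isCont (\<lambda>\<theta>. - (\<sigma> * q_coeff \<alpha> \<mu> \<sigma> \<theta>)) \<theta>0" "isCont (\<lambda>\<theta>. \<sigma> * q_coeff \<alpha> \<mu> (- \<sigma>) \<theta>) \<theta>0"
   unfolding q_coeff_def by (intro continuous_intros)+
  note t = this[unfolded isCont_def]
  have "- (\<sigma> * q_coeff \<alpha> \<mu> \<sigma> \<theta>0) > 0" using \<sigma>q(1) by simp
  from eventually_conj[OF order_tendstoD(1)[OF t(1) \<sigma>c] eventually_conj[OF order_tendstoD(1)[OF t(2) this] order_tendstoD(1)[OF t(3) \<sigma>q(2)]]]
  have "eventually (\<lambda>\<theta>. - \<sigma> * cos \<theta> > 0 \<and> - (\<sigma> * q_coeff \<alpha> \<mu> \<sigma> \<theta>) > 0 \<and> \<sigma> * q_coeff \<alpha> \<mu> (- \<sigma>) \<theta> > 0) (at \<theta>0)" .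
  then obtain r where r: "r > 0" "\<And>\<theta>. \<theta> \<noteq> \<theta>0 \<Longrightarrow> dist \<theta> \<theta>0 < r \<Longrightarrow>
    - \<sigma> * cos \<theta> > 0 \<and> - (\<sigma> * q_coeff \<alpha> \<mu> \<sigma> \<theta>) > 0 \<and> \<sigma> * q_coeff \<alpha> \<mu> (- \<sigma>) \<theta> > 0"
   unfolding eventually_at by blast
  show ?thesis
  proof (rule that[OF r(1)])
   fix \<theta> assume "\<bar>\<theta> - \<theta>0\<bar> < r"
   then have "\<theta> = \<theta>0 \<or> (\<theta> \<noteq> \<theta>0 \<and> dist \<theta> \<theta>0 < r)" by (auto simp: dist_real_def)
   then show "- \<sigma> * cos \<theta> > 0" "\<sigma> * q_coeff \<alpha> \<mu> \<sigma> \<theta> < 0" "\<sigma> * q_coeff \<alpha> \<mu> (- \<sigma>) \<theta> > 0"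
    using r(2)[of \<theta>] \<sigma>c \<sigma>q by auto
  qed
 qed
 have a_nonneg: "\<sigma> * a_coeff \<theta> \<phi> \<ge> 0" if "\<bar>\<theta> - \<theta>0\<bar> < r" for \<theta> \<phi>
 proof -
  have "\<sigma> * a_coeff \<theta> \<phi> = \<phi>\<^sup>2 * (- \<sigma> * cos \<theta>)" by (simp add: a_coeff_def)
  then show ?thesis using mult_nonneg_nonneg[OF zero_le_power2 less_imp_le[OF near(1)[OF that]], of \<phi>] by (simp only:)
 qed
 note bl = blip_coeffs[OF par(1,2) M(1)]
 \<comment> \<open>Four sets of coefficients for the same equations: no force in flight, the plus
   coefficients in compression, those of the side \<sigma> in release, and in sliding
   \<open>S_w\<close>, \<open>S_phi\<close> together with the corrections that the balance of
   \<open>v\<close> adds to the terms of order \<open>eps\<close>.\<close>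
 interpret F: truncated \<delta> 0 M b_coeff "\<lambda>_ _. 0" a_coeff "\<lambda>_. 0" "\<lambda>_. 0" "\<lambda>_. 0"
  by (intro truncated.intro bl blip_const) (use M(1) in auto)
 interpret C: truncated \<delta> 0 M b_coeff "\<lambda>_ _. 0" a_coeff "p_plus \<alpha> \<mu>" "c_plus \<alpha> \<mu>" "q_plus \<alpha> \<mu>"
  by (intro truncated.intro bl blip_const) (use M(1) in auto)
 interpret R: truncated \<delta> 0 M b_coeff "\<lambda>_ _. 0" a_coeff "p_coeff \<alpha> \<mu> \<sigma>" "c_coeff \<alpha> \<mu> \<sigma>" "q_coeff \<alpha> \<mu> \<sigma>"
  by (intro truncated.intro bl blip_const) (use M(1) in auto)
 interpret Z: truncated \<delta> "- M" M "\<lambda>\<theta> \<phi>. b_coeff \<theta> \<phi> - k_w \<alpha> \<theta> * a_coeff \<theta> \<phi>" "\<lambda>\<theta> \<phi>. - (k_ph \<alpha> \<theta> * a_coeff \<theta> \<phi>)" "\<lambda>_ _. 0"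
   "S_w \<alpha> \<mu>" "S_phi \<alpha> \<mu>" "\<lambda>_. 0"
  by (intro truncated.intro bl blip_const) (use M(1) in auto)
 have "\<exists>X. \<forall>eps. F.sol eps (0, w0 eps, \<theta>0, \<phi>0, v0) (X eps)" by (intro choice allI F.sol_exists)
 then obtain X0 where "\<forall>eps. F.sol eps (0, w0 eps, \<theta>0, \<phi>0, v0) (X0 eps)" by (elim exE)
 note X0 = spec[OF this]
 obtain T0 K0 where E0: "eventually (\<lambda>eps. T0 eps \<le> K0 \<and> flight \<theta>0 \<phi>0 r (X0 eps) (T0 eps)) (at_right 0)"
  and l0: "((\<lambda>eps. X0 eps (T0 eps)) \<longlongrightarrow> (0, 0, \<theta>0, \<phi>0, v0)) (at_right 0)"
  using F.free_flight[where ?\<theta>0.0 = \<theta>0 and ?\<phi>0.0 = \<phi>0, OF refl refl refl refl b M(3) v0 Kw(1) r Kw(2) always_eventually[OF allI[OF X0]]] by blast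
 have "\<exists>X. \<forall>eps. C.sol eps (X0 eps (T0 eps)) (X eps)" by (intro choice allI C.sol_exists)
 then obtain X1 where "\<forall>eps. C.sol eps (X0 eps (T0 eps)) (X1 eps)" by (elim exE)
 note X1 = spec[OF this]
 have e1: "eventually (\<lambda>eps. C.sol eps (X0 eps (T0 eps)) (X1 eps) \<and> st_y (X0 eps (T0 eps)) = 0 \<and> st_w (X0 eps (T0 eps)) \<le> 0) (at_right 0)"
  using E0 by eventually_elim (unfold flight_def, elim conjE, intro conjI X1, assumption+)
 obtain S1 K1 where K1: "K1 > 0" and E1: "eventually (\<lambda>eps. S1 eps \<le> K1 * ln (1 / eps) \<and> C.compressed (X1 eps) (S1 eps)) (at_right 0)"
  and l1: "((\<lambda>eps. X1 eps (S1 eps)) \<longlongrightarrow> (p_plus \<alpha> \<mu> \<theta>0 * Fs / lam (- p_plus \<alpha> \<mu> \<theta>0) \<delta>, p_plus \<alpha> \<mu> \<theta>0 * Fs, \<theta>0, \<phi>0 + c_plus \<alpha> \<mu> \<theta>0 * Fs, 0)) (at_right 0)"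
  using C.compression_phase[OF refl refl par(3) p q(1) b v0 Pm_def qm_def Fm_def Um_def RM_def M(4)[unfolded m1_def] M(5)[unfolded m2_def]
   M(6)[unfolded m3_def] M(7)[unfolded m4_def] M(8) e1 l0, folded Fs_def] by blast
 have "\<exists>X. \<forall>eps. Z.sol eps (X1 eps (S1 eps)) (X eps)" by (intro choice allI Z.sol_exists)
 then obtain X2 where "\<forall>eps. Z.sol eps (X1 eps (S1 eps)) (X2 eps)" by (elim exE)
 note X2 = spec[OF this]
 have e2: "eventually (\<lambda>eps. Z.sol eps (X1 eps (S1 eps)) (X2 eps) \<and> st_v (X1 eps (S1 eps)) = 0) (at_right 0)"
  using E1 by eventually_elim (unfold C.compressed_def, elim conjE, intro conjI X2, assumption)
 have l1': "((\<lambda>eps. X1 eps (S1 eps)) \<longlongrightarrow> (yl 0, wl 0, \<theta>0, \<phi>1, 0)) (at_right 0)"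
  using l1 by (simp only: L0 y1_def w1_def l_def Pn_def \<phi>1_def)
 have bnd: "\<bar>yl t\<bar> + \<delta> * \<bar>wl t\<bar> + (1 + \<delta>) \<le> M \<and> \<bar>wl t\<bar> + 1 \<le> M \<and> \<bar>\<phi>1 + S_phi \<alpha> \<mu> \<theta>0 / S_w \<alpha> \<mu> \<theta>0 * (wl t - wl 0)\<bar> + 1 \<le> M"
  if t: "t \<in> {0..T1}" for t
 proof (intro conjI)
  have "\<delta> * \<bar>wl t\<bar> \<le> m5" unfolding m5_def using k(2)[OF t] par by (intro mult_left_mono) auto
  then show "\<bar>yl t\<bar> + \<delta> * \<bar>wl t\<bar> + (1 + \<delta>) \<le> M" using k(1)[OF t] M(9) by linarith
  show "\<bar>wl t\<bar> + 1 \<le> M" using k(2)[OF t] M(10) by linarith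
  have "0 \<in> {0..T1}" using T by simp
  then have "\<bar>wl t - wl 0\<bar> \<le> 2 * k2" using k(2)[OF t] k(2)[of 0] by linarith
  then have "\<bar>Sp / S\<bar> * \<bar>wl t - wl 0\<bar> \<le> m6" unfolding m6_def by (rule mult_left_mono) simp
  then have "\<bar>Sp / S * (wl t - wl 0)\<bar> \<le> m6" by (simp only: abs_mult)
  then show "\<bar>\<phi>1 + S_phi \<alpha> \<mu> \<theta>0 / S_w \<alpha> \<mu> \<theta>0 * (wl t - wl 0)\<bar> + 1 \<le> M" using M(11) unfolding Sp_def S_def by linarith
 qed
 have qq: "blip_on UNIV (\<lambda>\<theta>. - \<sigma> * q_coeff \<alpha> \<mu> \<sigma> \<theta>)" "- \<sigma> * q_coeff \<alpha> \<mu> \<sigma> \<theta>0 > 0"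
  by (intro blip_mult blip_const bl) (use \<sigma>q(1) in simp)
 have aa: "blip_on UNIV (\<lambda>x. \<sigma> * a_coeff (fst x) (clip (- M) M (snd x)))" by (intro blip_mult blip_const bl)
 obtain S2 where E2: "eventually (\<lambda>eps. S2 eps \<le> T1 \<and> Z.slid (\<lambda>\<theta>. - \<sigma> * q_coeff \<alpha> \<mu> \<sigma> \<theta>) (\<lambda>\<theta> \<phi>. \<sigma> * a_coeff \<theta> \<phi>) \<theta>0 r eps (X2 eps) (S2 eps)) (at_right 0)"
  and l2: "((\<lambda>eps. X2 eps (S2 eps)) \<longlongrightarrow> (yl T, wl T, \<theta>0, \<phi>1 + S_phi \<alpha> \<mu> \<theta>0 / S_w \<alpha> \<mu> \<theta>0 * (wl T - wl 0), 0)) (at_right 0)"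
  using Z.sliding_phase[where qq = "\<lambda>\<theta>. - \<sigma> * q_coeff \<alpha> \<mu> \<sigma> \<theta>" and aa = "\<lambda>\<theta> \<phi>. \<sigma> * a_coeff \<theta> \<phi>" and ?\<theta>0.0 = \<theta>0,
   OF refl refl refl par(3) S[unfolded S_def] r qq aa T dy dw[unfolded S_def] u yneg bnd e2 l1'] by blast
 have "\<exists>X. \<forall>eps. R.sol eps (X2 eps (S2 eps)) (X eps)" by (intro choice allI R.sol_exists)
 then obtain X3 where "\<forall>eps. R.sol eps (X2 eps (S2 eps)) (X3 eps)" by (elim exE)
 note X3 = spec[OF this]
 have l2': "((\<lambda>eps. X2 eps (S2 eps)) \<longlongrightarrow> (- (\<delta> * e'), e', \<theta>0, \<phi>2, 0)) (at_right 0)"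
  using l2 by (simp only: yT e'_def \<phi>2_def Sp_def S_def)
 have phc: "Z.phc x = st_ph x" "C.phc x = st_ph x" "R.phc x = st_ph x" "F.phc x = st_ph x" if "\<bar>st_ph x\<bar> \<le> M" for x
  using that by (simp_all add: Z.phc_def clip_eq abs_le_iff)
 \<comment> \<open>Equality at the end of sliding, multiplied by \<sigma>, is the balance from which
   release starts; the force is nonnegative there because \<open>\<sigma> * A \<ge> 0\<close> and
   \<open>- \<sigma> * Q > 0\<close>.\<close>
 have e3: "eventually (\<lambda>eps. R.sol eps (X2 eps (S2 eps)) (X3 eps) \<and> st_v (X2 eps (S2 eps)) = 0 \<and> - st_y (X2 eps (S2 eps)) - \<delta> * st_w (X2 eps (S2 eps)) \<ge> 0 \<and>
   q_coeff \<alpha> \<mu> \<sigma> (st_th (X2 eps (S2 eps))) * (- st_y (X2 eps (S2 eps)) - \<delta> * st_w (X2 eps (S2 eps))) = - (eps * a_coeff (st_th (X2 eps (S2 eps))) (R.phc (X2 eps (S2 eps))))) (at_right 0)"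
  using E2 eventually_at_right_less[of "0::real"]
 proof eventually_elim
  case (elim eps)
  define x where "x = X2 eps (S2 eps)"
  define A where "A = a_coeff (st_th x) (Z.phc x)"
  define Q where "Q = q_coeff \<alpha> \<mu> \<sigma> (st_th x)"
  define f where "f = - st_y x - \<delta> * st_w x"
  have x: "- \<sigma> * Q * f = eps * (\<sigma> * A)" "\<bar>st_th x - \<theta>0\<bar> < r" "st_v x = 0" "\<bar>st_ph x\<bar> \<le> M"
  proof -
   note sl = elim(1)[THEN conjunct2, unfolded Z.slid_def]
   have S: "0 \<le> S2 eps" using conjunct1[OF sl] by simp
   note i = sl[THEN conjunct2, THEN conjunct2, THEN conjunct2, rule_format, OF S order_refl]
   have "Z.force x = f" using i by (simp add: x_def f_def)
   then show "- \<sigma> * Q * f = eps * (\<sigma> * A)" using sl[THEN conjunct2, THEN conjunct1] by (simp only: x_def A_def Q_def)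
   show "\<bar>st_th x - \<theta>0\<bar> < r" "st_v x = 0" "\<bar>st_ph x\<bar> \<le> M" using i by (simp_all add: x_def)
  qed
  have "eps * (\<sigma> * A) \<ge> 0" using a_nonneg[OF x(2)] elim by (simp add: A_def)
  moreover have "- \<sigma> * Q > 0" using near(2)[OF x(2)] by (simp add: Q_def)
  ultimately have "f \<ge> 0" using x(1) by (metis zero_le_mult_iff not_less)
  moreover have "Q * f = - (eps * A)"
  proof -
   have "\<sigma> * (- \<sigma> * Q * f) = \<sigma> * (eps * (\<sigma> * A))" using x(1) by simp
   then have "- (\<sigma> * \<sigma>) * (Q * f) = (\<sigma> * \<sigma>) * (eps * A)" by (simp add: mult_ac)
   then show ?thesis using \<sigma>(3) by simp
  qed
  ultimately show ?case using X3[of eps] x phc[OF x(4)] unfolding x_def[symmetric] f_def[symmetric] Q_def[symmetric] by (simp add: A_def)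
 qed
 have M7: "\<delta> * e' + 1 \<le> M" "\<delta> * e' + \<delta> * (e' + 1) + 1 \<le> M" using M(12,15) by (simp_all add: m7_def distrib_left)
 obtain S3 where E3: "eventually (\<lambda>eps. S3 eps \<le> \<delta> + 1 \<and> R.released \<sigma> (X3 eps) (S3 eps)) (at_right 0)"
  and l3: "((\<lambda>eps. X3 eps (S3 eps)) \<longlongrightarrow> (0, e', \<theta>0, \<phi>2, 0)) (at_right 0)"
  using R.release_phase[where ?\<theta>0.0 = \<theta>0, OF refl refl par(3) r \<sigma>(2) \<sigma>q(1) a_nonneg e' M7(1) M(13,14) M7(2) e3 l2'] by blast
 define Y where "Y eps = concat_at (T0 eps) (X0 eps) (concat_at (S1 eps) (X1 eps) (concat_at (S2 eps) (X2 eps) (X3 eps)))" for eps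
 define \<tau> where "\<tau> eps = T0 eps + (S1 eps + (S2 eps + S3 eps))" for eps
 define K where "K = M + K1 + \<bar>K0\<bar> + T1 + \<delta> + 1"
 have K: "K > 0" "M \<le> K" "K1 \<le> K" "K0 + (T1 + (\<delta> + 1)) \<le> K" using M(1) K1 T par(3) by (auto simp: K_def)
 have main: "eventually (\<lambda>eps. Y eps (\<tau> eps) = X3 eps (S3 eps) \<and> impact_path \<alpha> \<mu> \<delta> eps K (0, w0 eps, \<theta>0, \<phi>0, v0) (\<tau> eps) (Y eps) \<and> \<tau> eps \<le> K + K * ln (1 / eps)) (at_right 0)"
  using E0 E1 E2 E3 eventually_at_right_less[of "0::real"] eventually_at_right_field[of "\<lambda>eps. eps < 1" "0::real", THEN iffD2, OF exI[of _ 1], simplified]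
 proof eventually_elim
  case (elim eps)
  note fl = elim(1)[THEN conjunct2, unfolded flight_def] and co = elim(2)[THEN conjunct2, unfolded C.compressed_def]
  note sl = elim(3)[THEN conjunct2, unfolded Z.slid_def] and re = elim(4)[THEN conjunct2, unfolded R.released_def]
  note z = fl[THEN conjunct2, THEN conjunct2, THEN conjunct2, THEN conjunct2, THEN conjunct2, rule_format] and z0 = fl[THEN conjunct2, THEN conjunct2, THEN conjunct2, THEN conjunct2, THEN conjunct1, rule_format] and z1 = fl[THEN conjunct2, THEN conjunct2, THEN conjunct2, THEN conjunct1, rule_format]
  note o = co[THEN conjunct2, THEN conjunct2, THEN conjunct2, THEN conjunct2, rule_format] and o0 = co[THEN conjunct2, THEN conjunct2, THEN conjunct2, THEN conjunct1, rule_format] and o1 = co[THEN conjunct2, THEN conjunct2, THEN conjunct1, rule_format]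
  note t = sl[THEN conjunct2, THEN conjunct2, THEN conjunct2, rule_format] and t0 = sl[THEN conjunct2, THEN conjunct2, THEN conjunct1, rule_format] and h = re[THEN conjunct2, THEN conjunct2, THEN conjunct2, rule_format] and h1 = re[THEN conjunct2, THEN conjunct2, THEN conjunct1, rule_format]
  have eps: "eps > 0" "eps < 1" using elim by auto
  have S: "0 \<le> T0 eps" "0 < S1 eps" "0 < S2 eps" "0 < S3 eps" by (rule fl[THEN conjunct1] co[THEN conjunct1] sl[THEN conjunct1] re[THEN conjunct1])+
  have i0: "X0 eps 0 = (0, w0 eps, \<theta>0, \<phi>0, v0)" and i1: "X1 eps 0 = X0 eps (T0 eps)" and i2: "X2 eps 0 = X1 eps (S1 eps)" and i3: "X3 eps 0 = X2 eps (S2 eps)"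
   using X0[of eps] X1[of eps] X2[of eps] X3[of eps] by (auto simp: F.sol_def C.sol_def Z.sol_def R.sol_def)
  have p0: "piece \<alpha> \<mu> \<delta> eps (T0 eps) (X0 eps)"
  proof (rule F.sol_piece[OF X0])
   fix s assume s: "0 < s" "s < T0 eps"
   then have x: "st_y (X0 eps s) > 0" "st_ph (X0 eps s) = \<phi>0" "st_v (X0 eps s) > 0" using z0[OF s] z[of s] by simp_all
   have "F.fld eps (X0 eps s) = sfield \<alpha> \<mu> \<delta> eps 1 (X0 eps s)"
    unfolding sfield_free[OF x(1)] F.fld_def using phc(4)[of "X0 eps s"] x(2) M(3) by simp
   moreover have "slip_sign 1 (X0 eps s)" using x by (simp add: slip_sign_def)
   ultimately show "\<exists>sa. slip_sign sa (X0 eps s) \<and> F.fld eps (X0 eps s) = sfield \<alpha> \<mu> \<delta> eps sa (X0 eps s)" by blast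
  qed (use S in simp)
  have p1: "piece \<alpha> \<mu> \<delta> eps (S1 eps) (X1 eps)"
  proof (rule C.sol_piece[OF X1])
   fix s assume s: "0 < s" "s < S1 eps"
   then have x: "st_y (X1 eps s) \<le> 0" "\<bar>st_ph (X1 eps s)\<bar> \<le> M" "st_v (X1 eps s) > 0" "C.force (X1 eps s) = max (- st_y (X1 eps s) - \<delta> * st_w (X1 eps s)) 0"
    using o[of s] o0[of s] o1[of s] by simp_all
   have "C.fld eps (X1 eps s) = sfield \<alpha> \<mu> \<delta> eps 1 (X1 eps s)"
    unfolding sfield_contact[OF x(1,4)] C.fld_def using phc(2)[OF x(2)] by simp
   moreover have "slip_sign 1 (X1 eps s)" using x by (simp add: slip_sign_def)
   ultimately show "\<exists>sa. slip_sign sa (X1 eps s) \<and> C.fld eps (X1 eps s) = sfield \<alpha> \<mu> \<delta> eps sa (X1 eps s)" by blast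
  qed (use S in simp)
  have p2: "piece \<alpha> \<mu> \<delta> eps (S2 eps) (X2 eps)"
  proof (rule Z.sol_piece[OF X2])
   fix s assume s: "0 < s" "s < S2 eps"
   define x where "x = X2 eps s"
   have x: "st_y x \<le> 0" "\<bar>st_ph x\<bar> \<le> M" "st_v x = 0" "Z.force x = - st_y x - \<delta> * st_w x" "\<bar>st_th x - \<theta>0\<bar> < r"
    "- \<sigma> * q_coeff \<alpha> \<mu> \<sigma> (st_th x) * Z.force x > eps * (\<sigma> * a_coeff (st_th x) (Z.phc x))"
    using t[of s] t0[of s] s by (simp_all add: x_def)
   note hx = x(6)[unfolded phc(1)[OF x(2)]]
   have "- \<sigma> * q_coeff \<alpha> \<mu> \<sigma> (st_th x) > 0" using near(2)[OF x(5)] by simp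
   moreover have "eps * (\<sigma> * a_coeff (st_th x) (st_ph x)) \<ge> 0" using a_nonneg[OF x(5)] eps by simp
   \<comment> \<open>The clip used in sliding admits negative values; the sliding condition excludes
     them, so the truncated force agrees with the bracket.\<close>
   ultimately have f: "Z.force x > 0" using hx by (metis le_less_trans zero_less_mult_pos)
   obtain sa where sa: "\<bar>sa\<bar> \<le> 1" "sfield \<alpha> \<mu> \<delta> eps sa x =
     (st_w x, eps * (b_coeff (st_th x) (st_ph x) - k_w \<alpha> (st_th x) * a_coeff (st_th x) (st_ph x)) + S_w \<alpha> \<mu> (st_th x) * Z.force x,
      eps * st_ph x, eps * - (k_ph \<alpha> (st_th x) * a_coeff (st_th x) (st_ph x)) + S_phi \<alpha> \<mu> (st_th x) * Z.force x, 0)"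
    using sliding_sfield[OF par(1,2) f x(1,4) \<sigma>(1) near(3)[OF x(5)] a_nonneg[OF x(5)] eps(1) hx] by blast
   have "Z.fld eps x = sfield \<alpha> \<mu> \<delta> eps sa x" unfolding sa(2) Z.fld_def phc(1)[OF x(2)] by simp
   moreover have "slip_sign sa x" using sa x by (simp add: slip_sign_def)
   ultimately show "\<exists>sa. slip_sign sa (X2 eps s) \<and> Z.fld eps (X2 eps s) = sfield \<alpha> \<mu> \<delta> eps sa (X2 eps s)" unfolding x_def by blast
  qed (use S in simp)
  have p3: "piece \<alpha> \<mu> \<delta> eps (S3 eps) (X3 eps)"
  proof (rule R.sol_piece[OF X3])
   fix s assume s: "0 < s" "s < S3 eps"
   then have x: "st_y (X3 eps s) \<le> 0" "\<bar>st_ph (X3 eps s)\<bar> \<le> M" "\<sigma> * st_v (X3 eps s) \<ge> 0" "R.force (X3 eps s) = max (- st_y (X3 eps s) - \<delta> * st_w (X3 eps s)) 0"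
    using h[of s] h1[of s] by simp_all
   have "R.fld eps (X3 eps s) = sfield \<alpha> \<mu> \<delta> eps \<sigma> (X3 eps s)"
    unfolding sfield_contact[OF x(1,4)] R.fld_def using phc(3)[OF x(2)] by simp
   moreover have "slip_sign \<sigma> (X3 eps s)" using x(3) \<sigma>(1) by (auto simp: slip_sign_def)
   ultimately show "\<exists>sa. slip_sign sa (X3 eps s) \<and> R.fld eps (X3 eps s) = sfield \<alpha> \<mu> \<delta> eps sa (X3 eps s)" by blast
  qed (use S in simp)
  have nd: "nondegenerate \<alpha> \<mu> (X0 eps 0)" using v0 b p by (simp add: i0 nondegenerate_def)
  define \<Phi> where "\<Phi> x \<longleftrightarrow> \<bar>st_y x\<bar> \<le> K \<and> \<bar>st_w x\<bar> \<le> K" for x :: state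
  have ph: "\<Phi> x" if "\<bar>st_y x\<bar> \<le> M \<and> \<bar>st_w x\<bar> \<le> M" for x using that K(2) by (simp add: \<Phi>_def)
  have b0: "\<forall>s. 0 \<le> s \<longrightarrow> s \<le> T0 eps \<longrightarrow> \<Phi> (X0 eps s)"
  proof (intro allI impI ph)
   fix s assume "0 \<le> s" "s \<le> T0 eps"
   from z[OF this] show "\<bar>st_y (X0 eps s)\<bar> \<le> M \<and> \<bar>st_w (X0 eps s)\<bar> \<le> M" using M(2) by linarith
  qed
  have b1: "\<forall>s. 0 \<le> s \<longrightarrow> s \<le> S1 eps \<longrightarrow> \<Phi> (X1 eps s)" using o ph by blast
  have b2: "\<forall>s. 0 \<le> s \<longrightarrow> s \<le> S2 eps \<longrightarrow> \<Phi> (X2 eps s)" using t ph by blast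
  have b3: "\<forall>s. 0 \<le> s \<longrightarrow> s \<le> S3 eps \<longrightarrow> \<Phi> (X3 eps s)" using h ph by blast
  have yy: "T0 eps > 0 \<longrightarrow> st_w (X0 eps (T0 eps)) < 0" "st_y (X0 eps 0) = 0" "st_y (X0 eps (T0 eps)) = 0"
   "\<forall>s. 0 < s \<longrightarrow> s < T0 eps \<longrightarrow> st_y (X0 eps s) > 0" "\<forall>s. 0 < s \<longrightarrow> s \<le> S1 eps \<longrightarrow> st_y (X1 eps s) < 0"
   "\<forall>s. 0 \<le> s \<longrightarrow> s \<le> S2 eps \<longrightarrow> st_y (X2 eps s) < 0" "\<forall>s. 0 \<le> s \<longrightarrow> s < S3 eps \<longrightarrow> st_y (X3 eps s) < 0"
   using z0 z1 o0 t h1 fl[THEN conjunct2, THEN conjunct1] by (auto simp: i0)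
  note cp = chain_pieces[where \<Phi> = \<Phi>, OF p0 p1 p2 p3 S i1 i2 i3 nd yy b0 b1 b2 b3, folded Y_def \<tau>_def]
  have tau: "\<tau> eps \<le> K + K * ln (1 / eps)"
  proof -
   have "ln (1 / eps) \<ge> 0" using eps by simp
   then have "K1 * ln (1 / eps) \<le> K * ln (1 / eps)" by (rule mult_right_mono[OF K(3)])
   moreover have "T0 eps \<le> K0" "S1 eps \<le> K1 * ln (1 / eps)" "S2 eps \<le> T1" "S3 eps \<le> \<delta> + 1"
    by (rule elim(1)[THEN conjunct1] elim(2)[THEN conjunct1] elim(3)[THEN conjunct1] elim(4)[THEN conjunct1])+
   ultimately show ?thesis using K(4) unfolding \<tau>_def by linarith
  qed
  show ?case unfolding impact_path_def
  proof (intro conjI exI[of _ "T0 eps"] allI impI)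
   show "\<bar>st_y (Y eps s)\<bar> \<le> K" "\<bar>st_w (Y eps s)\<bar> \<le> K" if "0 \<le> s" "s \<le> \<tau> eps" for s
    using cp(7)[OF that] by (simp_all add: \<Phi>_def)
   show "T0 eps < \<tau> eps" using S by (simp add: \<tau>_def)
   show "st_y (Y eps (\<tau> eps)) = 0" unfolding cp(3) by (rule re[THEN conjunct2, THEN conjunct1])
  qed (use cp tau S i0 in auto)
 qed
 have lim: "((\<lambda>eps. Y eps (\<tau> eps)) \<longlongrightarrow> (0, e', \<theta>0, \<phi>2, 0)) (at_right 0)"
  by (rule Lim_transform_eventually[OF l3]) (use main in eventually_elim, simp)
 show ?thesis
  by (rule exI[of _ \<tau>], rule exI[of _ Y], rule exI[of _ K], rule conjI[OF K(1)], rule conjI, rule eventually_mono[OF main], erule conjunct2)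
   (use lim in \<open>simp only: ev' \<phi>2\<close>)
qed

section \<open>Return to the original variables and the final statement\<close>

lemma smooth_on_open_cong:
 assumes U: "open U" and fg: "\<And>x. x \<in> U \<Longrightarrow> f x = g x" and g: "smooth_on_open U g"
 shows "smooth_on_open U f"
proof -
 have ev: "eventually (\<lambda>y. y \<in> U) (nhds x)" if "x \<in> U" for x using U that by (rule eventually_nhds_in_open)
 have eq: "(deriv ^^ n) f x = (deriv ^^ n) g x" if "x \<in> U" for n x
  using that
 proof (induction n arbitrary: x)
  case (Suc n)
  have "eventually (\<lambda>y. (deriv ^^ n) f y = (deriv ^^ n) g y) (nhds x)"
   using ev[OF Suc.prems] by eventually_elim (rule Suc.IH)
  then show ?case by (auto intro: deriv_cong_ev)
 qed (use fg in simp)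
 show ?thesis unfolding smooth_on_open_def
 proof (intro allI ballI)
  fix n x assume x: "x \<in> U"
  have "((deriv ^^ n) g has_field_derivative deriv ((deriv ^^ n) g) x) (at x)"
   using g x unfolding smooth_on_open_def by (simp add: DERIV_deriv_iff_real_differentiable)
  then have "((deriv ^^ n) f has_field_derivative deriv ((deriv ^^ n) g) x) (at x)"
   by (rule has_field_derivative_transform_within_open[OF _ U x]) (simp add: eq)
  then show "(deriv ^^ n) f differentiable at x" using real_differentiable_def by blast
 qed
qed

lemma tendsto_imp_smallo:
 fixes f :: "real \<Rightarrow> real"
 assumes "(g \<longlongrightarrow> L) F" "eventually (\<lambda>x. f x = g x) F"
 shows "(\<lambda>x. f x - L) \<in> o[F](\<lambda>_. 1)"
proof (rule smalloI_tendsto)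
 have "((\<lambda>x. g x - L) \<longlongrightarrow> L - L) F" by (intro tendsto_intros assms)
 moreover have "eventually (\<lambda>x. g x - L = (f x - L) / 1) F" using assms(2) by eventually_elim simp
 ultimately show "((\<lambda>x. (f x - L) / 1) \<longlongrightarrow> 0) F" by (simp add: tendsto_cong)
qed simp

text \<open>Undoing the scaling multiplies time and \<open>y\<close> by \<open>eps\<close>: a
  duration of order \<open>ln (1 / eps)\<close> becomes \<open>O(eps * ln (1 / eps))\<close>, and
  bounded scaled depth becomes \<open>y = O(eps)\<close>. Nondegeneracy along the assembled path
  upgrades it from a solution to the forward flow.\<close>

lemma impact_flow:
 assumes par: "\<alpha> > 0" "\<mu> > 0" "\<delta> > 0" and v0: "v0 > 0" and w0: "w0 \<in> O[at_right 0](\<lambda>eps. eps)"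
  and p: "p_plus \<alpha> \<mu> \<theta>0 < 0" and b: "b_coeff \<theta>0 \<phi>0 < 0" and q: "q_plus \<alpha> \<mu> \<theta>0 < 0" "q_minus \<alpha> \<mu> \<theta>0 > 0"
  and a: "a_coeff \<theta>0 \<phi>0 \<noteq> 0"
 shows "\<exists>(T :: real \<Rightarrow> real) (y :: real \<Rightarrow> real \<Rightarrow> real) (w :: real \<Rightarrow> real \<Rightarrow> real)
    (\<theta> :: real \<Rightarrow> real \<Rightarrow> real) (\<phi> :: real \<Rightarrow> real \<Rightarrow> real) (v :: real \<Rightarrow> real \<Rightarrow> real).
    (\<forall>\<^sub>F eps in at_right 0.
      filippov_forward_flow (filippov_field \<alpha> \<mu> \<delta> eps) (0, w0 eps, \<theta>0, \<phi>0, v0) (T eps)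
       (\<lambda>t. (y eps t, w eps t, \<theta> eps t, \<phi> eps t, v eps t)) \<and>
      y eps (T eps) = 0 \<and>
      (\<exists>t1. 0 \<le> t1 \<and> t1 < T eps \<and>
       (\<forall>t\<in>{0..t1}. y eps t \<ge> 0) \<and> (\<forall>t\<in>{t1<..<T eps}. y eps t < 0))) \<and>
    T \<in> O[at_right 0](\<lambda>eps. eps * ln (1 / eps)) \<and>
    (\<lambda>eps. w eps (T eps) - e_coeff \<alpha> \<mu> \<delta> \<theta>0 * v0) \<in> o[at_right 0](\<lambda>_. 1) \<and>
    (\<lambda>eps. \<theta> eps (T eps) - \<theta>0) \<in> o[at_right 0](\<lambda>_. 1) \<and>
    (\<lambda>eps. \<phi> eps (T eps)
       - (\<phi>0 + (- (c_plus \<alpha> \<mu> \<theta>0 / q_plus \<alpha> \<mu> \<theta>0)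
            + S_phi \<alpha> \<mu> \<theta>0 / S_w \<alpha> \<mu> \<theta>0
             * (e_coeff \<alpha> \<mu> \<delta> \<theta>0 + p_plus \<alpha> \<mu> \<theta>0 / q_plus \<alpha> \<mu> \<theta>0)) * v0))
     \<in> o[at_right 0](\<lambda>_. 1) \<and>
    (\<lambda>eps. v eps (T eps)) \<in> o[at_right 0](\<lambda>_. 1) \<and>
    (\<exists>C. \<forall>\<^sub>F eps in at_right 0. \<forall>t\<in>{0..T eps}.
      \<bar>y eps t\<bar> \<le> C * eps \<and> \<bar>w eps t\<bar> \<le> C \<and>
      \<bar>normal_force \<delta> eps (y eps t) (w eps t)\<bar> \<le> C / eps)"
proof -
 obtain Kw where Kw: "Kw > 0" "eventually (\<lambda>eps. norm (w0 eps) \<le> Kw * norm eps) (at_right 0)"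
  using w0 by (elim landau_o.bigE)
 have Kw': "eventually (\<lambda>eps. \<bar>w0 eps\<bar> \<le> Kw * eps) (at_right 0)"
  using Kw(2) eventually_at_right_less[of "0::real"] by eventually_elim simp
 obtain \<tau> Y K where K: "K > 0" and ev: "eventually (\<lambda>eps. impact_path \<alpha> \<mu> \<delta> eps K (0, w0 eps, \<theta>0, \<phi>0, v0) (\<tau> eps) (Y eps) \<and> \<tau> eps \<le> K + K * ln (1 / eps)) (at_right 0)"
  and lim: "((\<lambda>eps. Y eps (\<tau> eps)) \<longlongrightarrow> (0, e_coeff \<alpha> \<mu> \<delta> \<theta>0 * v0, \<theta>0,
   \<phi>0 + (- (c_plus \<alpha> \<mu> \<theta>0 / q_plus \<alpha> \<mu> \<theta>0) + S_phi \<alpha> \<mu> \<theta>0 / S_w \<alpha> \<mu> \<theta>0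
    * (e_coeff \<alpha> \<mu> \<delta> \<theta>0 + p_plus \<alpha> \<mu> \<theta>0 / q_plus \<alpha> \<mu> \<theta>0)) * v0, 0)) (at_right 0)"
  using impact_trajectory[OF par v0 less_imp_le[OF Kw(1)] Kw' p b q a] by (elim exE conjE)
 note pos = eventually_at_right_less[of "0::real"]
 note lc = tendsto_components[OF lim]
 let ?T = "\<lambda>eps. eps * \<tau> eps"
 let ?Z = "\<lambda>eps t. unscale eps (Y eps (t / eps))"
 show ?thesis
 proof (rule exI[of _ ?T], rule exI[of _ "\<lambda>eps t. st_y (?Z eps t)"], rule exI[of _ "\<lambda>eps t. st_w (?Z eps t)"],
   rule exI[of _ "\<lambda>eps t. st_th (?Z eps t)"], rule exI[of _ "\<lambda>eps t. st_ph (?Z eps t)"], rule exI[of _ "\<lambda>eps t. st_v (?Z eps t)"],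
   intro conjI)
  show "\<forall>\<^sub>F eps in at_right 0.
      filippov_forward_flow (filippov_field \<alpha> \<mu> \<delta> eps) (0, w0 eps, \<theta>0, \<phi>0, v0) (?T eps)
       (\<lambda>t. (st_y (?Z eps t), st_w (?Z eps t), st_th (?Z eps t), st_ph (?Z eps t), st_v (?Z eps t))) \<and>
      st_y (?Z eps (?T eps)) = 0 \<and>
      (\<exists>t1. 0 \<le> t1 \<and> t1 < ?T eps \<and> (\<forall>t\<in>{0..t1}. st_y (?Z eps t) \<ge> 0) \<and> (\<forall>t\<in>{t1<..<?T eps}. st_y (?Z eps t) < 0))"
   using ev pos
  proof eventually_elim
   case (elim eps)
   note path = elim(1)[THEN conjunct1, unfolded impact_path_def]
   have eps: "eps > 0" and pc: "piece \<alpha> \<mu> \<delta> eps (\<tau> eps) (Y eps)" and Y0: "Y eps 0 = (0, w0 eps, \<theta>0, \<phi>0, v0)" and yT: "st_y (Y eps (\<tau> eps)) = 0"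
    using path elim(2) by simp_all
   obtain t1 where t1: "0 \<le> t1" "t1 < \<tau> eps" "\<And>t. 0 \<le> t \<Longrightarrow> t \<le> t1 \<Longrightarrow> st_y (Y eps t) \<ge> 0" "\<And>t. t1 < t \<Longrightarrow> t < \<tau> eps \<Longrightarrow> st_y (Y eps t) < 0"
    using path[THEN conjunct2, THEN conjunct2, THEN conjunct2, THEN conjunct1] by blast
   note nd = path[THEN conjunct2, THEN conjunct2, THEN conjunct2, THEN conjunct2, THEN conjunct1, rule_format]
   have sol: "filippov_solution (filippov_field \<alpha> \<mu> \<delta> eps) (0, w0 eps, \<theta>0, \<phi>0, v0) (?T eps) (?Z eps)"
    using piece_filippov_solution[OF pc eps] by (simp add: Y0 unscale_def)
   have nd': "nondegenerate \<alpha> \<mu> (?Z eps t)" if "0 \<le> t" "t < ?T eps" for t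
   proof -
    have "0 \<le> t / eps" "t / eps < \<tau> eps" using that eps by (simp_all add: pos_divide_less_eq mult.commute)
    from nd[OF this] show ?thesis using eps by (simp add: nondegenerate_def unscale_def)
   qed
   have flow: "filippov_forward_flow (filippov_field \<alpha> \<mu> \<delta> eps) (0, w0 eps, \<theta>0, \<phi>0, v0) (?T eps) (?Z eps)"
    by (rule filippov_forward_flowI[OF par eps sol nd'])
   have "\<exists>t1. 0 \<le> t1 \<and> t1 < ?T eps \<and> (\<forall>t\<in>{0..t1}. st_y (?Z eps t) \<ge> 0) \<and> (\<forall>t\<in>{t1<..<?T eps}. st_y (?Z eps t) < 0)"
   proof (intro exI[of _ "eps * t1"] conjI ballI)
    show "0 \<le> eps * t1" "eps * t1 < ?T eps" using t1 eps by simp_all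
    fix t assume "t \<in> {0..eps * t1}"
    then have "0 \<le> t / eps" "t / eps \<le> t1" using eps by (simp_all add: pos_divide_le_eq mult.commute)
    from t1(3)[OF this] show "st_y (?Z eps t) \<ge> 0" using eps by (simp add: unscale_def)
   next
    fix t assume "t \<in> {eps * t1<..<?T eps}"
    then have "t1 < t / eps" "t / eps < \<tau> eps" using eps by (simp_all add: pos_divide_less_eq pos_less_divide_eq mult.commute)
    from t1(4)[OF this] show "st_y (?Z eps t) < 0" using eps by (simp add: unscale_def mult_pos_neg)
   qed
   moreover have "st_y (?Z eps (?T eps)) = 0" using yT eps by (simp add: unscale_def)
   ultimately show ?case using flow by (simp only: prod.collapse simp_thms)
  qed
  show "?T \<in> O[at_right 0](\<lambda>eps. eps * ln (1 / eps))"
  proof (rule bigoI)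
   have "eventually (\<lambda>eps::real. ln (1 / eps) \<ge> 1) (at_right 0)" by real_asymp
   with ev pos show "\<forall>\<^sub>F eps in at_right 0. norm (?T eps) \<le> (2 * K) * norm (eps * ln (1 / eps))"
   proof eventually_elim
    case (elim eps)
    have t: "0 \<le> \<tau> eps" "\<tau> eps \<le> K + K * ln (1 / eps)" using elim(1) unfolding impact_path_def piece_def by simp_all
    have "K * 1 \<le> K * ln (1 / eps)" using elim(3) K by (intro mult_left_mono) auto
    then have "\<tau> eps \<le> 2 * K * ln (1 / eps)" using t(2) by simp
    then have "eps * \<tau> eps \<le> eps * (2 * K * ln (1 / eps))" by (rule mult_left_mono) (use elim(2) in simp)
    moreover have "norm (?T eps) = eps * \<tau> eps" using t(1) elim(2) by simp
    moreover have "0 \<le> eps * ln (1 / eps)" by (rule mult_nonneg_nonneg) (use elim(2,3) in linarith)+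
    then have "norm (eps * ln (1 / eps)) = eps * ln (1 / eps)" by (simp only: real_norm_def abs_of_nonneg)
    ultimately show ?case by (simp only: mult_ac)
   qed
  qed
  have tt: "eventually (\<lambda>eps. ?T eps / eps = \<tau> eps) (at_right 0)" using pos by eventually_elim simp
  show "(\<lambda>eps. st_w (?Z eps (?T eps)) - e_coeff \<alpha> \<mu> \<delta> \<theta>0 * v0) \<in> o[at_right 0](\<lambda>_. 1)"
   by (rule tendsto_imp_smallo[OF lc(2)]) (use tt in eventually_elim, simp add: unscale_def)
  show "(\<lambda>eps. st_th (?Z eps (?T eps)) - \<theta>0) \<in> o[at_right 0](\<lambda>_. 1)"
   by (rule tendsto_imp_smallo[OF lc(3)]) (use tt in eventually_elim, simp add: unscale_def)
  show "(\<lambda>eps. st_ph (?Z eps (?T eps)) - (\<phi>0 + (- (c_plus \<alpha> \<mu> \<theta>0 / q_plus \<alpha> \<mu> \<theta>0) + S_phi \<alpha> \<mu> \<theta>0 / S_w \<alpha> \<mu> \<theta>0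
    * (e_coeff \<alpha> \<mu> \<delta> \<theta>0 + p_plus \<alpha> \<mu> \<theta>0 / q_plus \<alpha> \<mu> \<theta>0)) * v0)) \<in> o[at_right 0](\<lambda>_. 1)"
   by (rule tendsto_imp_smallo[OF lc(4)]) (use tt in eventually_elim, simp add: unscale_def)
  have "(\<lambda>eps. st_v (?Z eps (?T eps)) - 0) \<in> o[at_right 0](\<lambda>_. 1)"
   by (rule tendsto_imp_smallo[OF lc(5)]) (use tt in eventually_elim, simp add: unscale_def)
  then show "(\<lambda>eps. st_v (?Z eps (?T eps))) \<in> o[at_right 0](\<lambda>_. 1)" by simp
  \<comment> \<open>With \<open>y / eps\<close> and \<open>w\<close> bounded by \<open>K\<close>,
    the argument of the bracket is at most \<open>K + \<delta> * K\<close>; the same constant also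
    covers \<open>y\<close> and \<open>w\<close>.\<close>
  show "\<exists>C. \<forall>\<^sub>F eps in at_right 0. \<forall>t\<in>{0..?T eps}. \<bar>st_y (?Z eps t)\<bar> \<le> C * eps \<and> \<bar>st_w (?Z eps t)\<bar> \<le> C \<and>
      \<bar>normal_force \<delta> eps (st_y (?Z eps t)) (st_w (?Z eps t))\<bar> \<le> C / eps"
  proof (intro exI[of _ "(1 + \<delta>) * K"])
   show "\<forall>\<^sub>F eps in at_right 0. \<forall>t\<in>{0..?T eps}. \<bar>st_y (?Z eps t)\<bar> \<le> ((1 + \<delta>) * K) * eps \<and> \<bar>st_w (?Z eps t)\<bar> \<le> (1 + \<delta>) * K \<and>
      \<bar>normal_force \<delta> eps (st_y (?Z eps t)) (st_w (?Z eps t))\<bar> \<le> (1 + \<delta>) * K / eps"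
    using ev pos
   proof eventually_elim
    case (elim eps)
    note bd = elim(1)[THEN conjunct1, unfolded impact_path_def, THEN conjunct2, THEN conjunct2, THEN conjunct2, THEN conjunct2, THEN conjunct2, rule_format]
    have KK: "K \<le> (1 + \<delta>) * K" using K par(3) by simp
    show ?case
    proof
     fix t assume t: "t \<in> {0..?T eps}"
     define x where "x = Y eps (t / eps)"
     have "0 \<le> t / eps" "t / eps \<le> \<tau> eps" using t elim(2) by (simp_all add: pos_divide_le_eq mult.commute)
     from bd[OF this] have x: "\<bar>st_y x\<bar> \<le> K" "\<bar>st_w x\<bar> \<le> K" by (simp_all add: x_def)
     have xz: "st_y (?Z eps t) = eps * st_y x" "st_w (?Z eps t) = st_w x" by (simp_all add: unscale_def x_def)
     have "\<bar>eps * st_y x\<bar> = \<bar>st_y x\<bar> * eps" using elim(2) by (simp add: abs_mult)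
     also have "\<dots> \<le> ((1 + \<delta>) * K) * eps" using x(1) KK elim(2) by (intro mult_right_mono) auto
     finally have 1: "\<bar>eps * st_y x\<bar> \<le> ((1 + \<delta>) * K) * eps" .
     define g where "g = - (1 / eps * (eps * st_y x)) - \<delta> * st_w x"
     have "\<bar>\<delta> * st_w x\<bar> \<le> \<delta> * K" using x(2) par(3) by (simp add: abs_mult)
     moreover have "1 / eps * (eps * st_y x) = st_y x" using elim(2) by simp
     ultimately have g: "\<bar>g\<bar> \<le> (1 + \<delta>) * K" using x(1) unfolding g_def distrib_right by linarith
     have "\<bar>bracket (eps * st_y x) g\<bar> \<le> \<bar>g\<bar>" using abs_ge_self[of g] by (simp add: bracket_def max_def)
     then have "1 / eps * \<bar>bracket (eps * st_y x) g\<bar> \<le> 1 / eps * ((1 + \<delta>) * K)" using g elim(2) by (intro mult_left_mono) auto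
     then have 2: "\<bar>normal_force \<delta> eps (eps * st_y x) (st_w x)\<bar> \<le> (1 + \<delta>) * K / eps"
      using elim(2) by (simp add: normal_force_def abs_mult g_def)
     show "\<bar>st_y (?Z eps t)\<bar> \<le> ((1 + \<delta>) * K) * eps \<and> \<bar>st_w (?Z eps t)\<bar> \<le> (1 + \<delta>) * K \<and>
      \<bar>normal_force \<delta> eps (st_y (?Z eps t)) (st_w (?Z eps t))\<bar> \<le> (1 + \<delta>) * K / eps"
      unfolding xz using 1 2 x(2) KK by simp
    qed
   qed
  qed
 qed
qed

lemma restitution_large_constant:
 assumes par: "\<alpha> > 0" "\<mu> > 0" and p: "p_plus \<alpha> \<mu> \<theta> < 0" and q: "q_plus \<alpha> \<mu> \<theta> < 0" "q_minus \<alpha> \<mu> \<theta> > 0"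
 shows "p_plus \<alpha> \<mu> \<theta> / q_plus \<alpha> \<mu> \<theta> * ((- p_plus \<alpha> \<mu> \<theta> + S_w \<alpha> \<mu> \<theta>) / (- p_plus \<alpha> \<mu> \<theta> * S_w \<alpha> \<mu> \<theta>))
  = (p_minus \<alpha> \<mu> \<theta> - p_plus \<alpha> \<mu> \<theta>) / (q_minus \<alpha> \<mu> \<theta> * p_plus \<alpha> \<mu> \<theta> - q_plus \<alpha> \<mu> \<theta> * p_minus \<alpha> \<mu> \<theta>)"
proof -
 define P P' Q Q' where "P = p_plus \<alpha> \<mu> \<theta>" and "P' = p_minus \<alpha> \<mu> \<theta>" and "Q = q_plus \<alpha> \<mu> \<theta>" and "Q' = q_minus \<alpha> \<mu> \<theta>"
 define D N where "D = Q' - Q" and "N = Q' * P - Q * P'"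
 have D: "D \<noteq> 0" and Q: "Q \<noteq> 0" and P: "P \<noteq> 0" using p q by (auto simp: D_def P_def Q_def Q'_def)
 have S: "S_w \<alpha> \<mu> \<theta> = N / D" by (simp add: S_w_def N_def D_def P_def P'_def Q_def Q'_def)
 have N: "N \<noteq> 0" using S_w_pos[OF par, of \<theta>] unfolding S by auto
 have "- P + N / D = - Q * (P' - P) / D" using D by (simp add: N_def D_def field_simps)
 then have "P / Q * ((- P + N / D) / (- P * (N / D))) = P / Q * ((- Q * (P' - P) / D) / (- P * (N / D)))" by simp
 also have "\<dots> = (P' - P) / N" using D Q P N by simp
 finally show ?thesis unfolding S N_def P_def P'_def Q_def Q'_def .
qed

theorem theorem1:
  fixes \<alpha> \<mu> \<delta> \<theta>0 \<phi>0 v0 :: real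
    and w0 :: "real \<Rightarrow> real"
  assumes "\<alpha> > 0" and "\<mu> > 0" and "\<delta> > 0"
    and "v0 > 0"
    and "w0 \<in> O[at_right 0](\<lambda>\<epsilon>. \<epsilon>)"
    and "p_plus \<alpha> \<mu> \<theta>0 < 0"
    and "b_coeff \<theta>0 \<phi>0 < 0"
    and "q_plus \<alpha> \<mu> \<theta>0 < 0"
    and "q_minus \<alpha> \<mu> \<theta>0 > 0"
    and "a_coeff \<theta>0 \<phi>0 \<noteq> 0"
  shows
    "(\<exists>(T :: real \<Rightarrow> real) (y :: real \<Rightarrow> real \<Rightarrow> real) (w :: real \<Rightarrow> real \<Rightarrow> real)
        (\<theta> :: real \<Rightarrow> real \<Rightarrow> real) (\<phi> :: real \<Rightarrow> real \<Rightarrow> real) (v :: real \<Rightarrow> real \<Rightarrow> real).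
        (\<forall>\<^sub>F \<epsilon> in at_right 0.
           filippov_forward_flow (filippov_field \<alpha> \<mu> \<delta> \<epsilon>) (0, w0 \<epsilon>, \<theta>0, \<phi>0, v0) (T \<epsilon>)
             (\<lambda>t. (y \<epsilon> t, w \<epsilon> t, \<theta> \<epsilon> t, \<phi> \<epsilon> t, v \<epsilon> t)) \<and>
           y \<epsilon> (T \<epsilon>) = 0 \<and>
           (\<exists>t1. 0 \<le> t1 \<and> t1 < T \<epsilon> \<and>
              (\<forall>t\<in>{0..t1}. y \<epsilon> t \<ge> 0) \<and> (\<forall>t\<in>{t1<..<T \<epsilon>}. y \<epsilon> t < 0))) \<and>
        T \<in> O[at_right 0](\<lambda>\<epsilon>. \<epsilon> * ln (1 / \<epsilon>)) \<and>
        (\<lambda>\<epsilon>. w \<epsilon> (T \<epsilon>) - e_coeff \<alpha> \<mu> \<delta> \<theta>0 * v0) \<in> o[at_right 0](\<lambda>_. 1) \<and>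
        (\<lambda>\<epsilon>. \<theta> \<epsilon> (T \<epsilon>) - \<theta>0) \<in> o[at_right 0](\<lambda>_. 1) \<and>
        (\<lambda>\<epsilon>. \<phi> \<epsilon> (T \<epsilon>)
              - (\<phi>0 + (- (c_plus \<alpha> \<mu> \<theta>0 / q_plus \<alpha> \<mu> \<theta>0)
                       + S_phi \<alpha> \<mu> \<theta>0 / S_w \<alpha> \<mu> \<theta>0
                         * (e_coeff \<alpha> \<mu> \<delta> \<theta>0 + p_plus \<alpha> \<mu> \<theta>0 / q_plus \<alpha> \<mu> \<theta>0)) * v0))
          \<in> o[at_right 0](\<lambda>_. 1) \<and>
        (\<lambda>\<epsilon>. v \<epsilon> (T \<epsilon>)) \<in> o[at_right 0](\<lambda>_. 1) \<and>
        (\<exists>C. \<forall>\<^sub>F \<epsilon> in at_right 0. \<forall>t\<in>{0..T \<epsilon>}.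
           \<bar>y \<epsilon> t\<bar> \<le> C * \<epsilon> \<and> \<bar>w \<epsilon> t\<bar> \<le> C \<and>
           \<bar>normal_force \<delta> \<epsilon> (y \<epsilon> t) (w \<epsilon> t)\<bar> \<le> C / \<epsilon>))
     \<and> smooth_on_open {0<..} (\<lambda>d. e_coeff \<alpha> \<mu> d \<theta>0)
     \<and> (mono_on {0<..} (\<lambda>d. e_coeff \<alpha> \<mu> d \<theta>0) \<or> antimono_on {0<..} (\<lambda>d. e_coeff \<alpha> \<mu> d \<theta>0))
     \<and> (\<exists>r :: real \<Rightarrow> real. r \<in> O[at_top](\<lambda>d. (1 / d\<^sup>2) * ln (1 / d)) \<and>
          (\<forall>\<^sub>F d in at_top.
             e_coeff \<alpha> \<mu> d \<theta>0 =
               (p_minus \<alpha> \<mu> \<theta>0 - p_plus \<alpha> \<mu> \<theta>0)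
                 / (q_minus \<alpha> \<mu> \<theta>0 * p_plus \<alpha> \<mu> \<theta>0 - q_plus \<alpha> \<mu> \<theta>0 * p_minus \<alpha> \<mu> \<theta>0)
                 * (1 / d\<^sup>2) * (1 + r d)))
     \<and> (\<exists>r :: real \<Rightarrow> real. r \<in> O[at_right 0](\<lambda>d. d\<^sup>2) \<and>
          (\<forall>\<^sub>F d in at_right 0.
             e_coeff \<alpha> \<mu> d \<theta>0 =
               sqrt (p_plus \<alpha> \<mu> \<theta>0 * (p_minus \<alpha> \<mu> \<theta>0 - p_plus \<alpha> \<mu> \<theta>0)
                     / (q_plus \<alpha> \<mu> \<theta>0 * (q_minus \<alpha> \<mu> \<theta>0 - q_plus \<alpha> \<mu> \<theta>0)))
               * (1 - sqrt (S_w \<alpha> \<mu> \<theta>0) / 2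
                      * (pi - arctan (sqrt (- (S_w \<alpha> \<mu> \<theta>0 / p_plus \<alpha> \<mu> \<theta>0)))) * d
                    + r d)))"
proof -
 have par: "\<alpha> > 0" "\<mu> > 0" and p: "p_plus \<alpha> \<mu> \<theta>0 < 0" and q: "q_plus \<alpha> \<mu> \<theta>0 < 0" "q_minus \<alpha> \<mu> \<theta>0 > 0" by fact+
 define S where "S = S_w \<alpha> \<mu> \<theta>0"
 define P where "P = - p_plus \<alpha> \<mu> \<theta>0"
 define k where "k = p_plus \<alpha> \<mu> \<theta>0 / q_plus \<alpha> \<mu> \<theta>0"
 define c where "c = k * sqrt (1 + S / P)"
 have S: "S > 0" unfolding S_def by (rule S_w_pos[OF par])
 have P: "P > 0" using p by (simp add: P_def)
 have k: "k \<ge> 0" using p q by (simp add: k_def divide_nonpos_neg)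
 then have c: "c \<ge> 0" using S P by (simp add: c_def)
 have e: "e_coeff \<alpha> \<mu> d \<theta>0 = restitution c S P d" if "d > 0" for d
  using e_coeff_eq_restitution[OF par that p] by (simp only: c_def k_def S_def P_def)
 have "smooth_on_open {0<..} (\<lambda>d. e_coeff \<alpha> \<mu> d \<theta>0)"
  by (rule smooth_on_open_cong[OF open_greaterThan _ restitution_smooth[OF S P]]) (use e in simp)
 \<comment> \<open>Of the two alternatives for monotonicity the decreasing one holds, since the
   prefactor \<open>c\<close> is nonnegative.\<close>
 moreover have "antimono_on {0<..} (\<lambda>d. e_coeff \<alpha> \<mu> d \<theta>0)"
  using restitution_antimono[OF S P c] e by (simp add: monotone_on_def)
 moreover have "\<exists>r. r \<in> O[at_top](\<lambda>d. (1 / d\<^sup>2) * ln (1 / d)) \<and>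
   (\<forall>\<^sub>F d in at_top. e_coeff \<alpha> \<mu> d \<theta>0 = (p_minus \<alpha> \<mu> \<theta>0 - p_plus \<alpha> \<mu> \<theta>0)
    / (q_minus \<alpha> \<mu> \<theta>0 * p_plus \<alpha> \<mu> \<theta>0 - q_plus \<alpha> \<mu> \<theta>0 * p_minus \<alpha> \<mu> \<theta>0) * (1 / d\<^sup>2) * (1 + r d))"
 proof -
  obtain r where r: "r \<in> O[at_top](\<lambda>d. (1 / d\<^sup>2) * ln (1 / d))"
   and ev: "\<forall>\<^sub>F d in at_top. restitution c S P d = k * ((P + S) / (P * S)) * (1 / d\<^sup>2) * (1 + r d)"
   using restitution_large[OF S P, of k] unfolding c_def by (elim exE conjE)
  note kc = restitution_large_constant[OF par p q, folded P_def S_def k_def]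
  show ?thesis
   by (rule exI[of _ r], rule conjI[OF r]) (use ev eventually_gt_at_top[of 0] in \<open>eventually_elim, simp only: e kc\<close>)
 qed
 moreover have "\<exists>r. r \<in> O[at_right 0](\<lambda>d. d\<^sup>2) \<and>
   (\<forall>\<^sub>F d in at_right 0. e_coeff \<alpha> \<mu> d \<theta>0 =
    sqrt (p_plus \<alpha> \<mu> \<theta>0 * (p_minus \<alpha> \<mu> \<theta>0 - p_plus \<alpha> \<mu> \<theta>0) / (q_plus \<alpha> \<mu> \<theta>0 * (q_minus \<alpha> \<mu> \<theta>0 - q_plus \<alpha> \<mu> \<theta>0)))
    * (1 - sqrt (S_w \<alpha> \<mu> \<theta>0) / 2 * (pi - arctan (sqrt (- (S_w \<alpha> \<mu> \<theta>0 / p_plus \<alpha> \<mu> \<theta>0)))) * d + r d))"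
 proof -
  obtain r where r: "r \<in> O[at_right 0](\<lambda>d. d\<^sup>2)"
   and ev: "\<forall>\<^sub>F d in at_right 0. restitution c S P d = c * (1 - sqrt S / 2 * (pi - arctan (sqrt (S / P))) * d + r d)"
   using restitution_small[OF S P, of c] by (elim exE conjE)
  have SP: "- (S / p_plus \<alpha> \<mu> \<theta>0) = S / P" by (simp add: P_def)
  note cc = restitution_constant[OF p q, folded P_def S_def k_def, folded c_def]
  show ?thesis unfolding S_def[symmetric] SP cc
   by (rule exI[of _ r], rule conjI[OF r]) (use ev eventually_at_right_less[of "0::real"] in \<open>eventually_elim, simp only: e\<close>)
 qed
 ultimately show ?thesis
  by (intro conjI impact_flow[OF assms] disjI2)
qed

end
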